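(* For every fixed integer $\Delta\ge 3$, the problem TTR restricted to instances with period $\Delta$ is NP-complete, even if the underlying static graph $G$ is a star (and thus has constant diameter).
   Context: All graphs are finite. A $\Delta$-periodic labeling of an undirected graph $G=(V,E)$ is a map $\lambda:E\to\{0,1,\dots,\Delta-1\}$; edge $e$ is then active (in both directions) exactly at the times $\lambda(e)+i\Delta$, $i\in\mathbb{N}_0$. A temporal $s$-$z$-path is a sequence $(v_{i-1},v_i,t_i)_{i=1}^{\ell}$ with $v_0=s$, $v_\ell=z$, pairwise distinct vertices $v_0,\dots,v_\ell$, $\{v_{i-1},v_i\}\in E$ active at time $t_i$ for every $i$, and $t_1<t_2<\dots<t_\ell$ (strictly increasing). Its duration is $t_\ell+1-t_1$. A fastest temporal path is one of minimum duration. $\hat d(u,v)$ is the distance of $u$ and $v$ in the static graph $G$ (all edges have unit length). TTR: The input is an undirected tree $G=(V,E)$, a matrix $D$ indexed by $V\times V$ with entries positive integers or $\infty$ (no restriction) such that $D_{u,v}\ge\hat d(u,v)$ for all $u,v$, and a positive integer $\Delta$. The question is whether there is a $\Delta$-periodic labeling $\lambda$ of $E$ such that, for all $u,v\in V$, the duration of a fastest temporal path from $u$ to $v$ is at most $D_{u,v}$. Diagonal entries of $D$ play no role; all conditions on $D$ are for distinct vertices. *)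

theory Defs
  imports "HOL-Computational_Algebra.Polynomial" "HOL-Library.Extended_Nat"
begin

section \<open>Polynomial time and NP-completeness\<close>

text \<open>Deterministic multi-tape Turing machines. States and symbols are natural numbers; only
  the behaviour on the finite sets \<open>states\<close> and \<open>symbols\<close> matters. Symbol 0 is the blank, 1 and 2
  are the two bits. The tapes are infinite in both directions.\<close>

datatype move = Move_Left | Stay | Move_Right

record tm =
  tape_count :: nat
  states :: "nat set"
  symbols :: "nat set"
  start_state :: nat
  halt_state :: nat
  transition :: "nat \<Rightarrow> nat list \<Rightarrow> nat \<times> (nat \<times> move) list"

definition tm_wf :: "tm \<Rightarrow> bool" where
  "tm_wf M \<longleftrightarrow>
     0 < tape_count M \<and> finite (states M) \<and> finite (symbols M) \<and> {0, 1, 2} \<subseteq> symbols M \<and>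
     start_state M \<in> states M \<and> halt_state M \<in> states M \<and>
     (\<forall>q \<in> states M. \<forall>ss. length ss = tape_count M \<and> set ss \<subseteq> symbols M \<longrightarrow>
        (case transition M q ss of (q', acts) \<Rightarrow>
           q' \<in> states M \<and> length acts = tape_count M \<and> fst ` set acts \<subseteq> symbols M))"

text \<open>A tape is its contents together with the head position.\<close>

type_synonym tape = "(int \<Rightarrow> nat) \<times> int"
type_synonym config = "nat \<times> tape list"

definition read_tape :: "tape \<Rightarrow> nat" where
  "read_tape tp = fst tp (snd tp)"

fun move_head :: "move \<Rightarrow> int \<Rightarrow> int" where
  "move_head Move_Left h = h - 1"
| "move_head Stay h = h"
| "move_head Move_Right h = h + 1"

definition act_tape :: "nat \<times> move \<Rightarrow> tape \<Rightarrow> tape" where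
  "act_tape a tp = ((fst tp)(snd tp := fst a), move_head (snd a) (snd tp))"

definition tm_step :: "tm \<Rightarrow> config \<Rightarrow> config" where
  "tm_step M c =
     (if fst c = halt_state M then c
      else case transition M (fst c) (map read_tape (snd c)) of
             (q', acts) \<Rightarrow> (q', map2 act_tape acts (snd c)))"

definition string_tape :: "bool list \<Rightarrow> tape" where
  "string_tape w =
     (\<lambda>i. if 0 \<le> i \<and> i < int (length w) then (if w ! nat i then 2 else 1) else 0, 0)"

text \<open>The \<open>j\<close>-th input string is written on the \<open>j\<close>-th tape; all other tapes are blank.\<close>

definition tm_init :: "tm \<Rightarrow> bool list list \<Rightarrow> config" where
  "tm_init M ws =
     (start_state M,
      map (\<lambda>j. string_tape (if j < length ws then ws ! j else [])) [0..<tape_count M])"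

text \<open>The output is what stands on the last tape from cell 0 up to the first blank.\<close>

definition tape_output :: "tape \<Rightarrow> bool list \<Rightarrow> bool" where
  "tape_output tp w \<longleftrightarrow>
     (\<forall>i \<le> length w. fst tp (int i) = fst (string_tape w) (int i))"

definition computes_within :: "tm \<Rightarrow> bool list list \<Rightarrow> bool list \<Rightarrow> nat \<Rightarrow> bool" where
  "computes_within M ws w T \<longleftrightarrow>
     length ws \<le> tape_count M \<and>
     (\<exists>t \<le> T. case (tm_step M ^^ t) (tm_init M ws) of
        (q, tps) \<Rightarrow> q = halt_state M \<and> tape_output (last tps) w)"

definition poly_time_computable :: "(bool list \<Rightarrow> bool list) \<Rightarrow> bool" where
  "poly_time_computable f \<longleftrightarrow>
     (\<exists>M (p :: nat poly). tm_wf M \<and> (\<forall>x. computes_within M [x] (f x) (poly p (length x))))"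

definition poly_time_decidable2 :: "(bool list \<Rightarrow> bool list \<Rightarrow> bool) \<Rightarrow> bool" where
  "poly_time_decidable2 R \<longleftrightarrow>
     (\<exists>M (p :: nat poly). tm_wf M \<and>
        (\<forall>x y. computes_within M [x, y] [R x y] (poly p (length x + length y))))"

definition in_NP :: "bool list set \<Rightarrow> bool" where
  "in_NP L \<longleftrightarrow>
     (\<exists>R (q :: nat poly). poly_time_decidable2 R \<and>
        (\<forall>x. x \<in> L \<longleftrightarrow> (\<exists>y. length y \<le> poly q (length x) \<and> R x y)))"

definition poly_reducible :: "bool list set \<Rightarrow> bool list set \<Rightarrow> bool" where
  "poly_reducible A B \<longleftrightarrow> (\<exists>f. poly_time_computable f \<and> (\<forall>x. x \<in> A \<longleftrightarrow> f x \<in> B))"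

definition NP_hard :: "bool list set \<Rightarrow> bool" where
  "NP_hard B \<longleftrightarrow> (\<forall>A. in_NP A \<longrightarrow> poly_reducible A B)"

definition NP_complete :: "bool list set \<Rightarrow> bool" where
  "NP_complete L \<longleftrightarrow> in_NP L \<and> NP_hard L"


section \<open>Undirected graphs, trees, stars\<close>

text \<open>An undirected edge is a two-element set of vertices.\<close>

definition fin_graph :: "'a set \<Rightarrow> 'a set set \<Rightarrow> bool" where
  "fin_graph V E \<longleftrightarrow> finite V \<and> (\<forall>e \<in> E. e \<subseteq> V \<and> card e = 2)"

definition path_between :: "'a set \<Rightarrow> 'a set set \<Rightarrow> 'a \<Rightarrow> 'a \<Rightarrow> 'a list \<Rightarrow> bool" where
  "path_between V E u v xs \<longleftrightarrow>
     xs \<noteq> [] \<and> hd xs = u \<and> last xs = v \<and> set xs \<subseteq> V \<and> distinct xs \<and>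
     successively (\<lambda>x y. {x, y} \<in> E) xs"

definition connected_graph :: "'a set \<Rightarrow> 'a set set \<Rightarrow> bool" where
  "connected_graph V E \<longleftrightarrow> (\<forall>u \<in> V. \<forall>v \<in> V. \<exists>xs. path_between V E u v xs)"

definition is_cycle :: "'a set set \<Rightarrow> 'a list \<Rightarrow> bool" where
  "is_cycle E xs \<longleftrightarrow>
     3 \<le> length xs \<and> distinct xs \<and> successively (\<lambda>x y. {x, y} \<in> E) xs \<and> {last xs, hd xs} \<in> E"

definition is_tree :: "'a set \<Rightarrow> 'a set set \<Rightarrow> bool" where
  "is_tree V E \<longleftrightarrow> fin_graph V E \<and> V \<noteq> {} \<and> connected_graph V E \<and> (\<nexists>xs. is_cycle E xs)"

definition is_star :: "'a set \<Rightarrow> 'a set set \<Rightarrow> bool" where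
  "is_star V E \<longleftrightarrow> finite V \<and> (\<exists>c \<in> V. E = {{c, v} | v. v \<in> V - {c}})"

definition static_dist :: "'a set \<Rightarrow> 'a set set \<Rightarrow> 'a \<Rightarrow> 'a \<Rightarrow> enat" where
  "static_dist V E u v = (INF xs \<in> {xs. path_between V E u v xs}. enat (length xs - 1))"


section \<open>Periodic labelings and temporal paths\<close>

definition periodic_labeling :: "'a set set \<Rightarrow> nat \<Rightarrow> ('a set \<Rightarrow> nat) \<Rightarrow> bool" where
  "periodic_labeling E \<Delta> lam \<longleftrightarrow> (\<forall>e \<in> E. lam e < \<Delta>)"

definition active_at :: "nat \<Rightarrow> ('a set \<Rightarrow> nat) \<Rightarrow> 'a set \<Rightarrow> nat \<Rightarrow> bool" where
  "active_at \<Delta> lam e t \<longleftrightarrow> (\<exists>i. t = lam e + i * \<Delta>)"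

text \<open>A transition \<open>(x, y, t)\<close> goes from \<open>x\<close> to \<open>y\<close> at time \<open>t\<close>; its target is \<open>fst (snd (x, y, t))\<close>.
  The list \<open>s # map (fst \<circ> snd) P\<close> consists of the vertices visited by \<open>P\<close>.\<close>

definition temporal_path ::
  "'a set set \<Rightarrow> nat \<Rightarrow> ('a set \<Rightarrow> nat) \<Rightarrow> 'a \<Rightarrow> 'a \<Rightarrow> ('a \<times> 'a \<times> nat) list \<Rightarrow> bool" where
  "temporal_path E \<Delta> lam s z P \<longleftrightarrow>
     P \<noteq> [] \<and>
     (let vs = s # map (fst \<circ> snd) P in
        distinct vs \<and> last vs = z \<and>
        (\<forall>i < length P. fst (P ! i) = vs ! i)) \<and>
     (\<forall>(x, y, t) \<in> set P. {x, y} \<in> E \<and> active_at \<Delta> lam {x, y} t) \<and>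
     sorted_wrt (<) (map (snd \<circ> snd) P)"

definition duration :: "('a \<times> 'a \<times> nat) list \<Rightarrow> nat" where
  "duration P = snd (snd (last P)) + 1 - snd (snd (hd P))"

text \<open>Equals \<open>\<infinity>\<close> if there is no temporal path; otherwise the infimum is attained.\<close>

definition fastest_duration ::
  "'a set set \<Rightarrow> nat \<Rightarrow> ('a set \<Rightarrow> nat) \<Rightarrow> 'a \<Rightarrow> 'a \<Rightarrow> enat" where
  "fastest_duration E \<Delta> lam s z = (INF P \<in> {P. temporal_path E \<Delta> lam s z P}. enat (duration P))"


section \<open>The problem TTR\<close>

text \<open>An instance has vertex set \<open>{..<vertex_count}\<close>. The diagonal of \<open>bound\<close> is unconstrained.\<close>

record ttr_instance =
  vertex_count :: nat
  edges :: "nat set set"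
  bound :: "nat \<Rightarrow> nat \<Rightarrow> enat"
  period :: nat

definition valid_instance :: "ttr_instance \<Rightarrow> bool" where
  "valid_instance I \<longleftrightarrow>
     is_tree {..<vertex_count I} (edges I) \<and> 0 < period I \<and>
     (\<forall>u < vertex_count I. \<forall>v < vertex_count I. u \<noteq> v \<longrightarrow>
        0 < bound I u v \<and> static_dist {..<vertex_count I} (edges I) u v \<le> bound I u v)"

definition realizable :: "ttr_instance \<Rightarrow> bool" where
  "realizable I \<longleftrightarrow>
     (\<exists>lam. periodic_labeling (edges I) (period I) lam \<and>
        (\<forall>u < vertex_count I. \<forall>v < vertex_count I. u \<noteq> v \<longrightarrow>
           fastest_duration (edges I) (period I) lam u v \<le> bound I u v))"

text \<open>Numbers are written in binary (least significant bit first), each bit preceded by \<open>True\<close>;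
  a block starting with \<open>False\<close> ends the number, or stands for \<open>\<infinity>\<close>. This is a prefix code.\<close>

fun binary :: "nat \<Rightarrow> bool list" where
  "binary n = (if n = 0 then [] else odd n # binary (n div 2))"

declare binary.simps [simp del]

definition encode_enat :: "enat \<Rightarrow> bool list" where
  "encode_enat d =
     (case d of
        enat n \<Rightarrow> concat (map (\<lambda>b. [True, b]) (binary n)) @ [False, False]
      | \<infinity> \<Rightarrow> [False, True])"

text \<open>Number of vertices, period, adjacency matrix and bound matrix (both row by row).\<close>

definition encode_instance :: "ttr_instance \<Rightarrow> bool list" where
  "encode_instance I =
     encode_enat (enat (vertex_count I)) @ encode_enat (enat (period I)) @
     [{u, v} \<in> edges I. u \<leftarrow> [0..<vertex_count I], v \<leftarrow> [0..<vertex_count I]] @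
     concat [encode_enat (bound I u v). u \<leftarrow> [0..<vertex_count I], v \<leftarrow> [0..<vertex_count I]]"

text \<open>TTR restricted to the instances in a class \<open>C\<close>, as a language: the encoded yes-instances.\<close>

definition TTR :: "ttr_instance set \<Rightarrow> bool list set" where
  "TTR C = {encode_instance I | I. I \<in> C \<and> valid_instance I \<and> realizable I}"

definition period_instances :: "nat \<Rightarrow> ttr_instance set" where
  "period_instances \<Delta> = {I. period I = \<Delta>}"

definition star_instances :: "ttr_instance set" where
  "star_instances = {I. is_star {..<vertex_count I} (edges I)}"

end

theory Submission
  imports Defs
begin

text \<open>Hardness. A polynomial-time computation is described by clauses that are uniform in time and
  position, and the satisfiability of such clauses is reduced to the \<open>\<Delta>\<close>-colourability of a graph. A
  graph is coloured by the labels of a star with the vertices as leaves: two edges with labels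
  \<open>a\<close> and \<open>b\<close> form a temporal path whose duration is at most \<open>\<Delta>\<close> if \<open>a \<noteq> b\<close> and \<open>\<Delta> + 1\<close> otherwise, so
  the bound \<open>\<Delta>\<close> for adjacent leaves and \<open>\<infinity>\<close> for all other pairs expresses proper colouring.

  Membership. Paths in a tree are unique, so a fastest temporal path starts at the first activity of
  its first edge and then takes every edge as early as possible. A certificate tabulates the
  predecessors and the times of these paths together with the bits of all time differences, and it
  is checked by a first-order formula over a domain of polynomial size.

  Both parts need polynomial-time machines. They are compiled from programs that iterate over the
  cells of tapes of polynomial length; evaluating a fixed first-order formula at all positions of
  such a tape, and emitting bits accordingly, is enough for the reduction as well as for the
  verifier.\<close>

section \<open>A while language over named tapes\<close>

text \<open>Nothing is ever parsed. The reduction prints an instance; the verifier prints the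
  instance that the certificate describes and compares the result with its input, so malformed
  inputs need no treatment of their own. The printed code starts with the number of vertices, so
  each string comes from two generators: the output of one is merely counted in binary, the output
  of the other is written. Loops that lengthen the tapes they run over would leave polynomial time.
  Each phase therefore keeps the tapes it loops over apart from those it writes, and only a fixed
  number of phases is composed. The bounds are written in binary and may be exponentially large,
  while the relevant times lie below \<open>n * \<Delta>\<close>, which is polynomial because
  \<open>\<Delta>\<close> is fixed. So times can be positions of the domain, and a bound is compared
  with a time difference at the most significant bit where the two differ. The hypothesis
  \<open>3 \<le> \<Delta>\<close> enters through the clause gadget: two colours serve as truth
  values, and the third one marks a true literal.\<close>

datatype 'r stmt =
    Skip
  | Act 'r "nat \<Rightarrow> nat \<times> move"
  | Seq "'r stmt" "'r stmt"
  | Cond 'r "nat set" "'r stmt" "'r stmt"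
  | Loop 'r "nat set" "'r stmt"

text \<open>A control state is the list of statements still to be executed. A control step depends on the
  tapes only through the scanned symbols, and yields one action per tape.\<close>

fun control_step ::
  "'r stmt list \<Rightarrow> ('r \<Rightarrow> nat) \<Rightarrow> 'r stmt list \<times> ('r \<Rightarrow> nat \<times> move)" where
  "control_step [] \<rho> = ([], \<lambda>r. (\<rho> r, Stay))"
| "control_step (Skip # K) \<rho> = (K, \<lambda>r. (\<rho> r, Stay))"
| "control_step (Act r f # K) \<rho> = (K, (\<lambda>r. (\<rho> r, Stay))(r := f (\<rho> r)))"
| "control_step (Seq p q # K) \<rho> = (p # q # K, \<lambda>r. (\<rho> r, Stay))"
| "control_step (Cond r A p q # K) \<rho> = ((if \<rho> r \<in> A then p else q) # K, \<lambda>r. (\<rho> r, Stay))"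
| "control_step (Loop r A p # K) \<rho> =
     (if \<rho> r \<in> A then p # Loop r A p # K else K, \<lambda>r. (\<rho> r, Stay))"

definition stmt_step :: "'r stmt list \<times> ('r \<Rightarrow> tape) \<Rightarrow> 'r stmt list \<times> ('r \<Rightarrow> tape)" where
  "stmt_step c =
     (let (K, a) = control_step (fst c) (\<lambda>r. read_tape (snd c r))
      in (K, \<lambda>r. act_tape (a r) (snd c r)))"

text \<open>Quantifying over the continuation \<open>K\<close> makes executions composable: the step
  count is exact and independent of what follows, so sequencing just adds step counts.\<close>

definition exec :: "'r stmt \<Rightarrow> ('r \<Rightarrow> tape) \<Rightarrow> ('r \<Rightarrow> tape) \<Rightarrow> nat \<Rightarrow> bool" where
  "exec p T T' t \<longleftrightarrow> (\<forall>K. (stmt_step ^^ t) (p # K, T) = (K, T'))"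

lemma act_tape_idle [simp]: "act_tape (read_tape tp, Stay) tp = tp"
  by (simp add: act_tape_def read_tape_def)

lemma stmt_step_simps:
  "stmt_step (Skip # K, T) = (K, T)"
  "stmt_step (Act r f # K, T) = (K, T(r := act_tape (f (read_tape (T r))) (T r)))"
  "stmt_step (Seq p q # K, T) = (p # q # K, T)"
  "stmt_step (Cond r A p q # K, T) = ((if read_tape (T r) \<in> A then p else q) # K, T)"
  "stmt_step (Loop r A p # K, T) =
     (if read_tape (T r) \<in> A then p # Loop r A p # K else K, T)"
  by (auto simp: stmt_step_def)

lemma funpow_Suc_apply: "(f ^^ Suc n) x = (f ^^ n) (f x)"
  by (simp add: funpow_Suc_right del: funpow.simps)

lemma exec_trans_step:
  "(\<And>K. stmt_step (p # K, T) = (q # K, T')) \<Longrightarrow> exec q T' T'' t \<Longrightarrow> exec p T T'' (Suc t)"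
  by (simp add: exec_def funpow_Suc_apply del: funpow.simps)

lemma exec_Skip: "exec Skip T T 1"
  by (simp add: exec_def stmt_step_simps)

lemma exec_Act: "exec (Act r f) T (T(r := act_tape (f (read_tape (T r))) (T r))) 1"
  by (simp add: exec_def stmt_step_simps)

lemma exec_Seq:
  assumes "exec p T T' t" "exec q T' T'' t'"
  shows "exec (Seq p q) T T'' (t + t' + 1)"
proof -
  have "(stmt_step ^^ (t + t' + 1)) (Seq p q # K, T) = (K, T'')" for K
  proof -
    have "(stmt_step ^^ (t + t' + 1)) (Seq p q # K, T) = (stmt_step ^^ (t' + t)) (p # q # K, T)"
      by (simp add: funpow_Suc_apply stmt_step_simps add.commute del: funpow.simps)
    also have "\<dots> = (K, T'')"
      using assms by (simp add: exec_def funpow_add)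
    finally show ?thesis .
  qed
  then show ?thesis by (simp add: exec_def)
qed

lemma exec_Cond:
  "exec (if read_tape (T r) \<in> A then p else q) T T' t \<Longrightarrow> exec (Cond r A p q) T T' (t + 1)"
  using exec_trans_step[of "Cond r A p q" T "if read_tape (T r) \<in> A then p else q" T T' t]
  by (simp add: stmt_step_simps)

lemma exec_Loop_end: "read_tape (T r) \<notin> A \<Longrightarrow> exec (Loop r A p) T T 1"
  by (simp add: exec_def stmt_step_simps)

lemma exec_Loop_step:
  assumes "read_tape (T r) \<in> A" "exec p T T' t" "exec (Loop r A p) T' T'' t'"
  shows "exec (Loop r A p) T T'' (t + t' + 1)"
proof -
  have "(stmt_step ^^ (t + t' + 1)) (Loop r A p # K, T) = (K, T'')" for K
  proof -
    have "(stmt_step ^^ (t + t' + 1)) (Loop r A p # K, T) =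
        (stmt_step ^^ (t' + t)) (p # Loop r A p # K, T)"
      using assms(1) by (simp add: funpow_Suc_apply stmt_step_simps add.commute del: funpow.simps)
    also have "\<dots> = (K, T'')"
      using assms by (simp add: exec_def funpow_add)
    finally show ?thesis .
  qed
  then show ?thesis by (simp add: exec_def)
qed

text \<open>The control states that can occur while \<open>p\<close> runs in front of
  \<open>K\<close>, before \<open>K\<close> itself is reached. A loop re-enters its body with the
  same continuation each time, which keeps the set finite; it becomes the state set of the
  machine.\<close>

fun continuations :: "'r stmt \<Rightarrow> 'r stmt list \<Rightarrow> 'r stmt list set" where
  "continuations Skip K = {Skip # K}"
| "continuations (Act r f) K = {Act r f # K}"
| "continuations (Seq p q) K = {Seq p q # K} \<union> continuations p (q # K) \<union> continuations q K"
| "continuations (Cond r A p q) K = {Cond r A p q # K} \<union> continuations p K \<union> continuations q K"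
| "continuations (Loop r A p) K = {Loop r A p # K} \<union> continuations p (Loop r A p # K)"

lemma finite_continuations: "finite (continuations p K)"
  by (induction p arbitrary: K) auto

lemma continuations_self: "p # K \<in> continuations p K"
  by (cases p) auto

fun stmt_ok :: "nat \<Rightarrow> 'r set \<Rightarrow> 'r stmt \<Rightarrow> bool" where
  "stmt_ok B R Skip \<longleftrightarrow> True"
| "stmt_ok B R (Act r f) \<longleftrightarrow> r \<in> R \<and> (\<forall>s<B. fst (f s) < B)"
| "stmt_ok B R (Seq p q) \<longleftrightarrow> stmt_ok B R p \<and> stmt_ok B R q"
| "stmt_ok B R (Cond r A p q) \<longleftrightarrow> r \<in> R \<and> stmt_ok B R p \<and> stmt_ok B R q"
| "stmt_ok B R (Loop r A p) \<longleftrightarrow> r \<in> R \<and> stmt_ok B R p"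

lemma continuations_closed:
  "S \<in> continuations p K \<Longrightarrow> fst (control_step S \<rho>) \<in> insert K (continuations p K)"
proof (induction p arbitrary: K)
  case (Seq p q)
  show ?case
    using Seq.prems Seq.IH(1)[of "q # K"] Seq.IH(2)[of K]
      continuations_self[of p "q # K"] continuations_self[of q K] by auto
next
  case (Cond r A p q)
  show ?case
    using Cond.prems Cond.IH(1)[of K] Cond.IH(2)[of K] continuations_self[of p K] continuations_self[of q K]
    by auto
next
  case (Loop r A p)
  show ?case
    using Loop.prems Loop.IH[of "Loop r A p # K"] continuations_self[of p "Loop r A p # K"]
    by (auto split: if_splits)
qed auto

lemma continuations_hd_ok:
  "stmt_ok B R p \<Longrightarrow> S \<in> continuations p K \<Longrightarrow> \<exists>s S'. S = s # S' \<and> stmt_ok B R s"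
proof (induction p arbitrary: K)
  case (Seq p q)
  show ?case using Seq.prems Seq.IH(1)[of "q # K"] Seq.IH(2)[of K] by auto
next
  case (Cond r A p q)
  show ?case using Cond.prems Cond.IH(1)[of K] Cond.IH(2)[of K] by auto
next
  case (Loop r A p)
  show ?case using Loop.prems Loop.IH[of "Loop r A p # K"] by auto
qed auto

text \<open>Only the register named by the head statement is inspected. So the registers in
  \<open>R\<close> determine the control flow, and a machine with one tape for each of them can
  follow it.\<close>

lemma control_step_cong:
  assumes "S = [] \<or> (\<exists>s S'. S = s # S' \<and> stmt_ok B R s)" "\<And>r. r \<in> R \<Longrightarrow> \<rho> r = \<rho>' r"
  shows "fst (control_step S \<rho>) = fst (control_step S \<rho>')"
    "r \<in> R \<Longrightarrow> snd (control_step S \<rho>) r = snd (control_step S \<rho>') r"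
  using assms by (cases "(S, \<rho>)" rule: control_step.cases; auto)+

lemma control_step_action:
  "snd (control_step S \<rho>) r = (\<rho> r, Stay) \<or>
   (\<exists>f K. S = Act r f # K \<and> snd (control_step S \<rho>) r = f (\<rho> r))"
  by (cases "(S, \<rho>)" rule: control_step.cases) auto

lemma control_step_symbols:
  assumes "S = [] \<or> (\<exists>s S'. S = s # S' \<and> stmt_ok B R s)" "\<rho> r < B"
  shows "fst (snd (control_step S \<rho>) r) < B"
  using control_step_action[of S \<rho> r] assms by fastforce

text \<open>The finitely many control states are numbered injectively by \<open>enc\<close>, the
  empty list being the halting state. The simulation is step by step, so the time of
  \<open>exec\<close> carries over without loss.\<close>

theorem stmt_to_tm:
  fixes p :: "'r stmt"
  assumes rs: "distinct rs" "rs \<noteq> []" and B: "3 \<le> B" and ok: "stmt_ok B (set rs) p"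
  shows "\<exists>M. tm_wf M \<and> tape_count M = length rs \<and>
    (\<forall>T T' t. exec p T T' t \<longrightarrow>
       (tm_step M ^^ t) (start_state M, map T rs) = (halt_state M, map T' rs))"
proof -
  define Q where "Q = insert [] (continuations p [])"
  have "finite Q" by (simp add: Q_def finite_continuations)
  then obtain enc :: "'r stmt list \<Rightarrow> nat" where enc: "inj_on enc Q"
    by (meson finite_imp_inj_to_nat_seg)
  define dec where "dec = the_inv_into Q enc"
  have dec: "dec (enc K) = K" if "K \<in> Q" for K
    unfolding dec_def using that enc by (rule the_inv_into_f_f[rotated])
  define rd where "rd ss r = the (map_of (zip rs ss) r)" for ss :: "nat list" and r
  define M where "M = \<lparr>tape_count = length rs, states = enc ` Q, symbols = {..<B},
    start_state = enc [p], halt_state = enc [],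
    transition = (\<lambda>q ss. let (K, a) = control_step (dec q) (rd ss) in (enc K, map a rs))\<rparr>"
  have pQ: "[p] \<in> Q" using continuations_self[of p "[]"] by (simp add: Q_def)
  have closed: "fst (control_step K \<rho>) \<in> Q" if "K \<in> Q" for K \<rho>
    using that continuations_closed[of K p "[]" \<rho>] by (auto simp: Q_def)
  have hd: "K = [] \<or> (\<exists>s S'. K = s # S' \<and> stmt_ok B (set rs) s)" if "K \<in> Q" for K
    using that continuations_hd_ok[OF ok, of K] by (auto simp: Q_def)
  have rd_map: "rd (map g rs) r = g r" if "r \<in> set rs" for g r
    using that by (simp add: rd_def map_of_zip_map)
  have rd_sym: "rd ss r < B" if "r \<in> set rs" "length ss = length rs" "set ss \<subseteq> {..<B}" for ss r
  proof -
    obtain i where "i < length rs" "rs ! i = r" using \<open>r \<in> set rs\<close> by (auto simp: in_set_conv_nth)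
    then have "rd ss r = ss ! i" using that rs by (auto simp: rd_def map_of_zip_nth)
    then show ?thesis using that \<open>i < length rs\<close> by (metis lessThan_iff nth_mem subsetD)
  qed
  have wf: "tm_wf M"
    unfolding tm_wf_def
  proof (intro conjI ballI allI impI)
    fix q ss assume q: "q \<in> states M" and ss: "length ss = tape_count M \<and> set ss \<subseteq> symbols M"
    then obtain K where K: "K \<in> Q" "q = enc K" by (auto simp: M_def)
    have "fst (snd (control_step K (rd ss)) r) < B" if "r \<in> set rs" for r
      using control_step_symbols[OF hd[OF K(1)], of "rd ss" r] rd_sym[of r ss] ss that
      by (auto simp: M_def)
    then show "case transition M q ss of (q', acts) \<Rightarrow>
        q' \<in> states M \<and> length acts = tape_count M \<and> fst ` set acts \<subseteq> symbols M"
      using closed[OF K(1), of "rd ss"] K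
      by (auto simp: M_def dec split: prod.splits)
  qed (use rs B \<open>finite Q\<close> pQ in \<open>auto simp: M_def Q_def\<close>)
  have step: "tm_step M (enc K, map T rs) = (enc (fst c'), map (snd c') rs)"
    if "K \<in> Q" "c' = stmt_step (K, T)" for K T c'
  proof (cases "K = []")
    case True
    then show ?thesis using that by (simp add: M_def tm_step_def stmt_step_def)
  next
    case False
    then have "enc K \<noteq> enc []" using enc that by (auto simp: Q_def inj_on_def)
    define \<rho> where "\<rho> = rd (map read_tape (map T rs))"
    have \<rho>: "\<rho> r = read_tape (T r)" if "r \<in> set rs" for r
      using rd_map[OF that, of "\<lambda>r. read_tape (T r)"] by (simp add: \<rho>_def comp_def)
    note cong = control_step_cong[OF hd[OF \<open>K \<in> Q\<close>], of \<rho> "\<lambda>r. read_tape (T r)", OF \<rho>]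
    have "map2 act_tape (map a rs) (map T rs) = map (\<lambda>r. act_tape (a r) (T r)) rs" for a
      by (induction rs) auto
    then show ?thesis
      using \<open>enc K \<noteq> enc []\<close> cong that(2) unfolding \<rho>_def
      by (auto simp: M_def tm_step_def stmt_step_def dec[OF \<open>K \<in> Q\<close>] split: prod.splits)
  qed
  have steps: "(tm_step M ^^ t) (enc K, map T rs) =
      (enc (fst ((stmt_step ^^ t) (K, T))), map (snd ((stmt_step ^^ t) (K, T))) rs)
      \<and> fst ((stmt_step ^^ t) (K, T)) \<in> Q" if "K \<in> Q" for K T t
  proof (induction t)
    case (Suc t)
    let ?c = "(stmt_step ^^ t) (K, T)"
    have "fst (stmt_step ?c) \<in> Q"
      using closed[of "fst ?c" "\<lambda>r. read_tape (snd ?c r)"] Suc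
      by (auto simp: stmt_step_def split: prod.splits)
    then show ?case using step[of "fst ?c" "stmt_step ?c" "snd ?c"] Suc by simp
  qed (use that in simp)
  have "(tm_step M ^^ t) (start_state M, map T rs) = (halt_state M, map T' rs)"
    if "exec p T T' t" for T T' t
    using steps[OF pQ, of t T] that by (simp add: exec_def M_def)
  then show ?thesis using wf by (intro exI[of _ M]) (simp add: M_def)
qed

section \<open>Programs with for-loops over tapes\<close>

datatype 'r prog =
    Nop
  | Put 'r nat
  | MoveR 'r
  | MoveL 'r
  | Then "'r prog" "'r prog" (infixr ";;" 60)
  | Branch 'r "nat set" "'r prog" "'r prog"
  | For 'r "'r prog"

text \<open>A tape is represented by the word on the cells from 0 on and a head position inside or
  immediately behind that word.\<close>

type_synonym 'r store = "'r \<Rightarrow> nat list \<times> nat"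

definition content :: "nat list \<Rightarrow> int \<Rightarrow> nat" where
  "content ws z = (if 0 \<le> z \<and> z < int (length ws) then ws ! nat z else 0)"

definition tape_of :: "nat list \<times> nat \<Rightarrow> tape" where
  "tape_of w = (content (fst w), int (snd w))"

definition scan :: "nat list \<times> nat \<Rightarrow> nat" where
  "scan w = (if snd w < length (fst w) then fst w ! snd w else 0)"

text \<open>In the case of \<open>For\<close>, each round resets \<open>r\<close> to its content on
  entry with the head at \<open>i\<close>. This agrees with a machine that just advances the head,
  since \<open>prog_ok\<close> forbids the body to write or move \<open>r\<close>.\<close>

fun run :: "'r prog \<Rightarrow> 'r store \<Rightarrow> 'r store" where
  "run Nop \<sigma> = \<sigma>"
| "run (Put r a) \<sigma> =
     \<sigma>(r := (if snd (\<sigma> r) < length (fst (\<sigma> r)) then (fst (\<sigma> r))[snd (\<sigma> r) := a]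
             else fst (\<sigma> r) @ [a], snd (\<sigma> r)))"
| "run (MoveR r) \<sigma> =
     \<sigma>(r := (fst (\<sigma> r), if snd (\<sigma> r) < length (fst (\<sigma> r)) then Suc (snd (\<sigma> r)) else snd (\<sigma> r)))"
| "run (MoveL r) \<sigma> = \<sigma>(r := (fst (\<sigma> r), snd (\<sigma> r) - 1))"
| "run (p ;; q) \<sigma> = run q (run p \<sigma>)"
| "run (Branch r A p q) \<sigma> = (if scan (\<sigma> r) \<in> A then run p \<sigma> else run q \<sigma>)"
| "run (For r p) \<sigma> =
     (fold (\<lambda>i s. run p (s(r := (fst (\<sigma> r), i)))) [0..<length (fst (\<sigma> r))] \<sigma>)
       (r := (fst (\<sigma> r), 0))"

fun puts :: "'r prog \<Rightarrow> 'r set" where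
  "puts (Put r a) = {r}"
| "puts (p ;; q) = puts p \<union> puts q"
| "puts (Branch r A p q) = puts p \<union> puts q"
| "puts (For r p) = puts p"
| "puts _ = {}"

fun loops :: "'r prog \<Rightarrow> 'r set" where
  "loops (p ;; q) = loops p \<union> loops q"
| "loops (Branch r A p q) = loops p \<union> loops q"
| "loops (For r p) = insert r (loops p)"
| "loops _ = {}"

fun touched :: "'r prog \<Rightarrow> 'r set" where
  "touched Nop = {}"
| "touched (Put r a) = {r}"
| "touched (MoveR r) = {r}"
| "touched (MoveL r) = {r}"
| "touched (p ;; q) = touched p \<union> touched q"
| "touched (Branch r A p q) = touched p \<union> touched q"
| "touched (For r p) = insert r (touched p)"

fun regs :: "'r prog \<Rightarrow> 'r set" where
  "regs Nop = {}"
| "regs (Put r a) = {r}"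
| "regs (MoveR r) = {r}"
| "regs (MoveL r) = {r}"
| "regs (p ;; q) = regs p \<union> regs q"
| "regs (Branch r A p q) = insert r (regs p \<union> regs q)"
| "regs (For r p) = insert r (regs p)"

text \<open>Only nonblank symbols are written, so the blanks on both sides of a word are reliable
  end marks for loops and for rewinding.\<close>

fun prog_ok :: "nat \<Rightarrow> 'r prog \<Rightarrow> bool" where
  "prog_ok B (Put r a) \<longleftrightarrow> 0 < a \<and> a < B"
| "prog_ok B (p ;; q) \<longleftrightarrow> prog_ok B p \<and> prog_ok B q"
| "prog_ok B (Branch r A p q) \<longleftrightarrow> prog_ok B p \<and> prog_ok B q"
| "prog_ok B (For r p) \<longleftrightarrow> prog_ok B p \<and> r \<notin> touched p"
| "prog_ok B _ \<longleftrightarrow> True"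

definition store_ok :: "nat \<Rightarrow> 'r store \<Rightarrow> bool" where
  "store_ok B \<sigma> \<longleftrightarrow> (\<forall>r. snd (\<sigma> r) \<le> length (fst (\<sigma> r)) \<and> set (fst (\<sigma> r)) \<subseteq> {0<..<B})"

lemma store_okD:
  assumes "store_ok B \<sigma>"
  shows "snd (\<sigma> r) \<le> length (fst (\<sigma> r))" "0 \<notin> set (fst (\<sigma> r))"
    "set (fst (\<sigma> r)) \<subseteq> {0<..<B}"
proof -
  show "snd (\<sigma> r) \<le> length (fst (\<sigma> r))" "set (fst (\<sigma> r)) \<subseteq> {0<..<B}"
    using assms by (auto simp: store_ok_def)
  then show "0 \<notin> set (fst (\<sigma> r))" by auto
qed

abbreviation step_right :: "'r \<Rightarrow> 'r stmt" where
  "step_right r \<equiv> Act r (\<lambda>s. (s, if s = 0 then Stay else Move_Right))"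

abbreviation go_right :: "'r \<Rightarrow> 'r stmt" where
  "go_right r \<equiv> Act r (\<lambda>s. (s, Move_Right))"

abbreviation go_left :: "'r \<Rightarrow> 'r stmt" where
  "go_left r \<equiv> Act r (\<lambda>s. (s, Move_Left))"

text \<open>The first move to the left is made unconditionally because the head may stand on the
  blank immediately behind the word, where the loop would stop at once. The loop ends on cell
  -1.\<close>

definition rewind :: "'r \<Rightarrow> 'r stmt" where
  "rewind r = Seq (go_left r) (Seq (Loop r (- {0}) (go_left r)) (go_right r))"

fun compile :: "'r prog \<Rightarrow> 'r stmt" where
  "compile Nop = Skip"
| "compile (Put r a) = Act r (\<lambda>s. (a, Stay))"
| "compile (MoveR r) = step_right r"
| "compile (MoveL r) = Seq (go_left r) (Cond r {0} (go_right r) Skip)"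
| "compile (p ;; q) = Seq (compile p) (compile q)"
| "compile (Branch r A p q) = Cond r A (compile p) (compile q)"
| "compile (For r p) =
     Seq (rewind r) (Seq (Loop r (- {0}) (Seq (compile p) (step_right r))) (rewind r))"

lemma stmt_ok_compile: "prog_ok B p \<Longrightarrow> regs p \<subseteq> R \<Longrightarrow> stmt_ok B R (compile p)"
  by (induction p) (auto simp: rewind_def)

lemma run_untouched: "r \<notin> touched p \<Longrightarrow> run p \<sigma> r = \<sigma> r"
proof (induction p arbitrary: \<sigma>)
  case (For r' p)
  have "fold (\<lambda>i s. run p (s(r' := (w, i)))) xs s r = s r" for w xs s
    using For by (induction xs arbitrary: s) auto
  then show ?case using For by auto
qed auto

lemma run_unput: "r \<notin> puts p \<Longrightarrow> prog_ok B p \<Longrightarrow> fst (run p \<sigma> r) = fst (\<sigma> r)"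
proof (induction p arbitrary: \<sigma>)
  case (For r' p)
  have "r \<noteq> r' \<Longrightarrow> fst (fold (\<lambda>i s. run p (s(r' := (w, i)))) xs s r) = fst (s r)" for w xs s
    using For by (induction xs arbitrary: s) auto
  then show ?case using For by auto
qed auto

lemma store_ok_upd: "store_ok B \<sigma> \<Longrightarrow> i \<le> length (fst (\<sigma> r)) \<Longrightarrow> store_ok B (\<sigma>(r := (fst (\<sigma> r), i)))"
  by (auto simp: store_ok_def)

lemma run_store_ok: "prog_ok B p \<Longrightarrow> store_ok B \<sigma> \<Longrightarrow> store_ok B (run p \<sigma>)"
proof (induction p arbitrary: \<sigma>)
  case (Put r a)
  have "set ((fst (\<sigma> r))[i := a]) \<subseteq> {0<..<B}" for i
    using Put set_update_subset_insert[of "fst (\<sigma> r)" i a] by (fastforce simp: store_ok_def)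
  then show ?case using Put by (auto simp: store_ok_def intro: le_SucI)
next
  case (MoveL r)
  then show ?case using store_ok_upd[of B \<sigma> "snd (\<sigma> r) - 1" r] store_okD(1)[of B \<sigma> r]
    by (simp del: fun_upd_apply)
next
  case (For r p)
  have "store_ok B s \<Longrightarrow> s r = (fst (\<sigma> r), j) \<Longrightarrow> set xs \<subseteq> {..<length (fst (\<sigma> r))} \<Longrightarrow>
     store_ok B (fold (\<lambda>i s. run p (s(r := (fst (\<sigma> r), i)))) xs s) \<and>
     fst (fold (\<lambda>i s. run p (s(r := (fst (\<sigma> r), i)))) xs s r) = fst (\<sigma> r)" for xs s j
  proof (induction xs arbitrary: s j)
    case (Cons i xs)
    let ?s = "s(r := (fst (\<sigma> r), i))"
    have "store_ok B ?s" using store_ok_upd[of B s i r] Cons.prems by auto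
    then show ?case using Cons.IH[of "run p ?s" i] Cons.prems For
      by (simp add: run_untouched del: fun_upd_apply) (simp add: run_untouched)
  qed simp
  then have F: "store_ok B (fold (\<lambda>i s. run p (s(r := (fst (\<sigma> r), i)))) [0..<length (fst (\<sigma> r))] \<sigma>)"
    "fst (fold (\<lambda>i s. run p (s(r := (fst (\<sigma> r), i)))) [0..<length (fst (\<sigma> r))] \<sigma> r) = fst (\<sigma> r)"
    using For.prems(2) prod.collapse[of "\<sigma> r"] by (metis atLeast_upt order_refl)+
  show ?case using store_ok_upd[OF F(1), of 0 r] F(2) by (simp del: fun_upd_apply)
qed (auto simp: store_ok_def)

text \<open>The argument of the polynomial bounds the lengths of all loop tapes. A round of a loop
  takes 3 steps beyond its body (advance, sequencing, loop test), and each of the two rewinds at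
  most \<open>2 * n + 5\<close>; the final test and two sequencing steps complete the 13.\<close>

fun cost :: "'r prog \<Rightarrow> nat poly" where
  "cost (p ;; q) = cost p + cost q + 1"
| "cost (Branch r A p q) = cost p + cost q + 1"
| "cost (For r p) = [:0, 1:] * (cost p + [:3:]) + [:13, 4:]"
| "cost _ = [:5:]"

text \<open>Loop tapes are never written, so \<open>n\<close> bounds the number of rounds of every
  loop throughout the run. Each \<open>Put\<close> lengthens a tape by at most one cell, so the
  running time also bounds the growth.\<close>

lemma run_length:
  assumes "prog_ok B p" "\<And>r. r \<in> loops p \<Longrightarrow> length (fst (\<sigma> r)) \<le> n" "loops p \<inter> puts p = {}"
  shows "length (fst (run p \<sigma> r)) \<le> length (fst (\<sigma> r)) + poly (cost p) n"
  using assms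
proof (induction p arbitrary: \<sigma>)
  case (Then p q)
  have "length (fst (run p \<sigma> r')) \<le> n" if "r' \<in> loops q" for r'
  proof -
    have "r' \<notin> puts p" using Then.prems(3) that by auto
    then show ?thesis using Then.prems(1) Then.prems(2)[of r'] that run_unput[of r' p B \<sigma>] by simp
  qed
  then show ?case using Then.IH(1)[of \<sigma>] Then.IH(2)[of "run p \<sigma>"] Then.prems by fastforce
next
  case (Branch r' A p q)
  then have "loops p \<inter> puts p = {}" "loops q \<inter> puts q = {}" by auto
  then show ?case using Branch.IH[of \<sigma>] Branch.prems by fastforce
next
  case (For r' p)
  let ?c = "poly (cost p) n"
  let ?f = "\<lambda>i s. run p (s(r' := (fst (\<sigma> r'), i)))"
  have *: "(\<forall>r\<in>insert r' (loops p). fst (s r) = fst (\<sigma> r)) \<Longrightarrow>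
     length (fst (fold ?f xs s r)) \<le> length (fst (s r)) + length xs * ?c" for xs s
  proof (induction xs arbitrary: s)
    case (Cons i xs)
    let ?s = "s(r' := (fst (\<sigma> r'), i))"
    have 1: "\<forall>r\<in>insert r' (loops p). fst (run p ?s r) = fst (\<sigma> r)"
    proof
      fix r assume r: "r \<in> insert r' (loops p)"
      then have "r \<notin> puts p" using For.prems(3) by auto
      then have "fst (run p ?s r) = fst (?s r)" using run_unput[of r p B ?s] For.prems(1) by simp
      then show "fst (run p ?s r) = fst (\<sigma> r)" using Cons.prems r by auto
    qed
    have "length (fst (run p ?s r)) \<le> length (fst (?s r)) + ?c"
      by (rule For.IH) (use For.prems Cons.prems in auto)
    also have "fst (?s r) = fst (s r)" using Cons.prems by auto
    finally show ?case using Cons.IH[OF 1] by (simp del: fun_upd_apply)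
  qed simp
  have "length (fst (\<sigma> r')) * ?c \<le> n * ?c" using For.prems by (intro mult_le_mono1) simp
  moreover have "length (fst (run (For r' p) \<sigma> r)) \<le> length (fst (\<sigma> r)) + length (fst (\<sigma> r')) * ?c"
    using *[of \<sigma> "[0..<length (fst (\<sigma> r'))]"] by (cases "r = r'") simp_all
  moreover have "poly (cost (For r' p)) n = n * ?c + 7 * n + 13" by (simp add: algebra_simps)
  ultimately show ?case by linarith
qed auto

section \<open>Correctness and running time of the compilation\<close>

lemma read_content: "read_tape (content ws, z) = content ws z"
  by (simp add: read_tape_def)

lemma act_content:
  "act_tape (content ws z, m) (content ws, z) = (content ws, move_head m z)"
  by (simp add: act_tape_def)

lemma content_eq_0:
  assumes "0 \<notin> set ws"
  shows "content ws z = 0 \<longleftrightarrow> z < 0 \<or> int (length ws) \<le> z"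
proof -
  have "ws ! nat z \<noteq> 0" if "0 \<le> z" "z < int (length ws)"
  proof -
    have "nat z < length ws" using that by linarith
    then show ?thesis using assms by (metis nth_mem)
  qed
  then show ?thesis by (auto simp: content_def)
qed

lemma exec_go:
  "T r = (content ws, z) \<Longrightarrow> exec (go_left r) T (T(r := (content ws, z - 1))) 1"
  "T r = (content ws, z) \<Longrightarrow> exec (go_right r) T (T(r := (content ws, z + 1))) 1"
  using exec_Act[of r "\<lambda>s. (s, Move_Left)" T] exec_Act[of r "\<lambda>s. (s, Move_Right)" T]
  by (simp_all add: read_content act_content)

lemma exec_step_right:
  assumes "0 \<notin> set ws" "i < length ws" "T r = (content ws, int i)"
  shows "exec (step_right r) T (T(r := (content ws, int (Suc i)))) 1"
  using assms exec_Act[of r "\<lambda>s. (s, if s = 0 then Stay else Move_Right)" T]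
  by (simp add: read_content act_content content_eq_0 add.commute)

lemma exec_loop_left:
  assumes "0 \<notin> set ws" "i \<le> length ws" "T r = (content ws, int i - 1)"
  shows "exec (Loop r (- {0}) (go_left r)) T (T(r := (content ws, -1))) (2 * i + 1)"
  using assms(2,3)
proof (induction i arbitrary: T)
  case 0
  have "T(r := (content ws, -1)) = T" using 0 by (auto simp: fun_eq_iff)
  then show ?case using exec_Loop_end[of T r "- {0}" "go_left r"] 0
    by (simp add: read_content content_eq_0 assms)
next
  case (Suc i)
  let ?T = "T(r := (content ws, int i - 1))"
  have 1: "read_tape (T r) \<in> - {0}" using Suc by (simp add: read_content content_eq_0 assms)
  have 2: "exec (go_left r) T ?T 1" using exec_go(1)[of T r ws "int i"] Suc by simp
  have 3: "exec (Loop r (- {0}) (go_left r)) ?T (T(r := (content ws, -1))) (2 * i + 1)"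
  proof -
    have "?T(r := (content ws, -1)) = T(r := (content ws, -1))" by (rule fun_upd_upd)
    moreover have "i \<le> length ws" "?T r = (content ws, int i - 1)" using Suc.prems by simp_all
    ultimately show ?thesis using Suc.IH[of ?T] by metis
  qed
  have "1 + (2 * i + 1) + 1 = 2 * Suc i + 1" by simp
  then show ?case using exec_Loop_step[OF 1 2 3] by metis
qed

lemma exec_rewind:
  assumes "0 \<notin> set ws" "i \<le> length ws" "T r = (content ws, int i)"
  shows "exec (rewind r) T (T(r := (content ws, 0))) (2 * i + 5)"
proof -
  let ?T1 = "T(r := (content ws, int i - 1))" and ?T2 = "T(r := (content ws, -1))"
  have 1: "exec (go_left r) T ?T1 1" using exec_go(1) assms by fast
  have 2: "exec (Loop r (- {0}) (go_left r)) ?T1 ?T2 (2 * i + 1)"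
    using exec_loop_left[of ws i ?T1 r] assms by simp
  have 3: "exec (go_right r) ?T2 (T(r := (content ws, 0))) 1"
    using exec_go(2)[of ?T2 r ws "-1"] by simp
  have "1 + (2 * i + 1 + 1 + 1) + 1 = 2 * i + 5" by simp
  then show ?thesis using exec_Seq[OF 1 exec_Seq[OF 2 3]] unfolding rewind_def by metis
qed

theorem exec_compile:
  assumes "prog_ok B p" "store_ok B \<sigma>" "\<And>r. r \<in> loops p \<Longrightarrow> length (fst (\<sigma> r)) \<le> n"
    "loops p \<inter> puts p = {}"
  shows "\<exists>t\<le>poly (cost p) n.
    exec (compile p) (\<lambda>r. tape_of (\<sigma> r)) (\<lambda>r. tape_of (run p \<sigma> r)) t"
  using assms
proof (induction p arbitrary: \<sigma>)
  case Nop
  show ?case using exec_Skip by (intro exI[of _ 1]) simp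
next
  case (Put r a)
  have le: "snd (\<sigma> r) \<le> length (fst (\<sigma> r))" using Put by (simp add: store_ok_def)
  have "act_tape (a, Stay) (tape_of (\<sigma> r)) = tape_of (run (Put r a) \<sigma> r)"
    using le by (auto simp: act_tape_def tape_of_def content_def fun_eq_iff nth_append nth_list_update)
  then have "(\<lambda>r. tape_of (\<sigma> r))(r := act_tape (a, Stay) (tape_of (\<sigma> r))) =
      (\<lambda>r'. tape_of (run (Put r a) \<sigma> r'))" by (auto simp: fun_eq_iff)
  then show ?case using exec_Act[of r "\<lambda>s. (a, Stay)" "\<lambda>r. tape_of (\<sigma> r)"]
    by (intro exI[of _ 1]) simp
next
  case (MoveR r)
  have ok: "snd (\<sigma> r) \<le> length (fst (\<sigma> r))" "0 \<notin> set (fst (\<sigma> r))"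
    using MoveR.prems(2) store_okD(1,2)[of B \<sigma> r] by auto
  have "(\<lambda>r. tape_of (\<sigma> r))(r := act_tape (let s = read_tape (tape_of (\<sigma> r)) in
        (s, if s = 0 then Stay else Move_Right)) (tape_of (\<sigma> r))) =
      (\<lambda>r'. tape_of (run (MoveR r) \<sigma> r'))"
    using ok
    by (auto simp: fun_eq_iff tape_of_def read_content act_content content_eq_0 Let_def)
  then show ?case
    using exec_Act[of r "\<lambda>s. (s, if s = 0 then Stay else Move_Right)" "\<lambda>r. tape_of (\<sigma> r)"]
    by (intro exI[of _ 1]) (simp add: Let_def)
next
  case (MoveL r)
  define T where "T = (\<lambda>r. tape_of (\<sigma> r))"
  define ws where "ws = fst (\<sigma> r)"
  define i where "i = snd (\<sigma> r)"
  let ?T1 = "T(r := (content ws, int i - 1))"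
  let ?T2 = "\<lambda>r'. tape_of (run (MoveL r) \<sigma> r')"
  have ok: "i \<le> length ws" "0 \<notin> set ws"
    using MoveL.prems(2) store_okD(1,2)[of B \<sigma> r] by (auto simp: ws_def i_def)
  have Tr: "T r = (content ws, int i)" by (simp add: T_def tape_of_def ws_def i_def)
  have 1: "exec (go_left r) T ?T1 1" using exec_go(1) Tr by fast
  have T2: "?T2 = T(r := (content ws, int (i - 1)))"
    by (auto simp: T_def fun_eq_iff tape_of_def ws_def i_def)
  have 2: "exec (Cond r {0} (go_right r) Skip) ?T1 ?T2 2"
  proof (cases "i = 0")
    case True
    then show ?thesis using exec_go(2)[of ?T1 r ws "-1"] ok T2
      exec_Cond[of ?T1 r "{0}" "go_right r" Skip ?T2 1]
      by (simp add: read_content content_eq_0 numeral_2_eq_2)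
  next
    case False
    then have "?T1 = ?T2" using T2 by (simp add: of_nat_diff)
    moreover have "exec (Cond r {0} (go_right r) Skip) ?T1 ?T1 2"
      using False ok exec_Cond[of ?T1 r "{0}" "go_right r" Skip ?T1 1] exec_Skip[of ?T1]
      by (simp add: read_content content_eq_0 numeral_2_eq_2)
    ultimately show ?thesis by simp
  qed
  show ?case using exec_Seq[OF 1 2] by (intro exI[of _ 4]) (simp add: T_def eval_nat_numeral)
next
  case (Then p q)
  obtain t where t: "t \<le> poly (cost p) n"
    "exec (compile p) (\<lambda>r. tape_of (\<sigma> r)) (\<lambda>r. tape_of (run p \<sigma> r)) t"
    using Then.IH(1)[of \<sigma>] Then.prems by fastforce
  have "length (fst (run p \<sigma> r)) \<le> n" if "r \<in> loops q" for r
  proof -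
    have "r \<notin> puts p" using Then.prems(4) that by auto
    then show ?thesis using Then.prems(1) Then.prems(3)[of r] that run_unput[of r p B \<sigma>] by simp
  qed
  then obtain t' where t': "t' \<le> poly (cost q) n"
    "exec (compile q) (\<lambda>r. tape_of (run p \<sigma> r)) (\<lambda>r. tape_of (run q (run p \<sigma>) r)) t'"
    using Then.IH(2)[of "run p \<sigma>"] Then.prems run_store_ok[of B p \<sigma>] by fastforce
  show ?case using exec_Seq[OF t(2) t'(2)] t(1) t'(1)
    by (intro exI[of _ "t + t' + 1"]) simp
next
  case (Branch r A p q)
  let ?T = "\<lambda>r. tape_of (\<sigma> r)"
  have rd: "read_tape (tape_of (\<sigma> r)) = scan (\<sigma> r)"
    by (simp add: tape_of_def read_content content_def scan_def)
  obtain t where t: "t \<le> poly (cost p) n + poly (cost q) n"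
    "exec (if scan (\<sigma> r) \<in> A then compile p else compile q) ?T
       (\<lambda>r'. tape_of (run (Branch r A p q) \<sigma> r')) t"
  proof (cases "scan (\<sigma> r) \<in> A")
    case True
    then show ?thesis using Branch.IH(1)[of \<sigma>] Branch.prems that by fastforce
  next
    case False
    then show ?thesis using Branch.IH(2)[of \<sigma>] Branch.prems that by fastforce
  qed
  then show ?case using exec_Cond[of ?T r A "compile p" "compile q" _ t] rd
    by (intro exI[of _ "t + 1"]) simp
next
  case (For r p)
  define ws where "ws = fst (\<sigma> r)"
  define c where "c = poly (cost p) n"
  let ?f = "\<lambda>i s. run p (s(r := (ws, i)))"
  let ?L = "Loop r (- {0}) (Seq (compile p) (step_right r))"
  have ws: "0 \<notin> set ws" "length ws \<le> n" using For.prems store_okD(2)[of B \<sigma> r] by (auto simp: ws_def)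
  have r: "r \<notin> touched p" using For.prems by simp
  \<comment> \<open>Generalised to a start at any cell \<open>i\<close>; the induction is on the
    number of cells that are left.\<close>
  have loop: "\<exists>t\<le>(length ws - i) * (c + 3) + 1.
      exec ?L (\<lambda>r. tape_of (s r))
        (\<lambda>r'. tape_of (((fold ?f [i..<length ws] s)(r := (ws, length ws))) r')) t"
    if "store_ok B s" "s r = (ws, i)" "i \<le> length ws"
      "\<forall>r\<in>loops p. length (fst (s r)) \<le> n" for i s
    using that
  proof (induction "length ws - i" arbitrary: i s)
    case 0
    then have "i = length ws" by simp
    moreover have "s(r := (ws, length ws)) = s" using 0 \<open>i = length ws\<close> by (auto simp: fun_eq_iff)
    ultimately show ?case
      using exec_Loop_end[of "\<lambda>r. tape_of (s r)" r "- {0}" "Seq (compile p) (step_right r)"] 0 ws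
      by (intro exI[of _ 1]) (simp add: tape_of_def read_content content_eq_0)
  next
    case (Suc d)
    then have i: "i < length ws" by simp
    have s_eq: "s(r := (ws, i)) = s" using Suc.prems by (auto simp: fun_eq_iff)
    let ?s1 = "run p s" and ?s2 = "(run p s)(r := (ws, Suc i))"
    have r1: "?s1 r = (ws, i)" using run_untouched[OF r, of s] Suc.prems by simp
    obtain t where t: "t \<le> c" "exec (compile p) (\<lambda>r. tape_of (s r)) (\<lambda>r. tape_of (?s1 r)) t"
      using For.IH[of s] For.prems Suc.prems unfolding c_def by fastforce
    have T2: "(\<lambda>r. tape_of (?s1 r))(r := (content ws, int (Suc i))) = (\<lambda>r. tape_of (?s2 r))"
      by (auto simp: fun_eq_iff tape_of_def)
    have 2: "exec (step_right r) (\<lambda>r. tape_of (?s1 r)) (\<lambda>r. tape_of (?s2 r)) 1"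
      using exec_step_right[of ws i "\<lambda>r. tape_of (?s1 r)" r] ws i r1 T2 by (simp add: tape_of_def)
    have ok1: "store_ok B ?s1" using run_store_ok For.prems Suc.prems by auto
    have ok2: "store_ok B ?s2" using store_ok_upd[OF ok1, of "Suc i" r] r1 i by simp
    have len: "\<forall>r'\<in>loops p. length (fst (?s2 r')) \<le> n"
    proof
      fix r' assume r': "r' \<in> loops p"
      then have "r' \<notin> puts p" using For.prems(4) by auto
      then have "fst (run p s r') = fst (s r')" using run_unput[of r' p B s] For.prems(1) by simp
      then show "length (fst (?s2 r')) \<le> n" using Suc.prems r' ws by auto
    qed
    have fold_eq: "fold ?f [i..<length ws] s = fold ?f [Suc i..<length ws] ?s1"
      using i s_eq by (simp add: upt_conv_Cons)
    \<comment> \<open>Every round sets \<open>r\<close> before it starts, so an update of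
      \<open>r\<close> in front of the \<open>fold\<close> survives only if there is no round at
      all.\<close>
    have fold_eq2: "fold ?f xs (a(r := w)) = (if xs = [] then a(r := w) else fold ?f xs a)" for xs a w
      by (cases xs) auto
    have fin: "(fold ?f [Suc i..<length ws] ?s2)(r := (ws, length ws)) =
        (fold ?f [i..<length ws] s)(r := (ws, length ws))"
      unfolding fold_eq by (subst fold_eq2) auto
    obtain t' where t': "t' \<le> (length ws - Suc i) * (c + 3) + 1"
      "exec ?L (\<lambda>r. tape_of (?s2 r))
        (\<lambda>r'. tape_of (((fold ?f [i..<length ws] s)(r := (ws, length ws))) r')) t'"
    proof -
      have d: "d = length ws - Suc i" and "?s2 r = (ws, Suc i)" and "Suc i \<le> length ws"
        using Suc.hyps(2) i by simp_all
      from Suc.hyps(1)[OF d ok2 this(2,3) len, unfolded fin] that show ?thesis by blast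
    qed
    have rd: "read_tape (tape_of (s r)) \<in> - {0}"
      using Suc.prems i ws by (simp add: tape_of_def read_content content_eq_0)
    have "(length ws - i) * (c + 3) = (length ws - Suc i) * (c + 3) + (c + 3)"
      using i by (metis Suc_diff_Suc mult_Suc add.commute)
    then show ?case
      using exec_Loop_step[OF rd exec_Seq[OF t(2) 2] t'(2)] t(1) t'(1)
      by (intro exI[of _ "t + 1 + 1 + t' + 1"]) simp
  qed
  let ?s0 = "\<sigma>(r := (ws, 0))"
  have ok0: "store_ok B ?s0" using store_ok_upd[OF For.prems(2), of 0 r] by (simp add: ws_def)
  have len0: "\<forall>r'\<in>loops p. length (fst (?s0 r')) \<le> n" using For.prems by (auto simp: ws_def)
  obtain t where t: "t \<le> length ws * (c + 3) + 1"
    "exec ?L (\<lambda>r. tape_of (?s0 r))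
       (\<lambda>r'. tape_of (((fold ?f [0..<length ws] ?s0)(r := (ws, length ws))) r')) t"
  proof -
    have "?s0 r = (ws, 0)" by simp
    from loop[OF ok0 this le0 len0, unfolded diff_zero minus_nat.diff_0] that show ?thesis by blast
  qed
  have pos: "snd (\<sigma> r) \<le> length ws" using For.prems by (simp add: store_ok_def ws_def)
  have T0: "(\<lambda>r. tape_of (\<sigma> r))(r := (content ws, 0)) = (\<lambda>r. tape_of (?s0 r))"
    by (auto simp: fun_eq_iff tape_of_def)
  have rw: "exec (rewind r) (\<lambda>r. tape_of (\<sigma> r)) (\<lambda>r. tape_of (?s0 r)) (2 * snd (\<sigma> r) + 5)"
    using exec_rewind[of ws "snd (\<sigma> r)" "\<lambda>r. tape_of (\<sigma> r)" r] ws pos T0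
    by (simp add: tape_of_def ws_def)
  have f0: "fold ?f xs ?s0 = (if xs = [] then ?s0 else fold ?f xs \<sigma>)" for xs
    by (cases xs) auto
  let ?fin = "fold ?f [0..<length ws] ?s0"
  have T3: "(\<lambda>r'. tape_of ((?fin(r := (ws, length ws))) r'))(r := (content ws, 0)) =
      (\<lambda>r'. tape_of (run (For r p) \<sigma> r'))"
    by (subst f0) (auto simp: fun_eq_iff tape_of_def ws_def[symmetric])
  have rw2: "exec (rewind r) (\<lambda>r'. tape_of ((?fin(r := (ws, length ws))) r'))
      (\<lambda>r'. tape_of (run (For r p) \<sigma> r')) (2 * length ws + 5)"
    using exec_rewind[of ws "length ws" "\<lambda>r'. tape_of ((?fin(r := (ws, length ws))) r')" r] ws T3
    by (simp add: tape_of_def)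
  have "length ws * (c + 3) \<le> n * (c + 3)" using ws by simp
  then have "2 * snd (\<sigma> r) + 5 + (t + (2 * length ws + 5) + 1) + 1 \<le> poly (cost (For r p)) n"
    using t(1) ws pos by (simp add: c_def algebra_simps)
  then show ?case using exec_Seq[OF rw exec_Seq[OF t(2) rw2]] unfolding compile.simps by blast
qed


text \<open>A semantic notion that survives composition: a later phase may loop over tapes which an
  earlier one has written, although within a single phase looped and written tapes must be disjoint
  for the syntactic cost bound.\<close>

definition poly_prog :: "nat \<Rightarrow> 'r prog \<Rightarrow> bool" where
  "poly_prog B p \<longleftrightarrow> prog_ok B p \<and>
     (\<exists>q. \<forall>\<sigma> n. store_ok B \<sigma> \<longrightarrow> (\<forall>r. length (fst (\<sigma> r)) \<le> n) \<longrightarrow>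
        (\<exists>t\<le>poly q n. exec (compile p) (\<lambda>r. tape_of (\<sigma> r)) (\<lambda>r. tape_of (run p \<sigma> r)) t) \<and>
        (\<forall>r. length (fst (run p \<sigma> r)) \<le> poly q n))"

lemma poly_prog_flat:
  assumes "prog_ok B p" "loops p \<inter> puts p = {}"
  shows "poly_prog B p"
  unfolding poly_prog_def
proof (intro conjI exI[of _ "cost p + [:0, 1:]"] allI impI)
  fix \<sigma> :: "'a store" and n
  assume \<sigma>: "store_ok B \<sigma>" "\<forall>r. length (fst (\<sigma> r)) \<le> n"
  obtain t where "t \<le> poly (cost p) n"
    "exec (compile p) (\<lambda>r. tape_of (\<sigma> r)) (\<lambda>r. tape_of (run p \<sigma> r)) t"
    using exec_compile[OF assms(1) \<sigma>(1), of n] \<sigma>(2) assms(2) by auto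
  then show "\<exists>t\<le>poly (cost p + [:0, 1:]) n.
      exec (compile p) (\<lambda>r. tape_of (\<sigma> r)) (\<lambda>r. tape_of (run p \<sigma> r)) t"
    by (intro exI[of _ t]) simp
  fix r
  have "length (fst (run p \<sigma> r)) \<le> length (fst (\<sigma> r)) + poly (cost p) n"
    using run_length[OF assms(1) _ assms(2)] \<sigma>(2) by blast
  then show "length (fst (run p \<sigma> r)) \<le> poly (cost p + [:0, 1:]) n"
    using \<sigma>(2)[rule_format, of r] by simp
qed (use assms in simp)

lemma poly_prog_Then:
  assumes "poly_prog B p" "poly_prog B q"
  shows "poly_prog B (p ;; q)"
proof -
  obtain a where a: "\<And>\<sigma> n. store_ok B \<sigma> \<Longrightarrow> \<forall>r. length (fst (\<sigma> r)) \<le> n \<Longrightarrow>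
     (\<exists>t\<le>poly a n. exec (compile p) (\<lambda>r. tape_of (\<sigma> r)) (\<lambda>r. tape_of (run p \<sigma> r)) t) \<and>
     (\<forall>r. length (fst (run p \<sigma> r)) \<le> poly a n)"
    using assms(1) unfolding poly_prog_def by blast
  obtain b where b: "\<And>\<sigma> n. store_ok B \<sigma> \<Longrightarrow> \<forall>r. length (fst (\<sigma> r)) \<le> n \<Longrightarrow>
     (\<exists>t\<le>poly b n. exec (compile q) (\<lambda>r. tape_of (\<sigma> r)) (\<lambda>r. tape_of (run q \<sigma> r)) t) \<and>
     (\<forall>r. length (fst (run q \<sigma> r)) \<le> poly b n)"
    using assms(2) unfolding poly_prog_def by blast
  have ok: "prog_ok B p" "prog_ok B q" using assms by (auto simp: poly_prog_def)
  show ?thesis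
    unfolding poly_prog_def
  proof (intro conjI exI[of _ "a + pcompose b a + 1"] allI impI)
    fix \<sigma> :: "'a store" and n
    assume \<sigma>: "store_ok B \<sigma>" "\<forall>r. length (fst (\<sigma> r)) \<le> n"
    note A = a[OF \<sigma>]
    note Q = b[OF run_store_ok[OF ok(1) \<sigma>(1)], of "poly a n"]
    obtain t where t: "t \<le> poly a n"
      "exec (compile p) (\<lambda>r. tape_of (\<sigma> r)) (\<lambda>r. tape_of (run p \<sigma> r)) t" using A by blast
    obtain t' where t': "t' \<le> poly b (poly a n)"
      "exec (compile q) (\<lambda>r. tape_of (run p \<sigma> r)) (\<lambda>r. tape_of (run q (run p \<sigma>) r)) t'"
      using A Q by blast
    show "\<exists>t\<le>poly (a + pcompose b a + 1) n.
        exec (compile (p ;; q)) (\<lambda>r. tape_of (\<sigma> r)) (\<lambda>r. tape_of (run (p ;; q) \<sigma> r)) t"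
      using exec_Seq[OF t(2) t'(2)] t(1) t'(1)
      by (intro exI[of _ "t + t' + 1"]) (simp add: poly_pcompose)
    show "length (fst (run (p ;; q) \<sigma> r)) \<le> poly (a + pcompose b a + 1) n" for r
    proof -
      have "length (fst (run q (run p \<sigma>) r)) \<le> poly b (poly a n)" using A Q by blast
      then show ?thesis by (simp add: poly_pcompose)
    qed
  qed (use ok in simp)
qed

section \<open>From programs to polynomial-time functions and relations\<close>

definition bit_symbol :: "bool \<Rightarrow> nat" where
  "bit_symbol b = (if b then 2 else 1)"

lemma string_tape_eq: "string_tape w = tape_of (map bit_symbol w, 0)"
  by (auto simp: string_tape_def tape_of_def content_def bit_symbol_def fun_eq_iff nat_less_iff)

definition input_store :: "'r \<Rightarrow> 'r \<Rightarrow> bool list \<Rightarrow> bool list \<Rightarrow> 'r store" where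
  "input_store rx ry x y =
     (\<lambda>r. ([], 0))(ry := (map bit_symbol y, 0), rx := (map bit_symbol x, 0))"

lemma finite_regs: "finite (regs p)"
  by (induction p) auto

text \<open>The registers are listed with \<open>rx\<close> and \<open>ry\<close> in front and
  \<open>ro\<close> at the end, as the conventions for input and output demand. A missing second
  input and an empty one give the same initial configuration, which serves machines with one and
  with two inputs alike.\<close>

theorem prog_to_tm:
  fixes p :: "'r prog"
  assumes p: "poly_prog B p" and B: "3 \<le> B" and dist: "rx \<noteq> ry" "rx \<noteq> ro" "ry \<noteq> ro"
  shows "\<exists>M q. tm_wf M \<and>
    (\<forall>x y z. fst (run p (input_store rx ry x y) ro) = map bit_symbol z \<longrightarrow>
       computes_within M [x, y] z (poly q (length x + length y)) \<and>
       (y = [] \<longrightarrow> computes_within M [x] z (poly q (length x))))"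
proof -
  obtain rest where rest: "set rest = regs p - {rx, ry, ro}" "distinct rest"
    using finite_distinct_list[OF finite_Diff[OF finite_regs]] by metis
  define rs where "rs = rx # ry # rest @ [ro]"
  have rs: "distinct rs" "rs \<noteq> []" "regs p \<subseteq> set rs" using rest dist by (auto simp: rs_def)
  have ok: "prog_ok B p" using p by (simp add: poly_prog_def)
  obtain M where M: "tm_wf M" "tape_count M = length rs"
    "\<And>T T' t. exec (compile p) T T' t \<Longrightarrow>
       (tm_step M ^^ t) (start_state M, map T rs) = (halt_state M, map T' rs)"
    using stmt_to_tm[OF rs(1,2) B stmt_ok_compile[OF ok rs(3)]] by blast
  obtain q where q: "\<And>\<sigma> n. store_ok B \<sigma> \<Longrightarrow> \<forall>r. length (fst (\<sigma> r)) \<le> n \<Longrightarrow>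
     (\<exists>t\<le>poly q n. exec (compile p) (\<lambda>r. tape_of (\<sigma> r)) (\<lambda>r. tape_of (run p \<sigma> r)) t)"
    using p unfolding poly_prog_def by blast
  have init2: "tm_init M [x, y] = (start_state M, map (\<lambda>r. tape_of (input_store rx ry x y r)) rs)"
    for x y
  proof -
    have "map (\<lambda>j. string_tape (if j < length [x, y] then [x, y] ! j else [])) [0..<length rs] =
        map (\<lambda>r. tape_of (input_store rx ry x y r)) rs"
    proof (rule nth_equalityI)
      fix i assume i: "i < length (map (\<lambda>j. string_tape
        (if j < length [x, y] then [x, y] ! j else [])) [0..<length rs])"
      then have i: "i < length rs" by simp
      have "string_tape (if i < length [x, y] then [x, y] ! i else []) =
          tape_of (input_store rx ry x y (rs ! i))"
      proof -
        consider "i = 0" | "i = 1" | k where "i = Suc (Suc k)"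
          by (metis One_nat_def not0_implies_Suc)
        then show ?thesis
        proof cases
          case 3
          have "rs ! i \<noteq> rx" "rs ! i \<noteq> ry"
            using nth_eq_iff_index_eq[OF rs(1), of i 0] nth_eq_iff_index_eq[OF rs(1), of i 1] i 3
            by (auto simp: rs_def)
          then show ?thesis using 3 by (simp add: string_tape_eq input_store_def)
        qed (use dist in \<open>auto simp: string_tape_eq input_store_def rs_def\<close>)
      qed
      then show "map (\<lambda>j. string_tape (if j < length [x, y] then [x, y] ! j else [])) [0..<length rs] ! i =
          map (\<lambda>r. tape_of (input_store rx ry x y r)) rs ! i"
        using i by (simp split del: if_split cong del: if_weak_cong)
    qed simp
    then show ?thesis by (simp add: tm_init_def M)
  qed
  have init1: "tm_init M [x] = tm_init M [x, []]" for x
  proof -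
    have "[x, []] ! j = []" if "\<not> j < length [x]" "j < length [x, []]" for j
      using that by (cases j) auto
    then have "(if j < length [x] then [x] ! j else []) =
        (if j < length [x, []] then [x, []] ! j else [])" for j by (cases j) auto
    then show ?thesis by (simp add: tm_init_def)
  qed
  have comp: "\<exists>t\<le>poly q (length x + length y). case (tm_step M ^^ t) (tm_init M [x, y]) of
      (q, tps) \<Rightarrow> q = halt_state M \<and> tape_output (last tps) z"
    if "fst (run p (input_store rx ry x y) ro) = map bit_symbol z" for x y z
  proof -
    let ?\<sigma> = "input_store rx ry x y"
    have "store_ok B ?\<sigma>" using B by (auto simp: store_ok_def input_store_def bit_symbol_def)
    moreover have "\<forall>r. length (fst (?\<sigma> r)) \<le> length x + length y"
      by (auto simp: input_store_def)
    ultimately obtain t where t: "t \<le> poly q (length x + length y)"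
      "exec (compile p) (\<lambda>r. tape_of (?\<sigma> r)) (\<lambda>r. tape_of (run p ?\<sigma> r)) t"
      using q by blast
    have "last (map (\<lambda>r. tape_of (run p ?\<sigma> r)) rs) = tape_of (run p ?\<sigma> ro)" by (simp add: rs_def)
    moreover have "tape_output (tape_of (run p ?\<sigma> ro)) z"
      using that by (simp add: tape_output_def tape_of_def string_tape_eq)
    ultimately show ?thesis using M(3)[OF t(2)] t(1) by (intro exI[of _ t]) (simp add: init2)
  qed
  have "computes_within M [x, y] z (poly q (length x + length y)) \<and>
       (y = [] \<longrightarrow> computes_within M [x] z (poly q (length x)))"
    if "fst (run p (input_store rx ry x y) ro) = map bit_symbol z" for x y z
    using comp[OF that] by (auto simp: computes_within_def M(2) rs_def init1)
  then show ?thesis using M(1) by blast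
qed

corollary prog_computable:
  fixes p :: "'r prog"
  assumes "poly_prog B p" "3 \<le> B" "rx \<noteq> ry" "rx \<noteq> ro" "ry \<noteq> ro"
    "\<And>x. fst (run p (input_store rx ry x []) ro) = map bit_symbol (f x)"
  shows "poly_time_computable f"
  using prog_to_tm[OF assms(1-5)] assms(6) unfolding poly_time_computable_def by blast

corollary prog_decidable2:
  fixes p :: "'r prog"
  assumes "poly_prog B p" "3 \<le> B" "rx \<noteq> ry" "rx \<noteq> ro" "ry \<noteq> ro"
    "\<And>x y. fst (run p (input_store rx ry x y) ro) = [bit_symbol (R x y)]"
  shows "poly_time_decidable2 R"
proof -
  obtain M q where "tm_wf M" "\<And>x y z. fst (run p (input_store rx ry x y) ro) = map bit_symbol z \<Longrightarrow>
      computes_within M [x, y] z (poly q (length x + length y))"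
    using prog_to_tm[OF assms(1-5)] by blast
  moreover have "fst (run p (input_store rx ry x y) ro) = map bit_symbol [R x y]" for x y
    using assms(6) by simp
  ultimately show ?thesis unfolding poly_time_decidable2_def by blast
qed

section \<open>First-order formulas and generators over a word\<close>

datatype fm =
    Less nat nat
  | Letter nat "nat set"
  | Rel nat nat nat nat
  | Neg fm
  | And fm fm
  | All nat fm

datatype gen =
    Emit "bool list"
  | GSeq gen gen
  | GIf fm gen gen
  | GFor nat gen

text \<open>Variables range over the positions \<open>{..<P}\<close> of a word with letters \<open>w\<close>; \<open>R\<close> is a family
  of ternary relations.\<close>

fun holds :: "nat \<Rightarrow> (nat \<Rightarrow> nat) \<Rightarrow> (nat \<Rightarrow> nat \<Rightarrow> nat \<Rightarrow> nat \<Rightarrow> bool) \<Rightarrow> fm \<Rightarrow> (nat \<Rightarrow> nat) \<Rightarrow> bool" where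
  "holds P w R (Less a b) e \<longleftrightarrow> e a < e b"
| "holds P w R (Letter a A) e \<longleftrightarrow> w (e a) \<in> A"
| "holds P w R (Rel j a b c) e \<longleftrightarrow> R j (e a) (e b) (e c)"
| "holds P w R (Neg \<phi>) e \<longleftrightarrow> \<not> holds P w R \<phi> e"
| "holds P w R (And \<phi> \<psi>) e \<longleftrightarrow> holds P w R \<phi> e \<and> holds P w R \<psi> e"
| "holds P w R (All v \<phi>) e \<longleftrightarrow> (\<forall>i<P. holds P w R \<phi> (e(v := i)))"

fun out :: "nat \<Rightarrow> (nat \<Rightarrow> nat) \<Rightarrow> (nat \<Rightarrow> nat \<Rightarrow> nat \<Rightarrow> nat \<Rightarrow> bool) \<Rightarrow> gen \<Rightarrow> (nat \<Rightarrow> nat) \<Rightarrow> bool list" where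
  "out P w R (Emit bs) e = bs"
| "out P w R (GSeq g h) e = out P w R g e @ out P w R h e"
| "out P w R (GIf \<phi> g h) e = (if holds P w R \<phi> e then out P w R g e else out P w R h e)"
| "out P w R (GFor v g) e = concat (map (\<lambda>i. out P w R g (e(v := i))) [0..<P])"

fun bound_vars :: "fm \<Rightarrow> nat set" where
  "bound_vars (Neg \<phi>) = bound_vars \<phi>"
| "bound_vars (And \<phi> \<psi>) = bound_vars \<phi> \<union> bound_vars \<psi>"
| "bound_vars (All v \<phi>) = insert v (bound_vars \<phi>)"
| "bound_vars _ = {}"

text \<open>A variable is a physical loop tape, hence a quantifier must not occur inside another one
  for the same variable. Variables from \<open>n\<close> on are left to the search in the
  certificate.\<close>

fun fm_ok :: "nat \<Rightarrow> fm \<Rightarrow> bool" where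
  "fm_ok n (Less a b) \<longleftrightarrow> a < n \<and> b < n"
| "fm_ok n (Letter a A) \<longleftrightarrow> a < n"
| "fm_ok n (Rel j a b c) \<longleftrightarrow> a < n \<and> b < n \<and> c < n"
| "fm_ok n (Neg \<phi>) \<longleftrightarrow> fm_ok n \<phi>"
| "fm_ok n (And \<phi> \<psi>) \<longleftrightarrow> fm_ok n \<phi> \<and> fm_ok n \<psi>"
| "fm_ok n (All v \<phi>) \<longleftrightarrow> v < n \<and> v \<notin> bound_vars \<phi> \<and> fm_ok n \<phi>"

fun gen_vars :: "gen \<Rightarrow> nat set" where
  "gen_vars (Emit bs) = {}"
| "gen_vars (GSeq g h) = gen_vars g \<union> gen_vars h"
| "gen_vars (GIf \<phi> g h) = bound_vars \<phi> \<union> gen_vars g \<union> gen_vars h"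
| "gen_vars (GFor v g) = insert v (gen_vars g)"

fun gen_ok :: "nat \<Rightarrow> gen \<Rightarrow> bool" where
  "gen_ok n (Emit bs) \<longleftrightarrow> True"
| "gen_ok n (GSeq g h) \<longleftrightarrow> gen_ok n g \<and> gen_ok n h"
| "gen_ok n (GIf \<phi> g h) \<longleftrightarrow> fm_ok n \<phi> \<and> gen_ok n g \<and> gen_ok n h"
| "gen_ok n (GFor v g) \<longleftrightarrow> v < n \<and> v \<notin> gen_vars g \<and> gen_ok n g"

text \<open>Tapes: input \<open>RX\<close>, certificate \<open>RY\<close>, output \<open>RO\<close>, generated string \<open>RZ\<close>, binary counter
  \<open>RC\<close>, helpers \<open>RH\<close> and \<open>RK\<close>, flags \<open>RL\<close>, \<open>RR\<close> and \<open>RF v\<close>, unary numbers \<open>RU b k\<close>. A variable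
  \<open>v\<close> is the head position of the loop tape \<open>RV v\<close>; its position is repeated on the shadow tape
  \<open>RS v\<close>, whose head, unlike that of a loop tape, may move inside the loop.\<close>

datatype reg = RX | RY | RO | RZ | RC | RH | RK | RL | RR | RV nat | RS nat | RF nat | RU bool nat

text \<open>Both shadow heads advance until one of them meets the end of the word; that one belongs
  to the larger position. By then \<open>RK\<close> has moved some \<open>m\<close> cells, so among
  the rounds of the second loop exactly the last \<open>m\<close> find \<open>RK\<close> at the end
  of its word, and these move the heads back.\<close>

definition less_prog :: "nat \<Rightarrow> nat \<Rightarrow> reg prog" where
  "less_prog a b =
     For RH (Branch (RS a) {0} Nop (Branch (RS b) {0} Nop
       (MoveR (RS a) ;; MoveR (RS b) ;; MoveR RK))) ;;
     Branch (RS b) {0} (Branch (RS a) {0} (Put RL 1) (Put RL 2)) (Put RL 1) ;;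
     For RH (Branch RK {0} (MoveL (RS a) ;; MoveL (RS b)) (MoveR RK)) ;;
     For RK Nop"

text \<open>A loop with an empty body, here over \<open>RS v\<close>, is the idiom for rewinding a
  tape.\<close>

definition for_var :: "nat \<Rightarrow> reg prog \<Rightarrow> reg prog" where
  "for_var v p = For (RV v) (p ;; MoveR (RS v)) ;; For (RS v) Nop"

definition if_eq :: "nat \<Rightarrow> nat \<Rightarrow> reg prog \<Rightarrow> reg prog" where
  "if_eq a b p = less_prog a b ;; Branch RL {2} Nop (less_prog b a ;; Branch RL {2} Nop p)"

text \<open>No position is ever computed on the certificate tape, whose table has cubic size. The
  tape is traversed from left to right while three further variables enumerate all triples, and the
  bit under the head is recorded when they hit the wanted triple. Behind the end of a short
  certificate the blank counts as false.\<close>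

definition rel_block :: "nat \<Rightarrow> bool \<Rightarrow> nat \<Rightarrow> nat \<Rightarrow> nat \<Rightarrow> reg prog" where
  "rel_block n hit a b c = for_var n (for_var (n + 1) (for_var (n + 2)
     ((if hit then if_eq n a (if_eq (n + 1) b (if_eq (n + 2) c (Branch RY {2} (Put RR 2) Nop)))
       else Nop) ;; MoveR RY)))"

fun rel_blocks :: "nat \<Rightarrow> nat \<Rightarrow> nat \<Rightarrow> nat \<Rightarrow> nat \<Rightarrow> nat \<Rightarrow> reg prog" where
  "rel_blocks n j a b c 0 = Nop"
| "rel_blocks n j a b c (Suc k) = rel_blocks n j a b c k ;; rel_block n (k = j) a b c"

definition rel_prog :: "nat \<Rightarrow> nat \<Rightarrow> nat \<Rightarrow> nat \<Rightarrow> nat \<Rightarrow> reg prog" where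
  "rel_prog n j a b c = Put RR 1 ;; rel_blocks n j a b c (Suc j) ;; For RY Nop"

text \<open>Truth values become control flow: \<open>p\<close> and \<open>q\<close> are what is
  executed in the two cases. Conjunction duplicates \<open>q\<close>, which is harmless for a fixed
  formula. For a quantifier, \<open>RF v\<close> remembers whether a counterexample has occurred.
  The case \<open>a = b\<close> is separated since \<open>less_prog\<close> moves two distinct
  heads.\<close>

fun test :: "nat \<Rightarrow> fm \<Rightarrow> reg prog \<Rightarrow> reg prog \<Rightarrow> reg prog" where
  "test n (Less a b) p q = (if a = b then q else less_prog a b ;; Branch RL {2} p q)"
| "test n (Letter a A) p q = Branch (RV a) A p q"
| "test n (Rel j a b c) p q = rel_prog n j a b c ;; Branch RR {2} p q"
| "test n (Neg \<phi>) p q = test n \<phi> q p"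
| "test n (And \<phi> \<psi>) p q = test n \<phi> (test n \<psi> p q) q"
| "test n (All v \<phi>) p q =
     Put (RF v) 1 ;; for_var v (test n \<phi> Nop (Put (RF v) 2)) ;; Branch (RF v) {1} p q"

fun gen_prog :: "nat \<Rightarrow> (bool \<Rightarrow> reg prog) \<Rightarrow> gen \<Rightarrow> reg prog" where
  "gen_prog n em (Emit bs) = foldr (\<lambda>b p. em b ;; p) bs Nop"
| "gen_prog n em (GSeq g h) = gen_prog n em g ;; gen_prog n em h"
| "gen_prog n em (GIf \<phi> g h) = test n \<phi> (gen_prog n em g) (gen_prog n em h)"
| "gen_prog n em (GFor v g) = for_var v (gen_prog n em g)"

lemma run_For_inv:
  assumes "Q 0 \<sigma>" "\<And>i s. i < length (fst (\<sigma> r)) \<Longrightarrow> Q i s \<Longrightarrow> Q (Suc i) (run p (s(r := (fst (\<sigma> r), i))))"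
  obtains s where "Q (length (fst (\<sigma> r))) s" "run (For r p) \<sigma> = s(r := (fst (\<sigma> r), 0))"
proof -
  have "k \<le> length (fst (\<sigma> r)) \<Longrightarrow>
      Q k (fold (\<lambda>i s. run p (s(r := (fst (\<sigma> r), i)))) [0..<k] \<sigma>)" for k
    using assms by (induction k) auto
  then show ?thesis using that by auto
qed

lemma run_For_Nop: "run (For r Nop) \<sigma> = \<sigma>(r := (fst (\<sigma> r), 0))"
proof -
  obtain s where "\<forall>r'. r' \<noteq> r \<longrightarrow> s r' = \<sigma> r'" "run (For r Nop) \<sigma> = s(r := (fst (\<sigma> r), 0))"
    by (rule run_For_inv[where Q = "\<lambda>i s. \<forall>r'. r' \<noteq> r \<longrightarrow> s r' = \<sigma> r'" and \<sigma> = \<sigma> and r = r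
          and p = Nop]) auto
  then show ?thesis by (auto simp: fun_eq_iff)
qed

section \<open>Evaluation of formulas and generators on a fixed word\<close>

locale word_programs =
  fixes W :: "nat list" and y :: "bool list" and n :: nat
  assumes W: "0 \<notin> set W"
begin

definition P where "P = length W"

definition flag_ok :: "nat list \<times> nat \<Rightarrow> bool" where
  "flag_ok w \<longleftrightarrow> snd w = 0 \<and> length (fst w) \<le> 1"

definition env_ok :: "(nat \<Rightarrow> nat) \<Rightarrow> reg store \<Rightarrow> bool" where
  "env_ok e \<sigma> \<longleftrightarrow> (\<forall>v < n + 3. \<sigma> (RV v) = (W, e v) \<and> \<sigma> (RS v) = (W, e v)) \<and>
     \<sigma> RH = (W, 0) \<and> \<sigma> RK = (W, 0) \<and> flag_ok (\<sigma> RL) \<and> flag_ok (\<sigma> RR) \<and> (\<forall>v. flag_ok (\<sigma> (RF v)))"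

definition cert :: "nat \<Rightarrow> nat \<Rightarrow> nat \<Rightarrow> nat \<Rightarrow> bool" where
  "cert j a b c \<longleftrightarrow>
     (let i = ((j * P + a) * P + b) * P + c in i < length y \<and> y ! i)"

lemma flag_put: "flag_ok (\<sigma> r) \<Longrightarrow> run (Put r a) \<sigma> = \<sigma>(r := ([a], 0))"
  by (cases "fst (\<sigma> r)") (auto simp: flag_ok_def)

lemma flag_ok_single [simp]: "flag_ok ([a], 0)"
  by (simp add: flag_ok_def)

lemma scan_W: "scan (W, i) = 0 \<longleftrightarrow> P \<le> i"
  using W by (cases "i < P") (simp_all add: scan_def P_def, metis nth_mem gr0I)

lemma env_ok_RL: "env_ok e \<sigma> \<Longrightarrow> env_ok e (\<sigma>(RL := ([a], 0)))"
  by (simp add: env_ok_def)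

lemma run_less_prog:
  assumes e: "env_ok e \<sigma>" and ab: "a \<noteq> b" "a < n + 3" "b < n + 3" "e a < P" "e b < P"
  shows "run (less_prog a b) \<sigma> = \<sigma>(RL := ([if e a < e b then 2 else 1], 0))"
proof -
  define m where "m = P - max (e a) (e b)"
  define S where "S l k = \<sigma>(RS a := (W, e a + k), RS b := (W, e b + k), RK := (W, l), RH := (W, 0))"
    for l k
  have \<sigma>: "\<sigma> (RS a) = (W, e a)" "\<sigma> (RS b) = (W, e b)" "\<sigma> RH = (W, 0)" "\<sigma> RK = (W, 0)"
    using e ab by (auto simp: env_ok_def)
  have m: "e a + m \<le> P" "e b + m \<le> P" "e a + m = P \<or> e b + m = P" "m \<le> P" "0 < m"
    using ab by (auto simp: m_def)
  let ?p1 = "Branch (RS a) {0} Nop (Branch (RS b) {0} Nop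
       (MoveR (RS a) ;; MoveR (RS b) ;; MoveR RK))"
  obtain s where s: "s(RH := (W, 0)) = S (min P m) (min P m)" "run (For RH ?p1) \<sigma> = s(RH := (W, 0))"
  proof (rule run_For_inv[where Q = "\<lambda>i s. s(RH := (W, 0)) = S (min i m) (min i m)" and \<sigma> = \<sigma>
        and r = RH and p = ?p1])
    show "\<sigma>(RH := (W, 0)) = S (min 0 m) (min 0 m)" using \<sigma> by (auto simp: S_def fun_eq_iff)
    fix i s assume i: "i < length (fst (\<sigma> RH))" and s: "s(RH := (W, 0)) = S (min i m) (min i m)"
    have eq: "s(RH := (fst (\<sigma> RH), i)) = (S (min i m) (min i m))(RH := (W, i))"
      using s \<sigma>(3) by (metis fst_conv fun_upd_upd)
    show "(run ?p1 (s(RH := (fst (\<sigma> RH), i))))(RH := (W, 0)) = S (min (Suc i) m) (min (Suc i) m)"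
    proof (cases "i < m")
      case True
      then have "min i m = i" "min (Suc i) m = Suc i" "e a + i < P" "e b + i < P" "i < P"
        using m by auto
      then show ?thesis unfolding eq using ab
        by (simp add: S_def scan_W fun_eq_iff P_def[symmetric])
    next
      case False
      then have "min i m = m" "min (Suc i) m = m" by auto
      then show ?thesis unfolding eq using ab m
        by (auto simp: S_def scan_W fun_eq_iff P_def[symmetric])
    qed
  qed (use \<sigma> P_def in auto)
  have 1: "run (For RH ?p1) \<sigma> = S m m" using s m by (simp add: min_absorb2)
  let ?v = "if e a < e b then 2 else 1"
  define S' where "S' l k = (S l k)(RL := ([?v], 0))" for l k
  have S_simps: "S l k (RS a) = (W, e a + k)" "S l k (RS b) = (W, e b + k)" "S l k RL = \<sigma> RL"
    for l k using ab by (auto simp: S_def)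
  have fl: "flag_ok (S m m RL)" using e by (simp add: S_simps env_ok_def)
  have 2: "run (Branch (RS b) {0} (Branch (RS a) {0} (Put RL 1) (Put RL 2)) (Put RL 1)) (S m m) =
      S' m m"
  proof -
    have "scan (S m m (RS a)) = 0 \<longleftrightarrow> P \<le> e a + m" "scan (S m m (RS b)) = 0 \<longleftrightarrow> P \<le> e b + m"
      by (simp_all add: S_simps scan_W)
    moreover have "P \<le> e b + m \<longleftrightarrow> e a \<le> e b" "P \<le> e a + m \<longleftrightarrow> e b \<le> e a"
      using ab by (auto simp: m_def)
    ultimately show ?thesis
      by (simp only: run.simps(6) flag_put[where \<sigma> = "S m m" and r = RL, OF fl] singleton_iff S'_def) auto
  qed
  let ?p2 = "Branch RK {0} (MoveL (RS a) ;; MoveL (RS b)) (MoveR RK)"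
  \<comment> \<open>The offset of the shadow heads after \<open>i\<close> rounds of the return loop:
    by truncated subtraction it stays \<open>m\<close> during the first \<open>P - m\<close> rounds,
    in which only \<open>RK\<close> moves.\<close>
  let ?back = "\<lambda>i. m - (i - (P - m))"
  have H: "fst (S' m m RH) = W" by (simp add: S'_def S_def)
  obtain s where s: "s(RH := (W, 0)) = S' (min P (m + P)) (?back P)"
    "run (For RH ?p2) (S' m m) = s(RH := (W, 0))"
  proof (rule run_For_inv[where Q = "\<lambda>i s. s(RH := (W, 0)) = S' (min P (m + i)) (?back i)"
        and \<sigma> = "S' m m" and r = RH and p = ?p2])
    show "(S' m m)(RH := (W, 0)) = S' (min P (m + 0)) (?back 0)"
      using m by (auto simp: S'_def S_def fun_eq_iff)
    fix i s assume i: "i < length (fst (S' m m RH))"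
      and s: "s(RH := (W, 0)) = S' (min P (m + i)) (?back i)"
    have eq: "s(RH := (fst (S' m m RH), i)) = (S' (min P (m + i)) (?back i))(RH := (W, i))"
      using s H by (metis fun_upd_upd)
    have iP: "i < P" using i H by (simp add: P_def)
    show "(run ?p2 (s(RH := (fst (S' m m RH), i))))(RH := (W, 0)) =
        S' (min P (m + Suc i)) (?back (Suc i))"
    proof (cases "m + i < P")
      case True
      then have "?back i = m" "?back (Suc i) = m" "min P (m + i) = m + i"
        "min P (m + Suc i) = Suc (m + i)" by auto
      then show ?thesis unfolding eq using True ab
        by (simp add: S'_def S_def scan_W fun_eq_iff P_def[symmetric])
    next
      case False
      define l where "l = ?back (Suc i)"
      have "?back i = Suc l" "min P (m + i) = P" "min P (m + Suc i) = P"
        using False m iP by (auto simp: l_def)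
      then show ?thesis unfolding eq l_def[symmetric] using ab
        by (simp add: S'_def S_def scan_W fun_eq_iff P_def[symmetric])
    qed
  qed (use H P_def in auto)
  have 3: "run (For RH ?p2) (S' m m) = S' P 0" using s m by simp
  have 4: "run (For RK Nop) (S' P 0) = \<sigma>(RL := ([?v], 0))"
    unfolding run_For_Nop using \<sigma> ab by (auto simp: S'_def S_def fun_eq_iff)
  show ?thesis unfolding less_prog_def run.simps(5) 1 2 3 4 ..
qed

lemma run_if_eq:
  assumes e: "env_ok e \<sigma>" and ab: "a \<noteq> b" "a < n + 3" "b < n + 3" "e a < P" "e b < P"
  shows "run (if_eq a b p) \<sigma> =
    (if e a = e b then run p (\<sigma>(RL := ([1], 0))) else \<sigma>(RL := ([2], 0)))"
  using run_less_prog[OF assms] run_less_prog[of e "\<sigma>(RL := ([1], 0))" b a] env_ok_RL[OF e, of 1] ab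
  by (auto simp: if_eq_def scan_def)

text \<open>The invariant \<open>J\<close> is about all other tapes. It must ignore
  \<open>RV v\<close> and \<open>RS v\<close> because these heads change between the rounds.\<close>

lemma run_for_var:
  assumes v: "v < n + 3" "e v = 0" and e: "env_ok e \<sigma>" and J0: "J 0 \<sigma>"
    and step: "\<And>i s. i < P \<Longrightarrow> env_ok (e(v := i)) s \<Longrightarrow> J i s \<Longrightarrow>
      env_ok (e(v := i)) (run p s) \<and> J (Suc i) (run p s)"
    and J: "\<And>i s w. J i (s(RV v := w)) = J i s" "\<And>i s w. J i (s(RS v := w)) = J i s"
  shows "env_ok e (run (for_var v p) \<sigma>) \<and> J P (run (for_var v p) \<sigma>)"
proof -
  have W\<sigma>: "fst (\<sigma> (RV v)) = W" using e v by (simp add: env_ok_def)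
  let ?Q = "\<lambda>i s. env_ok (e(v := i)) (s(RV v := (W, i))) \<and> J i s"
  obtain s where s: "?Q P s" "run (For (RV v) (p ;; MoveR (RS v))) \<sigma> = s(RV v := (W, 0))"
  proof (rule run_For_inv[where Q = ?Q and \<sigma> = \<sigma> and r = "RV v" and p = "p ;; MoveR (RS v)"])
    have "\<sigma>(RV v := (W, 0)) = \<sigma>" using e v by (auto simp: env_ok_def fun_eq_iff)
    moreover have "e(v := 0) = e" using v by auto
    ultimately show "?Q 0 \<sigma>" using e J0 by simp
    fix i s assume i: "i < length (fst (\<sigma> (RV v)))" and Q: "?Q i s"
    then have iP: "i < P" using W\<sigma> by (simp add: P_def)
    let ?s = "s(RV v := (W, i))" and ?i = "e(v := i)"
    have 1: "env_ok ?i (run p ?s)" "J (Suc i) (run p ?s)"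
      using step[OF iP, of ?s] Q J(1) by auto
    have "run p ?s (RS v) = (W, i)" using 1 v by (simp add: env_ok_def)
    then have 2: "run (p ;; MoveR (RS v)) ?s = (run p ?s)(RS v := (W, Suc i))"
      using iP by (simp add: P_def)
    have "env_ok (e(v := Suc i)) ((run p ?s)(RS v := (W, Suc i), RV v := (W, Suc i)))"
      using 1(1) by (auto simp: env_ok_def)
    moreover have "J (Suc i) ((run p ?s)(RS v := (W, Suc i)))" using 1(2) J(2) by simp
    ultimately show "?Q (Suc i) (run (p ;; MoveR (RS v)) (s(RV v := (fst (\<sigma> (RV v)), i))))"
      unfolding W\<sigma> 2 by simp
  qed (use W\<sigma> P_def in auto)
  have "fst (s (RS v)) = W" using s(1) v by (auto simp: env_ok_def split: if_splits)
  then have eq: "run (for_var v p) \<sigma> = s(RV v := (W, 0), RS v := (W, 0))"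
    by (simp add: for_var_def s(2) run_For_Nop del: run.simps(7))
  have "env_ok e (s(RV v := (W, 0), RS v := (W, 0)))"
    using s(1) v by (fastforce simp: env_ok_def split: if_splits)
  then show ?thesis unfolding eq using s(1) J by simp
qed

definition scratch :: "nat set \<Rightarrow> reg set" where
  "scratch B = {RL, RR, RH, RK, RY} \<union> range RV \<union> range RS \<union> RF ` B"

lemma scratch_Un [simp]: "r \<in> scratch (A \<union> B) \<longleftrightarrow> r \<in> scratch A \<or> r \<in> scratch B"
  by (auto simp: scratch_def)

lemma scratch_insert [simp]: "r \<in> scratch (insert v B) \<longleftrightarrow> r = RF v \<or> r \<in> scratch B"
  by (auto simp: scratch_def)

definition cert_tape :: "reg store \<Rightarrow> bool" where
  "cert_tape \<sigma> \<longleftrightarrow> \<sigma> RY = (map bit_symbol y, 0)"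

lemma agree_upd:
  "(\<forall>r. r \<notin> scratch B \<longrightarrow> (s(RV v := w)) r = \<sigma> r) \<longleftrightarrow> (\<forall>r. r \<notin> scratch B \<longrightarrow> s r = \<sigma> r)"
  "(\<forall>r. r \<notin> scratch B \<longrightarrow> (s(RS v := w)) r = \<sigma> r) \<longleftrightarrow> (\<forall>r. r \<notin> scratch B \<longrightarrow> s r = \<sigma> r)"
proof -
  have "RV v \<in> scratch B" "RS v \<in> scratch B" by (simp_all add: scratch_def)
  then show
    "(\<forall>r. r \<notin> scratch B \<longrightarrow> (s(RV v := w)) r = \<sigma> r) \<longleftrightarrow> (\<forall>r. r \<notin> scratch B \<longrightarrow> s r = \<sigma> r)"
    "(\<forall>r. r \<notin> scratch B \<longrightarrow> (s(RS v := w)) r = \<sigma> r) \<longleftrightarrow> (\<forall>r. r \<notin> scratch B \<longrightarrow> s r = \<sigma> r)"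
    by (metis fun_upd_apply)+
qed

lemma cert_tape_upd:
  "cert_tape (\<sigma>(RV v := w)) = cert_tape \<sigma>" "cert_tape (\<sigma>(RS v := w)) = cert_tape \<sigma>"
  by (simp_all add: cert_tape_def)

lemma run_rel_block:
  assumes e: "env_ok e \<sigma>" "e n = 0" "e (n + 1) = 0" "e (n + 2) = 0"
    and abc: "a < n" "b < n" "c < n" "e a < P" "e b < P" "e c < P"
    and J_def: "\<And>m s. J m s \<longleftrightarrow> s RY = (map bit_symbol y, min m (length y)) \<and>
        s RR = ([if idx < m \<and> idx < length y \<and> y ! idx then 2 else 1], 0) \<and>
        (\<forall>r. r \<notin> scratch {} \<longrightarrow> s r = \<sigma>0 r)"
    and idx: "idx = ((j * P + e a) * P + e b) * P + e c"
    and J0: "J (k * P * P * P) \<sigma>"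
  shows "env_ok e (run (rel_block n (k = j) a b c) \<sigma>) \<and>
     J (Suc k * P * P * P) (run (rel_block n (k = j) a b c) \<sigma>)"
proof -
  have JV: "J m (s(RV v := w)) = J m s" "J m (s(RS v := w)) = J m s" "J m (s(RL := w)) = J m s"
    for m s v w by (auto simp: J_def scratch_def)
  define body where "body = (if k = j then if_eq n a (if_eq (n + 1) b (if_eq (n + 2) c
      (Branch RY {2} (Put RR 2) Nop))) else Nop) ;; MoveR RY"
  have body: "env_ok e' (run body s) \<and> J (Suc m) (run body s)"
    if s: "env_ok e' s" "J m s" and i: "i1 < P" "i2 < P" "i3 < P"
      and e': "e' = e(n := i1, n + 1 := i2, n + 2 := i3)"
      and m: "m = ((k * P + i1) * P + i2) * P + i3" for e' s m i1 i2 i3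
  proof -
    have e'v: "e' n = i1" "e' (n + 1) = i2" "e' (n + 2) = i3" "e' a = e a" "e' b = e b" "e' c = e c"
      using abc by (auto simp: e')
    \<comment> \<open>Cells are numbered in base \<open>P\<close>, with the block number as leading
      part, and digits below \<open>P\<close> are unique.\<close>
    have idx_iff: "idx = m \<longleftrightarrow> k = j \<and> i1 = e a \<and> i2 = e b \<and> i3 = e c"
    proof
      have inj: "x = x' \<and> d = d'" if "x * P + d = x' * P + d'" "d < P" "d' < P" for x x' d d' :: nat
      proof -
        have "x = (x * P + d) div P" "x' = (x' * P + d') div P" using that(2,3) by simp_all
        then have "x = x'" using that(1) by metis
        then show ?thesis using that(1) by simp
      qed
      assume "idx = m"
      then show "k = j \<and> i1 = e a \<and> i2 = e b \<and> i3 = e c"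
        using i abc inj unfolding idx m by metis
    qed (simp add: idx m)
    define hit where "hit = (if k = j then if_eq n a (if_eq (n + 1) b (if_eq (n + 2) c
      (Branch RY {2} (Put RR 2) Nop))) else Nop)"
    obtain l where l: "run hit s = (if idx = m \<and> m < length y \<and> y ! m then s(RL := l, RR := ([2], 0)) else s(RL := l))
        \<and> flag_ok l"
    proof -
      have fl: "flag_ok (s RL)" using s by (simp add: env_ok_def)
      have eqs: "env_ok e' s'' \<Longrightarrow> run (if_eq n a p) s'' = (if i1 = e a then run p (s''(RL := ([1], 0))) else s''(RL := ([2], 0)))"
        "env_ok e' s'' \<Longrightarrow> run (if_eq (n + 1) b p) s'' = (if i2 = e b then run p (s''(RL := ([1], 0))) else s''(RL := ([2], 0)))"
        "env_ok e' s'' \<Longrightarrow> run (if_eq (n + 2) c p) s'' = (if i3 = e c then run p (s''(RL := ([1], 0))) else s''(RL := ([2], 0)))"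
        for p s''
        using run_if_eq[of e' s'' n a p] run_if_eq[of e' s'' "n + 1" b p] run_if_eq[of e' s'' "n + 2" c p]
          abc i e'v by auto
      have RY: "scan ((s(RL := ([1], 0))) RY) \<in> {2} \<longleftrightarrow> m < length y \<and> y ! m"
        using s(2) by (auto simp: J_def scan_def bit_symbol_def min_def)
      have RR: "run (Put RR 2) (s(RL := ([1], 0))) = s(RL := ([1], 0), RR := ([2], 0))"
        by (rule flag_put) (use s in \<open>simp add: env_ok_def\<close>)
      have last: "run (Branch RY {2} (Put RR 2) Nop) (s(RL := ([1], 0))) =
          (if m < length y \<and> y ! m then s(RL := ([1], 0), RR := ([2], 0)) else s(RL := ([1], 0)))"
        unfolding run.simps(6) RY RR by simp
      have e1: "env_ok e' (s(RL := ([1], 0)))" using env_ok_RL[OF s(1)] .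
      have "run hit s = (if k = j then if i1 = e a then if i2 = e b then if i3 = e c then
          (if m < length y \<and> y ! m then s(RL := ([1], 0), RR := ([2], 0)) else s(RL := ([1], 0)))
          else s(RL := ([2], 0)) else s(RL := ([2], 0)) else s(RL := ([2], 0)) else s)"
        unfolding hit_def
        by (cases "k = j") (simp_all only: eqs(1)[OF s(1)] eqs(2,3)[OF e1] last run.simps(1) if_True
          if_False simp_thms fun_upd_upd)
      moreover have "s(RL := s RL) = s" by simp
      ultimately show ?thesis
        using that[of "([1], 0)"] that[of "([2], 0)"] that[of "s RL"] fl idx_iff
        by (auto simp del: fun_upd_apply split: if_splits)
    qed
    have RY: "run hit s RY = (map bit_symbol y, min m (length y))"
      using l s(2) by (simp add: J_def)
    have eq: "run body s = (run hit s)(RY := (map bit_symbol y, min (Suc m) (length y)))"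
      unfolding body_def hit_def[symmetric] using RY by (auto simp: min_def fun_eq_iff)
    have "env_ok e' (run body s)"
      unfolding eq using s(1) l by (auto simp: env_ok_def)
    moreover have "J (Suc m) (run body s)"
      unfolding eq using s(2) l by (auto simp: J_def scratch_def less_Suc_eq)
    ultimately show ?thesis ..
  qed
  have l3: "env_ok e' (run (for_var (n + 2) body) s) \<and> J (((k * P + i1) * P + i2) * P + P) (run (for_var (n + 2) body) s)"
    if "env_ok e' s" "J (((k * P + i1) * P + i2) * P) s" "i1 < P" "i2 < P"
      "e' = e(n := i1, n + 1 := i2)" for e' s i1 i2
  proof (rule run_for_var[where J = "\<lambda>i. J (((k * P + i1) * P + i2) * P + i)"])
    show "env_ok (e'(n + 2 := i)) (run body s) \<and> J (((k * P + i1) * P + i2) * P + Suc i) (run body s)"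
      if "i < P" "env_ok (e'(n + 2 := i)) s" "J (((k * P + i1) * P + i2) * P + i) s" for i s
      using body[OF that(2,3) \<open>i1 < P\<close> \<open>i2 < P\<close> that(1)] \<open>e' = _\<close> by simp
  qed (use that e JV in \<open>auto simp del: fun_upd_apply\<close>, simp add: e)
  have l2: "env_ok e' (run (for_var (n + 1) (for_var (n + 2) body)) s) \<and>
      J (((k * P + i1) * P + P) * P) (run (for_var (n + 1) (for_var (n + 2) body)) s)"
    if "env_ok e' s" "J ((k * P + i1) * P * P) s" "i1 < P" "e' = e(n := i1)" for e' s i1
  proof (rule run_for_var[where J = "\<lambda>i. J (((k * P + i1) * P + i) * P)"])
    show "env_ok (e'(n + 1 := i)) (run (for_var (n + 2) body) s) \<and>
        J (((k * P + i1) * P + Suc i) * P) (run (for_var (n + 2) body) s)"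
      if "i < P" "env_ok (e'(n + 1 := i)) s" "J (((k * P + i1) * P + i) * P) s" for i s
      using l3[OF that(2,3) \<open>i1 < P\<close> that(1)] \<open>e' = _\<close> by (simp add: add.commute)
  qed (use that e JV in \<open>auto simp del: fun_upd_apply\<close>, simp add: e)
  have "env_ok e (run (for_var n (for_var (n + 1) (for_var (n + 2) body))) \<sigma>) \<and>
      J ((k * P + P) * P * P) (run (for_var n (for_var (n + 1) (for_var (n + 2) body))) \<sigma>)"
  proof (rule run_for_var[where J = "\<lambda>i. J ((k * P + i) * P * P)"])
    show "env_ok (e(n := i)) (run (for_var (n + 1) (for_var (n + 2) body)) s) \<and>
        J ((k * P + Suc i) * P * P) (run (for_var (n + 1) (for_var (n + 2) body)) s)"
      if "i < P" "env_ok (e(n := i)) s" "J ((k * P + i) * P * P) s" for i s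
    proof -
      have "((k * P + i) * P + P) * P = (k * P + Suc i) * P * P" by (simp add: algebra_simps)
      then show ?thesis using l2[OF that(2,3,1) refl] by metis
    qed
  qed (use J0 e JV in \<open>auto simp del: fun_upd_apply\<close>)
  then show ?thesis unfolding rel_block_def body_def[symmetric] by (simp add: algebra_simps)
qed

lemma run_rel_prog:
  assumes e: "env_ok e \<sigma>" "e n = 0" "e (n + 1) = 0" "e (n + 2) = 0"
    and abc: "a < n" "b < n" "c < n" "e a < P" "e b < P" "e c < P" and y: "cert_tape \<sigma>"
  shows "env_ok e (run (rel_prog n j a b c) \<sigma>) \<and> cert_tape (run (rel_prog n j a b c) \<sigma>) \<and>
    (scan (run (rel_prog n j a b c) \<sigma> RR) = 2 \<longleftrightarrow> cert j (e a) (e b) (e c)) \<and>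
    (\<forall>r. r \<notin> scratch {} \<longrightarrow> run (rel_prog n j a b c) \<sigma> r = \<sigma> r)"
proof -
  define idx where "idx = ((j * P + e a) * P + e b) * P + e c"
  define J where "J m s \<longleftrightarrow> s RY = (map bit_symbol y, min m (length y)) \<and>
        s RR = ([if idx < m \<and> idx < length y \<and> y ! idx then 2 else 1], 0) \<and>
        (\<forall>r. r \<notin> scratch {} \<longrightarrow> s r = \<sigma> r)" for m s
  let ?s0 = "\<sigma>(RR := ([1], 0))"
  have s0: "run (Put RR 1) \<sigma> = ?s0" by (rule flag_put) (use e in \<open>simp add: env_ok_def\<close>)
  have "env_ok e (run (rel_blocks n j a b c k) ?s0) \<and> J (k * P * P * P) (run (rel_blocks n j a b c k) ?s0)"
    for k
  proof (induction k)
    case 0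
    show ?case using e y by (auto simp: J_def env_ok_def cert_tape_def scratch_def)
  next
    case (Suc k)
    show ?case unfolding rel_blocks.simps run.simps(5)
      by (rule run_rel_block[OF conjunct1[OF Suc] e(2-4) abc J_def idx_def conjunct2[OF Suc]])
  qed
  note B = this[of "Suc j"]
  let ?s = "run (rel_blocks n j a b c (Suc j)) ?s0"
  have eq: "run (rel_prog n j a b c) \<sigma> = ?s(RY := (fst (?s RY), 0))"
    unfolding rel_prog_def run.simps(5) s0 run_For_Nop ..
  have "idx < Suc j * P * P * P"
  proof -
    have lt: "x * P + d < X * P" if "x < X" "d < P" for x X d :: nat
      using that(2) mult_le_mono1[OF Suc_leI[OF that(1)], of P] unfolding mult_Suc by linarith
    show ?thesis unfolding idx_def using abc by (intro lt) auto
  qed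
  then have "scan (?s RR) = 2 \<longleftrightarrow> cert j (e a) (e b) (e c)"
    using B by (auto simp: J_def scan_def cert_def idx_def Let_def)
  then show ?thesis unfolding eq using B by (auto simp: J_def env_ok_def cert_tape_def scratch_def)
qed

abbreviation "eval \<phi> e \<equiv> holds P (\<lambda>i. W ! i) cert \<phi> e"

definition bounded :: "(nat \<Rightarrow> nat) \<Rightarrow> bool" where
  "bounded e \<longleftrightarrow> (\<forall>v < n. e v < P) \<and> e n = 0 \<and> e (n + 1) = 0 \<and> e (n + 2) = 0"

text \<open>The continuations \<open>p\<close> and \<open>q\<close> are arbitrary because the
  induction instantiates them by further tests. The store \<open>\<sigma>'\<close> is the one with
  which the chosen continuation starts.\<close>

lemma run_test:
  assumes "env_ok e \<sigma>" "cert_tape \<sigma>" "bounded e" "fm_ok n \<phi>" "\<forall>v\<in>bound_vars \<phi>. e v = 0"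
  shows "\<exists>\<sigma>'. env_ok e \<sigma>' \<and> cert_tape \<sigma>' \<and> (\<forall>r. r \<notin> scratch (bound_vars \<phi>) \<longrightarrow> \<sigma>' r = \<sigma> r) \<and>
     run (test n \<phi> p q) \<sigma> = run (if eval \<phi> e then p else q) \<sigma>'"
  using assms
proof (induction \<phi> arbitrary: e \<sigma> p q)
  case (Less a b)
  then have "run (less_prog a b) \<sigma> = \<sigma>(RL := ([if e a < e b then 2 else 1], 0))" if "a \<noteq> b"
    using that by (intro run_less_prog) (auto simp: bounded_def)
  then show ?case using Less env_ok_RL[of e \<sigma>]
    by (intro exI[of _ "if a = b then \<sigma> else \<sigma>(RL := ([if e a < e b then 2 else 1], 0))"])
      (auto simp: scan_def scratch_def cert_tape_def)
next
  case (Letter a A)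
  then have "\<sigma> (RV a) = (W, e a)" "e a < P" by (auto simp: env_ok_def bounded_def)
  then show ?case using Letter by (intro exI[of _ \<sigma>]) (auto simp: scan_def P_def)
next
  case (Rel j a b c)
  note R = run_rel_prog[of e \<sigma> a b c j]
  show ?case using R Rel by (intro exI[of _ "run (rel_prog n j a b c) \<sigma>"]) (auto simp: bounded_def)
next
  case (Neg \<phi>)
  show ?case using Neg.IH[of e \<sigma> q p] Neg.prems by (cases "eval \<phi> e") simp_all
next
  case (And \<phi> \<psi>)
  obtain \<sigma>' where \<sigma>': "env_ok e \<sigma>'" "cert_tape \<sigma>'" "\<forall>r. r \<notin> scratch (bound_vars \<phi>) \<longrightarrow> \<sigma>' r = \<sigma> r"
    "run (test n \<phi> (test n \<psi> p q) q) \<sigma> = run (if eval \<phi> e then test n \<psi> p q else q) \<sigma>'"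
    using And.IH(1)[of e \<sigma> "test n \<psi> p q" q] And.prems by auto
  show ?case
  proof (cases "eval \<phi> e")
    case True
    obtain \<sigma>'' where "env_ok e \<sigma>''" "cert_tape \<sigma>''" "\<forall>r. r \<notin> scratch (bound_vars \<psi>) \<longrightarrow> \<sigma>'' r = \<sigma>' r"
      "run (test n \<psi> p q) \<sigma>' = run (if eval \<psi> e then p else q) \<sigma>''"
      using And.IH(2)[of e \<sigma>' p q] And.prems \<sigma>' by auto
    then show ?thesis using \<sigma>' True by (intro exI[of _ \<sigma>'']) simp
  next
    case False
    then show ?thesis using \<sigma>' by (intro exI[of _ \<sigma>']) (auto simp: scratch_def)
  qed
next
  case (All v \<phi>)
  have v: "v < n" "v \<notin> bound_vars \<phi>" "e v = 0" using All.prems by auto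
  let ?s0 = "\<sigma>(RF v := ([1], 0))"
  have s0: "run (Put (RF v) 1) \<sigma> = ?s0" by (rule flag_put) (use All.prems in \<open>simp add: env_ok_def\<close>)
  define J where "J i s \<longleftrightarrow> cert_tape s \<and>
     s (RF v) = ([if \<forall>i'<i. eval \<phi> (e(v := i')) then 1 else 2], 0) \<and>
     (\<forall>r. r \<notin> scratch (bound_vars (All v \<phi>)) \<longrightarrow> s r = \<sigma> r)" for i s
  let ?p = "test n \<phi> Nop (Put (RF v) 2)"
  have e0: "env_ok e ?s0" using All.prems(1) by (auto simp: env_ok_def)
  have J0: "J 0 ?s0" using All.prems(2) by (auto simp: J_def cert_tape_def scratch_def)
  have "env_ok e (run (for_var v ?p) ?s0) \<and> J P (run (for_var v ?p) ?s0)"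
  proof (rule run_for_var[where J = J])
    fix i s assume i: "i < P" and s: "env_ok (e(v := i)) s" "J i s"
    obtain \<sigma>' where \<sigma>': "env_ok (e(v := i)) \<sigma>'" "cert_tape \<sigma>'"
      "\<forall>r. r \<notin> scratch (bound_vars \<phi>) \<longrightarrow> \<sigma>' r = s r"
      "run ?p s = run (if eval \<phi> (e(v := i)) then Nop else Put (RF v) 2) \<sigma>'"
    proof -
      have "bounded (e(v := i))" using All.prems i v by (auto simp: bounded_def)
      moreover have "\<forall>u\<in>bound_vars \<phi>. (e(v := i)) u = 0" using All.prems v by auto
      moreover have "cert_tape s" "fm_ok n \<phi>" using s All.prems by (simp_all add: J_def)
      ultimately show ?thesis using All.IH[of "e(v := i)" s Nop "Put (RF v) 2"] s(1) that by metis
    qed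
    have F: "\<sigma>' (RF v) = s (RF v)" using \<sigma>'(3) v by (auto simp: scratch_def)
    have put: "run (Put (RF v) 2) \<sigma>' = \<sigma>'(RF v := ([2], 0))"
      by (rule flag_put) (use \<sigma>' in \<open>simp add: env_ok_def\<close>)
    have rest: "\<sigma>' r = \<sigma> r" if "r \<notin> scratch (bound_vars (All v \<phi>))" for r
      using that \<sigma>'(3) s(2) by (simp add: J_def)
    show "env_ok (e(v := i)) (run ?p s) \<and> J (Suc i) (run ?p s)"
    proof (cases "eval \<phi> (e(v := i))")
      case True
      then have eq: "run ?p s = \<sigma>'" using \<sigma>'(4) by simp
      show ?thesis unfolding eq using \<sigma>' F s True rest by (auto simp: J_def less_Suc_eq)
    next
      case False
      then have eq: "run ?p s = \<sigma>'(RF v := ([2], 0))" using \<sigma>'(4) put by (simp del: run.simps(2))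
      have "\<not> (\<forall>i'<Suc i. eval \<phi> (e(v := i')))" using False by blast
      then show ?thesis unfolding eq using \<sigma>' rest
        by (auto simp: J_def env_ok_def cert_tape_def scratch_def)
    qed
  next
    show "J i (s(RV v := w)) = J i s" "J i (s(RS v := w)) = J i s" for i s w
      by (simp_all only: J_def cert_tape_upd agree_upd) simp_all
  qed (use v e0 J0 in auto)
  then show ?case
    unfolding test.simps run.simps(5) s0
    by (intro exI[of _ "run (for_var v ?p) ?s0"]) (auto simp: J_def scan_def)
qed

text \<open>The action \<open>em\<close> on an emitted bit is abstract, and \<open>E bs\<close>
  describes its effect after the output \<open>bs\<close>. Two instances are needed: incrementing a
  counter and appending to a tape.\<close>

lemma run_gen_prog:
  assumes em: "\<And>e b bs s. env_ok e s \<Longrightarrow> cert_tape s \<Longrightarrow> E bs s \<Longrightarrow>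
      env_ok e (run (em b) s) \<and> cert_tape (run (em b) s) \<and> E (bs @ [b]) (run (em b) s)"
    and E: "\<And>bs s s'. (\<And>r. r \<notin> scratch UNIV \<Longrightarrow> s r = s' r) \<Longrightarrow> E bs s \<Longrightarrow> E bs s'"
    and "env_ok e \<sigma>" "cert_tape \<sigma>" "E bs \<sigma>" "bounded e" "gen_ok n g" "\<forall>v\<in>gen_vars g. e v = 0"
  shows "env_ok e (run (gen_prog n em g) \<sigma>) \<and> cert_tape (run (gen_prog n em g) \<sigma>) \<and>
    E (bs @ out P (\<lambda>i. W ! i) cert g e) (run (gen_prog n em g) \<sigma>)"
  using assms(3-)
proof (induction g arbitrary: e \<sigma> bs)
  case (Emit cs)
  have "env_ok e s \<Longrightarrow> cert_tape s \<Longrightarrow> E bs s \<Longrightarrow>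
      env_ok e (run (foldr (\<lambda>b p. em b ;; p) cs Nop) s) \<and>
      cert_tape (run (foldr (\<lambda>b p. em b ;; p) cs Nop) s) \<and>
      E (bs @ cs) (run (foldr (\<lambda>b p. em b ;; p) cs Nop) s)" for s bs
  proof (induction cs arbitrary: s bs)
    case (Cons c cs)
    show ?case using Cons.IH[of "run (em c) s" "bs @ [c]"] em[OF Cons.prems, of c] by simp
  qed simp
  then show ?case using Emit by simp
next
  case (GSeq g h)
  then show ?case using GSeq.IH(1)[of e \<sigma> bs]
      GSeq.IH(2)[of e "run (gen_prog n em g) \<sigma>" "bs @ out P (\<lambda>i. W ! i) cert g e"] by auto
next
  case (GIf \<phi> g h)
  obtain \<sigma>' where \<sigma>': "env_ok e \<sigma>'" "cert_tape \<sigma>'" "\<forall>r. r \<notin> scratch (bound_vars \<phi>) \<longrightarrow> \<sigma>' r = \<sigma> r"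
    "run (test n \<phi> (gen_prog n em g) (gen_prog n em h)) \<sigma> =
       run (if eval \<phi> e then gen_prog n em g else gen_prog n em h) \<sigma>'"
    using run_test[of e \<sigma> \<phi>] GIf.prems by fastforce
  have "scratch (bound_vars \<phi>) \<subseteq> scratch UNIV" by (auto simp: scratch_def)
  then have "E bs \<sigma>'" using \<sigma>'(3) GIf.prems(3) by (intro E[of \<sigma> \<sigma>' bs]) auto
  then show ?case using GIf.IH[of e \<sigma>' bs] GIf.prems \<sigma>' by (cases "eval \<phi> e") simp_all
next
  case (GFor v g)
  have v: "v < n" "v \<notin> gen_vars g" "e v = 0" using GFor.prems by auto
  define J where "J i s \<longleftrightarrow> cert_tape s \<and>
     E (bs @ concat (map (\<lambda>i. out P (\<lambda>i. W ! i) cert g (e(v := i))) [0..<i])) s" for i s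
  have EV: "E bs (s(RV v := w)) = E bs s" "E bs (s(RS v := w)) = E bs s" for bs s w
    by (rule iffI; erule E[rotated]; auto simp: scratch_def)+
  have "env_ok e (run (for_var v (gen_prog n em g)) \<sigma>) \<and> J P (run (for_var v (gen_prog n em g)) \<sigma>)"
  proof (rule run_for_var)
    fix i s assume i: "i < P" "env_ok (e(v := i)) s" "J i s"
    have "bounded (e(v := i))" using GFor.prems i v by (auto simp: bounded_def)
    moreover have "\<forall>u\<in>gen_vars g. (e(v := i)) u = 0" using GFor.prems v by auto
    ultimately show "env_ok (e(v := i)) (run (gen_prog n em g) s) \<and> J (Suc i) (run (gen_prog n em g) s)"
      using GFor.IH[of "e(v := i)" s "bs @ concat (map (\<lambda>i. out P (\<lambda>i. W ! i) cert g (e(v := i))) [0..<i])"]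
        i GFor.prems by (simp add: J_def del: fun_upd_apply)
  qed (use v GFor.prems EV in \<open>simp_all add: J_def cert_tape_upd del: fun_upd_apply\<close>)
  then show ?case by (simp add: J_def)
qed

end

section \<open>Generated strings are computable in polynomial time\<close>

definition app :: "reg \<Rightarrow> nat \<Rightarrow> reg prog" where
  "app r c = Put r c ;; MoveR r"

lemma run_app: "\<sigma> r = (ws, length ws) \<Longrightarrow> run (app r c) \<sigma> = \<sigma>(r := (ws @ [c], length (ws @ [c])))"
  by (simp add: app_def)

lemma app_simps [simp]: "puts (app r c) = {r}" "loops (app r c) = {}" "touched (app r c) = {r}"
  "prog_ok B (app r c) \<longleftrightarrow> 0 < c \<and> c < B"
  by (auto simp: app_def)

definition app_all :: "reg list \<Rightarrow> nat \<Rightarrow> reg prog" where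
  "app_all rs c = foldr (\<lambda>r p. app r c ;; p) rs Nop"

lemma app_all_simps [simp]: "puts (app_all rs c) = set rs" "loops (app_all rs c) = {}"
  "touched (app_all rs c) = set rs" "0 < c \<Longrightarrow> c < B \<Longrightarrow> prog_ok B (app_all rs c)"
  unfolding app_all_def by (induction rs) auto

definition rewind_all :: "reg list \<Rightarrow> reg prog" where
  "rewind_all rs = foldr (\<lambda>r p. For r Nop ;; p) rs Nop"

lemma rewind_all_simps [simp]: "puts (rewind_all rs) = {}" "loops (rewind_all rs) = set rs"
  "touched (rewind_all rs) = set rs" "prog_ok B (rewind_all rs)"
  unfolding rewind_all_def by (induction rs) auto

lemma run_app_all:
  "distinct rs \<Longrightarrow> \<forall>r\<in>set rs. \<sigma> r = (ws, length ws) \<Longrightarrow>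
   run (app_all rs c) \<sigma> r = (if r \<in> set rs then (ws @ [c], length (ws @ [c])) else \<sigma> r)"
proof (induction rs arbitrary: \<sigma>)
  case (Cons r' rs)
  let ?s = "\<sigma>(r' := (ws @ [c], length (ws @ [c])))"
  have eq: "run (app_all (r' # rs) c) \<sigma> = run (app_all rs c) ?s"
    using Cons.prems run_app[of \<sigma> r' ws c] by (simp add: app_all_def)
  have "run (app_all rs c) ?s r = (if r \<in> set rs then (ws @ [c], length (ws @ [c])) else ?s r)"
    by (rule Cons.IH) (use Cons.prems in auto)
  then show ?case unfolding eq using Cons.prems by simp
qed (simp add: app_all_def)

lemma run_rewind_all:
  "run (rewind_all rs) \<sigma> r = (if r \<in> set rs then (fst (\<sigma> r), 0) else \<sigma> r)"
proof (induction rs arbitrary: \<sigma>)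
  case (Cons r' rs)
  have "run (rewind_all (r' # rs)) \<sigma> = run (rewind_all rs) (\<sigma>(r' := (fst (\<sigma> r'), 0)))"
    using run_For_Nop[of r' \<sigma>] by (simp add: rewind_all_def del: run.simps(7))
  then show ?case using Cons by auto
qed (simp add: rewind_all_def)

text \<open>Horner's scheme in unary: tape \<open>k\<close> receives \<open>c\<close> symbols and
  then, for each cell of the input, a copy of tape \<open>Suc k\<close>, which holds the value of
  the remaining coefficients.\<close>

fun unary :: "bool \<Rightarrow> nat \<Rightarrow> nat list \<Rightarrow> reg prog" where
  "unary b k [] = Nop"
| "unary b k (c # cs) = unary b (Suc k) cs ;; foldr (\<lambda>_ p. app (RU b k) 3 ;; p) [0..<c] Nop ;;
     For RX (For (RU b (Suc k)) (app (RU b k) 3))"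

lemma poly_prog_unary: "4 \<le> B \<Longrightarrow> poly_prog B (unary b k cs)"
proof (induction cs arbitrary: k)
  case (Cons c cs)
  let ?p = "\<lambda>xs. foldr (\<lambda>_ p. app (RU b k) 3 ;; p) xs Nop"
  have 1: "prog_ok B (?p xs) \<and> loops (?p xs) = {} \<and> puts (?p xs) \<subseteq> {RU b k}" for xs :: "nat list"
    using Cons.prems by (induction xs) auto
  have "poly_prog B (?p [0..<c])" using 1[of "[0..<c]"] by (intro poly_prog_flat) auto
  moreover have "poly_prog B (For RX (For (RU b (Suc k)) (app (RU b k) 3)))"
    using Cons.prems by (intro poly_prog_flat) auto
  ultimately show ?case using Cons by (simp add: poly_prog_Then)
qed (simp add: poly_prog_flat)

lemma run_For_app:
  assumes "r \<noteq> t" "\<sigma> t = (ws, length ws)"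
  shows "run (For r (app t c)) \<sigma> =
    \<sigma>(t := (let v = ws @ replicate (length (fst (\<sigma> r))) c in (v, length v)), r := (fst (\<sigma> r), 0))"
proof -
  let ?v = "\<lambda>i. ws @ replicate i c"
  obtain s where "(\<forall>q. q \<noteq> r \<longrightarrow> s q = (\<sigma>(t := (?v (length (fst (\<sigma> r))), length (?v (length (fst (\<sigma> r))))))) q)"
    "run (For r (app t c)) \<sigma> = s(r := (fst (\<sigma> r), 0))"
  proof (rule run_For_inv[where Q = "\<lambda>i s. \<forall>q. q \<noteq> r \<longrightarrow> s q = (\<sigma>(t := (?v i, length (?v i)))) q"
        and \<sigma> = \<sigma> and r = r and p = "app t c"])
    fix i s assume "\<forall>q. q \<noteq> r \<longrightarrow> s q = (\<sigma>(t := (?v i, length (?v i)))) q"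
    then show "\<forall>q. q \<noteq> r \<longrightarrow> run (app t c) (s(r := (fst (\<sigma> r), i))) q =
        (\<sigma>(t := (?v (Suc i), length (?v (Suc i))))) q"
      using assms run_app[of "s(r := (fst (\<sigma> r), i))" t "?v i" c]
      by (simp add: replicate_append_same)
  qed (use assms in auto)
  then show ?thesis by (auto simp: fun_eq_iff Let_def)
qed

lemma run_unary:
  assumes "fst (\<sigma> RX) = X" "\<forall>k'\<ge>k. \<sigma> (RU b k') = ([], 0)"
  shows "\<sigma>' = run (unary b k cs) \<sigma> \<Longrightarrow> fst (\<sigma>' RX) = X \<and>
    \<sigma>' (RU b k) = (let u = replicate (poly (Poly cs) (length X)) 3 in (u, length u)) \<and>
    (\<forall>k'<k. \<sigma>' (RU b k') = \<sigma> (RU b k')) \<and> (\<forall>r. r \<noteq> RX \<longrightarrow> r \<notin> range (RU b) \<longrightarrow> \<sigma>' r = \<sigma> r)"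
  using assms
proof (induction cs arbitrary: k \<sigma>')
  case (Cons c cs)
  define s1 where "s1 = run (unary b (Suc k) cs) \<sigma>"
  define h where "h = poly (Poly cs) (length X)"
  have s1: "fst (s1 RX) = X" "s1 (RU b (Suc k)) = (replicate h 3, h)"
    "\<forall>k'<Suc k. s1 (RU b k') = \<sigma> (RU b k')" "\<forall>r. r \<noteq> RX \<longrightarrow> r \<notin> range (RU b) \<longrightarrow> s1 r = \<sigma> r"
    using Cons.IH[OF s1_def Cons.prems(2)] Cons.prems(3) by (auto simp: h_def Let_def)
  have rep: "s (RU b k) = (ws, length ws) \<Longrightarrow>
      run (foldr (\<lambda>_ p. app (RU b k) 3 ;; p) xs Nop) s =
      s(RU b k := (ws @ replicate (length xs) 3, length ws + length xs))"
    for s ws and xs :: "nat list"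
  proof (induction xs arbitrary: s ws)
    case (Cons a xs)
    then show ?case using Cons.IH[of "s(RU b k := (ws @ [3], length (ws @ [3])))" "ws @ [3]"]
        run_app[of s "RU b k" ws 3] by (simp del: fun_upd_apply add: fun_upd_same)
  qed (auto simp: fun_eq_iff)
  let ?s2 = "s1(RU b k := (replicate c 3, c))"
  have s2: "run (foldr (\<lambda>_ p. app (RU b k) 3 ;; p) [0..<c] Nop) s1 = ?s2"
    using rep[of s1 "[]" "[0..<c]"] s1 Cons.prems by simp
  let ?Q = "\<lambda>i s. s (RU b k) = (replicate (c + i * h) 3, c + i * h) \<and> fst (s (RU b (Suc k))) = replicate h 3
    \<and> (\<forall>r. r \<noteq> RX \<longrightarrow> r \<noteq> RU b k \<longrightarrow> r \<noteq> RU b (Suc k) \<longrightarrow> s r = s1 r)"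
  obtain s where s: "?Q (length (fst (?s2 RX))) s"
    "run (For RX (For (RU b (Suc k)) (app (RU b k) 3))) ?s2 = s(RX := (fst (?s2 RX), 0))"
  proof (rule run_For_inv[where Q = ?Q and \<sigma> = ?s2 and r = RX
        and p = "For (RU b (Suc k)) (app (RU b k) 3)"])
    fix i s assume "?Q i s"
    then show "?Q (Suc i) (run (For (RU b (Suc k)) (app (RU b k) 3)) (s(RX := (fst (?s2 RX), i))))"
      using run_For_app[of "RU b (Suc k)" "RU b k" "s(RX := (fst (?s2 RX), i))" "replicate (c + i * h) 3" 3]
      by (simp add: Let_def replicate_add[symmetric] algebra_simps del: run.simps(7))
  qed (use s1 in auto)
  have \<sigma>': "\<sigma>' = s(RX := (fst (s1 RX), 0))"
    unfolding Cons.prems(1) unary.simps run.simps(5) s1_def[symmetric] s2 s(2) by simp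
  have k: "s (RU b k) = (replicate (c + length X * h) 3, c + length X * h)"
    and rest: "\<And>r. r \<noteq> RX \<Longrightarrow> r \<noteq> RU b k \<Longrightarrow> r \<noteq> RU b (Suc k) \<Longrightarrow> s r = s1 r"
    using s(1) s1(1) by simp_all
  have "\<sigma>' (RU b k') = \<sigma> (RU b k')" if "k' < k" for k'
  proof -
    have "\<sigma>' (RU b k') = s (RU b k')" unfolding \<sigma>' by simp
    then show ?thesis using rest[of "RU b k'"] s1(3) that by simp
  qed
  moreover have "\<sigma>' r = \<sigma> r" if "r \<noteq> RX" "r \<notin> range (RU b)" for r
  proof -
    have "\<sigma>' r = s r" unfolding \<sigma>' using that by simp
    moreover have "s r = s1 r" using that by (intro rest) auto
    ultimately show ?thesis using s1(4) that by simp
  qed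
  moreover have "fst (\<sigma>' RX) = X" "\<sigma>' (RU b k) = s (RU b k)" unfolding \<sigma>' using s1(1) by simp_all
  ultimately show ?case using k by (simp add: h_def Let_def)
qed (auto simp: fun_eq_iff)

text \<open>The word is at once the domain of the formulas and the layout of a tableau. Letter 7
  marks position 0, letters 4 and 5 precede the origins of the input tape and the certificate tape,
  letter 6 marks the possible certificate cells, and the blocks \<open>u\<close>, as long as the
  time bound \<open>a\<close>, give the heads room on both sides.\<close>

definition domain_word :: "nat poly \<Rightarrow> nat poly \<Rightarrow> bool list \<Rightarrow> nat list" where
  "domain_word a b x = (let u = replicate (poly a (length x)) 3 in
     [7] @ u @ [4] @ map bit_symbol x @ u @ [5] @ replicate (poly b (length x)) 6 @ u @ [8])"

definition domain_regs :: "nat \<Rightarrow> reg list" where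
  "domain_regs n = [RH, RK] @ map RV [0..<n + 3] @ map RS [0..<n + 3]"

definition domain_prog :: "nat \<Rightarrow> reg prog" where
  "domain_prog n = (let A = app_all (domain_regs n) in
     A 7 ;; For (RU True 0) (A 3) ;; A 4 ;; For RX (Branch RX {1} (A 1) (A 2)) ;;
     For (RU True 0) (A 3) ;; A 5 ;; For (RU False 0) (A 6) ;; For (RU True 0) (A 3) ;; A 8)"

lemma distinct_domain_regs: "distinct (domain_regs n)"
  by (auto simp: domain_regs_def distinct_map inj_on_def)

lemma run_domain_prog:
  assumes D: "\<forall>r\<in>set (domain_regs n). \<sigma> r = ([], 0)" and X: "fst (\<sigma> RX) = map bit_symbol x"
    and U: "fst (\<sigma> (RU True 0)) = replicate (poly a (length x)) 3"
      "fst (\<sigma> (RU False 0)) = replicate (poly b (length x)) 3"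
    and \<sigma>': "\<sigma>' = run (domain_prog n) \<sigma>"
  shows "(\<forall>r\<in>set (domain_regs n). fst (\<sigma>' r) = domain_word a b x) \<and> fst (\<sigma>' RX) = map bit_symbol x \<and>
    (\<forall>r. r \<notin> set (domain_regs n) \<union> {RX, RU True 0, RU False 0} \<longrightarrow> \<sigma>' r = \<sigma> r)"
proof -
  let ?D = "set (domain_regs n)" and ?A = "app_all (domain_regs n)"
  let ?T = "{RX, RU True 0, RU False 0}"
  have TD: "r \<notin> ?D" if "r \<in> ?T" for r using that by (auto simp: domain_regs_def)
  define G where "G ws s \<longleftrightarrow> (\<forall>r\<in>?D. s r = (ws, length ws)) \<and> (\<forall>r\<in>?T. fst (s r) = fst (\<sigma> r)) \<and>
    (\<forall>r. r \<notin> ?D \<union> ?T \<longrightarrow> s r = \<sigma> r)" for ws s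
  have A: "G (ws @ [c]) (run (?A c) s)" if "G ws s" for ws s c
    using that run_app_all[OF distinct_domain_regs[of n], of s ws c] TD by (auto simp: G_def)
  have upd: "G ws (s(r := (fst (\<sigma> r), i)))" if "G ws s" "r \<in> ?T" for ws s r i
    using that TD[OF that(2)] by (auto simp: G_def)
  have F: "G (ws @ vs) (run (For r p) s)"
    if F: "G ws s" "r \<in> ?T" "length vs = length (fst (\<sigma> r))"
      "\<And>i s ws. i < length vs \<Longrightarrow> G ws s \<Longrightarrow> s r = (fst (\<sigma> r), i) \<Longrightarrow> G (ws @ [vs ! i]) (run p s)"
    for ws s r p vs
  proof -
    have sr: "fst (s r) = fst (\<sigma> r)" using F(1,2) by (auto simp: G_def)
    obtain s' where s': "G (ws @ take (length (fst (s r))) vs) s'" "run (For r p) s = s'(r := (fst (s r), 0))"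
    proof (rule run_For_inv[where Q = "\<lambda>i s. G (ws @ take i vs) s" and \<sigma> = s and r = r and p = p])
      fix i s' assume i: "i < length (fst (s r))" "G (ws @ take i vs) s'"
      have "G ((ws @ take i vs) @ [vs ! i]) (run p (s'(r := (fst (s r), i))))"
        by (rule F(4)) (use i sr F(1-3) upd in auto)
      then show "G (ws @ take (Suc i) vs) (run p (s'(r := (fst (s r), i))))"
        using i sr F by (simp add: take_Suc_conv_app_nth)
    qed (use F in auto)
    then show ?thesis using upd[of _ s' r 0] sr F by simp
  qed
  have FA: "G (ws @ replicate (length (fst (\<sigma> r))) c) (run (For r (?A c)) s)"
    if "G ws s" "r \<in> ?T" for ws s r c
    by (rule F[OF that]) (use A in auto)
  have FX: "G (ws @ map bit_symbol x) (run (For RX (Branch RX {1} (?A 1) (?A 2))) s)"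
    if "G ws s" for ws s
  proof (rule F[OF that])
    fix i s ws assume i: "i < length (map bit_symbol x)" and s: "G ws s" "s RX = (fst (\<sigma> RX), i)"
    then have "scan (s RX) = map bit_symbol x ! i" using X by (simp add: scan_def)
    then show "G (ws @ [map bit_symbol x ! i]) (run (Branch RX {1} (?A 1) (?A 2)) s)"
      using i A[OF s(1), of 1] A[OF s(1), of 2] by (simp add: bit_symbol_def)
  qed (use X in auto)
  have G0: "G [] \<sigma>" using D by (simp add: G_def)
  let ?u = "replicate (poly a (length x)) 3"
  have FU: "G ws s \<Longrightarrow> G (ws @ ?u) (run (For (RU True 0) (?A 3)) s)"
    "G ws s \<Longrightarrow> G (ws @ replicate (poly b (length x)) 6) (run (For (RU False 0) (?A 6)) s)" for ws s
    using FA[of ws s "RU True 0" 3] FA[of ws s "RU False 0" 6] U by simp_all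
  have "G (((((((([] @ [7]) @ ?u) @ [4]) @ map bit_symbol x) @ ?u) @ [5]) @
      replicate (poly b (length x)) 6) @ ?u @ [8]) \<sigma>'"
    unfolding \<sigma>' domain_prog_def Let_def run.simps(5) append_assoc[of _ ?u "[8]", symmetric]
    by (intro A FU FX G0)
  then have "G (domain_word a b x) \<sigma>'" by (simp add: domain_word_def Let_def)
  then show ?thesis using X by (auto simp: G_def)
qed

lemma poly_prog_domain: "9 \<le> B \<Longrightarrow> poly_prog B (domain_prog n)"
  unfolding domain_prog_def Let_def
  by (intro poly_prog_flat) (auto simp: domain_regs_def)

section \<open>A binary counter and the number at the head of the output\<close>

fun bin_inc :: "bool list \<Rightarrow> bool list" where
  "bin_inc [] = [True]"
| "bin_inc (False # bs) = True # bs"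
| "bin_inc (True # bs) = False # bin_inc bs"

lemma binary_Suc: "binary (Suc m) = bin_inc (binary m)"
proof (induction m rule: less_induct)
  case (less m)
  show ?case
  proof (cases "even m")
    case True
    then show ?thesis by (cases "m = 0") (simp add: binary.simps, simp add: binary.simps[of m] binary.simps[of "Suc m"])
  next
    case False
    then have "Suc m div 2 = Suc (m div 2)" "m \<noteq> 0" by presburger+
    then show ?thesis using False less[of "m div 2"]
      by (simp add: binary.simps[of m] binary.simps[of "Suc m"])
  qed
qed

lemma length_binary: "m < 2 ^ k \<Longrightarrow> length (binary m) \<le> k"
proof (induction k arbitrary: m)
  case 0
  then show ?case by (simp add: binary.simps[of 0])
next
  case (Suc k)
  then show ?case using Suc.IH[of "m div 2"]
    by (cases "m = 0") (simp add: binary.simps, auto simp: binary.simps[of m] less_mult_imp_div_less)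
qed

text \<open>The counter tape is written and hence cannot be looped over; a loop over
  \<open>RH\<close> supplies the rounds instead, enough as long as the counter has fewer than
  \<open>P\<close> bits. The flag \<open>RL\<close> is the carry, and the second loop returns the
  head to the first bit.\<close>

definition inc_prog :: "reg prog" where
  "inc_prog = Put RL 2 ;;
     For RH (Branch RL {2} (Branch RC {2} (Put RC 1 ;; MoveR RC) (Put RC 2 ;; Put RL 1)) Nop) ;;
     For RH (MoveL RC)"

definition header_prog :: "reg prog" where
  "header_prog =
     For RH (Branch RC {0} Nop (app RZ 2 ;; Branch RC {2} (app RZ 2) (app RZ 1) ;; MoveR RC)) ;;
     app RZ 1 ;; app RZ 1"

context word_programs
begin

lemma run_inc_prog:
  assumes H: "\<sigma> RH = (W, 0)" and L: "flag_ok (\<sigma> RL)" and C: "\<sigma> RC = (map bit_symbol bs, 0)"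
    and len: "length bs < P" and \<sigma>': "\<sigma>' = run inc_prog \<sigma>"
  shows "\<sigma>' RC = (map bit_symbol (bin_inc bs), 0)"
proof -
  let ?s0 = "\<sigma>(RL := ([2], 0))"
  let ?p = "Branch RL {2} (Branch RC {2} (Put RC 1 ;; MoveR RC) (Put RC 2 ;; Put RL 1)) Nop"
  have 0: "run (Put RL 2) \<sigma> = ?s0" using flag_put[where \<sigma> = \<sigma> and r = RL, OF L] .
  \<comment> \<open>Either the carry is still pending and the \<open>i\<close> bits passed so far
    have turned from one to zero, or the tape already holds the result.\<close>
  let ?Q = "\<lambda>i s. (s RL = ([2], 0) \<and> (\<exists>bs'. bin_inc bs = replicate i False @ bin_inc bs' \<and>
      length bs = i + length bs' \<and> s RC = (map bit_symbol (replicate i False @ bs'), i))) \<or>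
      (s RL = ([1], 0) \<and> fst (s RC) = map bit_symbol (bin_inc bs) \<and> snd (s RC) \<le> i)"
  obtain s where s: "?Q (length (fst (?s0 RH))) s" "run (For RH ?p) ?s0 = s(RH := (fst (?s0 RH), 0))"
  proof (rule run_For_inv[where Q = ?Q and \<sigma> = ?s0 and r = RH and p = ?p])
    show "?Q 0 ?s0" using C by auto
    fix i s assume "?Q i s"
    then consider bs' where "s RL = ([2], 0)" "bin_inc bs = replicate i False @ bin_inc bs'"
      "length bs = i + length bs'" "s RC = (map bit_symbol (replicate i False @ bs'), i)"
      | "s RL = ([1], 0)" "fst (s RC) = map bit_symbol (bin_inc bs)" "snd (s RC) \<le> i" by blast
    then show "?Q (Suc i) (run ?p (s(RH := (fst (?s0 RH), i))))"
    proof cases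
      case 1
      show ?thesis
      proof (cases "\<exists>b. bs' = True # b")
        case True
        then obtain b where "bs' = True # b" by blast
        then show ?thesis using 1
          by (intro disjI1)
            (auto simp: scan_def nth_append bit_symbol_def list_update_append replicate_append_same[symmetric]
              intro!: exI[of _ b])
      next
        case False
        then show ?thesis using 1
          by (intro disjI2, cases bs')
            (auto simp: scan_def nth_append bit_symbol_def list_update_append)
      qed
    next
      case 2
      then show ?thesis by (intro disjI2) (auto simp: scan_def)
    qed
  qed auto
  have P: "length (fst (?s0 RH)) = P" "fst (?s0 RH) = W" using H by (simp_all add: P_def)
  define s1 where "s1 = s(RH := (W, 0))"
  have s1: "fst (s1 RC) = map bit_symbol (bin_inc bs)" "snd (s1 RC) \<le> P" "fst (s1 RH) = W"
    using s(1) len unfolding P(1) s1_def by auto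
  let ?R = "\<lambda>i s. s RC = (fst (s1 RC), snd (s1 RC) - i)"
  obtain s2 where s2: "?R (length (fst (s1 RH))) s2" "run (For RH (MoveL RC)) s1 = s2(RH := (fst (s1 RH), 0))"
    by (rule run_For_inv[where Q = ?R and \<sigma> = s1 and r = RH and p = "MoveL RC"]) auto
  have "\<sigma>' = s2(RH := (W, 0))"
    using s(2) s2(2) s1(3) unfolding \<sigma>' inc_prog_def run.simps(5) 0 P s1_def by simp
  then show ?thesis using s2(1) s1 by (simp add: P_def)
qed

lemma run_header_prog:
  assumes H: "\<sigma> RH = (W, 0)" and C: "\<sigma> RC = (map bit_symbol bs, 0)" and Z: "\<sigma> RZ = ([], 0)"
    and len: "length bs \<le> P" and \<sigma>': "\<sigma>' = run header_prog \<sigma>"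
  shows "\<sigma>' RZ = (let z = map bit_symbol (concat (map (\<lambda>b. [True, b]) bs) @ [False, False]) in (z, length z)) \<and>
    (\<forall>r. r \<notin> {RC, RZ} \<longrightarrow> \<sigma>' r = \<sigma> r)"
proof -
  let ?p = "Branch RC {0} Nop (app RZ 2 ;; Branch RC {2} (app RZ 2) (app RZ 1) ;; MoveR RC)"
  let ?z = "\<lambda>i. map bit_symbol (concat (map (\<lambda>b. [True, b]) (take i bs)))"
  let ?Q = "\<lambda>i s. s RC = (map bit_symbol bs, min i (length bs)) \<and> s RZ = (?z i, length (?z i)) \<and>
    (\<forall>r. r \<notin> {RC, RZ, RH} \<longrightarrow> s r = \<sigma> r)"
  obtain s where s: "?Q (length (fst (\<sigma> RH))) s" "run (For RH ?p) \<sigma> = s(RH := (fst (\<sigma> RH), 0))"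
  proof (rule run_For_inv[where Q = ?Q and \<sigma> = \<sigma> and r = RH and p = ?p])
    show "?Q 0 \<sigma>" using C Z by auto
    fix i s assume Q: "?Q i s"
    let ?s = "s(RH := (fst (\<sigma> RH), i))"
    show "?Q (Suc i) (run ?p ?s)"
    proof (cases "i < length bs")
      case True
      let ?z2 = "?z i @ [2]"
      let ?s2 = "?s(RZ := (?z2, length ?z2))"
      have 1: "run (app RZ 2) ?s = ?s2" using run_app[of ?s RZ "?z i" 2] Q by simp
      have sc: "scan (?s RC) = bit_symbol (bs ! i)" "scan (?s2 RC) = bit_symbol (bs ! i)"
        using Q True by (simp_all add: scan_def)
      have 2: "run (Branch RC {2} (app RZ 2) (app RZ 1)) ?s2 =
          ?s2(RZ := (?z2 @ [bit_symbol (bs ! i)], length (?z2 @ [bit_symbol (bs ! i)])))"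
      proof -
        have z: "?s2 RZ = (?z2, length ?z2)" by simp
        show ?thesis
        proof (cases "bs ! i")
          case True
          then have "scan (?s2 RC) \<in> {2}" "bit_symbol (bs ! i) = 2"
            using sc(2) by (simp_all add: bit_symbol_def)
          then show ?thesis by (simp only: run.simps(6) if_True run_app[where \<sigma> = ?s2 and r = RZ, OF z])
        next
          case False
          then have "scan (?s2 RC) \<notin> {2}" "bit_symbol (bs ! i) = 1"
            using sc(2) by (simp_all add: bit_symbol_def)
          then show ?thesis by (simp only: run.simps(6) if_False run_app[where \<sigma> = ?s2 and r = RZ, OF z])
        qed
      qed
      have "run ?p ?s = run (MoveR RC) (?s2(RZ := (?z2 @ [bit_symbol (bs ! i)], length (?z2 @ [bit_symbol (bs ! i)]))))"
        unfolding run.simps(5,6) 1 2[unfolded run.simps(6)] sc(1) by (simp add: bit_symbol_def)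
      then show ?thesis using Q True
        by (simp add: take_Suc_conv_app_nth min_def bit_symbol_def)
    next
      case False
      then have "scan (?s RC) = 0" using Q by (simp add: scan_def)
      then show ?thesis using Q False by (simp add: min_def)
    qed
  qed auto
  let ?z = "map bit_symbol (concat (map (\<lambda>b. [True, b]) bs))"
  let ?s1 = "s(RH := (W, 0))"
  have "?s1 RZ = (?z, length ?z)" using s(1) H len by (simp add: P_def)
  then have "run (app RZ 1) ?s1 = ?s1(RZ := (?z @ [1], length (?z @ [1])))" by (rule run_app)
  moreover have "run (app RZ 1) (?s1(RZ := (?z @ [1], length (?z @ [1])))) =
      ?s1(RZ := (?z @ [1, 1], length (?z @ [1, 1])))"
    using run_app[of "?s1(RZ := (?z @ [1], length (?z @ [1])))" RZ "?z @ [1]" 1] by simp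
  ultimately have "\<sigma>' = ?s1(RZ := (?z @ [1, 1], length (?z @ [1, 1])))"
    unfolding \<sigma>' header_prog_def run.simps(5) s(2) using H by simp
  then show ?thesis using s(1) H by (auto simp: bit_symbol_def Let_def)
qed

end

lemma (in word_programs) run_inc_prog_frame:
  assumes H: "\<sigma> RH = (W, 0)" and L: "flag_ok (\<sigma> RL)" and \<sigma>': "\<sigma>' = run inc_prog \<sigma>"
  shows "\<sigma>' RH = (W, 0)" "flag_ok (\<sigma>' RL)" "\<And>r. r \<notin> {RL, RC, RH} \<Longrightarrow> \<sigma>' r = \<sigma> r"
proof -
  let ?p = "Branch RL {2} (Branch RC {2} (Put RC 1 ;; MoveR RC) (Put RC 2 ;; Put RL 1)) Nop"
  let ?s0 = "\<sigma>(RL := ([2], 0))"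
  have 0: "run (Put RL 2) \<sigma> = ?s0" using flag_put[where \<sigma> = \<sigma> and r = RL, OF L] .
  obtain s where s: "flag_ok (s RL)" "run (For RH ?p) ?s0 = s(RH := (fst (?s0 RH), 0))"
  proof (rule run_For_inv[where Q = "\<lambda>i s. flag_ok (s RL)" and \<sigma> = ?s0 and r = RH and p = ?p])
    fix i s assume s: "flag_ok (s RL)"
    then show "flag_ok (run ?p (s(RH := (fst (?s0 RH), i))) RL)"
      by (cases "fst (s RL)") (auto simp: flag_ok_def)
  qed auto
  define s1 where "s1 = s(RH := (W, 0))"
  have \<sigma>'_eq: "\<sigma>' = run (For RH (MoveL RC)) s1"
    unfolding \<sigma>' inc_prog_def run.simps(5) 0 s(2) s1_def using H by simp
  have "\<sigma>' RL = s1 RL" unfolding \<sigma>'_eq by (rule run_untouched) simp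
  then show "flag_ok (\<sigma>' RL)" using s(1) by (simp add: s1_def)
  show "\<sigma>' RH = (W, 0)" unfolding \<sigma>'_eq s1_def by simp
  show "\<sigma>' r = \<sigma> r" if "r \<notin> {RL, RC, RH}" for r
    unfolding \<sigma>' by (rule run_untouched) (use that in \<open>simp add: inc_prog_def\<close>)
qed

section \<open>The generated string and the complete programs\<close>

definition relation_of :: "nat \<Rightarrow> bool list \<Rightarrow> nat \<Rightarrow> nat \<Rightarrow> nat \<Rightarrow> nat \<Rightarrow> bool" where
  "relation_of P y j a b c \<longleftrightarrow> (let i = ((j * P + a) * P + b) * P + c in i < length y \<and> y ! i)"

text \<open>The code of an instance begins with the number of vertices. The first generator emits
  one bit per vertex, and only the length of its output matters.\<close>

definition gen_string :: "nat poly \<Rightarrow> nat poly \<Rightarrow> gen \<Rightarrow> gen \<Rightarrow> bool list \<Rightarrow> bool list \<Rightarrow> bool list" where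
  "gen_string a b g0 g1 x y =
     (let W = domain_word a b x; P = length W;
          z = (\<lambda>g. out P (\<lambda>i. W ! i) (relation_of P y) g (\<lambda>_. 0))
      in encode_enat (enat (length (z g0))) @ z g1)"

definition setup_prog :: "nat poly \<Rightarrow> nat poly \<Rightarrow> nat \<Rightarrow> reg prog" where
  "setup_prog a b n = unary True 0 (coeffs a) ;; unary False 0 (coeffs b) ;; domain_prog n ;;
     rewind_all (domain_regs n)"

definition main_prog :: "nat \<Rightarrow> gen \<Rightarrow> gen \<Rightarrow> reg prog" where
  "main_prog n g0 g1 = gen_prog n (\<lambda>_. inc_prog) g0 ;; header_prog ;;
     gen_prog n (\<lambda>b. app RZ (bit_symbol b)) g1"

definition copy_prog :: "reg prog" where
  "copy_prog = For RZ (Branch RZ {1} (app RO 1) (app RO 2))"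

definition compare_prog :: "reg prog" where
  "compare_prog = For RX Nop ;; Put RR 1 ;;
     For RZ (Branch RZ {1} (Branch RX {1} Nop (Put RR 2)) (Branch RX {2} Nop (Put RR 2)) ;; MoveR RX) ;;
     Branch RX {0} Nop (Put RR 2) ;; Branch RR {1} (Put RO 2) (Put RO 1)"

lemma zero_notin_domain_word: "0 \<notin> set (domain_word a b x)"
  by (auto simp: domain_word_def Let_def bit_symbol_def split: if_splits)

lemma run_setup_prog:
  assumes \<sigma>': "\<sigma>' = run (setup_prog a b n) (input_store RX RY x y)"
  shows "word_programs.env_ok (domain_word a b x) n (\<lambda>_. 0) \<sigma>'" "word_programs.cert_tape y \<sigma>'"
    "fst (\<sigma>' RX) = map bit_symbol x" "\<sigma>' RO = ([], 0)" "\<sigma>' RZ = ([], 0)" "\<sigma>' RC = ([], 0)"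
proof -
  interpret word_programs "domain_word a b x" y n
    by unfold_locales (rule zero_notin_domain_word)
  let ?\<sigma> = "input_store RX RY x y"
  define s1 where "s1 = run (unary True 0 (coeffs a)) ?\<sigma>"
  define s2 where "s2 = run (unary False 0 (coeffs b)) s1"
  define s3 where "s3 = run (domain_prog n) s2"
  have init: "fst (?\<sigma> RX) = map bit_symbol x" "\<And>r. r \<noteq> RX \<Longrightarrow> r \<noteq> RY \<Longrightarrow> ?\<sigma> r = ([], 0)"
    "?\<sigma> RY = (map bit_symbol y, 0)" by (auto simp: input_store_def)
  have s1: "fst (s1 RX) = map bit_symbol x" "fst (s1 (RU True 0)) = replicate (poly a (length x)) 3"
    "\<And>r. r \<noteq> RX \<Longrightarrow> r \<notin> range (RU True) \<Longrightarrow> s1 r = ?\<sigma> r"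
    using run_unary[of ?\<sigma> "map bit_symbol x" 0 True s1 "coeffs a"] init by (auto simp: s1_def Let_def)
  have s2: "fst (s2 RX) = map bit_symbol x" "fst (s2 (RU False 0)) = replicate (poly b (length x)) 3"
    "\<And>r. r \<noteq> RX \<Longrightarrow> r \<notin> range (RU False) \<Longrightarrow> s2 r = s1 r"
  proof -
    have "s1 (RU False k') = ([], 0)" for k' using s1(3)[of "RU False k'"] init(2) by auto
    then show "fst (s2 RX) = map bit_symbol x" "fst (s2 (RU False 0)) = replicate (poly b (length x)) 3"
      "\<And>r. r \<noteq> RX \<Longrightarrow> r \<notin> range (RU False) \<Longrightarrow> s2 r = s1 r"
      using run_unary[of s1 "map bit_symbol x" 0 False s2 "coeffs b"] s1(1) by (auto simp: s2_def Let_def)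
  qed
  have plain: "s2 r = ?\<sigma> r" if "r \<noteq> RX" "r \<notin> range (RU True)" "r \<notin> range (RU False)" for r
    using s1(3) s2(3) that by simp
  have U: "fst (s2 (RU True 0)) = replicate (poly a (length x)) 3"
    using s1(2) s2(3)[of "RU True 0"] by (simp add: image_iff)
  have D: "s2 r = ([], 0)" if "r \<in> set (domain_regs n)" for r
    using that plain[of r] init(2)[of r] by (auto simp: domain_regs_def image_iff)
  have s3: "\<forall>r\<in>set (domain_regs n). fst (s3 r) = domain_word a b x" "fst (s3 RX) = map bit_symbol x"
    "\<And>r. r \<notin> set (domain_regs n) \<union> {RX, RU True 0, RU False 0} \<Longrightarrow> s3 r = s2 r"
    using run_domain_prog[OF _ s2(1) U s2(2) s3_def] D by auto
  have \<sigma>'_eq: "\<sigma>' r = (if r \<in> set (domain_regs n) then (domain_word a b x, 0) else s3 r)" for r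
    using s3(1) unfolding \<sigma>' setup_prog_def run.simps(5) s1_def[symmetric] s2_def[symmetric]
      s3_def[symmetric] run_rewind_all by auto
  have rest: "\<sigma>' r = ?\<sigma> r" if "r \<in> {RY, RO, RZ, RC, RL, RR} \<union> range RF" for r
  proof -
    have r: "r \<notin> set (domain_regs n) \<union> {RX, RU True 0, RU False 0}"
      using that by (auto simp: domain_regs_def)
    have "\<sigma>' r = s3 r" using r by (simp add: \<sigma>'_eq)
    also have "\<dots> = ?\<sigma> r" using s3(3)[OF r] plain[of r] that by auto
    finally show ?thesis .
  qed
  show "env_ok (\<lambda>_. 0) \<sigma>'"
  proof -
    have "\<sigma>' r = (domain_word a b x, 0)" if "r \<in> set (domain_regs n)" for r
      using that by (simp add: \<sigma>'_eq)
    moreover have "flag_ok (\<sigma>' r)" if "r \<in> {RL, RR} \<union> range RF" for r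
      using that rest[of r] init(2)[of r] by (auto simp: flag_ok_def)
    ultimately show ?thesis by (auto simp: env_ok_def domain_regs_def)
  qed
  show "cert_tape \<sigma>'" using rest[of RY] init by (simp add: cert_tape_def)
  show "fst (\<sigma>' RX) = map bit_symbol x" using s3(2) by (simp add: \<sigma>'_eq domain_regs_def image_iff)
  show "\<sigma>' RO = ([], 0)" "\<sigma>' RZ = ([], 0)" "\<sigma>' RC = ([], 0)" using rest init by simp_all
qed

lemma run_main_prog:
  assumes P: "P = length (domain_word a b x)" and ok: "gen_ok n g0" "gen_ok n g1"
    and len: "length (out P (\<lambda>i. domain_word a b x ! i) (relation_of P y) g0 (\<lambda>_. 0)) \<le> 2 ^ (P - 1)"
    and \<sigma>': "\<sigma>' = run (main_prog n g0 g1) (run (setup_prog a b n) (input_store RX RY x y))"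
  shows "fst (\<sigma>' RX) = map bit_symbol x" "\<sigma>' RO = ([], 0)"
    "fst (\<sigma>' RZ) = map bit_symbol (gen_string a b g0 g1 x y)" "word_programs.flag_ok (\<sigma>' RR)"
proof -
  interpret word_programs "domain_word a b x" y n
    by unfold_locales (rule zero_notin_domain_word)
  have P_eq: "word_programs.P (domain_word a b x) = P" by (simp add: P_def P)
  have "P \<noteq> 0" unfolding P by (simp add: domain_word_def Let_def)
  have rel: "cert = relation_of P y"
    by (intro ext) (simp add: cert_def relation_of_def P_eq)
  define s0 where "s0 = run (setup_prog a b n) (input_store RX RY x y)"
  note s0 = run_setup_prog[OF s0_def]
  have bd: "bounded (\<lambda>_. 0)" using \<open>P \<noteq> 0\<close> by (simp add: bounded_def P_eq)
  let ?o = "\<lambda>g. out P (\<lambda>i. domain_word a b x ! i) (relation_of P y) g (\<lambda>_. 0)"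
  \<comment> \<open>The claim on the counter is conditional because the invariant has to cover
    outputs of every length, whereas incrementing is correct only while the counter is short enough
    for the word.\<close>
  define E where "E bs s \<longleftrightarrow> fst (s RX) = map bit_symbol x \<and> s RZ = ([], 0) \<and> s RO = ([], 0) \<and>
    (length bs \<le> 2 ^ (P - 1) \<longrightarrow> s RC = (map bit_symbol (binary (length bs)), 0))" for bs :: "bool list" and s :: "reg store"
  define s1 where "s1 = run (gen_prog n (\<lambda>_. inc_prog) g0) s0"
  have s1: "env_ok (\<lambda>_. 0) s1 \<and> cert_tape s1 \<and> E ([] @ ?o g0) s1"
    unfolding s1_def rel[symmetric] unfolding P_eq[symmetric]
  proof (rule run_gen_prog[where E = E])
    fix e c bs s assume s: "env_ok e s" "cert_tape s" "E bs s"
    define s' where "s' = run inc_prog s"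
    have s': "s' RH = (domain_word a b x, 0)" "flag_ok (s' RL)" "\<And>r. r \<notin> {RL, RC, RH} \<Longrightarrow> s' r = s r"
      using run_inc_prog_frame[OF _ _ s'_def] s(1) by (auto simp: env_ok_def)
    have "s' RC = (map bit_symbol (binary (length (bs @ [c]))), 0)" if l: "length (bs @ [c]) \<le> 2 ^ (P - 1)"
    proof -
      have "length bs < 2 ^ (P - 1)" using l by simp
      then have "length (binary (length bs)) < word_programs.P (domain_word a b x)"
        using length_binary[of "length bs" "P - 1"] \<open>P \<noteq> 0\<close> by (simp add: P_eq)
      then show ?thesis
        using run_inc_prog[OF _ _ _ _ s'_def, of "binary (length bs)"] s l
        by (simp add: E_def env_ok_def binary_Suc)
    qed
    then show "env_ok e (run inc_prog s) \<and> cert_tape (run inc_prog s) \<and> E (bs @ [c]) (run inc_prog s)"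
      using s s' unfolding s'_def[symmetric] by (auto simp: E_def env_ok_def cert_tape_def)
  next
    fix bs s s' assume a: "\<And>r. r \<notin> scratch UNIV \<Longrightarrow> s r = s' r" "E bs s"
    have "{RX, RZ, RO, RC} \<inter> scratch UNIV = {}" by (auto simp: scratch_def)
    then have "s RX = s' RX" "s RZ = s' RZ" "s RO = s' RO" "s RC = s' RC" by (simp_all add: a(1))
    then show "E bs s'" using a(2) by (simp add: E_def)
  next
    show "E [] s0" using s0 by (simp add: E_def binary.simps)
  qed (use s0 bd ok in simp_all)
  have RC: "s1 RC = (map bit_symbol (binary (length (?o g0))), 0)" using s1 len by (simp add: E_def)
  define s2 where "s2 = run header_prog s1"
  let ?h = "encode_enat (enat (length (?o g0)))"
  have lenb: "length (binary (length (?o g0))) \<le> word_programs.P (domain_word a b x)"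
  proof -
    have "(2::nat) ^ (P - 1) < 2 ^ P" using \<open>P \<noteq> 0\<close> by simp
    then have "length (?o g0) < 2 ^ P" using len by linarith
    then show ?thesis using length_binary by (simp add: P_eq)
  qed
  have s2: "s2 RZ = (map bit_symbol ?h, length ?h)" "\<And>r. r \<notin> {RC, RZ} \<Longrightarrow> s2 r = s1 r"
    using run_header_prog[OF _ RC _ lenb s2_def] s1
    by (auto simp: E_def env_ok_def encode_enat_def Let_def)
  define E' where "E' bs s \<longleftrightarrow> fst (s RX) = map bit_symbol x \<and> s RO = ([], 0) \<and>
    s RZ = (map bit_symbol (?h @ bs), length (?h @ bs))" for bs and s :: "reg store"
  have s3: "env_ok (\<lambda>_. 0) \<sigma>' \<and> cert_tape \<sigma>' \<and> E' ([] @ ?o g1) \<sigma>'"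
    unfolding \<sigma>' main_prog_def run.simps(5) s0_def[symmetric] s1_def[symmetric] s2_def[symmetric]
      rel[symmetric] unfolding P_eq[symmetric]
  proof (rule run_gen_prog[where E = E'])
    fix e c bs s assume s: "env_ok e s" "cert_tape s" "E' bs s"
    then have "run (app RZ (bit_symbol c)) s =
        s(RZ := (map bit_symbol (?h @ bs) @ [bit_symbol c], length (map bit_symbol (?h @ bs) @ [bit_symbol c])))"
      by (intro run_app) (simp add: E'_def)
    then show "env_ok e (run (app RZ (bit_symbol c)) s) \<and> cert_tape (run (app RZ (bit_symbol c)) s) \<and>
        E' (bs @ [c]) (run (app RZ (bit_symbol c)) s)"
      using s by (simp add: E'_def env_ok_def cert_tape_def)
  next
    fix bs s s' assume a: "\<And>r. r \<notin> scratch UNIV \<Longrightarrow> s r = s' r" "E' bs s"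
    have "{RX, RZ, RO, RC} \<inter> scratch UNIV = {}" by (auto simp: scratch_def)
    then have "s RX = s' RX" "s RZ = s' RZ" "s RO = s' RO" "s RC = s' RC" by (simp_all add: a(1))
    then show "E' bs s'" using a(2) by (simp add: E'_def)
  next
    show "env_ok (\<lambda>_. 0) s2" "cert_tape s2" using s1 s2(2) by (auto simp: env_ok_def cert_tape_def)
    show "E' [] s2" using s1 s2 by (simp add: E_def E'_def)
  qed (use bd ok in simp_all)
  then show "fst (\<sigma>' RX) = map bit_symbol x" "\<sigma>' RO = ([], 0)" "flag_ok (\<sigma>' RR)"
    "fst (\<sigma>' RZ) = map bit_symbol (gen_string a b g0 g1 x y)"
    by (auto simp: E'_def gen_string_def Let_def P env_ok_def)
qed

lemma run_copy_prog:
  assumes "\<sigma> RO = ([], 0)" "fst (\<sigma> RZ) = map bit_symbol z"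
  shows "fst (run copy_prog \<sigma> RO) = map bit_symbol z"
proof -
  let ?p = "Branch RZ {1} (app RO 1) (app RO 2)"
  let ?Q = "\<lambda>i s. s RO = (map bit_symbol (take i z), length (take i z))"
  obtain s where s: "?Q (length (fst (\<sigma> RZ))) s" "run (For RZ ?p) \<sigma> = s(RZ := (fst (\<sigma> RZ), 0))"
  proof (rule run_For_inv[where Q = ?Q and \<sigma> = \<sigma> and r = RZ and p = ?p])
    fix i s assume i: "i < length (fst (\<sigma> RZ))" and Q: "?Q i s"
    let ?s = "s(RZ := (fst (\<sigma> RZ), i))"
    have "scan (?s RZ) = bit_symbol (z ! i)" using i assms by (simp add: scan_def)
    then have "run ?p ?s = run (app RO (bit_symbol (z ! i))) ?s"
      unfolding run.simps(6) by (simp add: bit_symbol_def)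
    also have "\<dots> = ?s(RO := (map bit_symbol (take i z) @ [bit_symbol (z ! i)],
        length (map bit_symbol (take i z) @ [bit_symbol (z ! i)])))"
      by (rule run_app) (use Q in simp)
    finally show "?Q (Suc i) (run ?p ?s)" using i assms by (simp add: take_Suc_conv_app_nth)
  qed (use assms in simp)
  show ?thesis unfolding copy_prog_def s(2) using s(1) assms by simp
qed

lemma run_compare_prog:
  assumes RR: "word_programs.flag_ok (\<sigma> RR)" and RO: "\<sigma> RO = ([], 0)"
    and X: "fst (\<sigma> RX) = map bit_symbol x" and Z: "fst (\<sigma> RZ) = map bit_symbol z"
  shows "fst (run compare_prog \<sigma> RO) = [bit_symbol (z = x)]"
proof -
  interpret word_programs "[]" by unfold_locales simp
  let ?X = "map bit_symbol x"
  define s0 where "s0 = \<sigma>(RX := (?X, 0), RR := ([1], 0))"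
  have s0: "run (Put RR 1) (run (For RX Nop) \<sigma>) = s0"
    unfolding run_For_Nop s0_def using flag_put[where \<sigma> = "\<sigma>(RX := (fst (\<sigma> RX), 0))" and r = RR] RR X
    by (simp del: run.simps)
  let ?p = "Branch RZ {1} (Branch RX {1} Nop (Put RR 2)) (Branch RX {2} Nop (Put RR 2)) ;; MoveR RX"
  let ?Q = "\<lambda>i s. s RX = (?X, min i (length x)) \<and>
     s RR = ([if i \<le> length x \<and> take i z = take i x then 1 else 2], 0) \<and> s RO = ([], 0)"
  have Z0: "fst (s0 RZ) = map bit_symbol z" using Z by (simp add: s0_def)
  obtain s where s: "?Q (length (fst (s0 RZ))) s" "run (For RZ ?p) s0 = s(RZ := (fst (s0 RZ), 0))"
  proof (rule run_For_inv[where Q = ?Q and \<sigma> = s0 and r = RZ and p = ?p])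
    show "?Q 0 s0" using RO by (simp add: s0_def)
    fix i s assume i: "i < length (fst (s0 RZ))" and Q: "?Q i s"
    let ?s = "s(RZ := (fst (s0 RZ), i))"
    have iz: "i < length z" using i Z0 by simp
    have scz: "scan (?s RZ) = bit_symbol (z ! i)" using iz Z0 by (simp add: scan_def)
    have scx: "scan (?s RX) = (if i < length x then bit_symbol (x ! i) else 0)"
      using Q by (simp add: scan_def min_def)
    have take: "take (Suc i) z = take (Suc i) x \<longleftrightarrow> take i z = take i x \<and> z ! i = x ! i"
      if "i < length x" using that iz by (simp add: take_Suc_conv_app_nth)
    have put: "run (Put RR 2) ?s = ?s(RR := ([2], 0))" using Q by simp
    show "?Q (Suc i) (run ?p ?s)"
    proof (cases "i < length x \<and> z ! i = x ! i")
      case True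
      then have "run ?p ?s = run (MoveR RX) ?s"
        unfolding run.simps(5,6) scz scx by (simp add: bit_symbol_def)
      then show ?thesis using Q True take by (simp add: min_def)
    next
      case False
      have "run ?p ?s = run (MoveR RX) (?s(RR := ([2], 0)))"
        unfolding run.simps(5,6) scz scx put using False by (auto simp: bit_symbol_def)
      then show ?thesis using Q False take by (auto simp: min_def)
    qed
  qed
  define t where "t = s(RZ := (fst (s0 RZ), 0))"
  have t: "t RX = (?X, min (length z) (length x))" "t RO = ([], 0)"
    "t RR = ([if length z \<le> length x \<and> z = take (length z) x then 1 else 2], 0)"
    using s(1) Z0 by (simp_all add: t_def)
  have sc: "scan (t RX) \<in> {0} \<longleftrightarrow> length x \<le> length z"
    unfolding t by (auto simp: scan_def bit_symbol_def)
  have eq: "z = x \<longleftrightarrow> length z \<le> length x \<and> z = take (length z) x \<and> length x \<le> length z"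
    by (metis le_antisym order_refl take_all)
  define u where "u = run (Branch RX {0} Nop (Put RR 2)) t"
  have u: "(scan (u RR) \<in> {1} \<longleftrightarrow> z = x) \<and> u RO = ([], 0)"
  proof (cases "length x \<le> length z")
    case True
    then have "u = t" unfolding u_def run.simps(6) sc by simp
    moreover have "scan (t RR) = 1 \<longleftrightarrow> length z \<le> length x \<and> z = take (length z) x"
      unfolding t(3) by (simp add: scan_def)
    ultimately show ?thesis using t(2) eq True by blast
  next
    case False
    then have "u = t(RR := ([2], 0))" unfolding u_def run.simps(6) sc using t by simp
    then have "scan (u RR) = 2" "u RO = t RO" by (simp_all add: scan_def)
    then show ?thesis using t(2) eq False by auto
  qed
  have "run compare_prog \<sigma> = run (Branch RR {1} (Put RO 2) (Put RO 1)) u"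
    unfolding compare_prog_def run.simps(5) s0 s(2) t_def[symmetric] u_def[symmetric] ..
  then show ?thesis using u unfolding run.simps(6) by (simp add: bit_symbol_def)
qed

text \<open>Tests write only flags and loop only over word tapes and the certificate. This and the
  next lemmas provide the separation of looped and written tapes that \<open>poly_prog_flat\<close>
  asks for.\<close>

lemma puts_test: "puts (test n \<phi> p q) \<subseteq> puts p \<union> puts q \<union> {RL, RR} \<union> range RF"
proof (induction \<phi> arbitrary: p q)
  case (Rel j a b c)
  have "puts (rel_blocks n j a b c k) \<subseteq> {RL, RR}" for k
    by (induction k) (auto simp: rel_block_def for_var_def if_eq_def less_prog_def)
  from this[of "Suc j"] show ?case by (auto simp: rel_prog_def simp del: rel_blocks.simps)
next
  case (And \<phi> \<psi>)
  show ?case using And.IH(1)[of "test n \<psi> p q" q] And.IH(2)[of p q] by auto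
next
  case (All v \<phi>)
  then show ?case using All.IH[of Nop "Put (RF v) 2"] by (auto simp: for_var_def)
qed (auto simp: less_prog_def)

lemma loops_test: "loops (test n \<phi> p q) \<subseteq> loops p \<union> loops q \<union> {RH, RK, RY} \<union> range RV \<union> range RS"
proof (induction \<phi> arbitrary: p q)
  case (Rel j a b c)
  have "loops (rel_blocks n j a b c k) \<subseteq> {RH, RK, RY} \<union> range RV \<union> range RS" for k
    by (induction k) (auto simp: rel_block_def for_var_def if_eq_def less_prog_def)
  from this[of "Suc j"] show ?case by (auto simp: rel_prog_def simp del: rel_blocks.simps)
next
  case (And \<phi> \<psi>)
  show ?case using And.IH(1)[of "test n \<psi> p q" q] And.IH(2)[of p q] by auto
next
  case (All v \<phi>)
  then show ?case using All.IH[of Nop "Put (RF v) 2"] by (auto simp: for_var_def)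
qed (auto simp: less_prog_def)

lemma touched_test: "touched (test n \<phi> p q) \<subseteq> touched p \<union> touched q \<union>
    {RL, RR, RH, RK, RY} \<union> range RS \<union> range RF \<union> RV ` (bound_vars \<phi> \<union> {n..})"
proof (induction \<phi> arbitrary: p q)
  case (Rel j a b c)
  have "touched (rel_blocks n j a b c k) \<subseteq> {RL, RR, RH, RK, RY} \<union> range RS \<union> RV ` {n..}" for k
    by (induction k) (auto simp: rel_block_def for_var_def if_eq_def less_prog_def)
  from this[of "Suc j"] show ?case by (auto simp: rel_prog_def simp del: rel_blocks.simps)
next
  case (And \<phi> \<psi>)
  show ?case using And.IH(1)[of "test n \<psi> p q" q] And.IH(2)[of p q] by auto
next
  case (All v \<phi>)
  then show ?case using All.IH[of Nop "Put (RF v) 2"] by (auto simp: for_var_def)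
qed (auto simp: less_prog_def)

lemma prog_ok_test:
  "3 \<le> B \<Longrightarrow> fm_ok n \<phi> \<Longrightarrow> prog_ok B p \<Longrightarrow> prog_ok B q \<Longrightarrow> prog_ok B (test n \<phi> p q)"
proof (induction \<phi> arbitrary: p q)
  case (Rel j a b c)
  have "prog_ok B (rel_blocks n j a b c k)" for k
    using Rel.prems by (induction k) (auto simp: rel_block_def for_var_def if_eq_def less_prog_def)
  then show ?case using Rel.prems by (auto simp: rel_prog_def simp del: rel_blocks.simps)
next
  case (All v \<phi>)
  have "RV v \<notin> touched (test n \<phi> Nop (Put (RF v) 2))"
    using touched_test[of n \<phi> Nop "Put (RF v) 2"] All.prems by auto
  then show ?case using All by (auto simp: for_var_def)
qed (auto simp: less_prog_def)

lemma gen_prog_regs: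
  assumes "\<And>b. touched (em b) \<inter> range RV = {}" "3 \<le> B" "\<And>b. prog_ok B (em b)"
  shows "puts (gen_prog n em g) \<subseteq> (\<Union>b. puts (em b)) \<union> {RL, RR} \<union> range RF"
    "loops (gen_prog n em g) \<subseteq> (\<Union>b. loops (em b)) \<union> {RH, RK, RY} \<union> range RV \<union> range RS"
    "touched (gen_prog n em g) \<inter> range RV \<subseteq> RV ` (gen_vars g \<union> {n..})"
    "gen_ok n g \<Longrightarrow> prog_ok B (gen_prog n em g)"
proof -
  have "puts (foldr (\<lambda>b p. em b ;; p) bs Nop) \<subseteq> (\<Union>b. puts (em b))" for bs by (induction bs) auto
  note e = this
  show "puts (gen_prog n em g) \<subseteq> (\<Union>b. puts (em b)) \<union> {RL, RR} \<union> range RF"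
  proof (induction g)
    case (GIf \<phi> g h)
    then show ?case using puts_test[of n \<phi> "gen_prog n em g" "gen_prog n em h"] by auto
  qed (use e in \<open>auto simp: for_var_def\<close>)
  have "loops (foldr (\<lambda>b p. em b ;; p) bs Nop) \<subseteq> (\<Union>b. loops (em b))" for bs by (induction bs) auto
  note l = this
  show "loops (gen_prog n em g) \<subseteq> (\<Union>b. loops (em b)) \<union> {RH, RK, RY} \<union> range RV \<union> range RS"
  proof (induction g)
    case (GIf \<phi> g h)
    then show ?case using loops_test[of n \<phi> "gen_prog n em g" "gen_prog n em h"] by auto
  qed (use l in \<open>auto simp: for_var_def\<close>)
  have em: "touched (foldr (\<lambda>b p. em b ;; p) bs Nop) \<inter> range RV = {}" for bs
    using assms(1) by (induction bs) auto
  show t: "touched (gen_prog n em g) \<inter> range RV \<subseteq> RV ` (gen_vars g \<union> {n..})" for g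
  proof (induction g)
    case (GIf \<phi> g h)
    then show ?case using touched_test[of n \<phi> "gen_prog n em g" "gen_prog n em h"]
      by (fastforce)
  qed (use em in \<open>auto simp: for_var_def\<close>)
  have ok: "prog_ok B (foldr (\<lambda>b p. em b ;; p) bs Nop)" for bs using assms(3) by (induction bs) auto
  show "gen_ok n g \<Longrightarrow> prog_ok B (gen_prog n em g)"
  proof (induction g)
    case (GFor v g)
    have "RV v \<notin> touched (gen_prog n em g)" using t[of g] GFor.prems by auto
    then show ?case using GFor by (auto simp: for_var_def)
  qed (use ok assms(2) prog_ok_test in auto)
qed

lemma poly_prog_main:
  assumes "gen_ok n g0" "gen_ok n g1"
  shows "poly_prog 9 (setup_prog a b n)" "poly_prog 9 (main_prog n g0 g1)"
    "poly_prog 9 copy_prog" "poly_prog 9 compare_prog"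
proof -
  show "poly_prog 9 (setup_prog a b n)"
    unfolding setup_prog_def
    by (intro poly_prog_Then poly_prog_unary poly_prog_domain) (auto intro: poly_prog_flat)
  have "poly_prog 9 (gen_prog n (\<lambda>_. inc_prog) g0)"
  proof (rule poly_prog_flat)
    have em: "\<And>b::bool. touched inc_prog \<inter> range RV = {}" "(3::nat) \<le> 9" "\<And>b::bool. prog_ok 9 inc_prog"
      by (auto simp: inc_prog_def)
    note r = gen_prog_regs[where em = "\<lambda>_. inc_prog", OF em]
    show "prog_ok 9 (gen_prog n (\<lambda>_. inc_prog) g0)" using r(4) assms by blast
    show "loops (gen_prog n (\<lambda>_. inc_prog) g0) \<inter> puts (gen_prog n (\<lambda>_. inc_prog) g0) = {}"
      using r(1)[of n g0] r(2)[of n g0] by (fastforce simp: inc_prog_def)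
  qed
  moreover have "poly_prog 9 header_prog" by (rule poly_prog_flat) (auto simp: header_prog_def)
  moreover have "poly_prog 9 (gen_prog n (\<lambda>b. app RZ (bit_symbol b)) g1)"
  proof (rule poly_prog_flat)
    have em: "\<And>b. touched (app RZ (bit_symbol b)) \<inter> range RV = {}" "(3::nat) \<le> 9"
      "\<And>b. prog_ok 9 (app RZ (bit_symbol b))"
      by (auto simp: bit_symbol_def)
    note r = gen_prog_regs[where em = "\<lambda>b. app RZ (bit_symbol b)", OF em]
    show "prog_ok 9 (gen_prog n (\<lambda>b. app RZ (bit_symbol b)) g1)" using r(4) assms by blast
    show "loops (gen_prog n (\<lambda>b. app RZ (bit_symbol b)) g1) \<inter>
        puts (gen_prog n (\<lambda>b. app RZ (bit_symbol b)) g1) = {}"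
      using r(1)[of n g1] r(2)[of n g1] by fastforce
  qed
  ultimately show "poly_prog 9 (main_prog n g0 g1)" by (simp add: main_prog_def poly_prog_Then)
  show "poly_prog 9 copy_prog" by (rule poly_prog_flat) (auto simp: copy_prog_def)
  show "poly_prog 9 compare_prog" by (rule poly_prog_flat) (auto simp: compare_prog_def)
qed

text \<open>The same program either copies the generated string to the output or compares it with
  the input. The bound \<open>2 ^ (P - 1)\<close> on the counted output, with \<open>P\<close> the
  length of the word, ensures that the binary counter can be handled by loops over the word.\<close>

theorem gen_string_computable:
  assumes "gen_ok n g0" "gen_ok n g1"
    and "\<And>x y. length (out (length (domain_word a b x)) (\<lambda>i. domain_word a b x ! i)
      (relation_of (length (domain_word a b x)) y) g0 (\<lambda>_. 0)) \<le> 2 ^ (length (domain_word a b x) - 1)"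
  shows "poly_time_computable (\<lambda>x. gen_string a b g0 g1 x [])"
    "poly_time_decidable2 (\<lambda>x y. gen_string a b g0 g1 x y = x)"
proof -
  note ok = poly_prog_main[OF assms(1,2)]
  note main = run_main_prog[OF refl assms(1,2) assms(3) refl]
  show "poly_time_computable (\<lambda>x. gen_string a b g0 g1 x [])"
    by (rule prog_computable[where p = "setup_prog a b n ;; main_prog n g0 g1 ;; copy_prog" and B = 9
          and rx = RX and ry = RY and ro = RO])
      (simp_all add: poly_prog_Then ok run_copy_prog[OF main(2,3)] del: fun_upd_apply)
  show "poly_time_decidable2 (\<lambda>x y. gen_string a b g0 g1 x y = x)"
    by (rule prog_decidable2[where p = "setup_prog a b n ;; main_prog n g0 g1 ;; compare_prog" and B = 9
          and rx = RX and ry = RY and ro = RO])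
      (simp_all add: poly_prog_Then ok run_compare_prog[OF main(4,2,1,3)] del: fun_upd_apply)
qed

section \<open>Derived formulas\<close>

definition Or :: "fm \<Rightarrow> fm \<Rightarrow> fm" where "Or \<phi> \<psi> = Neg (And (Neg \<phi>) (Neg \<psi>))"
definition Ex :: "nat \<Rightarrow> fm \<Rightarrow> fm" where "Ex v \<phi> = Neg (All v (Neg \<phi>))"
definition Iff :: "fm \<Rightarrow> fm \<Rightarrow> fm" where "Iff \<phi> \<psi> = Or (And \<phi> \<psi>) (And (Neg \<phi>) (Neg \<psi>))"
definition Eq :: "nat \<Rightarrow> nat \<Rightarrow> fm" where "Eq a b = And (Neg (Less a b)) (Neg (Less b a))"
definition Bool :: "bool \<Rightarrow> fm" where "Bool b = (if b then Neg (Less 0 0) else Less 0 0)"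

text \<open>Variable 9 is reserved for the quantifiers in the following formulas.\<close>

definition Succ :: "nat \<Rightarrow> nat \<Rightarrow> fm" where
  "Succ a b = And (Less a b) (Neg (Ex 9 (And (Less a 9) (Less 9 b))))"
definition Zero :: "nat \<Rightarrow> fm" where "Zero a = Neg (Ex 9 (Less 9 a))"
definition NotLast :: "nat \<Rightarrow> fm" where "NotLast a = Ex 9 (Less a 9)"

lemma holds_derived [simp]:
  "holds P w R (Or \<phi> \<psi>) e \<longleftrightarrow> holds P w R \<phi> e \<or> holds P w R \<psi> e"
  "holds P w R (Ex v \<phi>) e \<longleftrightarrow> (\<exists>i<P. holds P w R \<phi> (e(v := i)))"
  "holds P w R (Iff \<phi> \<psi>) e \<longleftrightarrow> (holds P w R \<phi> e \<longleftrightarrow> holds P w R \<psi> e)"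
  "holds P w R (Eq a b) e \<longleftrightarrow> e a = e b"
  "holds P w R (Bool c) e \<longleftrightarrow> c"
  by (auto simp: Or_def Ex_def Iff_def Eq_def Bool_def)

lemma holds_Succ [simp]:
  "a \<noteq> 9 \<Longrightarrow> b \<noteq> 9 \<Longrightarrow> e b < P \<Longrightarrow> holds P w R (Succ a b) e \<longleftrightarrow> e b = Suc (e a)"
  by (auto simp: Succ_def dest: Suc_lessI intro!: exI[of _ "Suc (e a)"])

lemma holds_Zero [simp]: "a \<noteq> 9 \<Longrightarrow> e a < P \<Longrightarrow> holds P w R (Zero a) e \<longleftrightarrow> e a = 0"
  by (auto simp: Zero_def)

lemma holds_NotLast [simp]: "a \<noteq> 9 \<Longrightarrow> holds P w R (NotLast a) e \<longleftrightarrow> Suc (e a) < P"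
  by (auto simp: NotLast_def intro!: exI[of _ "Suc (e a)"])

lemma bound_vars_derived [simp]:
  "bound_vars (Or \<phi> \<psi>) = bound_vars \<phi> \<union> bound_vars \<psi>" "bound_vars (Ex v \<phi>) = insert v (bound_vars \<phi>)"
  "bound_vars (Iff \<phi> \<psi>) = bound_vars \<phi> \<union> bound_vars \<psi>" "bound_vars (Eq a b) = {}"
  "bound_vars (Bool c) = {}" "bound_vars (Succ a b) = {9}" "bound_vars (Zero a) = {9}"
  "bound_vars (NotLast a) = {9}"
  by (auto simp: Or_def Ex_def Iff_def Eq_def Bool_def Succ_def Zero_def NotLast_def)

lemma fm_ok_derived [simp]:
  "fm_ok n (Or \<phi> \<psi>) \<longleftrightarrow> fm_ok n \<phi> \<and> fm_ok n \<psi>"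
  "fm_ok n (Ex v \<phi>) \<longleftrightarrow> v < n \<and> v \<notin> bound_vars \<phi> \<and> fm_ok n \<phi>"
  "fm_ok n (Iff \<phi> \<psi>) \<longleftrightarrow> fm_ok n \<phi> \<and> fm_ok n \<psi>" "fm_ok n (Eq a b) \<longleftrightarrow> a < n \<and> b < n"
  "0 < n \<Longrightarrow> fm_ok n (Bool c)" "fm_ok n (Succ a b) \<longleftrightarrow> a < n \<and> b < n \<and> 9 < n"
  "fm_ok n (Zero a) \<longleftrightarrow> a < n \<and> 9 < n" "fm_ok n (NotLast a) \<longleftrightarrow> a < n \<and> 9 < n"
  by (auto simp: Or_def Ex_def Iff_def Eq_def Bool_def Succ_def Zero_def NotLast_def)

definition gen_seq :: "gen list \<Rightarrow> gen" where "gen_seq gs = foldr GSeq gs (Emit [])"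

lemma gen_seq_simps [simp]:
  "out P w R (gen_seq gs) e = concat (map (\<lambda>g. out P w R g e) gs)"
  "gen_vars (gen_seq gs) = (\<Union>g\<in>set gs. gen_vars g)" "gen_ok n (gen_seq gs) \<longleftrightarrow> (\<forall>g\<in>set gs. gen_ok n g)"
  unfolding gen_seq_def by (induction gs) auto

section \<open>Stars\<close>

definition star_edges :: "nat \<Rightarrow> nat set set" where
  "star_edges N = {{0, v} | v. v \<in> {..<N} - {0}}"

lemma star_edges_iff: "{u, v} \<in> star_edges N \<longleftrightarrow> u \<noteq> v \<and> u < N \<and> v < N \<and> (u = 0 \<or> v = 0)"
  by (auto simp: star_edges_def doubleton_eq_iff)

lemma star_is_tree:
  assumes "is_star V E"
  shows "is_tree V E"
proof -
  obtain c where c: "finite V" "c \<in> V" "E = {{c, v} | v. v \<in> V - {c}}"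
    using assms by (auto simp: is_star_def)
  have E: "{u, v} \<in> E \<longleftrightarrow> u \<noteq> v \<and> u \<in> V \<and> v \<in> V \<and> (u = c \<or> v = c)" for u v
    using c by (auto simp: doubleton_eq_iff)
  have "\<exists>xs. path_between V E u v xs" if "u \<in> V" "v \<in> V" for u v
  proof -
    consider "u = v" | "u \<noteq> v" "u = c \<or> v = c" | "u \<noteq> v" "u \<noteq> c" "v \<noteq> c" by blast
    then show ?thesis
    proof cases
      case 1
      then show ?thesis using that by (intro exI[of _ "[u]"]) (simp add: path_between_def)
    next
      case 2
      then show ?thesis using that by (intro exI[of _ "[u, v]"]) (simp add: path_between_def E)
    next
      case 3
      then show ?thesis using that c(2) by (intro exI[of _ "[u, c, v]"]) (simp add: path_between_def E)
    qed
  qed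
  moreover have "\<not> is_cycle E xs" for xs
  proof
    assume cyc: "is_cycle E xs"
    then obtain x y z ys where xs: "xs = x # y # z # ys"
      by (auto simp: is_cycle_def numeral_3_eq_3 Suc_le_length_iff)
    \<comment> \<open>Two consecutive edges of a cycle meet in the centre, which the closing edge
      then misses.\<close>
    have "y = c" using cyc xs by (auto simp: is_cycle_def E)
    moreover have "last xs \<in> set (z # ys)" using xs by simp
    ultimately show False using cyc xs by (auto simp: is_cycle_def E)
  qed
  ultimately show ?thesis
    using c by (auto simp: is_tree_def fin_graph_def connected_graph_def)
qed

lemma star_instance:
  assumes N: "0 < N" and \<Delta>: "3 \<le> \<Delta>" and A': "\<forall>u v. A u v \<longrightarrow> u \<noteq> 0 \<and> v \<noteq> 0"
    and I: "I = \<lparr>vertex_count = N, edges = star_edges N,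
      bound = (\<lambda>u v. if A u v then enat \<Delta> else \<infinity>), period = \<Delta>\<rparr>"
  shows "I \<in> period_instances \<Delta> \<inter> star_instances" "valid_instance I"
    "realizable I \<longleftrightarrow> (\<exists>\<chi>. (\<forall>v<N. \<chi> v < \<Delta>) \<and> (\<forall>u<N. \<forall>v<N. u \<noteq> v \<longrightarrow> A u v \<longrightarrow> \<chi> u \<noteq> \<chi> v))"
proof -
  note A = A'[rule_format]
  have star: "is_star {..<N} (star_edges N)"
    using N by (auto simp: is_star_def star_edges_def intro!: bexI[of _ 0])
  then show "I \<in> period_instances \<Delta> \<inter> star_instances"
    by (simp add: I period_instances_def star_instances_def)
  have "static_dist {..<N} (star_edges N) u v \<le> enat \<Delta>"
    if "u < N" "v < N" "u \<noteq> v" "A u v" for u v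
  proof -
    have "path_between {..<N} (star_edges N) u v [u, 0, v]"
      using that A[of u v] N by (simp add: path_between_def star_edges_iff)
    then have "static_dist {..<N} (star_edges N) u v \<le> enat (length [u, 0, v] - 1)"
      unfolding static_dist_def by (intro INF_lower) simp
    also have "\<dots> \<le> enat \<Delta>" using \<Delta> by simp
    finally show ?thesis .
  qed
  then show "valid_instance I"
    using star_is_tree[OF star] \<Delta> by (auto simp: valid_instance_def I zero_enat_def)
  show "realizable I \<longleftrightarrow> (\<exists>\<chi>. (\<forall>v<N. \<chi> v < \<Delta>) \<and> (\<forall>u<N. \<forall>v<N. u \<noteq> v \<longrightarrow> A u v \<longrightarrow> \<chi> u \<noteq> \<chi> v))"
  proof
    assume "realizable I"
    then obtain lam where lam: "periodic_labeling (star_edges N) \<Delta> lam"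
      "\<And>u v. u < N \<Longrightarrow> v < N \<Longrightarrow> u \<noteq> v \<Longrightarrow> A u v \<Longrightarrow>
        fastest_duration (star_edges N) \<Delta> lam u v \<le> enat \<Delta>"
      by (fastforce simp: realizable_def I)
    define \<chi> where "\<chi> v = (if v = 0 then 0 else lam {0, v})" for v
    have "\<chi> u \<noteq> \<chi> v" if uv: "u < N" "v < N" "u \<noteq> v" "A u v" for u v
    proof
      assume eq: "\<chi> u = \<chi> v"
      have nz: "u \<noteq> 0" "v \<noteq> 0" using A uv by auto
      have "\<exists>p. temporal_path (star_edges N) \<Delta> lam u v p \<and> duration p \<le> \<Delta>"
      proof (rule ccontr)
        assume "\<not> ?thesis"
        then have "enat (Suc \<Delta>) \<le> fastest_duration (star_edges N) \<Delta> lam u v"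
          unfolding fastest_duration_def by (intro INF_greatest) (auto simp: not_le Suc_le_eq)
        then have "enat (Suc \<Delta>) \<le> enat \<Delta>" using lam(2)[OF uv] by (rule order_trans)
        then show False by simp
      qed
      then obtain p where p: "temporal_path (star_edges N) \<Delta> lam u v p" "duration p \<le> \<Delta>" by blast
      then have "p \<noteq> []" by (simp add: temporal_path_def)
      obtain x1 y1 t1 where first: "hd p = (x1, y1, t1)" by (cases "hd p")
      obtain x2 y2 t2 where last: "last p = (x2, y2, t2)" by (cases "last p")
      have "x1 = u"
        using p(1) first \<open>p \<noteq> []\<close> by (auto simp: temporal_path_def Let_def hd_conv_nth dest: spec[of _ 0])
      have "y2 = v"
        using p(1) last \<open>p \<noteq> []\<close> by (simp add: temporal_path_def Let_def last_map)
      have e1: "{x1, y1} \<in> star_edges N" "active_at \<Delta> lam {x1, y1} t1"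
        using p(1) first \<open>p \<noteq> []\<close> hd_in_set[of p] by (auto simp: temporal_path_def)
      have e2: "{x2, y2} \<in> star_edges N" "active_at \<Delta> lam {x2, y2} t2"
        using p(1) last \<open>p \<noteq> []\<close> last_in_set[of p] by (auto simp: temporal_path_def)
      have "y1 = 0" "x2 = 0" using e1 e2 nz \<open>x1 = u\<close> \<open>y2 = v\<close> by (auto simp: star_edges_iff)
      obtain k where k: "t1 = \<chi> u + k * \<Delta>"
        using e1 \<open>x1 = u\<close> \<open>y1 = 0\<close> nz by (auto simp: active_at_def \<chi>_def insert_commute)
      obtain l where l: "t2 = \<chi> v + l * \<Delta>"
        using e2 \<open>y2 = v\<close> \<open>x2 = 0\<close> nz by (auto simp: active_at_def \<chi>_def)
      have "t1 < t2"
      proof -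
        obtain a p' where p': "p = a # p'" using \<open>p \<noteq> []\<close> by (cases p) auto
        have "p' \<noteq> []" using p' first last \<open>x1 = u\<close> \<open>x2 = 0\<close> nz by auto
        then have "last p \<in> set p'" using p' by simp
        moreover have "\<forall>q\<in>set p'. snd (snd a) < snd (snd q)"
          using p(1) p' by (auto simp: temporal_path_def)
        ultimately show ?thesis using p' first last by fastforce
      qed
      \<comment> \<open>With equal labels the two times are congruent modulo
        \<open>\<Delta>\<close>; being distinct, they are at least \<open>\<Delta>\<close> apart,
        and the duration exceeds \<open>\<Delta>\<close> by at least one.\<close>
      then have "k < l" using k l eq by simp
      then have "(k + 1) * \<Delta> \<le> l * \<Delta>" by (intro mult_le_mono1) simp
      then have "t1 + \<Delta> \<le> t2" using k l eq by simp
      then show False using p(2) first last by (simp add: duration_def)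
    qed
    moreover have "\<forall>v<N. \<chi> v < \<Delta>"
      using lam(1) \<Delta> by (auto simp: periodic_labeling_def \<chi>_def star_edges_iff)
    ultimately show "\<exists>\<chi>. (\<forall>v<N. \<chi> v < \<Delta>) \<and> (\<forall>u<N. \<forall>v<N. u \<noteq> v \<longrightarrow> A u v \<longrightarrow> \<chi> u \<noteq> \<chi> v)" by blast
  next
    assume "\<exists>\<chi>. (\<forall>v<N. \<chi> v < \<Delta>) \<and> (\<forall>u<N. \<forall>v<N. u \<noteq> v \<longrightarrow> A u v \<longrightarrow> \<chi> u \<noteq> \<chi> v)"
    then obtain \<chi> where \<chi>: "\<And>v. v < N \<Longrightarrow> \<chi> v < \<Delta>"
      "\<And>u v. u < N \<Longrightarrow> v < N \<Longrightarrow> u \<noteq> v \<Longrightarrow> A u v \<Longrightarrow> \<chi> u \<noteq> \<chi> v" by blast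
    \<comment> \<open>The centre is vertex 0, so the maximum of an edge is its leaf.\<close>
    define lam where "lam e = \<chi> (Max e)" for e
    have lam: "lam {0, v} = \<chi> v" "lam {v, 0} = \<chi> v" for v by (simp_all add: lam_def)
    have "periodic_labeling (star_edges N) \<Delta> lam"
      using \<chi>(1) by (auto simp: periodic_labeling_def star_edges_def lam)
    moreover have "fastest_duration (star_edges N) \<Delta> lam u v \<le> bound I u v"
      if uv: "u < N" "v < N" "u \<noteq> v" for u v
    proof (cases "A u v")
      case True
      \<comment> \<open>The first activity of the second edge after \<open>\<chi> u\<close>; since
        the colours differ, the wait is shorter than a full period.\<close>
      define t2 where "t2 = (if \<chi> u < \<chi> v then \<chi> v else \<chi> v + \<Delta>)"
      have less: "\<chi> u < t2" "t2 < \<chi> u + \<Delta>"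
        using \<chi>(1)[OF uv(1)] \<chi>(1)[OF uv(2)] \<chi>(2)[OF uv True] by (auto simp: t2_def)
      have "active_at \<Delta> lam {0, v} t2"
        unfolding active_at_def lam t2_def by (intro exI[of _ "if \<chi> u < \<chi> v then 0 else 1"]) simp
      moreover have "active_at \<Delta> lam {u, 0} (\<chi> u)"
        unfolding active_at_def lam by (intro exI[of _ 0]) simp
      ultimately have "temporal_path (star_edges N) \<Delta> lam u v [(u, 0, \<chi> u), (0, v, t2)]"
        using uv A[OF True] less by (auto simp: temporal_path_def star_edges_iff less_Suc_eq)
      then have "fastest_duration (star_edges N) \<Delta> lam u v \<le> enat (duration [(u, 0, \<chi> u), (0, v, t2)])"
        unfolding fastest_duration_def by (intro INF_lower) simp
      also have "\<dots> \<le> enat \<Delta>" using less by (simp add: duration_def)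
      finally show ?thesis using True by (simp add: I)
    qed (simp add: I)
    moreover have "vertex_count I = N" "edges I = star_edges N" "period I = \<Delta>"
      by (simp_all add: I)
    ultimately show "realizable I" unfolding realizable_def by metis
  qed
qed

section \<open>Uniform clause systems and colourings\<close>

text \<open>A literal \<open>(a, s, dt, di)\<close> of a clause schema instantiated at \<open>(t, i)\<close> states that the variable of
  kind \<open>a\<close> at \<open>(t + dt, i + di)\<close> has the value \<open>s\<close>. A schema is instantiated at those \<open>(t, i)\<close> whose
  letters in the word \<open>W\<close> belong to the two given sets.\<close>

type_synonym 'a lit = "'a \<times> bool \<times> bool \<times> bool"
type_synonym 'a schema = "(nat set \<times> nat set) \<times> 'a lit list"

definition lit_true :: "('a \<Rightarrow> nat \<Rightarrow> nat \<Rightarrow> bool) \<Rightarrow> nat \<Rightarrow> nat \<Rightarrow> 'a lit \<Rightarrow> bool" where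
  "lit_true \<alpha> t i l = (case l of (a, s, dt, di) \<Rightarrow> \<alpha> a (t + of_bool dt) (i + of_bool di) = s)"

definition guard :: "nat list \<Rightarrow> nat set \<times> nat set \<Rightarrow> nat \<Rightarrow> nat \<Rightarrow> bool" where
  "guard W g t i \<longleftrightarrow> Suc t < length W \<and> Suc i < length W \<and> W ! t \<in> fst g \<and> W ! i \<in> snd g"

definition satisfies :: "nat list \<Rightarrow> 'a schema set \<Rightarrow> ('a \<Rightarrow> nat \<Rightarrow> nat \<Rightarrow> bool) \<Rightarrow> bool" where
  "satisfies W C \<alpha> \<longleftrightarrow> (\<forall>(g, ls)\<in>C. \<forall>t i. guard W g t i \<longrightarrow> (\<exists>l\<in>set ls. lit_true \<alpha> t i l))"

text \<open>Vertices come in blocks, one for each tag. All vertices with tag \<open>Pal c\<close> receive the same colour,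
  called \<open>c\<close> below. \<open>Var a\<close> takes colours 0 and 1. For a clause schema \<open>s\<close>, the vertices \<open>Gv s l\<close> form a
  path over the literals with colours in \<open>{0, 1, 2}\<close>, whose end conditions exclude the colouring that
  alternates between 0 and 1; \<open>Hv s l\<close> excludes colour 2 from \<open>Gv s l\<close> if literal \<open>l\<close> is false.\<close>

datatype 'a tag = Centre | Pal nat | Var 'a | Hv nat nat | Gv nat nat

definition shift_fm :: "bool \<Rightarrow> nat \<Rightarrow> nat \<Rightarrow> fm" where
  "shift_fm d a b = (if d then Succ a b else Eq a b)"

text \<open>The palette leaves to \<open>Hv s l\<close> only colour 2 and the colour that the
  variable has when the literal is false. The edge to the variable forbids the latter in that case,
  so 2 remains. The edge from \<open>Hv\<close> to \<open>Gv\<close> is present only where the guard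
  of the schema holds; elsewhere the path is always colourable.\<close>

fun arc_fm :: "'a schema list \<Rightarrow> 'a tag \<Rightarrow> 'a tag \<Rightarrow> nat \<Rightarrow> nat \<Rightarrow> nat \<Rightarrow> nat \<Rightarrow> fm" where
  "arc_fm cl (Pal c) (Pal c') t i t' i' = Bool (c \<noteq> c')"
| "arc_fm cl (Pal c) (Var x) t i t' i' = Bool (2 \<le> c)"
| "arc_fm cl (Pal c) (Hv s l) t i t' i' =
     Bool (3 \<le> c \<or> c = (if fst (snd (snd (cl ! s) ! l)) then 1 else 0))"
| "arc_fm cl (Pal c) (Gv s l) t i t' i' =
     Bool (3 \<le> c \<or> (l = 0 \<and> c = 1) \<or> (Suc l = length (snd (cl ! s)) \<and> c = l mod 2))"
| "arc_fm cl (Hv s l) (Var x) t i t' i' =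
     (case snd (cl ! s) ! l of (x', _, dt, di) \<Rightarrow>
        if x = x' then And (shift_fm dt t t') (shift_fm di i i') else Bool False)"
| "arc_fm cl (Hv s l) (Gv s' l') t i t' i' =
     (if s = s' \<and> l = l'
      then And (And (Eq t t') (Eq i i'))
        (And (And (NotLast t) (NotLast i))
          (And (Letter t (fst (fst (cl ! s)))) (Letter i (snd (fst (cl ! s))))))
      else Bool False)"
| "arc_fm cl (Gv s l) (Gv s' l') t i t' i' =
     (if s = s' \<and> l' = Suc l then And (Eq t t') (Eq i i') else Bool False)"
| "arc_fm cl _ _ t i t' i' = Bool False"

text \<open>\<open>Centre\<close> stands first so that vertex number 0 is
  \<open>(Centre, 0, 0)\<close>, the centre of the star. The other vertices with this tag are leaves
  without any finite bound.\<close>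

definition tags :: "nat \<Rightarrow> 'a list \<Rightarrow> 'a schema list \<Rightarrow> 'a tag list" where
  "tags \<Delta> ks cl = Centre # map Pal [0..<\<Delta>] @ map Var ks @
     concat (map (\<lambda>s. map (Hv s) [0..<length (snd (cl ! s))] @ map (Gv s) [0..<length (snd (cl ! s))])
       [0..<length cl])"

definition arc :: "nat list \<Rightarrow> 'a schema list \<Rightarrow> 'a tag \<times> nat \<times> nat \<Rightarrow> 'a tag \<times> nat \<times> nat \<Rightarrow> bool" where
  "arc W cl u v = (case (u, v) of ((\<tau>, t, i), (\<tau>', t', i')) \<Rightarrow>
     holds (length W) (\<lambda>i. W ! i) (\<lambda>_ _ _ _. False) (arc_fm cl \<tau> \<tau>' 0 1 2 3)
       ((\<lambda>_. 0)(0 := t, 1 := i, 2 := t', 3 := i')))"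

text \<open>A clause without true literal confines its path to two colours and thus forces exactly
  the alternation that the end conditions exclude. Conversely, one vertex of colour 2, at a true
  literal, lets the parity change in between.\<close>

lemma colourable_iff_satisfiable:
  fixes cl :: "'a schema list"
  assumes \<Delta>: "3 \<le> \<Delta>" and W: "W \<noteq> []"
    and cl: "\<And>g ls. (g, ls) \<in> set cl \<Longrightarrow> ls \<noteq> [] \<and> fst ` set ls \<subseteq> set ks"
  shows "(\<exists>\<chi>. (\<forall>\<tau>\<in>set (tags \<Delta> ks cl). \<forall>t<length W. \<forall>i<length W. \<chi> (\<tau>, t, i) < \<Delta>) \<and>
      (\<forall>\<tau>\<in>set (tags \<Delta> ks cl). \<forall>\<tau>'\<in>set (tags \<Delta> ks cl).
        \<forall>t<length W. \<forall>i<length W. \<forall>t'<length W. \<forall>i'<length W.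
          arc W cl (\<tau>, t, i) (\<tau>', t', i') \<longrightarrow> \<chi> (\<tau>, t, i) \<noteq> \<chi> (\<tau>', t', i')))
    \<longleftrightarrow> (\<exists>\<alpha>. satisfies W (set cl) \<alpha>)"
    (is "(\<exists>\<chi>. ?range \<chi> \<and> ?proper \<chi>) \<longleftrightarrow> _")
proof
  let ?P = "length W" and ?T = "set (tags \<Delta> ks cl)"
  have P0: "0 < ?P" using W by simp
  have T: "Pal c \<in> ?T \<longleftrightarrow> c < \<Delta>" "Var x \<in> ?T \<longleftrightarrow> x \<in> set ks"
    "Hv s l \<in> ?T \<longleftrightarrow> s < length cl \<and> l < length (snd (cl ! s))"
    "Gv s l \<in> ?T \<longleftrightarrow> s < length cl \<and> l < length (snd (cl ! s))" for c x s l
    by (auto simp: tags_def image_iff)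
  {
    assume "\<exists>\<chi>. ?range \<chi> \<and> ?proper \<chi>"
    then obtain \<chi> where \<chi>: "\<And>\<tau> t i. \<tau> \<in> ?T \<Longrightarrow> t < ?P \<Longrightarrow> i < ?P \<Longrightarrow> \<chi> (\<tau>, t, i) < \<Delta>"
      "\<And>\<tau> \<tau>' t i t' i'. \<tau> \<in> ?T \<Longrightarrow> \<tau>' \<in> ?T \<Longrightarrow> t < ?P \<Longrightarrow> i < ?P \<Longrightarrow> t' < ?P \<Longrightarrow> i' < ?P \<Longrightarrow>
        arc W cl (\<tau>, t, i) (\<tau>', t', i') \<Longrightarrow> \<chi> (\<tau>, t, i) \<noteq> \<chi> (\<tau>', t', i')" by metis
    \<comment> \<open>Colours are determined only up to a permutation, and the palette names them.
      Its \<open>\<Delta>\<close> classes are completely joined to each other, so \<open>f\<close>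
      is onto.\<close>
    define f where "f c = \<chi> (Pal c, 0, 0)" for c
    have "inj_on f {..<\<Delta>}"
    proof (rule inj_onI, rule ccontr)
      fix c d assume "c \<in> {..<\<Delta>}" "d \<in> {..<\<Delta>}" "f c = f d" "c \<noteq> d"
      then show False using \<chi>(2)[of "Pal c" "Pal d" 0 0 0 0] P0 by (simp add: T f_def arc_def)
    qed
    moreover have "f ` {..<\<Delta>} \<subseteq> {..<\<Delta>}" using \<chi>(1) P0 by (auto simp: f_def T)
    ultimately have surj: "f ` {..<\<Delta>} = {..<\<Delta>}" by (simp add: endo_inj_surj)
    have colour: "\<exists>c<\<Delta>. \<chi> (\<tau>, t, i) = f c" if "\<tau> \<in> ?T" "t < ?P" "i < ?P" for \<tau> t i
      using \<chi>(1)[OF that] surj by (metis imageE lessThan_iff)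
    have neq: "\<chi> (\<tau>, t, i) \<noteq> f c"
      if "\<tau> \<in> ?T" "t < ?P" "i < ?P" "c < \<Delta>" "arc W cl (Pal c, 0, 0) (\<tau>, t, i)" for \<tau> t i c
      using \<chi>(2)[of "Pal c" \<tau> 0 0 t i] that P0 by (auto simp: T f_def)
    have three: "\<chi> (\<tau>, t, i) \<in> {f 0, f 1, f 2}"
      if th: "\<tau> \<in> ?T" "t < ?P" "i < ?P" "\<And>c. 3 \<le> c \<Longrightarrow> arc W cl (Pal c, 0, 0) (\<tau>, t, i)" for \<tau> t i
    proof -
      obtain c where c: "c < \<Delta>" "\<chi> (\<tau>, t, i) = f c" using colour[OF th(1-3)] by blast
      then have "\<not> 3 \<le> c" using neq[OF th(1-3) c(1)] th(4) by blast
      then have "c = 0 \<or> c = 1 \<or> c = 2" by auto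
      then show ?thesis using c by auto
    qed
    define \<alpha> where "\<alpha> a t i \<longleftrightarrow> \<chi> (Var a, t, i) = f 1" for a t i
    have "\<exists>l\<in>set ls. lit_true \<alpha> t i l" if s: "(g, ls) \<in> set cl" "guard W g t i" for g ls t i
    proof (rule ccontr)
      assume false: "\<not> (\<exists>l\<in>set ls. lit_true \<alpha> t i l)"
      obtain s where "s < length cl" "cl ! s = (g, ls)" using s by (metis in_set_conv_nth)
      note s' = this
      have ti: "Suc t < ?P" "Suc i < ?P" "W ! t \<in> fst g" "W ! i \<in> snd g"
        using s by (auto simp: guard_def)
      \<comment> \<open>Since the literal is false, \<open>Hv s l\<close> is pushed to colour 2,
        which \<open>Gv s l\<close> must then avoid.\<close>
      have G: "\<chi> (Gv s l, t, i) \<in> {f 0, f 1} \<and> \<chi> (Gv s l, t, i) \<noteq> f 2" if l: "l < length ls" for l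
      proof -
        obtain a sg dt di where lit: "ls ! l = (a, sg, dt, di)" by (cases "ls ! l") auto
        have a: "a \<in> set ks" using cl[OF s(1)] l lit by (metis fst_conv image_subset_iff nth_mem)
        let ?t = "t + of_bool dt" and ?i = "i + of_bool di"
        have ti': "?t < ?P" "?i < ?P" using ti by auto
        have V: "\<chi> (Var a, ?t, ?i) \<in> {f 0, f 1}"
          using three[of "Var a" ?t ?i] neq[of "Var a" ?t ?i 2] a ti' \<Delta> by (auto simp: T arc_def)
        have "\<not> lit_true \<alpha> t i (ls ! l)" using false l by auto
        then have V': "\<chi> (Var a, ?t, ?i) = f (if sg then 0 else 1)"
          using V by (auto simp: lit_true_def lit \<alpha>_def split: if_splits)
        have H: "\<chi> (Hv s l, t, i) \<in> {f 0, f 1, f 2}" "\<chi> (Hv s l, t, i) \<noteq> f (if sg then 1 else 0)"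
          using three[of "Hv s l" t i] neq[of "Hv s l" t i "if sg then 1 else 0"] ti s' l lit \<Delta>
          by (auto simp: T arc_def)
        have "arc W cl (Hv s l, t, i) (Var a, ?t, ?i)"
          using ti ti' s' lit by (auto simp: arc_def shift_fm_def)
        then have "\<chi> (Hv s l, t, i) \<noteq> \<chi> (Var a, ?t, ?i)"
          using \<chi>(2)[of "Hv s l" "Var a" t i ?t ?i] ti ti' s' l a by (simp add: T)
        then have H2: "\<chi> (Hv s l, t, i) = f 2" using H V' by (cases sg) auto
        have "arc W cl (Hv s l, t, i) (Gv s l, t, i)"
          using ti s' by (auto simp: arc_def)
        then have "\<chi> (Gv s l, t, i) \<noteq> f 2"
          using \<chi>(2)[of "Hv s l" "Gv s l" t i t i] ti s' l H2 by (simp add: T)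
        moreover have "\<chi> (Gv s l, t, i) \<in> {f 0, f 1, f 2}"
          using three[of "Gv s l" t i] ti s' l by (auto simp: T arc_def)
        ultimately show ?thesis by auto
      qed
      have alt: "l < length ls \<Longrightarrow> \<chi> (Gv s l, t, i) = f (l mod 2)" for l
      proof (induction l)
        case 0
        then show ?case using G[of 0] neq[of "Gv s 0" t i 1] ti s' \<Delta> by (auto simp: T arc_def)
      next
        case (Suc l)
        have "arc W cl (Gv s l, t, i) (Gv s (Suc l), t, i)" using ti s' by (auto simp: arc_def)
        then have "\<chi> (Gv s l, t, i) \<noteq> \<chi> (Gv s (Suc l), t, i)"
          using \<chi>(2)[of "Gv s l" "Gv s (Suc l)" t i t i] ti s' Suc.prems by (simp add: T)
        moreover have "l mod 2 = 0 \<and> Suc l mod 2 = 1 \<or> l mod 2 = 1 \<and> Suc l mod 2 = 0" by presburger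
        ultimately show ?case using Suc G[of "Suc l"] by auto
      qed
      define l where "l = length ls - 1"
      have l: "l < length ls" "Suc l = length ls" using cl[OF s(1)] by (auto simp: l_def)
      then have "\<chi> (Gv s l, t, i) \<noteq> f (l mod 2)"
        using neq[of "Gv s l" t i "l mod 2"] ti s' \<Delta> by (auto simp: T arc_def)
      then show False using alt l by simp
    qed
    then show "\<exists>\<alpha>. satisfies W (set cl) \<alpha>" unfolding satisfies_def by blast
  }
  assume "\<exists>\<alpha>. satisfies W (set cl) \<alpha>"
  then obtain \<alpha> where \<alpha>: "satisfies W (set cl) \<alpha>" by blast
  define ls where "ls s = snd (cl ! s)" for s
  define gd where "gd s t i \<longleftrightarrow> guard W (fst (cl ! s)) t i" for s t i
  define k where "k s t i = (if gd s t i then SOME l. l < length (ls s) \<and> lit_true \<alpha> t i (ls s ! l) else 0)"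
    for s t i
  have k: "k s t i < length (ls s)" "gd s t i \<Longrightarrow> lit_true \<alpha> t i (ls s ! k s t i)"
    if "s < length cl" for s t i
  proof -
    have mem: "(fst (cl ! s), ls s) \<in> set cl" using that by (simp add: ls_def)
    have "\<exists>l. l < length (ls s) \<and> lit_true \<alpha> t i (ls s ! l)" if "gd s t i"
      using \<alpha> mem that unfolding satisfies_def gd_def by (fastforce simp: in_set_conv_nth)
    then have *: "k s t i < length (ls s) \<and> lit_true \<alpha> t i (ls s ! k s t i)" if "gd s t i"
      using that someI_ex[of "\<lambda>l. l < length (ls s) \<and> lit_true \<alpha> t i (ls s ! l)"] by (simp add: k_def)
    have "k s t i = 0" if "\<not> gd s t i" using that by (simp add: k_def)
    then show "k s t i < length (ls s)" using * cl[OF mem] by (cases "gd s t i") auto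
    show "gd s t i \<Longrightarrow> lit_true \<alpha> t i (ls s ! k s t i)" using * by blast
  qed
  \<comment> \<open>On the path of a clause, colour 2 sits at the index \<open>k\<close> of a true
    literal. Before it the colours alternate with the parity that suits the first vertex, behind it
    with the opposite one, which suits the last.\<close>
  define \<chi> where "\<chi> u = (case u of
      (Pal c, t, i) \<Rightarrow> c
    | (Var a, t, i) \<Rightarrow> if \<alpha> a t i then 1 else 0
    | (Hv s l, t, i) \<Rightarrow> if gd s t i \<and> l = k s t i then (if fst (snd (ls s ! l)) then 0 else 1) else 2
    | (Gv s l, t, i) \<Rightarrow> if l = k s t i then 2 else if l < k s t i then l mod 2 else Suc l mod 2
    | _ \<Rightarrow> (0::nat))" for u
  have "\<chi> (\<tau>, t, i) < \<Delta>" if "\<tau> \<in> ?T" for \<tau> t i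
  proof -
    have "l mod 2 < \<Delta>" for l :: nat using \<Delta> mod_less_divisor[of 2 l] by linarith
    then show ?thesis using that \<Delta> by (cases \<tau> rule: tag.exhaust) (auto simp: \<chi>_def T)
  qed
  moreover have "\<chi> (\<tau>, t, i) \<noteq> \<chi> (\<tau>', t', i')"
    if a: "arc W cl (\<tau>, t, i) (\<tau>', t', i')" and \<tau>: "\<tau> \<in> ?T" "\<tau>' \<in> ?T"
      and ti: "t < ?P" "i < ?P" "t' < ?P" "i' < ?P" for \<tau> t i \<tau>' t' i'
  proof -
    have m2: "l mod 2 < 3" "l mod 2 \<noteq> Suc l mod 2" for l :: nat by presburger+
    consider c c' where "\<tau> = Pal c" "\<tau>' = Pal c'" | c x where "\<tau> = Pal c" "\<tau>' = Var x"
      | c s l where "\<tau> = Pal c" "\<tau>' = Hv s l" | c s l where "\<tau> = Pal c" "\<tau>' = Gv s l"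
      | s l x where "\<tau> = Hv s l" "\<tau>' = Var x" | s l s' l' where "\<tau> = Hv s l" "\<tau>' = Gv s' l'"
      | s l s' l' where "\<tau> = Gv s l" "\<tau>' = Gv s' l'"
      using a by (cases \<tau>; cases \<tau>') (auto simp: arc_def)
    then show ?thesis
    proof cases
      case 1
      then show ?thesis using a by (simp add: arc_def \<chi>_def)
    next
      case 2
      then show ?thesis using a by (simp add: arc_def \<chi>_def)
    next
      case 3
      then show ?thesis using a by (auto simp: arc_def \<chi>_def ls_def split: if_splits)
    next
      case 4
      then have "s < length cl" "l < length (ls s)" using \<tau> by (auto simp: T ls_def)
      note k[OF this(1), of t' i'] this
      then show ?thesis using a 4 m2(1)[of l] m2(1)[of "Suc l"] m2(2)[of l]
        by (auto simp: arc_def \<chi>_def ls_def[symmetric] split: if_splits)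
    next
      case 5
      then have s: "s < length cl" using \<tau> by (auto simp: T)
      obtain sg dt di where l: "ls s ! l = (x, sg, dt, di)" "t' = t + of_bool dt" "i' = i + of_bool di"
        using a 5 ti by (cases "ls s ! l") (auto simp: arc_def ls_def shift_fm_def split: if_splits)
      then show ?thesis using k(2)[OF s, of t i] 5
        by (auto simp: \<chi>_def lit_true_def)
    next
      case 6
      then have "s < length cl" using \<tau> by (auto simp: T)
      then show ?thesis using a 6 ti
        by (auto simp: arc_def \<chi>_def gd_def guard_def split: if_splits)
    next
      case 7
      then show ?thesis using a ti m2 m2(2)[symmetric]
        by (auto simp: arc_def \<chi>_def split: if_splits)
    qed
  qed
  ultimately show "\<exists>\<chi>. ?range \<chi> \<and> ?proper \<chi>" by blast
qed

section \<open>Enumeration of the vertices by nested loops\<close>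

lemma concat_map_upt_mult:
  "concat (map F [0..<a * b]) = concat (map (\<lambda>i. concat (map (\<lambda>j. F (i * b + j)) [0..<b])) [0..<a])"
proof (induction a)
  case (Suc a)
  have "[0..<Suc a * b] = [0..<a * b] @ map (\<lambda>j. a * b + j) [0..<b]"
    using upt_add_eq_append[of 0 "a * b" b] by (simp add: add.commute map_add_upt)
  then show ?case using Suc by (simp add: comp_def)
qed simp

lemma concat_concat: "concat (concat xss) = concat (map concat xss)"
  by (induction xss) auto

text \<open>A vertex number is a numeral in base \<open>P\<close> whose leading part is the index of
  the tag. Looping over tags, then \<open>t\<close>, then \<open>i\<close> hence visits the vertices
  in increasing order, as the row by row encoding requires.\<close>

definition decode_vertex :: "nat \<Rightarrow> 'a tag list \<Rightarrow> nat \<Rightarrow> 'a tag \<times> nat \<times> nat" where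
  "decode_vertex P ts u = (ts ! (u div (P * P)), u div P mod P, u mod P)"

definition vertex_gen :: "'a tag list \<Rightarrow> nat \<Rightarrow> nat \<Rightarrow> ('a tag \<Rightarrow> gen) \<Rightarrow> gen" where
  "vertex_gen ts a b f = gen_seq (map (\<lambda>\<tau>. GFor a (GFor b (f \<tau>))) ts)"

lemma decode_vertex_eq:
  assumes "t < P" "i < P"
  shows "decode_vertex P ts ((k * P + t) * P + i) = (ts ! k, t, i)"
proof -
  have 1: "((k * P + t) * P + i) div P = k * P + t" using assms by simp
  have "((k * P + t) * P + i) div (P * P) = (k * P + t) div P"
    using 1 by (simp add: div_mult2_eq)
  then show ?thesis using assms 1 by (simp add: decode_vertex_def)
qed

lemma out_vertex_gen:
  assumes "a \<noteq> b"
  shows "out P w R (vertex_gen ts a b f) e = concat (map (\<lambda>u. case decode_vertex P ts u of (\<tau>, t, i) \<Rightarrow>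
    out P w R (f \<tau>) (e(a := t, b := i))) [0..<length ts * P * P])"
proof -
  have "map (\<lambda>\<tau>. out P w R (GFor a (GFor b (f \<tau>))) e) ts =
      map (\<lambda>k. out P w R (GFor a (GFor b (f (ts ! k)))) e) [0..<length ts]"
    by (rule nth_equalityI) simp_all
  moreover have 1: "map (\<lambda>i. case decode_vertex P ts ((k * P + t) * P + i) of (\<tau>, t, i) \<Rightarrow>
        out P w R (f \<tau>) (e(a := t, b := i))) [0..<P] =
      map (\<lambda>i. out P w R (f (ts ! k)) (e(a := t, b := i))) [0..<P]" if "t < P" for k t
    by (rule map_cong) (use that in \<open>auto simp: decode_vertex_eq\<close>)
  have "map (\<lambda>t. concat (map (\<lambda>i. case decode_vertex P ts ((k * P + t) * P + i) of (\<tau>, t, i) \<Rightarrow>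
        out P w R (f \<tau>) (e(a := t, b := i))) [0..<P])) [0..<P] =
      map (\<lambda>t. concat (map (\<lambda>i. out P w R (f (ts ! k)) (e(a := t, b := i))) [0..<P])) [0..<P]" for k
    by (rule map_cong[OF refl]) (simp only: 1 set_upt atLeastLessThan_iff)
  ultimately show ?thesis
    by (simp only: vertex_gen_def concat_map_upt_mult gen_seq_simps map_map comp_def out.simps)
qed

lemma holds_arc_fm:
  assumes "a \<noteq> 9" "b \<noteq> 9" "c \<noteq> 9" "d \<noteq> 9" "e a < length W" "e b < length W" "e c < length W" "e d < length W"
  shows "holds (length W) (\<lambda>i. W ! i) R (arc_fm cl \<tau> \<tau>' a b c d) e \<longleftrightarrow>
    arc W cl (\<tau>, e a, e b) (\<tau>', e c, e d)"
  using assms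
  by (cases "(cl, \<tau>, \<tau>', a, b, c, d)" rule: arc_fm.cases)
    (auto simp: arc_def shift_fm_def split: prod.splits)

lemma arc_fm_ok: "a < 9 \<Longrightarrow> b < 9 \<Longrightarrow> c < 9 \<Longrightarrow> d < 9 \<Longrightarrow>
    fm_ok 10 (arc_fm cl \<tau> \<tau>' a b c d) \<and> bound_vars (arc_fm cl \<tau> \<tau>' a b c d) \<subseteq> {9}"
  by (cases "(cl, \<tau>, \<tau>', a, b, c, d)" rule: arc_fm.cases)
    (auto simp: shift_fm_def split: prod.splits)

definition centre_fm :: "'a tag \<Rightarrow> nat \<Rightarrow> nat \<Rightarrow> fm" where
  "centre_fm \<tau> a b = (case \<tau> of Centre \<Rightarrow> And (Zero a) (Zero b) | _ \<Rightarrow> Bool False)"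

definition count_gen :: "'a tag list \<Rightarrow> gen" where
  "count_gen ts = vertex_gen ts 0 1 (\<lambda>_. Emit [True])"

definition matrix_gen :: "'a tag list \<Rightarrow> ('a tag \<Rightarrow> 'a tag \<Rightarrow> fm) \<Rightarrow> bool list \<Rightarrow> bool list \<Rightarrow> gen" where
  "matrix_gen ts \<phi> x y =
     vertex_gen ts 0 1 (\<lambda>\<tau>. vertex_gen ts 2 3 (\<lambda>\<tau>'. GIf (\<phi> \<tau> \<tau>') (Emit x) (Emit y)))"

text \<open>Two vertices of a star are adjacent iff exactly one of them is the centre, hence the
  negated equivalence. Arcs are oriented, so the bound matrix tests both directions.\<close>

definition colour_gen :: "nat \<Rightarrow> 'a tag list \<Rightarrow> 'a schema list \<Rightarrow> gen" where
  "colour_gen \<Delta> ts cl = gen_seq [Emit (encode_enat (enat \<Delta>)),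
     matrix_gen ts (\<lambda>\<tau> \<tau>'. Neg (Iff (centre_fm \<tau> 0 1) (centre_fm \<tau>' 2 3))) [True] [False],
     matrix_gen ts (\<lambda>\<tau> \<tau>'. Or (arc_fm cl \<tau> \<tau>' 0 1 2 3) (arc_fm cl \<tau>' \<tau> 2 3 0 1))
       (encode_enat (enat \<Delta>)) (encode_enat \<infinity>)]"

lemma out_matrix_gen:
  assumes P: "P = length W" "0 < P"
    and \<phi>: "\<And>\<tau> \<tau>' t i t' i'. t < P \<Longrightarrow> i < P \<Longrightarrow> t' < P \<Longrightarrow> i' < P \<Longrightarrow>
      holds P w R (\<phi> \<tau> \<tau>') ((\<lambda>_. 0)(0 := t, 1 := i, 2 := t', 3 := i')) \<longleftrightarrow> Q (\<tau>, t, i) (\<tau>', t', i')"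
    and N: "N = length ts * P * P"
  shows "out P w R (matrix_gen ts \<phi> x y) (\<lambda>_. 0) =
    concat (map (\<lambda>u. concat (map (\<lambda>v.
      if Q (decode_vertex P ts u) (decode_vertex P ts v) then x else y) [0..<N])) [0..<N])"
proof -
  have "out P w R (vertex_gen ts 2 3 (\<lambda>\<tau>'. GIf (\<phi> \<tau> \<tau>') (Emit x) (Emit y))) ((\<lambda>_. 0)(0 := t, 1 := i)) =
      concat (map (\<lambda>v. if Q (\<tau>, t, i) (decode_vertex P ts v) then x else y) [0..<N])"
    if ti: "t < P" "i < P" for \<tau> t i
    using \<phi>[OF ti] P
    by (simp add: out_vertex_gen N decode_vertex_def del: fun_upd_apply cong: if_cong)
  then show ?thesis
    using P by (simp add: matrix_gen_def out_vertex_gen N decode_vertex_def del: fun_upd_apply)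
qed

theorem colouring_reduction:
  fixes cl :: "'a schema list"
  assumes \<Delta>: "3 \<le> \<Delta>" and cl: "\<And>g ls. (g, ls) \<in> set cl \<Longrightarrow> ls \<noteq> [] \<and> fst ` set ls \<subseteq> set ks"
    and size: "\<And>x. length (tags \<Delta> ks cl) * length (domain_word a b x) * length (domain_word a b x)
      \<le> 2 ^ (length (domain_word a b x) - 1)"
  shows "\<exists>f. poly_time_computable f \<and>
    (\<forall>x. \<exists>I \<in> period_instances \<Delta> \<inter> star_instances. f x = encode_instance I \<and> valid_instance I \<and>
       (realizable I \<longleftrightarrow> (\<exists>\<alpha>. satisfies (domain_word a b x) (set cl) \<alpha>)))"
proof -
  define ts where "ts = tags \<Delta> ks cl"
  have vg: "gen_vars (vertex_gen ts a b f) \<subseteq> {a, b} \<union> (\<Union>\<tau>. gen_vars (f \<tau>))"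
    "gen_ok n (vertex_gen ts a b f)"
    if "a < n" "b < n" "a \<noteq> b" "\<And>\<tau>. gen_ok n (f \<tau>)" "\<And>\<tau>. a \<notin> gen_vars (f \<tau>)" "\<And>\<tau>. b \<notin> gen_vars (f \<tau>)"
    for a b n and f :: "'a tag \<Rightarrow> gen"
    using that by (auto simp: vertex_gen_def)
  have mg: "gen_ok 10 (matrix_gen ts \<phi> x y)"
    if "\<And>\<tau> \<tau>'. fm_ok 10 (\<phi> \<tau> \<tau>')" "\<And>\<tau> \<tau>'. bound_vars (\<phi> \<tau> \<tau>') \<subseteq> {9}" for \<phi> x y
  proof -
    let ?f = "\<lambda>\<tau> \<tau>'. GIf (\<phi> \<tau> \<tau>') (Emit x) (Emit y)"
    have f: "gen_vars (?f \<tau> \<tau>') \<subseteq> {9}" "gen_ok 10 (?f \<tau> \<tau>')" for \<tau> \<tau>' using that by simp_all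
    have g: "gen_ok 10 (vertex_gen ts 2 3 (?f \<tau>))" for \<tau> by (rule vg(2)) (use f in force)+
    have "gen_vars (vertex_gen ts 2 3 (?f \<tau>)) \<subseteq> {2, 3} \<union> (\<Union>\<tau>'. gen_vars (?f \<tau> \<tau>'))" for \<tau>
      by (rule vg(1)[where n = 10]) (use f in force)+
    then have "gen_vars (vertex_gen ts 2 3 (?f \<tau>)) \<subseteq> {2, 3, 9}" for \<tau> using f(1) by blast
    then have "0 \<notin> gen_vars (vertex_gen ts 2 3 (?f \<tau>))" "1 \<notin> gen_vars (vertex_gen ts 2 3 (?f \<tau>))" for \<tau>
      by force+
    then show ?thesis unfolding matrix_gen_def by (rule_tac vg(2)) (use g in \<open>auto simp del: One_nat_def\<close>)
  qed
  have ok0: "gen_ok 10 (count_gen ts)" by (auto simp: count_gen_def intro!: vg(2))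
  have "fm_ok 10 (centre_fm \<tau> a b) \<and> bound_vars (centre_fm \<tau> a b) \<subseteq> {9}"
    if "a < 9" "b < 9" for a b and \<tau> :: "'a tag"
    using that by (cases \<tau>) (auto simp: centre_fm_def)
  note c = this[of 0 1] this[of 2 3] arc_fm_ok[of 0 1 2 3 cl] arc_fm_ok[of 2 3 0 1 cl]
  have "gen_ok 10 (matrix_gen ts (\<lambda>\<tau> \<tau>'. Neg (Iff (centre_fm \<tau> 0 1) (centre_fm \<tau>' 2 3))) x y)"
    "gen_ok 10 (matrix_gen ts (\<lambda>\<tau> \<tau>'. Or (arc_fm cl \<tau> \<tau>' 0 1 2 3) (arc_fm cl \<tau>' \<tau> 2 3 0 1)) x y)"
    for x y by (rule mg; use c in \<open>simp del: One_nat_def\<close>)+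
  then have ok1: "gen_ok 10 (colour_gen \<Delta> ts cl)" by (simp add: colour_gen_def del: One_nat_def)
  have ts: "ts \<noteq> []" "\<And>k. k < length ts \<Longrightarrow> ts ! k = Centre \<longleftrightarrow> k = 0"
  proof -
    have 1: "ts = Centre # tl ts" "Centre \<notin> set (tl ts)" by (auto simp: ts_def tags_def)
    then show "ts \<noteq> []" by auto
    show "ts ! k = Centre \<longleftrightarrow> k = 0" if "k < length ts" for k
      using 1 that by (cases k) (metis nth_Cons_0, metis Suc_less_eq length_Cons nth_Cons_Suc nth_mem nat.distinct(1))
  qed
  have count: "length (out P w R (count_gen ts) e) = length ts * P * P" for P w R e
    by (simp add: count_gen_def out_vertex_gen length_concat comp_def case_prod_beta sum_list_triv)
  have comp: "poly_time_computable (\<lambda>x. gen_string a b (count_gen ts) (colour_gen \<Delta> ts cl) x [])"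
    by (rule gen_string_computable(1)[OF ok0 ok1]) (unfold count, unfold ts_def, rule size)
  have "\<exists>I \<in> period_instances \<Delta> \<inter> star_instances.
      gen_string a b (count_gen ts) (colour_gen \<Delta> ts cl) x [] = encode_instance I \<and> valid_instance I \<and>
       (realizable I \<longleftrightarrow> (\<exists>\<alpha>. satisfies (domain_word a b x) (set cl) \<alpha>))" for x
  proof -
    define W where "W = domain_word a b x"
    define P where "P = length W"
    define N where "N = length ts * P * P"
    let ?d = "decode_vertex P ts"
    define A where "A u v \<longleftrightarrow> arc W cl (?d u) (?d v) \<or> arc W cl (?d v) (?d u)" for u v
    have P0: "0 < P" by (simp add: P_def W_def domain_word_def Let_def)
    have N0: "0 < N" using P0 ts by (simp add: N_def)
    have dec: "?d u = (Centre, 0, 0) \<longleftrightarrow> u = 0" if "u < N" for u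
    proof -
      have "u div (P * P) < length ts" using that by (simp add: N_def mult.assoc less_mult_imp_div_less)
      then have "?d u = (Centre, 0, 0) \<longleftrightarrow> u div (P * P) = 0 \<and> u div P mod P = 0 \<and> u mod P = 0"
        by (simp add: decode_vertex_def ts)
      also have "\<dots> \<longleftrightarrow> u = 0"
        by (metis (no_types) add.right_neutral div_0 div_mult2_eq div_mult_mod_eq mod_0 mult_zero_left)
      finally show ?thesis .
    qed
    have arc_centre: "\<not> arc W cl (Centre, t, i) v" "\<not> arc W cl v (Centre, t, i)" for t i v
    proof -
      obtain \<tau> t' i' where "v = (\<tau>, t', i')" by (cases v) auto
      then show "\<not> arc W cl (Centre, t, i) v" "\<not> arc W cl v (Centre, t, i)"
        by (cases \<tau>; simp add: arc_def)+
    qed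
    have "?d 0 = (Centre, 0, 0)" using dec[of 0] N0 by simp
    then have A0: "\<forall>u v. A u v \<longrightarrow> u \<noteq> 0 \<and> v \<noteq> 0"
      unfolding A_def using arc_centre by metis
    define I where "I = \<lparr>vertex_count = N, edges = star_edges N,
      bound = (\<lambda>u v. if A u v then enat \<Delta> else \<infinity>), period = \<Delta>\<rparr>"
    note star = star_instance[where A = A, OF N0 \<Delta> A0 I_def]
    have W0: "W \<noteq> []" using P0 by (simp add: P_def)
    let ?T = "set ts"
    have "realizable I \<longleftrightarrow> (\<exists>\<chi>. (\<forall>\<tau>\<in>?T. \<forall>t<P. \<forall>i<P. \<chi> (\<tau>, t, i) < \<Delta>) \<and>
      (\<forall>\<tau>\<in>?T. \<forall>\<tau>'\<in>?T. \<forall>t<P. \<forall>i<P. \<forall>t'<P. \<forall>i'<P.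
          arc W cl (\<tau>, t, i) (\<tau>', t', i') \<longrightarrow> \<chi> (\<tau>, t, i) \<noteq> \<chi> (\<tau>', t', i')))"
      unfolding star(3)
    proof (rule iffI)
      assume "\<exists>\<chi>. (\<forall>v<N. \<chi> v < \<Delta>) \<and> (\<forall>u<N. \<forall>v<N. u \<noteq> v \<longrightarrow> A u v \<longrightarrow> \<chi> u \<noteq> \<chi> v)"
      then obtain \<chi> where \<chi>: "\<And>v. v < N \<Longrightarrow> \<chi> v < \<Delta>"
        "\<And>u v. u < N \<Longrightarrow> v < N \<Longrightarrow> u \<noteq> v \<Longrightarrow> A u v \<Longrightarrow> \<chi> u \<noteq> \<chi> v" by metis
      define code where "code w = (SOME u. u < N \<and> ?d u = w)" for w
      have code: "code (\<tau>, t, i) < N \<and> ?d (code (\<tau>, t, i)) = (\<tau>, t, i)"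
        if ti: "\<tau> \<in> ?T" "t < P" "i < P" for \<tau> t i
      proof -
        obtain k where k: "k < length ts" "ts ! k = \<tau>" using ti by (auto simp: in_set_conv_nth)
        have "k * P + t < length ts * P"
          using k ti mult_le_mono1[of "Suc k" "length ts" P] by simp
        then have "(k * P + t) * P + i < N"
          using ti mult_le_mono1[of "Suc (k * P + t)" "length ts * P" P] by (simp add: N_def)
        then have "\<exists>u. u < N \<and> ?d u = (\<tau>, t, i)"
          using decode_vertex_eq[OF ti(2,3), of ts k] k by auto
        then show ?thesis unfolding code_def by (rule someI_ex)
      qed
      \<comment> \<open>\<open>star_instance\<close> constrains only distinct vertices, whereas the
        colouring condition speaks of all pairs; the two agree because no vertex has an arc to
        itself.\<close>
      have irrefl: "\<not> arc W cl v v" for v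
      proof -
        obtain \<tau> t' i' where "v = (\<tau>, t', i')" by (cases v) auto
        then show ?thesis by (cases \<tau>) (simp_all add: arc_def)
      qed
      have "\<chi> (code (\<tau>, t, i)) \<noteq> \<chi> (code (\<tau>', t', i'))"
        if "\<tau> \<in> ?T" "\<tau>' \<in> ?T" "t < P" "i < P" "t' < P" "i' < P" "arc W cl (\<tau>, t, i) (\<tau>', t', i')"
        for \<tau> \<tau>' t i t' i'
        using \<chi>(2)[of "code (\<tau>, t, i)" "code (\<tau>', t', i')"] code[of \<tau> t i] code[of \<tau>' t' i']
          that irrefl[of "(\<tau>, t, i)"] by (metis A_def)
      moreover have "\<chi> (code (\<tau>, t, i)) < \<Delta>" if "\<tau> \<in> ?T" "t < P" "i < P" for \<tau> t i
        using \<chi>(1) code that by blast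
      ultimately show "\<exists>\<chi>. (\<forall>\<tau>\<in>?T. \<forall>t<P. \<forall>i<P. \<chi> (\<tau>, t, i) < \<Delta>) \<and>
        (\<forall>\<tau>\<in>?T. \<forall>\<tau>'\<in>?T. \<forall>t<P. \<forall>i<P. \<forall>t'<P. \<forall>i'<P.
          arc W cl (\<tau>, t, i) (\<tau>', t', i') \<longrightarrow> \<chi> (\<tau>, t, i) \<noteq> \<chi> (\<tau>', t', i'))"
        by (intro exI[of _ "\<lambda>w. \<chi> (code w)"]) blast
    next
      assume "\<exists>\<chi>. (\<forall>\<tau>\<in>?T. \<forall>t<P. \<forall>i<P. \<chi> (\<tau>, t, i) < \<Delta>) \<and>
        (\<forall>\<tau>\<in>?T. \<forall>\<tau>'\<in>?T. \<forall>t<P. \<forall>i<P. \<forall>t'<P. \<forall>i'<P.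
          arc W cl (\<tau>, t, i) (\<tau>', t', i') \<longrightarrow> \<chi> (\<tau>, t, i) \<noteq> \<chi> (\<tau>', t', i'))"
      then obtain \<chi> where \<chi>: "\<And>\<tau> t i. \<tau> \<in> ?T \<Longrightarrow> t < P \<Longrightarrow> i < P \<Longrightarrow> \<chi> (\<tau>, t, i) < \<Delta>"
        "\<And>\<tau> \<tau>' t i t' i'. \<tau> \<in> ?T \<Longrightarrow> \<tau>' \<in> ?T \<Longrightarrow> t < P \<Longrightarrow> i < P \<Longrightarrow> t' < P \<Longrightarrow> i' < P \<Longrightarrow>
          arc W cl (\<tau>, t, i) (\<tau>', t', i') \<Longrightarrow> \<chi> (\<tau>, t, i) \<noteq> \<chi> (\<tau>', t', i')" by metis
      have d: "\<exists>\<tau> t i. ?d u = (\<tau>, t, i) \<and> \<tau> \<in> ?T \<and> t < P \<and> i < P" if "u < N" for u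
        using that P0 by (simp add: decode_vertex_def N_def mult.assoc less_mult_imp_div_less)
      have "\<chi> (?d u) < \<Delta>" if "u < N" for u using d[OF that] \<chi>(1) by metis
      moreover have "\<chi> (?d u) \<noteq> \<chi> (?d v)" if "u < N" "v < N" "A u v" for u v
        using d[OF that(1)] d[OF that(2)] that(3) \<chi>(2) unfolding A_def by metis
      ultimately show "\<exists>\<chi>. (\<forall>v<N. \<chi> v < \<Delta>) \<and> (\<forall>u<N. \<forall>v<N. u \<noteq> v \<longrightarrow> A u v \<longrightarrow> \<chi> u \<noteq> \<chi> v)"
        by (intro exI[of _ "\<lambda>u. \<chi> (?d u)"]) blast
    qed
    then have real: "realizable I \<longleftrightarrow> (\<exists>\<alpha>. satisfies W (set cl) \<alpha>)"
      using colourable_iff_satisfiable[OF \<Delta> W0 cl] unfolding P_def ts_def by simp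
    let ?out = "\<lambda>g. out P (\<lambda>i. W ! i) (relation_of P []) g (\<lambda>_. 0)"
    have m1: "?out (matrix_gen ts (\<lambda>\<tau> \<tau>'. Neg (Iff (centre_fm \<tau> 0 1) (centre_fm \<tau>' 2 3))) [True] [False]) =
      concat (map (\<lambda>u. concat (map (\<lambda>v. if ((?d u = (Centre, 0, 0)) \<noteq> (?d v = (Centre, 0, 0)))
        then [True] else [False]) [0..<N])) [0..<N])"
    proof (rule out_matrix_gen[where Q = "\<lambda>w w'. (w = (Centre, 0, 0)) \<noteq> (w' = (Centre, 0, 0))",
          OF P_def P0 _ N_def])
      fix \<tau> \<tau>' :: "'a tag" and t i t' i' assume "t < P" "i < P" "t' < P" "i' < P"
      then show "holds P (\<lambda>i. W ! i) (relation_of P []) (Neg (Iff (centre_fm \<tau> 0 1) (centre_fm \<tau>' 2 3)))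
        ((\<lambda>_. 0)(0 := t, 1 := i, 2 := t', 3 := i')) \<longleftrightarrow>
        ((\<tau>, t, i) = (Centre, 0, 0)) \<noteq> ((\<tau>', t', i') = (Centre, 0, 0))"
        by (cases \<tau>; cases \<tau>') (auto simp: centre_fm_def)
    qed
    have m2: "?out (matrix_gen ts (\<lambda>\<tau> \<tau>'. Or (arc_fm cl \<tau> \<tau>' 0 1 2 3) (arc_fm cl \<tau>' \<tau> 2 3 0 1)) y z) =
      concat (map (\<lambda>u. concat (map (\<lambda>v. if arc W cl (?d u) (?d v) \<or> arc W cl (?d v) (?d u)
        then y else z) [0..<N])) [0..<N])" for y z
      by (rule out_matrix_gen[where Q = "\<lambda>w w'. arc W cl w w' \<or> arc W cl w' w", OF P_def P0 _ N_def])
        (simp add: holds_arc_fm P_def)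
    have edge: "{u, v} \<in> star_edges N \<longleftrightarrow> ((?d u = (Centre, 0, 0)) \<noteq> (?d v = (Centre, 0, 0)))"
      if "u < N" "v < N" for u v using that dec by (auto simp: star_edges_iff)
    have singles: "concat (map (\<lambda>v. if b v then [True] else [False]) xs) = map b xs" for b and xs :: "nat list"
      by (induction xs) auto
    have edges: "map (\<lambda>v. {u, v} \<in> star_edges N) [0..<N] =
        concat (map (\<lambda>v. if ((?d u = (Centre, 0, 0)) \<noteq> (?d v = (Centre, 0, 0)))
          then [True] else [False]) [0..<N])" if "u < N" for u
      unfolding singles using edge[OF that] by (intro map_cong) simp_all
    have edges': "concat (map (\<lambda>u. map (\<lambda>v. {u, v} \<in> star_edges N) [0..<N]) [0..<N]) =
        concat (map (\<lambda>u. concat (map (\<lambda>v. if ((?d u = (Centre, 0, 0)) \<noteq> (?d v = (Centre, 0, 0)))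
          then [True] else [False]) [0..<N])) [0..<N])"
      by (intro arg_cong[of _ _ concat] map_cong refl edges) simp
    have bnd: "encode_enat (if b then x else y) = (if b then encode_enat x else encode_enat y)" for b x y
      by simp
    have "gen_string a b (count_gen ts) (colour_gen \<Delta> ts cl) x [] = encode_instance I"
      unfolding gen_string_def Let_def W_def[symmetric] P_def[symmetric] count encode_instance_def I_def
        colour_gen_def gen_seq_simps
      by (simp add: m1 m2 edges' bnd A_def N_def[symmetric] concat_concat comp_def
          del: One_nat_def)
    then show ?thesis using star(1,2) real by (intro bexI[of _ I]) (simp_all add: W_def)
  qed
  then show ?thesis using comp by blast
qed

section \<open>Computations as clause systems\<close>

text \<open>Propositional variables at time \<open>t\<close> and position \<open>i\<close>: \<open>St q\<close>, the state is \<open>q\<close>; \<open>Hd j\<close>, the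
  head of tape \<open>j\<close> is at \<open>i\<close>; \<open>Sy j s\<close>, cell \<open>i\<close> of tape \<open>j\<close> contains \<open>s\<close>; \<open>Rd j s\<close>, tape \<open>j\<close> reads
  \<open>s\<close>; \<open>Tr q ss\<close>, the transition from \<open>q\<close> and \<open>ss\<close> takes place; \<open>HL j\<close> and \<open>HR j\<close>, the head of tape
  \<open>j\<close> is to the left or to the right of \<open>i\<close>; \<open>Gd\<close>, cell \<open>i\<close> belongs to the certificate; \<open>Bt\<close>, the bit
  of the certificate. Apart from \<open>Gd\<close> and \<open>Bt\<close> and the acceptance condition, all clauses are definite
  Horn clauses. So every model contains the computation for the certificate it describes, and
  nothing needs to be said about uniqueness.\<close>

datatype kind = St nat | Hd nat | Sy nat nat | Rd nat nat | Tr nat "nat list" | HL nat | HR nat | Gd | Bt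

text \<open>Idling in the halting state is made an explicit transition, so the clauses treat all
  states alike.\<close>

definition delta :: "tm \<Rightarrow> nat \<Rightarrow> nat list \<Rightarrow> nat \<times> (nat \<times> move) list" where
  "delta M q ss = (if q = halt_state M then (q, map (\<lambda>s. (s, Stay)) ss) else transition M q ss)"

lemma tm_step_delta:
  "tm_step M c = (case delta M (fst c) (map read_tape (snd c)) of
     (q', acts) \<Rightarrow> (q', map2 act_tape acts (snd c)))"
proof -
  have "map2 act_tape (map (\<lambda>s. (s, Stay)) (map read_tape tps)) tps = tps" for tps
    by (induction tps) auto
  then show ?thesis by (cases c) (auto simp: tm_step_def delta_def comp_def split: prod.splits)
qed

text \<open>The letters preceding cell 0 of a tape in the word.\<close>

definition origin_letter :: "nat \<Rightarrow> nat" where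
  "origin_letter j = (if j = 1 then 5 else 4)"

definition words :: "tm \<Rightarrow> nat list set" where
  "words M = {ss. set ss \<subseteq> symbols M \<and> length ss = tape_count M}"

text \<open>Literals can only look forward in position. A move to the left is therefore stated at
  the target cell \<open>i\<close>, with the old head at \<open>i + 1\<close>; this is possible
  since \<open>Tr\<close> is derived at every position.\<close>

fun move_clause :: "kind \<Rightarrow> nat \<Rightarrow> move \<Rightarrow> kind lit list" where
  "move_clause T j Stay = [(T, False, False, False), (Hd j, False, False, False), (Hd j, True, True, False)]"
| "move_clause T j Move_Right = [(T, False, False, False), (Hd j, False, False, False), (Hd j, True, True, True)]"
| "move_clause T j Move_Left = [(T, False, False, False), (Hd j, False, False, True), (Hd j, True, True, False)]"

text \<open>A transition depends on several heads at different cells, while a clause sees only two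
  neighbouring positions. So the symbol read on each tape is spread over all positions; likewise
  \<open>HL\<close> and \<open>HR\<close> are spread from the head outwards, and they let all cells
  except the scanned one keep their content. The last family forbids every symbol but 2 in the first
  output cell once the machine has halted.\<close>

definition clauses :: "tm \<Rightarrow> kind schema set" where
  "clauses M = (let k = tape_count M; \<Sigma> = symbols M; any = (UNIV, UNIV) in
     {(({7}, UNIV), [(St (start_state M), True, False, False)])} \<union>
     (\<lambda>j. (({7}, {origin_letter j}), [(Hd j, True, False, True)])) ` {..<k} \<union>
     {(({7}, {1}), [(Sy 0 1, True, False, False)]), (({7}, {2}), [(Sy 0 2, True, False, False)]),
      (({7}, - {1, 2}), [(Sy 0 0, True, False, False)]), (({7}, - {6}), [(Sy 1 0, True, False, False)]),
      (({7}, {6}), [(Gd, False, False, False), (Bt, False, False, False), (Sy 1 2, True, False, False)]),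
      (({7}, {6}), [(Gd, False, False, False), (Bt, True, False, False), (Sy 1 1, True, False, False)]),
      (({7}, {6}), [(Gd, True, False, False), (Sy 1 0, True, False, False)]),
      (({7}, {6}), [(Gd, False, False, True), (Gd, True, False, False)])} \<union>
     (\<lambda>j. (({7}, UNIV), [(Sy j 0, True, False, False)])) ` {2..<k} \<union>
     (\<lambda>(j, s). (any, [(Hd j, False, False, False), (Sy j s, False, False, False), (Rd j s, True, False, False)])) `
       ({..<k} \<times> \<Sigma>) \<union>
     (\<lambda>(j, s). (any, [(Rd j s, False, False, False), (Rd j s, True, False, True)])) ` ({..<k} \<times> \<Sigma>) \<union>
     (\<lambda>(j, s). (any, [(Rd j s, False, False, True), (Rd j s, True, False, False)])) ` ({..<k} \<times> \<Sigma>) \<union>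
     (\<lambda>(q, ss). (any, (St q, False, False, False) # map (\<lambda>j. (Rd j (ss ! j), False, False, False)) [0..<k] @
       [(Tr q ss, True, False, False)])) ` (states M \<times> words M) \<union>
     (\<lambda>(q, ss). (any, [(Tr q ss, False, False, False), (St (fst (delta M q ss)), True, True, False)])) `
       (states M \<times> words M) \<union>
     (\<lambda>((q, ss), j). (any, [(Tr q ss, False, False, False), (Hd j, False, False, False),
       (Sy j (fst (snd (delta M q ss) ! j)), True, True, False)])) ` ((states M \<times> words M) \<times> {..<k}) \<union>
     (\<lambda>((q, ss), j). (any, move_clause (Tr q ss) j (snd (snd (delta M q ss) ! j)))) `
       ((states M \<times> words M) \<times> {..<k}) \<union>
     (\<lambda>j. (any, [(Hd j, False, False, False), (HL j, True, False, True)])) ` {..<k} \<union>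
     (\<lambda>j. (any, [(HL j, False, False, False), (HL j, True, False, True)])) ` {..<k} \<union>
     (\<lambda>j. (any, [(Hd j, False, False, True), (HR j, True, False, False)])) ` {..<k} \<union>
     (\<lambda>j. (any, [(HR j, False, False, True), (HR j, True, False, False)])) ` {..<k} \<union>
     (\<lambda>(j, s). (any, [(HL j, False, False, False), (Sy j s, False, False, False), (Sy j s, True, True, False)])) `
       ({..<k} \<times> \<Sigma>) \<union>
     (\<lambda>(j, s). (any, [(HR j, False, False, False), (Sy j s, False, False, False), (Sy j s, True, True, False)])) `
       ({..<k} \<times> \<Sigma>) \<union>
     (\<lambda>s. ((UNIV, {origin_letter (k - 1)}), [(St (halt_state M), False, False, False),
       (Sy (k - 1) s, False, False, True)])) ` (\<Sigma> - {2}))"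

lemma finite_clauses: "tm_wf M \<Longrightarrow> finite (clauses M)"
  unfolding clauses_def Let_def words_def tm_wf_def by (simp add: finite_lists_length_eq)

lemma clauses_nonempty: "(g, ls) \<in> clauses M \<Longrightarrow> ls \<noteq> []"
proof -
  have "move_clause T j m \<noteq> []" "[] \<noteq> move_clause T j m" for T j m by (cases m; simp)+
  then show "(g, ls) \<in> clauses M \<Longrightarrow> ls \<noteq> []" unfolding clauses_def Let_def by auto
qed

lemma poly_nat_mono: "x \<le> y \<Longrightarrow> poly p x \<le> poly p (y::nat)"
  by (induction p) (auto intro: add_mono mult_mono)

text \<open>One computation, on the input \<open>x\<close> with a fixed certificate
  \<open>y\<close>. The margin 3 keeps the heads and their neighbours at positions where clauses are
  instantiated.\<close>

locale tableau =
  fixes M :: tm and R :: "bool list \<Rightarrow> bool list \<Rightarrow> bool" and x y :: "bool list" and a b :: "nat poly"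
  assumes M: "tm_wf M" and time: "\<exists>T. T + 3 \<le> poly a (length x) \<and> computes_within M [x, y] [R x y] T"
    and y_len: "length y \<le> poly b (length x)"
begin

definition "W = domain_word a b x"
definition "P = length W"
definition "Q = poly a (length x)"
definition "q = poly b (length x)"
definition "org j = (if j = (1::nat) then 2 * Q + length x + 3 else Q + 2)"
definition "k = tape_count M"
definition "conf t = (tm_step M ^^ t) (tm_init M [x, y])"
definition "tp t j = snd (conf t) ! j"
definition "hd_pos t j = nat (snd (tp t j) + int (org j))"
definition "symb t j i = fst (tp t j) (int i - int (org j))"
definition "rds t = map read_tape (snd (conf t))"
definition "dlt t = delta M (fst (conf t)) (rds t)"

lemma P_eq: "P = 3 * Q + length x + q + 4"
  by (simp add: P_def W_def domain_word_def Let_def Q_def q_def)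

lemma W_nth:
  assumes "i < P"
  shows "W ! i = (if i = 0 then 7 else if i < Q + 1 then 3 else if i = Q + 1 then 4
    else if i < Q + 2 + length x then bit_symbol (x ! (i - (Q + 2)))
    else if i < 2 * Q + length x + 2 then 3 else if i = 2 * Q + length x + 2 then 5
    else if i < org 1 + q then 6 else if i < org 1 + q + Q then 3 else 8)"
proof -
  have W_eq: "W = [7] @ replicate Q 3 @ [4] @ map bit_symbol x @ replicate Q 3 @ [5] @
      replicate q 6 @ replicate Q 3 @ [8]"
    by (simp add: W_def domain_word_def Let_def Q_def q_def)
  have P: "i < 3 * Q + length x + q + 4" using assms by (simp add: P_eq)
  consider "i = 0" | "0 < i" "i < Q + 1" | "i = Q + 1" | "Q + 1 < i" "i < Q + 2 + length x"
    | "Q + 2 + length x \<le> i" "i < 2 * Q + length x + 2" | "i = 2 * Q + length x + 2"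
    | "2 * Q + length x + 2 < i" "i < org 1 + q" | "org 1 + q \<le> i" "i < org 1 + q + Q"
    | "org 1 + q + Q \<le> i"
    using P unfolding org_def by linarith
  then show ?thesis
    by cases (insert P, simp_all add: W_eq nth_append org_def, auto)
qed

text \<open>Letter 7 occurs at position 0 only, so a schema guarded by it speaks about time
  0.\<close>

lemma guard_start: "guard W ({7}, B) t i \<longleftrightarrow> t = 0 \<and> Suc 0 < P \<and> Suc i < P \<and> W ! i \<in> B"
  using W_nth[of t] W_nth[of 0] by (auto simp: guard_def P_def[symmetric] bit_symbol_def split: if_splits)

lemma letter_origin: "i < P \<Longrightarrow> W ! i = origin_letter j \<longleftrightarrow> Suc i = org j"
  using W_nth[of i] by (auto simp: origin_letter_def org_def bit_symbol_def split: if_splits)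

lemma letter_6: "i < P \<Longrightarrow> W ! i = 6 \<longleftrightarrow> org 1 \<le> i \<and> i < org 1 + q"
  using W_nth[of i] by (auto simp: org_def bit_symbol_def split: if_splits)

lemma letter_12: "i < P \<Longrightarrow> W ! i \<in> {1, 2} \<longleftrightarrow> org 0 \<le> i \<and> i < org 0 + length x"
  using W_nth[of i] by (auto simp: org_def bit_symbol_def split: if_splits)

lemma letter_x: "m < length x \<Longrightarrow> W ! (org 0 + m) = bit_symbol (x ! m)"
  using W_nth[of "org 0 + m"] by (simp add: org_def P_eq)

lemma k2: "2 \<le> k"
  using time by (auto simp: computes_within_def k_def)

lemma conf_0: "conf 0 = tm_init M [x, y]"
  by (simp add: conf_def)

lemma conf_Suc: "conf (Suc t) = (fst (dlt t), map2 act_tape (snd (dlt t)) (snd (conf t)))"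
proof -
  have "conf (Suc t) = tm_step M (conf t)" by (simp add: conf_def)
  then show ?thesis by (simp add: tm_step_delta dlt_def rds_def case_prod_beta)
qed

lemma delta_wf:
  "s \<in> states M \<Longrightarrow> ss \<in> words M \<Longrightarrow> fst (delta M s ss) \<in> states M \<and>
     length (snd (delta M s ss)) = k \<and> (\<forall>j<k. fst (snd (delta M s ss) ! j) \<in> symbols M)"
proof (cases "s = halt_state M")
  case False
  assume s: "s \<in> states M" "ss \<in> words M"
  have "case transition M s ss of (q', acts) \<Rightarrow>
      q' \<in> states M \<and> length acts = tape_count M \<and> fst ` set acts \<subseteq> symbols M"
  proof -
    have ss: "length ss = tape_count M \<and> set ss \<subseteq> symbols M" using s(2) by (simp add: words_def)
    have "\<forall>s\<in>states M. \<forall>ss. length ss = tape_count M \<and> set ss \<subseteq> symbols M \<longrightarrow>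
        (case transition M s ss of (q', acts) \<Rightarrow>
          q' \<in> states M \<and> length acts = tape_count M \<and> fst ` set acts \<subseteq> symbols M)"
      using M unfolding tm_wf_def by (elim conjE)
    from this[THEN bspec, OF s(1), THEN spec, THEN mp, OF ss] show ?thesis .
  qed
  then have t: "fst (transition M s ss) \<in> states M" "length (snd (transition M s ss)) = k"
    "fst ` set (snd (transition M s ss)) \<subseteq> symbols M"
    by (simp_all add: case_prod_beta k_def)
  then have "fst (snd (transition M s ss) ! j) \<in> symbols M" if "j < k" for j
    using that by (metis image_subset_iff nth_mem)
  then show ?thesis using False t by (simp add: delta_def)
qed (auto simp: delta_def words_def k_def)

lemma conf_wf: "fst (conf t) \<in> states M \<and> length (snd (conf t)) = k \<and>
    (\<forall>j<k. \<forall>z. fst (tp t j) z \<in> symbols M) \<and> rds t \<in> words M"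
proof (induction t)
  case 0
  have "{0, 1, 2} \<subseteq> symbols M" "start_state M \<in> states M" using M by (auto simp: tm_wf_def)
  then show ?case
    by (auto simp: conf_0 tm_init_def tp_def rds_def words_def k_def string_tape_def read_tape_def)
next
  case (Suc t)
  have d: "fst (dlt t) \<in> states M" "length (snd (dlt t)) = k" "\<forall>j<k. fst (snd (dlt t) ! j) \<in> symbols M"
    using delta_wf[of "fst (conf t)" "rds t"] Suc by (auto simp: dlt_def)
  have 1: "length (snd (conf (Suc t))) = k" using d Suc by (simp add: conf_Suc)
  have 2: "\<forall>j<k. \<forall>z. fst (tp (Suc t) j) z \<in> symbols M"
    using d Suc by (auto simp: tp_def conf_Suc act_tape_def)
  have "rds (Suc t) \<in> words M"
  proof -
    have "read_tape (snd (conf (Suc t)) ! i) \<in> symbols M" if "i < k" for i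
      using 2 that by (simp add: read_tape_def tp_def)
    then show ?thesis
      using 1 by (simp add: rds_def words_def k_def image_subset_iff all_set_conv_all_nth)
  qed
  then show ?case using 1 2 d by (simp add: conf_Suc)
qed

lemma tp_Suc: "j < k \<Longrightarrow> tp (Suc t) j = act_tape (snd (dlt t) ! j) (tp t j)"
  using conf_wf[of t] delta_wf[of "fst (conf t)" "rds t"] by (simp add: tp_def conf_Suc dlt_def)

lemma rds_nth: "j < k \<Longrightarrow> rds t ! j = read_tape (tp t j)"
  using conf_wf[of t] by (simp add: rds_def tp_def)

lemma head_bound: "j < k \<Longrightarrow> \<bar>snd (tp t j)\<bar> \<le> int t"
proof (induction t)
  case 0
  then show ?case by (simp add: tp_def conf_0 tm_init_def k_def string_tape_def)
next
  case (Suc t)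
  have "\<bar>move_head m z - z\<bar> \<le> 1" for m z by (cases m) auto
  then have "\<bar>snd (tp (Suc t) j) - snd (tp t j)\<bar> \<le> 1"
    using tp_Suc[OF Suc.prems, of t] by (simp add: act_tape_def)
  then show ?case using Suc by linarith
qed

text \<open>Every origin lies at least \<open>Q\<close> cells to the right of position 0 and a head
  moves at most one cell per step, so the truncation in \<open>hd_pos\<close> has no effect.\<close>

lemma int_hd_pos: "j < k \<Longrightarrow> t \<le> Q \<Longrightarrow> int (hd_pos t j) = snd (tp t j) + int (org j)"
proof -
  assume "j < k" "t \<le> Q"
  then have "- int Q \<le> snd (tp t j)" using head_bound[of j t] by linarith
  moreover have "int Q \<le> int (org j)" by (simp add: org_def)
  ultimately show ?thesis by (simp add: hd_pos_def)
qed

lemma symb_head: "j < k \<Longrightarrow> t \<le> Q \<Longrightarrow> symb t j (hd_pos t j) = rds t ! j"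
  using int_hd_pos[of j t] by (simp add: symb_def rds_nth read_tape_def)

lemma symb_Suc: "j < k \<Longrightarrow>
    symb (Suc t) j i = (if int i = snd (tp t j) + int (org j) then fst (snd (dlt t) ! j) else symb t j i)"
  by (auto simp: symb_def tp_Suc act_tape_def)

lemma symb_0_0: "Suc i < P \<Longrightarrow> symb 0 0 i = (if W ! i = 1 then 1 else if W ! i = 2 then 2 else 0)"
proof -
  assume i: "Suc i < P"
  have s: "symb 0 0 i = fst (string_tape x) (int i - int (org 0))"
    using k2 by (simp add: symb_def tp_def conf_0 tm_init_def k_def)
  show ?thesis
  proof (cases "org 0 \<le> i \<and> i < org 0 + length x")
    case True
    then obtain m where m: "i = org 0 + m" "m < length x" by (metis le_Suc_ex nat_add_left_cancel_less)
    then show ?thesis using s letter_x[OF m(2)] by (simp add: string_tape_def bit_symbol_def)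
  next
    case False
    then have "W ! i \<notin> {1, 2}" using letter_12 i by simp
    then show ?thesis using s False by (auto simp: string_tape_def)
  qed
qed

lemma symb_0_1: "symb 0 1 i =
    (if org 1 \<le> i \<and> i < org 1 + length y then bit_symbol (y ! (i - org 1)) else 0)"
proof -
  have "symb 0 1 i = fst (string_tape y) (int i - int (org 1))"
    using k2 by (simp add: symb_def tp_def conf_0 tm_init_def k_def)
  then show ?thesis by (auto simp: string_tape_def bit_symbol_def nat_diff_distrib)
qed

lemma symb_0_j: "2 \<le> j \<Longrightarrow> j < k \<Longrightarrow> symb 0 j i = 0"
  by (simp add: symb_def tp_def conf_0 tm_init_def k_def string_tape_def)

lemma halting: "\<exists>T. T + 3 \<le> Q \<and> fst (conf T) = halt_state M \<and>
    symb T (k - 1) (org (k - 1)) = bit_symbol (R x y)"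
proof -
  obtain T t where T: "T + 3 \<le> Q" "t \<le> T"
    and t: "fst (conf t) = halt_state M" "tape_output (last (snd (conf t))) [R x y]"
    using time unfolding computes_within_def Q_def conf_def by (auto simp: case_prod_beta)
  have "last (snd (conf t)) = tp t (k - 1)"
    using conf_wf[of t] k2 by (subst last_conv_nth) (auto simp: tp_def)
  then have "symb t (k - 1) (org (k - 1)) = bit_symbol (R x y)"
    using t(2) by (auto simp: tape_output_def symb_def string_tape_def bit_symbol_def dest!: spec[of _ 0])
  then show ?thesis using T t by (intro exI[of _ t]) simp
qed

lemma halted: "fst (conf t) = halt_state M \<Longrightarrow> conf (t + d) = conf t"
  by (induction d) (simp_all add: conf_def tm_step_def case_prod_beta)

lemma halted_unique:
  assumes "fst (conf t) = halt_state M" "fst (conf t') = halt_state M"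
  shows "conf t = conf t'"
  using halted[OF assms(1), of "t' - t"] halted[OF assms(2), of "t - t'"] by (cases "t \<le> t'") auto

section \<open>The clauses and the computation imply each other\<close>

definition model :: "kind \<Rightarrow> nat \<Rightarrow> nat \<Rightarrow> bool" where
  "model v t i = (case v of
      St s \<Rightarrow> fst (conf t) = s
    | Hd j \<Rightarrow> int i = snd (tp t j) + int (org j)
    | Sy j s \<Rightarrow> symb t j i = s
    | Rd j s \<Rightarrow> rds t ! j = s
    | Tr s ss \<Rightarrow> fst (conf t) = s \<and> rds t = ss
    | HL j \<Rightarrow> int i > snd (tp t j) + int (org j)
    | HR j \<Rightarrow> int i < snd (tp t j) + int (org j)
    | Gd \<Rightarrow> org 1 \<le> i \<and> i < org 1 + length y
    | Bt \<Rightarrow> y ! (i - org 1))"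

lemma model_satisfies:
  assumes "R x y"
  shows "satisfies W (clauses M) model"
proof -
  have rd: "j < k \<Longrightarrow> symb t j i = s \<Longrightarrow> int i = snd (tp t j) + int (org j) \<Longrightarrow> rds t ! j = s" for j t i s
    by (simp add: symb_def rds_nth read_tape_def)
  have tr: "rds t = ss" if "\<forall>j\<in>{0..<k}. rds t ! j = ss ! j" "ss \<in> words M" for t ss
    using that conf_wf[of t] by (intro nth_equalityI) (auto simp: words_def k_def)
  have dl: "fst (conf t) = s \<Longrightarrow> rds t = ss \<Longrightarrow> delta M s ss = dlt t" for t s ss
    by (simp add: dlt_def)
  have mv: "\<exists>l\<in>set (move_clause (Tr s ss) j (snd (snd (delta M s ss) ! j))). lit_true model t i l"
    if "j < k" for s ss j t i
  proof (cases "fst (conf t) = s \<and> rds t = ss")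
    case True
    then have "snd (tp (Suc t) j) = move_head (snd (snd (delta M s ss) ! j)) (snd (tp t j))"
      using tp_Suc[OF that, of t] dl[of t s ss] by (simp add: act_tape_def)
    then show ?thesis
      by (cases "snd (snd (delta M s ss) ! j)") (auto simp: lit_true_def model_def)
  next
    case False
    then show ?thesis by (cases "snd (snd (delta M s ss) ! j)") (auto simp: lit_true_def model_def)
  qed
  \<comment> \<open>A halted configuration never changes, so whenever the machine has halted it is
    in the accepting configuration.\<close>
  have acc: "symb t (k - 1) (Suc i) = 2" if "fst (conf t) = halt_state M" "W ! i = origin_letter (k - 1)" "i < P" for t i
  proof -
    obtain T where T: "fst (conf T) = halt_state M" "symb T (k - 1) (org (k - 1)) = 2"
      using halting assms by (auto simp: bit_symbol_def)
    have "Suc i = org (k - 1)" using letter_origin that by blast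
    then show ?thesis using T halted_unique[OF that(1) T(1)] by (simp add: symb_def tp_def)
  qed
  have h0: "snd (tp 0 j) = 0" if "j < k" for j
    using that by (simp add: tp_def conf_0 tm_init_def k_def string_tape_def)
  show ?thesis
    unfolding satisfies_def
  proof (intro ballI allI impI, clarify)
    fix A B ls t i assume mem: "((A, B), ls) \<in> clauses M" and g: "guard W (A, B) t i"
    have ti: "Suc t < P" "Suc i < P" "W ! t \<in> A" "W ! i \<in> B" using g by (auto simp: guard_def P_def)
    show "\<exists>l\<in>set ls. lit_true model t i l"
      using mem g unfolding clauses_def Let_def k_def[symmetric]
      apply (elim UnE)
      subgoal by (auto simp: lit_true_def model_def guard_start conf_0 tm_init_def)
      subgoal by (auto simp: lit_true_def model_def guard_start letter_origin h0)
      subgoal premises prems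
      proof -
        have "symb 0 0 i = (if W ! i = 1 then 1 else if W ! i = 2 then 2 else 0)"
          by (rule symb_0_0) (rule ti)
        moreover have "symb 0 1 i = 0" if "W ! i \<noteq> 6"
          using that symb_0_1[of i] letter_6[of i] y_len ti(2) by (auto simp: q_def)
        moreover have "symb 0 1 i = (if i < org 1 + length y then bit_symbol (y ! (i - org 1)) else 0)"
          "org 1 \<le> i" if "W ! i = 6"
          using that symb_0_1[of i] letter_6[of i] ti(2) by simp_all
        ultimately show ?thesis
          using prems
          by (elim insertE emptyE)
            (simp_all add: guard_start lit_true_def model_def bit_symbol_def del: One_nat_def split: if_splits)
      qed
      subgoal by (auto simp: lit_true_def model_def guard_start symb_0_j)
      subgoal using rd by (auto simp: lit_true_def model_def)
      subgoal by (auto simp: lit_true_def model_def)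
      subgoal by (auto simp: lit_true_def model_def)
      subgoal using tr by (auto simp: lit_true_def model_def)
      subgoal using dl by (auto simp: lit_true_def model_def conf_Suc)
      subgoal using dl by (auto simp: lit_true_def model_def symb_Suc)
      subgoal using mv by auto
      subgoal by (auto simp: lit_true_def model_def)
      subgoal by (auto simp: lit_true_def model_def)
      subgoal by (auto simp: lit_true_def model_def)
      subgoal by (auto simp: lit_true_def model_def)
      subgoal by (auto simp: lit_true_def model_def symb_Suc)
      subgoal by (auto simp: lit_true_def model_def symb_Suc)
      subgoal using acc[of t i] ti by (auto simp: lit_true_def model_def)
      done
  qed
qed


text \<open>Here \<open>y\<close> is the string that \<open>\<alpha>\<close> itself describes in the
  certificate cells. By induction on time, \<open>\<alpha>\<close> contains all facts about each
  configuration; the acceptance clauses then leave only symbol 2 for the output.\<close>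

lemma satisfies_imp_accepts:
  assumes sat: "satisfies W (clauses M) \<alpha>"
    and Gd: "\<And>m. m < length y \<Longrightarrow> \<alpha> Gd 0 (org 1 + m) \<and> \<alpha> Bt 0 (org 1 + m) = y ! m"
    and Gd_end: "length y < q \<Longrightarrow> \<not> \<alpha> Gd 0 (org 1 + length y)"
  shows "R x y"
proof -
  \<comment> \<open>The union is nested to the left, so the families of clauses are split off from
    the end; \<open>c1\<close> to \<open>c18\<close> follow the order of the definition.\<close>
  note S = sat[unfolded satisfies_def clauses_def Let_def ball_Un k_def[symmetric]]
  note c18 = S[THEN conjunct2] and S = S[THEN conjunct1]
  note c17 = S[THEN conjunct2] and S = S[THEN conjunct1]
  note c16 = S[THEN conjunct2] and S = S[THEN conjunct1]
  note c15 = S[THEN conjunct2] and S = S[THEN conjunct1]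
  note c14 = S[THEN conjunct2] and S = S[THEN conjunct1]
  note c13 = S[THEN conjunct2] and S = S[THEN conjunct1]
  note c12 = S[THEN conjunct2] and S = S[THEN conjunct1]
  note c11 = S[THEN conjunct2] and S = S[THEN conjunct1]
  note c10 = S[THEN conjunct2] and S = S[THEN conjunct1]
  note c9 = S[THEN conjunct2] and S = S[THEN conjunct1]
  note c8 = S[THEN conjunct2] and S = S[THEN conjunct1]
  note c7 = S[THEN conjunct2] and S = S[THEN conjunct1]
  note c6 = S[THEN conjunct2] and S = S[THEN conjunct1]
  note c5 = S[THEN conjunct2] and S = S[THEN conjunct1]
  note c4 = S[THEN conjunct2] and S = S[THEN conjunct1]
  note c3 = S[THEN conjunct2] and S = S[THEN conjunct1]
  note c2 = S[THEN conjunct2] and c1 = S[THEN conjunct1]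
  have any: "guard W (UNIV, UNIV) t i \<longleftrightarrow> Suc t < P \<and> Suc i < P" for t i
    by (simp add: guard_def P_def)
  have P1: "Suc 0 < P" by (simp add: P_eq)
  have St0: "\<alpha> (St (start_state M)) 0 i" if "Suc i < P" for i
    using c1 that P1 by (simp add: guard_start lit_true_def)
  have Hd0: "\<alpha> (Hd j) 0 (Suc i)" if "j < k" "Suc i < P" "W ! i = origin_letter j" for i j
    using c2 that P1 by (auto simp: guard_start lit_true_def)
  have Sy0: "W ! i = 1 \<Longrightarrow> \<alpha> (Sy 0 1) 0 i" "W ! i = 2 \<Longrightarrow> \<alpha> (Sy 0 2) 0 i"
    "W ! i \<noteq> 1 \<Longrightarrow> W ! i \<noteq> 2 \<Longrightarrow> \<alpha> (Sy 0 0) 0 i" "W ! i \<noteq> 6 \<Longrightarrow> \<alpha> (Sy 1 0) 0 i"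
    "W ! i = 6 \<Longrightarrow> \<alpha> Gd 0 i \<Longrightarrow> \<alpha> (Sy 1 (bit_symbol (\<alpha> Bt 0 i))) 0 i"
    "W ! i = 6 \<Longrightarrow> \<not> \<alpha> Gd 0 i \<Longrightarrow> \<alpha> (Sy 1 0) 0 i"
    "W ! i = 6 \<Longrightarrow> \<alpha> Gd 0 (Suc i) \<Longrightarrow> \<alpha> Gd 0 i" if "Suc i < P" for i
    using c3 that P1 by (auto simp: guard_start lit_true_def bit_symbol_def)
  have Sy0j: "\<alpha> (Sy j 0) 0 i" if "2 \<le> j" "j < k" "Suc i < P" for i j
    using c4 that P1 by (auto simp: guard_start lit_true_def)
  have Rd: "\<alpha> (Hd j) t i \<Longrightarrow> \<alpha> (Sy j s) t i \<Longrightarrow> \<alpha> (Rd j s) t i"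
    "\<alpha> (Rd j s) t i \<Longrightarrow> \<alpha> (Rd j s) t (Suc i)" "\<alpha> (Rd j s) t (Suc i) \<Longrightarrow> \<alpha> (Rd j s) t i"
    "\<alpha> (HL j) t i \<Longrightarrow> \<alpha> (Sy j s) t i \<Longrightarrow> \<alpha> (Sy j s) (Suc t) i"
    "\<alpha> (HR j) t i \<Longrightarrow> \<alpha> (Sy j s) t i \<Longrightarrow> \<alpha> (Sy j s) (Suc t) i"
    if "j < k" "s \<in> symbols M" "Suc t < P" "Suc i < P" for j s t i
    using c5 c6 c7 c16 c17 that by (force simp: any lit_true_def)+
  have H: "\<alpha> (Hd j) t i \<Longrightarrow> \<alpha> (HL j) t (Suc i)" "\<alpha> (HL j) t i \<Longrightarrow> \<alpha> (HL j) t (Suc i)"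
    "\<alpha> (Hd j) t (Suc i) \<Longrightarrow> \<alpha> (HR j) t i" "\<alpha> (HR j) t (Suc i) \<Longrightarrow> \<alpha> (HR j) t i"
    if "j < k" "Suc t < P" "Suc i < P" for j t i
    using c12 c13 c14 c15 that by (auto simp: any lit_true_def)
  have Tr: "\<alpha> (Tr s ss) t i"
    if "s \<in> states M" "ss \<in> words M" "Suc t < P" "Suc i < P" "\<alpha> (St s) t i"
      "\<And>j. j < k \<Longrightarrow> \<alpha> (Rd j (ss ! j)) t i" for s ss t i
    using c8 that by (force simp: any lit_true_def)
  have TrSt: "\<alpha> (Tr s ss) t i \<Longrightarrow> \<alpha> (St (fst (delta M s ss))) (Suc t) i"
    if "s \<in> states M" "ss \<in> words M" "Suc t < P" "Suc i < P" for s ss t i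
    using c9 that by (force simp: any lit_true_def)
  have TrSy: "\<alpha> (Tr s ss) t i \<Longrightarrow> \<alpha> (Hd j) t i \<Longrightarrow> \<alpha> (Sy j (fst (snd (delta M s ss) ! j))) (Suc t) i"
    if "s \<in> states M" "ss \<in> words M" "j < k" "Suc t < P" "Suc i < P" for s ss j t i
    using c10 that by (force simp: any lit_true_def)
  have TrMv: "\<exists>l\<in>set (move_clause (Tr s ss) j (snd (snd (delta M s ss) ! j))). lit_true \<alpha> t i l"
    if "s \<in> states M" "ss \<in> words M" "j < k" "Suc t < P" "Suc i < P" for s ss j t i
    using c11 that by (force simp: any)
  have Acc: "\<alpha> (St (halt_state M)) t i \<Longrightarrow> s \<noteq> 2 \<Longrightarrow> \<not> \<alpha> (Sy (k - 1) s) t (Suc i)"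
    if "s \<in> symbols M" "Suc t < P" "Suc i < P" "W ! i = origin_letter (k - 1)" for s t i
    using c18 that by (force simp: guard_def P_def lit_true_def)
  define Inv where "Inv t \<longleftrightarrow> (\<forall>i. Suc i < P \<longrightarrow> \<alpha> (St (fst (conf t))) t i) \<and>
    (\<forall>j<k. \<alpha> (Hd j) t (hd_pos t j)) \<and> (\<forall>j<k. \<forall>i. Suc i < P \<longrightarrow> \<alpha> (Sy j (symb t j i)) t i)" for t
  have org: "Q + 2 \<le> org j" "org j + Q < P" for j by (auto simp: org_def P_eq)
  \<comment> \<open>\<open>Gd\<close> is propagated to the left, so once a certificate cell is
    unmarked, no later one is marked.\<close>
  have not_Gd: "\<not> \<alpha> Gd 0 (org 1 + length y + d)" if "length y + d < q" for d
    using that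
  proof (induction d)
    case 0
    then show ?case using Gd_end by simp
  next
    case (Suc d)
    let ?i = "org 1 + length y + d"
    have "Suc ?i < P" using Suc.prems by (simp add: org_def P_eq)
    moreover have "W ! ?i = 6" using letter_6[of ?i] Suc.prems \<open>Suc ?i < P\<close> by simp
    ultimately show ?case using Sy0(7)[of ?i] Suc by auto
  qed
  have "Inv 0"
    unfolding Inv_def
  proof (intro conjI allI impI)
    fix j assume j: "j < k"
    have "hd_pos 0 j = org j"
      using j by (simp add: hd_pos_def tp_def conf_0 tm_init_def k_def string_tape_def)
    moreover have "W ! (org j - 1) = origin_letter j" "Suc (org j - 1) = org j"
      using letter_origin[of "org j - 1" j] org[of j] by simp_all
    ultimately show "\<alpha> (Hd j) 0 (hd_pos 0 j)" using Hd0[OF j, of "org j - 1"] org[of j] by simp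
  next
    fix j i assume j: "j < k" and i: "Suc i < P"
    consider "j = 0" | "j = 1" | "2 \<le> j" by linarith
    then show "\<alpha> (Sy j (symb 0 j i)) 0 i"
    proof cases
      case 1
      then show ?thesis using Sy0(1-3)[OF i] symb_0_0[OF i] by simp
    next
      case 2
      show ?thesis
      proof (cases "W ! i = 6")
        case True
        then obtain m where m: "i = org 1 + m" "m < q"
          using letter_6[of i] i by (metis Suc_lessD le_Suc_ex nat_add_left_cancel_less)
        show ?thesis
        proof (cases "m < length y")
          case True
          then show ?thesis using Gd[OF True] Sy0(5)[OF i \<open>W ! i = 6\<close>] symb_0_1[of i] m 2 by simp
        next
          case False
          then show ?thesis using not_Gd[of "m - length y"] Sy0(6)[OF i \<open>W ! i = 6\<close>] symb_0_1[of i] m 2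
            by simp
        qed
      next
        case False
        then have "symb 0 1 i = 0" using symb_0_1[of i] letter_6[of i] y_len i by (auto simp: q_def)
        then show ?thesis using Sy0(4)[OF i False] 2 by simp
      qed
    next
      case 3
      then show ?thesis using Sy0j j i by (simp add: symb_0_j)
    qed
  qed (use St0 in \<open>simp add: conf_0 tm_init_def\<close>)
  have step: "Inv (Suc t)" if I: "Inv t" and t: "t + 3 \<le> Q" for t
  proof -
    have tP: "Suc t < P" using t by (simp add: P_eq)
    let ?s = "fst (conf t)" and ?ss = "rds t"
    have wf: "?s \<in> states M" "?ss \<in> words M" using conf_wf[of t] by simp_all
    have h: "1 \<le> hd_pos t j" "Suc (hd_pos t j) < P" if "j < k" for j
      using int_hd_pos[OF that, of t] head_bound[OF that, of t] t org[of j] by linarith+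
    have sym_in: "symb t j i \<in> symbols M" if "j < k" for j i
      using conf_wf[of t] that by (simp add: symb_def)
    have Hd: "\<alpha> (Hd j) t (hd_pos t j)" if "j < k" for j using I that by (simp add: Inv_def)
    have Sy: "\<alpha> (Sy j (symb t j i)) t i" if "j < k" "Suc i < P" for j i using I that by (simp add: Inv_def)
    \<comment> \<open>The read symbol is derived at the head and spread in both directions, so the
      transition takes place at every position.\<close>
    have rd: "\<alpha> (Rd j (?ss ! j)) t i" if j: "j < k" and i: "Suc i < P" for j i
    proof -
      have eq: "symb t j (hd_pos t j) = ?ss ! j" using symb_head[OF j, of t] t by simp
      have in\<Sigma>: "?ss ! j \<in> symbols M" using sym_in[OF j, of "hd_pos t j"] eq by simp
      have at: "\<alpha> (Rd j (?ss ! j)) t (hd_pos t j)"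
        using Rd(1)[OF j in\<Sigma> tP h(2)[OF j] Hd[OF j]] Sy[OF j h(2)[OF j]] eq by simp
      have up: "hd_pos t j + d < P \<Longrightarrow> \<alpha> (Rd j (?ss ! j)) t (hd_pos t j + d)" for d
      proof (induction d)
        case (Suc d)
        then show ?case using Rd(2)[OF j in\<Sigma> tP, of "hd_pos t j + d"] by simp
      qed (use at in simp)
      have down: "d \<le> hd_pos t j \<Longrightarrow> \<alpha> (Rd j (?ss ! j)) t (hd_pos t j - d)" for d
      proof (induction d)
        case (Suc d)
        then have "hd_pos t j - d = Suc (hd_pos t j - Suc d)" by simp
        then show ?case using Rd(3)[OF j in\<Sigma> tP, of "hd_pos t j - Suc d"] Suc h(2)[OF j] by simp
      qed (use at in simp)
      show ?thesis using up[of "i - hd_pos t j"] down[of "hd_pos t j - i"] i by (cases "hd_pos t j \<le> i") auto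
    qed
    have tr: "\<alpha> (Tr ?s ?ss) t i" if "Suc i < P" for i
      using Tr[OF wf tP that] rd that I by (simp add: Inv_def)
    have d: "delta M ?s ?ss = dlt t" by (simp add: dlt_def)
    show ?thesis
      unfolding Inv_def
    proof (intro conjI allI impI)
      fix i assume "Suc i < P"
      then show "\<alpha> (St (fst (conf (Suc t)))) (Suc t) i"
        using TrSt[OF wf tP] tr d by (simp add: conf_Suc)
    next
      fix j assume j: "j < k"
      have new: "int (hd_pos (Suc t) j) = move_head (snd (snd (dlt t) ! j)) (snd (tp t j)) + int (org j)"
        using int_hd_pos[OF j, of "Suc t"] t tp_Suc[OF j, of t] by (simp add: act_tape_def)
      have old: "int (hd_pos t j) = snd (tp t j) + int (org j)" using int_hd_pos[OF j, of t] t by simp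
      show "\<alpha> (Hd j) (Suc t) (hd_pos (Suc t) j)"
      proof (cases "snd (snd (dlt t) ! j)")
        case Stay
        then have "hd_pos (Suc t) j = hd_pos t j" using new old by simp
        then show ?thesis using TrMv[OF wf j tP h(2)[OF j]] tr[OF h(2)[OF j]] Hd[OF j] Stay
          by (simp add: d lit_true_def)
      next
        case Move_Right
        then have "hd_pos (Suc t) j = Suc (hd_pos t j)" using new old by simp
        then show ?thesis using TrMv[OF wf j tP h(2)[OF j]] tr[OF h(2)[OF j]] Hd[OF j] Move_Right
          by (simp add: d lit_true_def)
      next
        case Move_Left
        let ?i = "hd_pos t j - 1"
        have i: "Suc ?i = hd_pos t j" "Suc ?i < P" using h[OF j] by simp_all
        have "hd_pos (Suc t) j = ?i" using new old Move_Left i by simp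
        then show ?thesis using TrMv[OF wf j tP i(2)] tr[OF i(2)] Hd[OF j] Move_Left i(1)
          by (simp add: d lit_true_def)
      qed
    next
      fix j i assume j: "j < k" and i: "Suc i < P"
      have old: "int (hd_pos t j) = snd (tp t j) + int (org j)" using int_hd_pos[OF j, of t] t by simp
      have HL: "Suc (hd_pos t j + d) < P \<Longrightarrow> \<alpha> (HL j) t (Suc (hd_pos t j + d))" for d
      proof (induction d)
        case 0
        then show ?case using H(1)[OF j tP h(2)[OF j] Hd[OF j]] by simp
      next
        case (Suc d)
        then show ?case using H(2)[OF j tP, of "Suc (hd_pos t j + d)"] by simp
      qed
      have HR: "d < hd_pos t j \<Longrightarrow> \<alpha> (HR j) t (hd_pos t j - Suc d)" for d
      proof (induction d)
        case 0
        then show ?case using H(3)[OF j tP, of "hd_pos t j - 1"] Hd[OF j] h(2)[OF j] by simp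
      next
        case (Suc d)
        then have "hd_pos t j - Suc d = Suc (hd_pos t j - Suc (Suc d))" by simp
        then show ?case using H(4)[OF j tP, of "hd_pos t j - Suc (Suc d)"] Suc h(2)[OF j] by simp
      qed
      consider "i = hd_pos t j" | "hd_pos t j < i" | "i < hd_pos t j" by linarith
      then show "\<alpha> (Sy j (symb (Suc t) j i)) (Suc t) i"
      proof cases
        case 1
        then show ?thesis using TrSy[OF wf j tP i tr[OF i]] Hd[OF j] old by (simp add: symb_Suc[OF j] d)
      next
        case 2
        then have "symb (Suc t) j i = symb t j i" using old by (simp add: symb_Suc[OF j])
        moreover have "\<alpha> (HL j) t i" using HL[of "i - Suc (hd_pos t j)"] 2 i by simp
        ultimately show ?thesis using Rd(4)[OF j sym_in[OF j] tP i] Sy[OF j i] by simp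
      next
        case 3
        then have "symb (Suc t) j i = symb t j i" using old by (simp add: symb_Suc[OF j])
        moreover have "\<alpha> (HR j) t i" using HR[of "hd_pos t j - Suc i"] 3 by simp
        ultimately show ?thesis using Rd(5)[OF j sym_in[OF j] tP i] Sy[OF j i] by simp
      qed
    qed
  qed
  have Inv: "t + 2 \<le> Q \<Longrightarrow> Inv t" for t
    by (induction t) (use \<open>Inv 0\<close> step in auto)
  obtain T where T: "T + 3 \<le> Q" "fst (conf T) = halt_state M"
    "symb T (k - 1) (org (k - 1)) = bit_symbol (R x y)" using halting by blast
  let ?i = "org (k - 1) - 1"
  have i: "Suc ?i = org (k - 1)" "Suc ?i < P" "Suc (Suc ?i) < P" "W ! ?i = origin_letter (k - 1)" "k - 1 < k"
    using org[of "k - 1"] letter_origin[of ?i "k - 1"] k2 T by simp_all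
  have I: "Inv T" using Inv T by simp
  have "\<alpha> (St (halt_state M)) T ?i" using I i(2) T(2) by (simp add: Inv_def)
  moreover have "\<alpha> (Sy (k - 1) (bit_symbol (R x y))) T (Suc ?i)" using I i T(3) unfolding Inv_def by metis
  moreover have "bit_symbol (R x y) \<in> symbols M" using M by (auto simp: tm_wf_def bit_symbol_def)
  moreover have "Suc T < P" using T by (simp add: P_eq)
  ultimately have "bit_symbol (R x y) = 2" using Acc i by blast
  then show ?thesis by (simp add: bit_symbol_def split: if_splits)
qed

end

text \<open>The clauses depend on the machine alone and are fixed before \<open>c\<close>. Thus the
  word can afterwards be made long compared with the number of tags arising from \<open>C\<close>,
  as the binary counter of the reduction requires.\<close>

theorem NP_as_clauses:
  assumes "in_NP A"
  shows "\<exists>C :: kind schema set. finite C \<and> (\<forall>(g, ls) \<in> C. ls \<noteq> []) \<and>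
    (\<forall>c. \<exists>a b. (\<forall>n. c \<le> poly a n) \<and>
       (\<forall>x. x \<in> A \<longleftrightarrow> (\<exists>\<alpha>. satisfies (domain_word a b x) C \<alpha>)))"
proof -
  obtain R b where R: "poly_time_decidable2 R"
    "\<And>x. x \<in> A \<longleftrightarrow> (\<exists>y. length y \<le> poly b (length x) \<and> R x y)"
    using assms by (auto simp: in_NP_def)
  obtain M p where M: "tm_wf M" "\<And>x y. computes_within M [x, y] [R x y] (poly p (length x + length y))"
    using R(1) by (auto simp: poly_time_decidable2_def)
  have "\<exists>a b. (\<forall>n. c \<le> poly a n) \<and>
       (\<forall>x. x \<in> A \<longleftrightarrow> (\<exists>\<alpha>. satisfies (domain_word a b x) (clauses M) \<alpha>))" for c
  \<comment> \<open>The running time on \<open>x\<close> with a longest admissible certificate, plus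
    the margin 3 of the tableau and the lower bound \<open>c\<close>.\<close>
  proof (rule exI[of _ "pcompose p ([:0, 1:] + b) + [:c + 3:]"], rule exI[of _ b], intro conjI allI)
    let ?a = "pcompose p ([:0, 1:] + b) + [:c + 3:]"
    show "c \<le> poly ?a n" for n by simp
    fix x
    have tab: "tableau M R x y ?a b" if "length y \<le> poly b (length x)" for y
    proof
      have "poly p (length x + length y) \<le> poly p (length x + poly b (length x))"
        using that by (intro poly_nat_mono) simp
      then have "poly p (length x + length y) + 3 \<le> poly ?a (length x)" by (simp add: poly_pcompose)
      then show "\<exists>T. T + 3 \<le> poly ?a (length x) \<and> computes_within M [x, y] [R x y] T"
        using M(2) by blast
    qed (use M that in auto)
    show "x \<in> A \<longleftrightarrow> (\<exists>\<alpha>. satisfies (domain_word ?a b x) (clauses M) \<alpha>)"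
    proof
      assume "x \<in> A"
      then obtain y where y: "length y \<le> poly b (length x)" "R x y" using R(2) by blast
      interpret tableau M R x y ?a b by (rule tab) (rule y)
      show "\<exists>\<alpha>. satisfies (domain_word ?a b x) (clauses M) \<alpha>"
        using model_satisfies[OF y(2)] unfolding W_def by blast
    next
      assume "\<exists>\<alpha>. satisfies (domain_word ?a b x) (clauses M) \<alpha>"
      then obtain \<alpha> where \<alpha>: "satisfies (domain_word ?a b x) (clauses M) \<alpha>" by blast
      define l where "l = poly b (length x)"
      define o1 where "o1 = 2 * poly ?a (length x) + length x + 3"
      \<comment> \<open>The first unmarked certificate cell, or the maximal length if all are
        marked; the bits before it form the certificate.\<close>
      define L where "L = (LEAST m. m = l \<or> \<not> \<alpha> Gd 0 (o1 + m))"
      have L: "L = l \<or> \<not> \<alpha> Gd 0 (o1 + L)" unfolding L_def by (rule LeastI_ex) blast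
      have "L \<le> l" unfolding L_def by (rule Least_le) simp
      have before: "\<alpha> Gd 0 (o1 + m)" if "m < L" for m using not_less_Least that unfolding L_def by blast
      define y where "y = map (\<lambda>m. \<alpha> Bt 0 (o1 + m)) [0..<L]"
      have y: "length y \<le> poly b (length x)" using \<open>L \<le> l\<close> by (simp add: y_def l_def)
      interpret tableau M R x y ?a b by (rule tab) (rule y)
      have o1: "org 1 = o1" unfolding org_def Q_def o1_def by simp
      have "R x y"
      proof (rule satisfies_imp_accepts)
        show "satisfies W (clauses M) \<alpha>" using \<alpha> unfolding W_def .
        show "\<alpha> Gd 0 (org 1 + m) \<and> \<alpha> Bt 0 (org 1 + m) = y ! m" if "m < length y" for m
          using that before unfolding o1 by (simp add: y_def)
        show "\<not> \<alpha> Gd 0 (org 1 + length y)" if "length y < tableau.q x b"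
          using that L unfolding o1 q_def l_def[symmetric] by (simp add: y_def)
      qed
      then show "x \<in> A" using R(2) y by blast
    qed
  qed
  moreover have "\<forall>(g, ls) \<in> clauses M. ls \<noteq> []" using clauses_nonempty by blast
  ultimately show ?thesis using finite_clauses[OF M(1)] by blast
qed

section \<open>Hardness\<close>

fun bits_value :: "bool list \<Rightarrow> nat" where
  "bits_value [] = 0"
| "bits_value (b # bs) = of_bool b + 2 * bits_value bs"

lemma bits_value_binary: "bits_value (binary n) = n"
proof (induction n rule: less_induct)
  case (less n)
  show ?case
  proof (cases "n = 0")
    case False
    then have "bits_value (binary n) = of_bool (odd n) + 2 * (n div 2)"
      using less[of "n div 2"] by (simp add: binary.simps[of n])
    also have "\<dots> = n" by (cases "even n") auto
    finally show ?thesis .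
  qed (simp add: binary.simps)
qed

lemma bits_value_less: "bits_value bs < 2 ^ length bs"
  by (induction bs) auto

lemma encode_enat_append_eq:
  assumes "encode_enat d @ s = encode_enat d' @ s'"
  shows "d = d' \<and> s = s'"
proof -
  have aux: "concat (map (\<lambda>b. [True, b]) bs) @ [False, c] @ s = concat (map (\<lambda>b. [True, b]) bs') @ [False, c'] @ s'
    \<Longrightarrow> bs = bs' \<and> c = c' \<and> s = s'" for bs bs' c c'
  proof (induction bs arbitrary: bs')
    case Nil
    then show ?case by (cases bs') auto
  next
    case (Cons b bs)
    then show ?case by (cases bs') auto
  qed
  have enc: "\<exists>bs c. encode_enat d = concat (map (\<lambda>b. [True, b]) bs) @ [False, c] \<and>
      d = (if c then \<infinity> else enat (bits_value bs)) \<and> (c \<longrightarrow> bs = [])" for d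
  proof (cases d)
    case (enat n)
    then show ?thesis by (intro exI[of _ "binary n"] exI[of _ False]) (simp add: encode_enat_def bits_value_binary)
  next
    case infinity
    then show ?thesis by (intro exI[of _ "[]"] exI[of _ True]) (simp add: encode_enat_def)
  qed
  obtain bs c where 1: "encode_enat d = concat (map (\<lambda>b. [True, b]) bs) @ [False, c]"
    "d = (if c then \<infinity> else enat (bits_value bs))" using enc by blast
  obtain bs' c' where 2: "encode_enat d' = concat (map (\<lambda>b. [True, b]) bs') @ [False, c']"
    "d' = (if c' then \<infinity> else enat (bits_value bs'))" using enc by blast
  have "bs = bs' \<and> c = c' \<and> s = s'" using aux assms unfolding 1(1) 2(1) append_assoc by blast
  then show ?thesis using 1 2 by simp
qed

lemma encode_list_inj:
  "length ds = length ds' \<Longrightarrow> concat (map encode_enat ds) = concat (map encode_enat ds') \<Longrightarrow> ds = ds'"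
proof (induction ds arbitrary: ds')
  case (Cons d ds)
  then obtain d' ds'' where "ds' = d' # ds''" by (cases ds') auto
  then show ?case using Cons encode_enat_append_eq[of d "concat (map encode_enat ds)" d'] by auto
qed simp

lemma pairs_eqD:
  assumes "concat (map (\<lambda>u. map (f u) [0..<n]) [0..<n]) = concat (map (\<lambda>u. map (g u) [0..<n]) [0..<n])"
    and "u < n" "v < n"
  shows "f u v = g u v"
proof -
  let ?u = "u * n + v"
  have "?u < n * n" using assms(2,3) mult_le_mono1[of "Suc u" n n] by simp
  have eq: "concat (map (\<lambda>u. map (f u) [0..<n]) [0..<n]) = map (\<lambda>i. f (i div n) (i mod n)) [0..<n * n]"
    for f :: "nat \<Rightarrow> nat \<Rightarrow> 'a"
  proof -
    have "concat (map (\<lambda>i. [f (i div n) (i mod n)]) [0..<n * n]) =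
        concat (map (\<lambda>u. concat (map (\<lambda>v. [f u v]) [0..<n])) [0..<n])"
      unfolding concat_map_upt_mult by (intro arg_cong[of _ _ concat] map_cong refl) auto
    moreover have "concat (map (\<lambda>i. [h i]) xs) = map h xs" for h :: "nat \<Rightarrow> 'a" and xs by (induction xs) auto
    ultimately show ?thesis by simp
  qed
  have "map (\<lambda>i. f (i div n) (i mod n)) [0..<n * n] ! ?u = map (\<lambda>i. g (i div n) (i mod n)) [0..<n * n] ! ?u"
    using arg_cong[OF assms(1), of "\<lambda>xs. xs ! ?u"] unfolding eq .
  then show ?thesis using \<open>?u < n * n\<close> assms by simp
qed

lemma length_pairs: "length (concat (map (\<lambda>u. map (f u) [0..<n]) [0..<n])) = n * n"
  by (simp add: length_concat comp_def sum_list_triv)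

lemma encode_instance_inj:
  assumes "encode_instance I = encode_instance I'"
  shows "vertex_count I = vertex_count I' \<and> period I = period I' \<and>
    (\<forall>u<vertex_count I. \<forall>v<vertex_count I. ({u, v} \<in> edges I \<longleftrightarrow> {u, v} \<in> edges I') \<and> bound I u v = bound I' u v)"
proof -
  define n where "n = vertex_count I"
  note eq = assms[unfolded encode_instance_def append_assoc]
  have n: "vertex_count I' = n" using encode_enat_append_eq[OF eq] by (simp add: n_def)
  note eq2 = encode_enat_append_eq[OF eq, THEN conjunct2]
  have per: "period I = period I'" using encode_enat_append_eq[OF eq2] by simp
  note eq3 = encode_enat_append_eq[OF eq2, THEN conjunct2]
  have "concat (map (\<lambda>u. map (\<lambda>v. {u, v} \<in> edges I) [0..<n]) [0..<n]) =
      concat (map (\<lambda>u. map (\<lambda>v. {u, v} \<in> edges I') [0..<n]) [0..<n]) \<and>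
    concat (concat (map (\<lambda>u. map (\<lambda>v. encode_enat (bound I u v)) [0..<n]) [0..<n])) =
    concat (concat (map (\<lambda>u. map (\<lambda>v. encode_enat (bound I' u v)) [0..<n]) [0..<n]))"
    using eq3 unfolding n n_def[symmetric] by (subst (asm) append_eq_append_conv) (simp_all add: length_pairs)
  then have e: "concat (map (\<lambda>u. map (\<lambda>v. {u, v} \<in> edges I) [0..<n]) [0..<n]) =
      concat (map (\<lambda>u. map (\<lambda>v. {u, v} \<in> edges I') [0..<n]) [0..<n])"
    and b: "concat (map encode_enat (concat (map (\<lambda>u. map (bound I u) [0..<n]) [0..<n]))) =
      concat (map encode_enat (concat (map (\<lambda>u. map (bound I' u) [0..<n]) [0..<n])))"
    by (simp_all add: map_concat comp_def)
  have "concat (map (\<lambda>u. map (bound I u) [0..<n]) [0..<n]) = concat (map (\<lambda>u. map (bound I' u) [0..<n]) [0..<n])"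
    using encode_list_inj[OF _ b] by (simp add: length_pairs)
  then show ?thesis using pairs_eqD[OF e] pairs_eqD n per by (auto simp: n_def[symmetric])
qed

text \<open>Membership only says that some yes-instance has the same code. The code fixes the bounds
  between vertices and, as the edges of a tree join vertices, the whole edge set; so both instances
  are realizable or neither is.\<close>

lemma encode_TTR_iff:
  assumes "I \<in> C" "valid_instance I"
  shows "encode_instance I \<in> TTR C \<longleftrightarrow> realizable I"
proof
  assume "encode_instance I \<in> TTR C"
  then obtain I' where I': "encode_instance I = encode_instance I'" "valid_instance I'" "realizable I'"
    by (auto simp: TTR_def)
  note eq = encode_instance_inj[OF I'(1)]
  have sub: "E1 \<subseteq> E2" if sb: "\<forall>u<n. \<forall>v<n. {u, v} \<in> E1 \<longleftrightarrow> {u, v} \<in> E2" "is_tree {..<n} E1" for E1 E2 and n :: nat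
  proof
    fix e assume "e \<in> E1"
    then obtain u v where "e = {u, v}" "u < n" "v < n"
      using sb(2) by (fastforce simp: is_tree_def fin_graph_def card_2_iff)
    then show "e \<in> E2" using sb(1) \<open>e \<in> E1\<close> by blast
  qed
  have "edges I = edges I'"
    using sub[of "vertex_count I" "edges I" "edges I'"] sub[of "vertex_count I" "edges I'" "edges I"]
      eq assms(2) I'(2) by (auto simp: valid_instance_def)
  then show "realizable I" using I'(3) eq unfolding realizable_def by auto
qed (use assms in \<open>auto simp: TTR_def\<close>)

lemma square_less_exp:
  fixes K :: nat
  obtains c where "\<And>P. c \<le> P \<Longrightarrow> K * P * P \<le> 2 ^ (P - 1)"
proof
  \<comment> \<open>From 12 on, the cube of \<open>P\<close> is at most \<open>2 ^ (P - 1)\<close>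
    (1728 against 2048 at the start), and \<open>K\<close> is absorbed by one factor
    \<open>P\<close>.\<close>
  fix P assume P: "max 12 K \<le> P"
  have "P * P * P \<le> 2 ^ (P - 1)" if "12 \<le> P" for P :: nat
    using that
  proof (induction P rule: dec_induct)
    case (step m)
    have "Suc m * Suc m * Suc m = m * m * m + 3 * (m * m) + 3 * m + 1" by (simp add: algebra_simps)
    also have "\<dots> \<le> m * m * m + m * m * m"
    proof -
      have "12 * (m * m) \<le> m * m * m" using step by simp
      moreover have "m \<le> m * m" "1 \<le> m * m" using step by simp_all
      ultimately show ?thesis by linarith
    qed
    also have "\<dots> \<le> 2 ^ (m - 1) + 2 ^ (m - 1)" using step by simp
    also have "\<dots> = 2 ^ (Suc m - 1)" using step by (cases m) simp_all
    finally show ?case .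
  qed simp
  moreover have "K * P * P \<le> P * P * P" using P by simp
  ultimately show "K * P * P \<le> 2 ^ (P - 1)" using P by (meson max.boundedE order_trans)
qed

theorem star_TTR_hard:
  assumes \<Delta>: "3 \<le> \<Delta>"
  shows "NP_hard (TTR (period_instances \<Delta>))" "NP_hard (TTR (period_instances \<Delta> \<inter> star_instances))"
proof -
  have "\<exists>f. poly_time_computable f \<and> (\<forall>x. (x \<in> A \<longleftrightarrow> f x \<in> TTR (period_instances \<Delta>)) \<and>
      (x \<in> A \<longleftrightarrow> f x \<in> TTR (period_instances \<Delta> \<inter> star_instances)))" if A: "in_NP A" for A
  proof -
    obtain C :: "kind schema set" where C: "finite C" "\<forall>(g, ls) \<in> C. ls \<noteq> []"
      "\<And>c. \<exists>a b. (\<forall>n. c \<le> poly a n) \<and>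
         (\<forall>x. x \<in> A \<longleftrightarrow> (\<exists>\<alpha>. satisfies (domain_word a b x) C \<alpha>))"
      using NP_as_clauses[OF A] by metis
    obtain cl where cl: "set cl = C" using finite_list[OF C(1)] by metis
    define ks where "ks = concat (map (\<lambda>(g, ls). map fst ls) cl)"
    have ks: "ls \<noteq> [] \<and> fst ` set ls \<subseteq> set ks" if "(g, ls) \<in> set cl" for g ls
    proof
      show "ls \<noteq> []" using that C(2) cl by auto
      have "set (map fst ls) \<subseteq> set ks"
        using that unfolding ks_def set_concat set_map by (intro Union_upper image_eqI[of _ _ "map fst ls"]) force+
      then show "fst ` set ls \<subseteq> set ks" by simp
    qed
    obtain c where c: "\<And>P. c \<le> P \<Longrightarrow> length (tags \<Delta> ks cl) * P * P \<le> 2 ^ (P - 1)"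
      using square_less_exp[of "length (tags \<Delta> ks cl)"] by metis
    obtain a b where ab: "\<forall>n. c \<le> poly a n"
      "\<And>x. x \<in> A \<longleftrightarrow> (\<exists>\<alpha>. satisfies (domain_word a b x) C \<alpha>)" using C(3) by metis
    have size: "length (tags \<Delta> ks cl) * length (domain_word a b x) * length (domain_word a b x)
      \<le> 2 ^ (length (domain_word a b x) - 1)" for x
    proof (rule c)
      have "poly a (length x) \<le> length (domain_word a b x)" by (simp add: domain_word_def Let_def)
      then show "c \<le> length (domain_word a b x)" using ab(1) order_trans by blast
    qed
    obtain f where f: "poly_time_computable f \<and>
      (\<forall>x. \<exists>I \<in> period_instances \<Delta> \<inter> star_instances. f x = encode_instance I \<and> valid_instance I \<and>
         (realizable I \<longleftrightarrow> (\<exists>\<alpha>. satisfies (domain_word a b x) (set cl) \<alpha>)))"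
      using colouring_reduction[OF \<Delta> ks size] ..
    have "(x \<in> A \<longleftrightarrow> f x \<in> TTR (period_instances \<Delta>)) \<and>
      (x \<in> A \<longleftrightarrow> f x \<in> TTR (period_instances \<Delta> \<inter> star_instances))" for x
    proof -
      obtain I where "I \<in> period_instances \<Delta> \<inter> star_instances" "f x = encode_instance I" "valid_instance I"
        "realizable I \<longleftrightarrow> x \<in> A" using f unfolding cl ab(2)[symmetric] by blast
      then show ?thesis
        using encode_TTR_iff[of I "period_instances \<Delta>"]
          encode_TTR_iff[of I "period_instances \<Delta> \<inter> star_instances"] by simp
    qed
    then show ?thesis using f by blast
  qed
  then show "NP_hard (TTR (period_instances \<Delta>))" "NP_hard (TTR (period_instances \<Delta> \<inter> star_instances))"
    unfolding NP_hard_def poly_reducible_def by blast+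
qed

section \<open>Paths in trees\<close>

lemma path_between_Cons:
  "path_between V E u v (u # p) \<longleftrightarrow> u \<in> V \<and> (if p = [] then u = v else
     u \<notin> set p \<and> {u, hd p} \<in> E \<and> path_between V E (hd p) v p)"
  by (auto simp: path_between_def successively_Cons)

lemma path_between_snoc:
  "path_between V E u v (p @ [v]) \<longleftrightarrow> v \<in> V \<and> (if p = [] then u = v else
     v \<notin> set p \<and> {last p, v} \<in> E \<and> path_between V E u (last p) p)"
  by (auto simp: path_between_def successively_append_iff)

lemma path_between_prefix:
  assumes "path_between V E u v (p @ w # q)"
  shows "path_between V E u w (p @ [w])"
  using assms by (auto simp: path_between_def successively_append_iff successively_Cons hd_append split: if_splits)

lemma successively_rev_edges:
  "successively (\<lambda>x y. {x, y} \<in> E) (rev xs) \<longleftrightarrow> successively (\<lambda>x y. {x, y} \<in> E) xs"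
  by (simp add: insert_commute)

text \<open>Where two paths with the same ends part, the first vertex of one that the other visits
  again closes a cycle: up to there the two segments have only the vertex of separation in
  common.\<close>

lemma path_unique:
  assumes "\<nexists>xs. is_cycle E xs" "path_between V E u v p" "path_between V E u v q"
  shows "p = q"
  using assms(2,3)
proof (induction p arbitrary: u q)
  case Nil
  then show ?case by (simp add: path_between_def)
next
  case (Cons u' p)
  have "u' = u" using Cons.prems(1) by (simp add: path_between_def)
  obtain q' where q: "q = u # q'" using Cons.prems(2) by (cases q) (auto simp: path_between_def)
  note P = Cons.prems(1)[unfolded \<open>u' = u\<close> path_between_Cons] and Q = Cons.prems(2)[unfolded q path_between_Cons]
  show ?case
  proof (cases "p = [] \<or> q' = []")
    case True
    have "p = [] \<longleftrightarrow> u = v" using P by (auto simp: path_between_def split: if_splits)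
    moreover have "q' = [] \<longleftrightarrow> u = v" using Q by (auto simp: path_between_def split: if_splits)
    ultimately show ?thesis using True q \<open>u' = u\<close> by simp
  next
    case False
    then have P': "path_between V E (hd p) v p" "u \<notin> set p" "{u, hd p} \<in> E"
      and Q': "path_between V E (hd q') v q'" "u \<notin> set q'" "{u, hd q'} \<in> E" using P Q by auto
    show ?thesis
    proof (cases "hd p = hd q'")
      case True
      then show ?thesis using Cons.IH[OF P'(1)] Q'(1) q \<open>u' = u\<close> by simp
    next
      case ne: False
      have "v \<in> set p" "v \<in> set q'"
        using P'(1) Q'(1) last_in_set[of p] last_in_set[of q'] by (auto simp: path_between_def)
      then have "\<exists>x\<in>set p. x \<in> set q'" by blast
      then obtain p1 z p2 where p: "p = p1 @ z # p2" "z \<in> set q'" "\<forall>x\<in>set p1. x \<notin> set q'"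
        using split_list_first_prop[of p "\<lambda>x. x \<in> set q'"] by blast
      obtain q1 q2 where q': "q' = q1 @ z # q2" using split_list[OF p(2)] by blast
      let ?c = "u # p1 @ [z] @ rev q1"
      have dist: "distinct ?c"
        using P' Q' p q' by (auto simp: path_between_def)
      have len: "3 \<le> length ?c" using ne p(1) q' by (cases p1; cases q1) auto
      have s1: "successively (\<lambda>x y. {x, y} \<in> E) (p1 @ [z])"
        using P'(1) p(1) by (auto simp: path_between_def successively_append_iff successively_Cons split: if_splits)
      have s2: "successively (\<lambda>x y. {x, y} \<in> E) (q1 @ [z])"
        using Q'(1) q' by (auto simp: path_between_def successively_append_iff successively_Cons split: if_splits)
      have s3: "successively (\<lambda>x y. {x, y} \<in> E) (z # rev q1)"
        using s2 successively_rev_edges[of E "q1 @ [z]"] by simp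
      have "successively (\<lambda>x y. {x, y} \<in> E) (p1 @ z # rev q1)"
        using s1 s3 by (auto simp: successively_append_iff)
      then have "successively (\<lambda>x y. {x, y} \<in> E) ?c"
        using P'(3) p(1) by (cases p1) (auto simp: successively_Cons)
      moreover have "{last ?c, hd ?c} \<in> E"
        using Q'(3) q' by (cases q1) (auto simp: insert_commute)
      ultimately have "is_cycle E ?c" using dist len unfolding is_cycle_def by blast
      then show ?thesis using assms(1) by blast
    qed
  qed
qed

lemma cycle_neighbours:
  assumes "is_cycle E xs" "v \<in> set xs"
  obtains a b where "a \<in> set xs" "b \<in> set xs" "a \<noteq> b" "{a, v} \<in> E" "{v, b} \<in> E"
proof -
  let ?l = "length xs"
  have l: "3 \<le> ?l" and d: "distinct xs" using assms by (auto simp: is_cycle_def)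
  obtain i where i: "i < ?l" "xs ! i = v" using assms(2) by (auto simp: in_set_conv_nth)
  have step: "{xs ! j, xs ! (Suc j mod ?l)} \<in> E" if "j < ?l" for j
  proof (cases "Suc j < ?l")
    case True
    then show ?thesis using assms(1) by (auto simp: is_cycle_def successively_conv_nth)
  next
    case False
    then have "Suc j = ?l" using that by simp
    then have "?l - 1 = j" "Suc j mod ?l = 0" "xs \<noteq> []" by auto
    then have "{xs ! j, xs ! (Suc j mod ?l)} = {last xs, hd xs}" by (simp add: last_conv_nth hd_conv_nth)
    then show ?thesis using assms(1) by (simp add: is_cycle_def)
  qed
  define j where "j = (if i = 0 then ?l - 1 else i - 1)"
  have j: "j < ?l" "Suc j mod ?l = i" using i l by (auto simp: j_def)
  have si: "Suc i mod ?l < ?l" using l by (intro mod_less_divisor) linarith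
  have "Suc i mod ?l \<noteq> j"
  proof (cases "Suc i < ?l")
    case True
    then show ?thesis using l by (auto simp: j_def)
  next
    case False
    then have "Suc i = ?l" using i by simp
    then show ?thesis using l by (auto simp: j_def)
  qed
  then have "xs ! j \<noteq> xs ! (Suc i mod ?l)" using d j si by (simp add: nth_eq_iff_index_eq)
  then show ?thesis using that[of "xs ! j" "xs ! (Suc i mod ?l)"] step[OF j(1)] step[OF i(1)] i j si by simp
qed

section \<open>Earliest arrival along a path\<close>

definition next_time :: "nat \<Rightarrow> nat \<Rightarrow> nat \<Rightarrow> nat" where
  "next_time \<Delta> l t = (LEAST t'. t < t' \<and> t' mod \<Delta> = l)"

lemma next_time:
  assumes "l < \<Delta>"
  shows "t < next_time \<Delta> l t" "next_time \<Delta> l t mod \<Delta> = l" "next_time \<Delta> l t \<le> t + \<Delta>"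
    "\<And>t'. t < t' \<Longrightarrow> t' mod \<Delta> = l \<Longrightarrow> next_time \<Delta> l t \<le> t'"
proof -
  \<comment> \<open>The wait is strictly positive: it is the full period when \<open>t\<close>
    already has the residue \<open>l\<close>.\<close>
  define d where "d = (if t mod \<Delta> < l then l - t mod \<Delta> else \<Delta> - (t mod \<Delta> - l))"
  have m: "t mod \<Delta> < \<Delta>" using assms by (intro mod_less_divisor) simp
  have d: "0 < d \<and> d \<le> \<Delta>"
    using m assms unfolding d_def if_split[of "\<lambda>x. 0 < x \<and> x \<le> \<Delta>"] by linarith
  have "(t + d) mod \<Delta> = (t mod \<Delta> + d) mod \<Delta>" by (rule mod_add_left_eq[symmetric])
  also have "\<dots> = l"
  proof (cases "t mod \<Delta> < l")
    case False
    then have "t mod \<Delta> + d = \<Delta> + l" using less_imp_le[OF m] unfolding d_def if_not_P[OF False] by linarith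
    then have "(t mod \<Delta> + d) mod \<Delta> = (\<Delta> + l) mod \<Delta>" by (rule arg_cong)
    then show ?thesis using assms by simp
  qed (use assms in \<open>simp add: d_def\<close>)
  finally have w: "t < t + d \<and> (t + d) mod \<Delta> = l" using d by simp
  show "t < next_time \<Delta> l t" "next_time \<Delta> l t mod \<Delta> = l"
    unfolding next_time_def using LeastI[of "\<lambda>t'. t < t' \<and> t' mod \<Delta> = l", OF w] by simp_all
  show "next_time \<Delta> l t \<le> t'" if "t < t'" "t' mod \<Delta> = l" for t'
    unfolding next_time_def by (rule Least_le) (use that in simp)
  from this[of "t + d"] show "next_time \<Delta> l t \<le> t + \<Delta>" using w d by simp
qed

text \<open>The arrival time for the reversed path, starting with the first activity of the first edge.\<close>

fun arrival :: "(nat set \<Rightarrow> nat) \<Rightarrow> nat \<Rightarrow> nat list \<Rightarrow> nat" where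
  "arrival lam \<Delta> (v # w # x # p) = next_time \<Delta> (lam {w, v}) (arrival lam \<Delta> (w # x # p))"
| "arrival lam \<Delta> (v # w # []) = lam {w, v}"
| "arrival lam \<Delta> _ = 0"

lemma arrival_Cons_Cons:
  "arrival lam \<Delta> (v # w # p) = (if p = [] then lam {w, v} else next_time \<Delta> (lam {w, v}) (arrival lam \<Delta> (w # p)))"
  by (cases p) auto

text \<open>Each further edge costs at most one period, so the times of the greedy journey stay
  below the number of vertices times \<open>\<Delta>\<close> and fit into a domain of polynomial
  size.\<close>

lemma arrival_bound:
  assumes "0 < \<Delta>" "\<And>e. e \<in> E \<Longrightarrow> lam e < \<Delta>" "successively (\<lambda>x y. {x, y} \<in> E) p"
  shows "arrival lam \<Delta> p < length p * \<Delta> + (if p = [] then 1 else 0)"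
  using assms(3)
proof (induction p)
  case (Cons v p)
  show ?case
  proof (cases p)
    case p: (Cons w q)
    then have l: "lam {w, v} < \<Delta>" using Cons.prems assms(2) by (simp add: insert_commute)
    have "arrival lam \<Delta> p < length p * \<Delta>" using Cons p by (simp add: successively_Cons)
    then have "next_time \<Delta> (lam {w, v}) (arrival lam \<Delta> p) < length p * \<Delta> + \<Delta>"
      using next_time(3)[OF l, of "arrival lam \<Delta> p"] by linarith
    then show ?thesis using l p by (auto simp: arrival_Cons_Cons)
  qed (use assms(1) in simp)
qed simp

lemma temporal_path_snoc:
  "temporal_path E \<Delta> lam u z (P @ [(x, y, t)]) \<longleftrightarrow>
     y = z \<and> {x, y} \<in> E \<and> active_at \<Delta> lam {x, y} t \<and> y \<notin> set (u # map (fst \<circ> snd) P) \<and>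
     (if P = [] then x = u else temporal_path E \<Delta> lam u x P \<and> snd (snd (last P)) < t)"
proof (cases "P = []")
  case True
  then show ?thesis by (auto simp: temporal_path_def)
next
  case False
  let ?vs = "u # map (fst \<circ> snd) P"
  have "(\<forall>i<length (P @ [(x, y, t)]). fst ((P @ [(x, y, t)]) ! i) = (?vs @ [y]) ! i) \<longleftrightarrow>
      (\<forall>i<length P. fst (P ! i) = ?vs ! i) \<and> x = last ?vs"
    using False by (auto simp: less_Suc_eq nth_append last_conv_nth nth_Cons')
  moreover have "(\<forall>s\<in>snd ` snd ` set P. s < t) \<longleftrightarrow> snd (snd (last P)) < t"
    if "sorted_wrt (<) (map (snd \<circ> snd) P)"
  proof -
    obtain P' l where "P = P' @ [l]" using False by (cases P rule: rev_cases) auto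
    then show ?thesis using that by (auto simp: sorted_wrt_append intro: less_trans)
  qed
  ultimately show ?thesis
    using False unfolding temporal_path_def Let_def
    by (auto simp: sorted_wrt_append image_image)
qed

lemma temporal_path_route:
  assumes "\<Union>E \<subseteq> V" "temporal_path E \<Delta> lam u v P"
  shows "path_between V E u v (u # map (fst \<circ> snd) P)"
proof -
  have "P \<noteq> []" using assms(2) by (simp add: temporal_path_def)
  then show ?thesis using assms(2)
  proof (induction P arbitrary: v rule: rev_nonempty_induct)
    case (single a)
    obtain x y t where "a = (x, y, t)" by (cases a)
    then show ?case using single temporal_path_snoc[of E \<Delta> lam u v "[]"] assms(1)
      by (auto simp: path_between_def)
  next
    case (snoc a P)
    obtain x y t where a: "a = (x, y, t)" by (cases a)
    note s = snoc.prems[unfolded a temporal_path_snoc]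
    have "temporal_path E \<Delta> lam u x P" using s snoc.hyps by simp
    from snoc.IH[OF this] have "path_between V E u x (u # map (fst \<circ> snd) P)" .
    moreover have "last (u # map (fst \<circ> snd) P) = x" using calculation by (simp add: path_between_def)
    ultimately show ?case using s path_between_snoc[of V E u v "u # map (fst \<circ> snd) P"] assms(1)
      by (auto simp: a comp_def)
  qed
qed

text \<open>Shifted back by \<open>m\<close> periods, a temporal path starts at the first activity
  of its first edge. From then on the greedy journey reaches each vertex no later, since the labels
  repeat with the period. Hence no temporal path along this route is shorter in duration.\<close>

lemma arrival_le_last:
  assumes "0 < \<Delta>" "\<And>e. e \<in> E \<Longrightarrow> lam e < \<Delta>" "temporal_path E \<Delta> lam u v P"
  shows "\<exists>m. snd (snd (hd P)) = lam {u, fst (snd (hd P))} + m * \<Delta> \<and>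
    arrival lam \<Delta> (rev (u # map (fst \<circ> snd) P)) + m * \<Delta> \<le> snd (snd (last P))"
proof -
  have "P \<noteq> []" using assms(3) by (simp add: temporal_path_def)
  then show ?thesis using assms(3)
  proof (induction P arbitrary: v rule: rev_nonempty_induct)
    case (single a)
    obtain x y t where "a = (x, y, t)" by (cases a)
    then show ?case using single temporal_path_snoc[of E \<Delta> lam u v "[]"]
      by (auto simp: active_at_def)
  next
    case (snoc a P)
    obtain x y t where a: "a = (x, y, t)" by (cases a)
    have tp: "temporal_path E \<Delta> lam u x P" and lt: "snd (snd (last P)) < t" and e: "{x, v} \<in> E" "y = v"
      and act: "active_at \<Delta> lam {x, v} t"
      using snoc.prems snoc.hyps by (auto simp: a temporal_path_snoc)
    obtain m where m: "snd (snd (hd P)) = lam {u, fst (snd (hd P))} + m * \<Delta>"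
      "arrival lam \<Delta> (rev (u # map (fst \<circ> snd) P)) + m * \<Delta> \<le> snd (snd (last P))"
      using snoc.IH[OF tp] by blast
    have "last (u # map (fst \<circ> snd) P) = x" using tp unfolding temporal_path_def Let_def by blast
    then obtain q where q: "rev (u # map (fst \<circ> snd) P) = x # q"
      by (cases "u # map (fst \<circ> snd) P" rule: rev_cases) auto
    have "q \<noteq> []" using arg_cong[OF q, of length] snoc.hyps by auto
    have l: "lam {x, v} < \<Delta>" using assms(2) e by blast
    let ?r = "arrival lam \<Delta> (x # q)"
    have lt': "?r < t - m * \<Delta>" "m * \<Delta> \<le> t" using m(2) lt unfolding q by simp_all
    obtain i where i: "t = lam {x, v} + i * \<Delta>" using act by (auto simp: active_at_def)
    have "(t - m * \<Delta>) mod \<Delta> = lam {x, v}"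
    proof -
      have "(t - m * \<Delta>) mod \<Delta> = ((t - m * \<Delta>) + m * \<Delta>) mod \<Delta>" by (rule mod_mult_self1[symmetric])
      also have "\<dots> = lam {x, v}" unfolding le_add_diff_inverse2[OF lt'(2)] unfolding i using l by simp
      finally show ?thesis .
    qed
    then have "next_time \<Delta> (lam {x, v}) ?r \<le> t - m * \<Delta>" using next_time(4)[OF l lt'(1)] by blast
    then have "arrival lam \<Delta> (v # rev (u # map (fst \<circ> snd) P)) + m * \<Delta> \<le> t"
      unfolding q using \<open>q \<noteq> []\<close> lt' by (simp add: arrival_Cons_Cons)
    then show ?case using m(1) snoc.hyps e(2)
      by (intro exI[of _ m]) (simp add: a comp_def)
  qed
qed

section \<open>Comparing numbers bit by bit\<close>

lemma less_if_bit:
  fixes x d :: nat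
  assumes "bit d j" "\<not> bit x j" "\<And>k. j < k \<Longrightarrow> bit d k \<longleftrightarrow> bit x k"
  shows "x < d"
proof -
  have "drop_bit (Suc j) d = drop_bit (Suc j) x"
    using assms(3) by (auto simp: bit_eq_iff bit_drop_bit_eq)
  then have "d div 2 ^ j div 2 = x div 2 ^ j div 2"
    by (simp add: drop_bit_eq_div div_mult2_eq[symmetric] mult.commute)
  moreover have "odd (d div 2 ^ j)" "even (x div 2 ^ j)"
    using assms(1,2) by (simp_all add: bit_iff_odd)
  moreover have "n < m" if "m div 2 = n div 2" "odd m" "even n" for m n :: nat
    using that by presburger
  ultimately have "x div 2 ^ j < d div 2 ^ j" by blast
  then show ?thesis using div_le_mono[of d x "2 ^ j"] by linarith
qed

lemma bit_less_self: "bit m j \<Longrightarrow> j < (m :: nat)"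
proof (rule ccontr)
  assume "bit m j" "\<not> j < m"
  then have "m < 2 ^ j" using less_exp[of j] by linarith
  then show False using \<open>bit m j\<close> by (simp add: bit_iff_odd)
qed

text \<open>The most significant differing bit decides. Stated this way, the comparison is
  first-order over bit positions and applies to bounds of exponential size.\<close>

lemma less_iff_bit:
  fixes x d :: nat
  shows "x < d \<longleftrightarrow> (\<exists>j. bit d j \<and> \<not> bit x j \<and> (\<forall>k>j. bit d k \<longleftrightarrow> bit x k))"
proof
  assume "x < d"
  define S where "S = {j. bit d j \<noteq> bit x j}"
  have "S \<subseteq> {..<d + x}" using bit_less_self by (fastforce simp: S_def)
  then have fin: "finite S" using finite_subset by blast
  have "S \<noteq> {}" using \<open>x < d\<close> bit_eqI[of x d] by (auto simp: S_def)
  then have M: "Max S \<in> S" using fin by simp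
  have above: "bit d k \<longleftrightarrow> bit x k" if "Max S < k" for k
  proof (rule ccontr)
    assume "bit d k \<noteq> bit x k"
    then have "k \<le> Max S" by (intro Max_ge[OF fin]) (simp add: S_def)
    then show False using that by simp
  qed
  have "bit d (Max S)"
  proof (rule ccontr)
    assume "\<not> bit d (Max S)"
    then have "d < x" using less_if_bit[of x "Max S" d] M above unfolding S_def mem_Collect_eq by blast
    then show False using \<open>x < d\<close> by simp
  qed
  then show "\<exists>j. bit d j \<and> \<not> bit x j \<and> (\<forall>k>j. bit d k \<longleftrightarrow> bit x k)"
    using M above unfolding S_def mem_Collect_eq by blast
qed (use less_if_bit in blast)

text \<open>The carry reaches bit \<open>j\<close> iff all lower bits are one. A certificate uses
  this recursion to pin down the bits of time differences, starting from 0.\<close>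

lemma bit_Suc_nat: "bit (Suc m) j \<longleftrightarrow> (bit m j \<noteq> (\<forall>k<j. bit m k))"
proof (induction j arbitrary: m)
  case (Suc j)
  have "(\<forall>k<Suc j. bit m k) \<longleftrightarrow> odd m \<and> (\<forall>k<j. bit (m div 2) k)"
    by (auto simp: bit_Suc less_Suc_eq_0_disj bit_0)
  moreover have "Suc m div 2 = (if odd m then Suc (m div 2) else m div 2)" by auto
  ultimately show ?case using Suc[of "m div 2"] by (auto simp: bit_Suc)
qed (simp add: bit_0)

definition bits_nat :: "nat \<Rightarrow> (nat \<Rightarrow> bool) \<Rightarrow> nat" where
  "bits_nat P f = horner_sum of_bool 2 (map f [0..<P])"

lemma bit_bits_nat: "bit (bits_nat P f) j \<longleftrightarrow> j < P \<and> f j"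
  by (auto simp: bits_nat_def bit_horner_sum_bit_iff)

lemma bits_nat_bit: "d < 2 ^ P \<Longrightarrow> bits_nat P (bit d) = d"
  by (simp add: bits_nat_def horner_sum_bit_eq_take_bit take_bit_nat_eq_self)

text \<open>A bit belongs to the representation without leading zeros iff some bit at or above it is
  set, a condition that a generator can test while it prints the bits in order.\<close>

lemma binary_bits_nat:
  "concat (map (\<lambda>b. [True, b]) (binary (bits_nat P f))) =
   concat (map (\<lambda>j. if \<exists>k<P. j \<le> k \<and> f k then [True, f j] else []) [0..<P])"
proof (induction P arbitrary: f)
  case (Suc P)
  have B: "bits_nat (Suc P) f = of_bool (f 0) + 2 * bits_nat P (\<lambda>j. f (Suc j))"
    by (simp add: bits_nat_def upt_conv_Cons map_Suc_upt[symmetric] comp_def del: upt_Suc map_Suc_upt)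
  have S: "(\<exists>k<Suc P. Suc j \<le> k \<and> f k) \<longleftrightarrow> (\<exists>k<P. j \<le> k \<and> f (Suc k))" for j
    by (metis Suc_le_D Suc_le_mono Suc_less_eq)
  have Z: "(\<exists>k<Suc P. 0 \<le> k \<and> f k) \<longleftrightarrow> f 0 \<or> (\<exists>k<P. f (Suc k))"
    by (metis Suc_less_eq gr0_conv_Suc not_gr0 zero_le zero_less_Suc)
  have N: "bits_nat P (\<lambda>j. f (Suc j)) = 0 \<longleftrightarrow> \<not> (\<exists>k<P. f (Suc k))"
    by (auto simp: bit_eq_iff bit_bits_nat)
  have e: "[0..<Suc P] = 0 # map Suc [0..<P]" by (simp add: upt_conv_Cons map_Suc_upt del: upt_Suc)
  have "binary (bits_nat (Suc P) f) =
      (if \<exists>k<Suc P. 0 \<le> k \<and> f k then f 0 # binary (bits_nat P (\<lambda>j. f (Suc j))) else [])"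
    unfolding Z B using N by (subst binary.simps) (auto simp: binary.simps[of 0])
  then show ?case unfolding e
    using Suc[of "\<lambda>j. f (Suc j)"] S Z by (auto simp: comp_def binary.simps[of 0])
qed (simp add: bits_nat_def binary.simps)

lemma length_encode_enat: "length (encode_enat (enat m)) = 2 * length (binary m) + 2"
  by (simp add: encode_enat_def length_concat comp_def sum_list_triv)

lemma less_exp_length_binary: "m < 2 ^ length (binary m)"
  using bits_value_less[of "binary m"] by (simp add: bits_value_binary)

section \<open>Certificates\<close>

definition Imp :: "fm \<Rightarrow> fm \<Rightarrow> fm" where "Imp \<phi> \<psi> = Or (Neg \<phi>) \<psi>"
definition Conj :: "fm list \<Rightarrow> fm" where "Conj \<phi>s = foldr And \<phi>s (Bool True)"
definition Disj :: "fm list \<Rightarrow> fm" where "Disj \<phi>s = foldr Or \<phi>s (Bool False)"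

lemma Imp_simps [simp]:
  "holds P w R (Imp \<phi> \<psi>) e \<longleftrightarrow> (holds P w R \<phi> e \<longrightarrow> holds P w R \<psi> e)"
  "bound_vars (Imp \<phi> \<psi>) = bound_vars \<phi> \<union> bound_vars \<psi>" "fm_ok n (Imp \<phi> \<psi>) \<longleftrightarrow> fm_ok n \<phi> \<and> fm_ok n \<psi>"
  by (auto simp: Imp_def)

lemma Conj_simps [simp]:
  "holds P w R (Conj \<phi>s) e \<longleftrightarrow> (\<forall>\<phi>\<in>set \<phi>s. holds P w R \<phi> e)"
  "bound_vars (Conj \<phi>s) = (\<Union>\<phi>\<in>set \<phi>s. bound_vars \<phi>)" "0 < n \<Longrightarrow> fm_ok n (Conj \<phi>s) \<longleftrightarrow> (\<forall>\<phi>\<in>set \<phi>s. fm_ok n \<phi>)"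
  unfolding Conj_def by (induction \<phi>s) auto

lemma Disj_simps [simp]:
  "holds P w R (Disj \<phi>s) e \<longleftrightarrow> (\<exists>\<phi>\<in>set \<phi>s. holds P w R \<phi> e)"
  "bound_vars (Disj \<phi>s) = (\<Union>\<phi>\<in>set \<phi>s. bound_vars \<phi>)" "0 < n \<Longrightarrow> fm_ok n (Disj \<phi>s) \<longleftrightarrow> (\<forall>\<phi>\<in>set \<phi>s. fm_ok n \<phi>)"
  unfolding Disj_def by (induction \<phi>s) auto

text \<open>The relations of a certificate: \<open>R 0 u u u\<close> says that \<open>u\<close> is a vertex, \<open>R 1 u v v\<close> that \<open>u\<close> and
  \<open>v\<close> are adjacent, \<open>R 2 u v v\<close> that the bound for \<open>u\<close> and \<open>v\<close> is infinite; \<open>R 3 u v\<close> are the bits of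
  this bound otherwise. \<open>R 4 u v\<close> is the set of times at which the edge \<open>{u, v}\<close> is active. On the
  temporal path from \<open>u\<close> to \<open>v\<close>, the vertex before \<open>v\<close> is given by \<open>R 5 u v\<close>, the last time by
  \<open>R 6 u v\<close> and the first time by \<open>R 7 u v\<close>. Finally, \<open>R 8 s t\<close> are the bits of \<open>t - s\<close>, and
  \<open>R (9 + c) t t t\<close> says that \<open>t\<close> is congruent to \<open>c\<close> modulo the period.\<close>

definition is_vertex :: "nat \<Rightarrow> fm" where "is_vertex a = Rel 0 a a a"
definition adjacent :: "nat \<Rightarrow> nat \<Rightarrow> fm" where "adjacent a b = Rel 1 a b b"
definition unbounded :: "nat \<Rightarrow> nat \<Rightarrow> fm" where "unbounded a b = Rel 2 a b b"
definition residue :: "nat \<Rightarrow> nat \<Rightarrow> fm" where "residue c a = Rel (9 + c) a a a"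

lemmas atom_defs = is_vertex_def adjacent_def unbounded_def residue_def

text \<open>The period is a constant of the formula, so its residues can be listed as finitely many
  relations instead of being computed.\<close>

definition check :: "bool \<Rightarrow> nat \<Rightarrow> fm" where
  "check star \<Delta> = Conj [
     Ex 0 (is_vertex 0),
     All 0 (All 1 (Imp (And (Less 0 1) (is_vertex 1)) (is_vertex 0))),
     All 0 (All 1 (Imp (adjacent 0 1) (Conj [is_vertex 0, is_vertex 1, adjacent 1 0, Neg (Eq 0 1)]))),
     All 3 (Imp (Zero 3) (Conj (map (\<lambda>c. Iff (residue c 3) (Bool (c = 0))) [0..<\<Delta>]))),
     All 3 (All 5 (Imp (Succ 3 5)
       (Conj (map (\<lambda>c. Iff (residue (Suc c mod \<Delta>) 5) (residue c 3)) [0..<\<Delta>])))),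
     All 0 (All 1 (Imp (adjacent 0 1)
       (Disj (map (\<lambda>c. All 3 (Iff (Rel 4 0 1 3) (residue c 3))) [0..<\<Delta>])))),
     All 0 (All 1 (All 3 (Imp (Rel 4 0 1 3) (Rel 4 1 0 3)))),
     Conj (map (\<lambda>i. All 0 (All 1 (All 2 (All 3 (Imp (And (Rel i 0 1 2) (Rel i 0 1 3)) (Eq 2 3)))))) [5, 6, 7]),
     All 0 (All 1 (Imp (Conj [is_vertex 0, is_vertex 1, Neg (Eq 0 1)])
       (Ex 2 (Ex 3 (Ex 4 (Conj [Rel 5 0 1 2, Rel 6 0 1 3, Rel 7 0 1 4, adjacent 2 1, Rel 4 2 1 3,
         Or (And (Eq 2 0) (Eq 4 3))
            (And (Neg (Eq 2 0)) (And (Rel 7 0 2 4) (Ex 5 (And (Rel 6 0 2 5) (Less 5 3))))),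
         Or (unbounded 0 1) (Ex 6 (Conj [Rel 3 0 1 6, Neg (Rel 8 4 3 6),
           All 7 (Imp (Less 6 7) (Iff (Rel 3 0 1 7) (Rel 8 4 3 7)))]))])))))),
     All 2 (All 0 (All 1 (Imp (And (Zero 2) (adjacent 0 1))
       (Or (And (Neg (Eq 0 2)) (Rel 5 2 0 1)) (And (Neg (Eq 1 2)) (Rel 5 2 1 0)))))),
     All 4 (All 6 (Neg (Rel 8 4 4 6))),
     All 4 (All 3 (All 5 (Imp (And (Neg (Less 3 4)) (Succ 3 5)) (All 6 (Iff (Rel 8 4 5 6)
       (Neg (Iff (Rel 8 4 3 6) (All 7 (Imp (Less 7 6) (Rel 8 4 3 7)))))))))),
     if star then Ex 2 (And (is_vertex 2) (All 0 (All 1 (Iff (adjacent 0 1)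
       (Conj [is_vertex 0, is_vertex 1, Neg (Eq 0 1), Or (Eq 0 2) (Eq 1 2)])))))
     else Bool True]"

text \<open>The formulas have order but no arithmetic, so residues and differences are pinned down
  by recursion along the successor. A journey is described by its last step and the journey to the
  vertex before; the times strictly decrease backwards, so this is well-founded and cannot run in
  circles.\<close>

locale certificate =
  fixes \<Delta> P :: nat and R :: "nat \<Rightarrow> nat \<Rightarrow> nat \<Rightarrow> nat \<Rightarrow> bool"
  assumes vertex: "\<exists>u<P. R 0 u u u"
    and downward: "\<forall>u<P. \<forall>v<P. u < v \<and> R 0 v v v \<longrightarrow> R 0 u u u"
    and adjacency: "\<forall>u<P. \<forall>v<P. R 1 u v v \<longrightarrow> R 0 u u u \<and> R 0 v v v \<and> R 1 v u u \<and> u \<noteq> v"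
    and residue_0: "\<forall>t<P. t = 0 \<longrightarrow> (\<forall>c<\<Delta>. R (9 + c) t t t \<longleftrightarrow> c = 0)"
    and residue_Suc: "\<forall>t<P. \<forall>t'<P. t' = Suc t \<longrightarrow>
      (\<forall>c<\<Delta>. R (9 + Suc c mod \<Delta>) t' t' t' \<longleftrightarrow> R (9 + c) t t t)"
    and labels: "\<forall>u<P. \<forall>v<P. R 1 u v v \<longrightarrow> (\<exists>c<\<Delta>. \<forall>t<P. R 4 u v t \<longleftrightarrow> R (9 + c) t t t)"
    and active_sym: "\<forall>u<P. \<forall>v<P. \<forall>t<P. R 4 u v t \<longrightarrow> R 4 v u t"
    and functional: "\<forall>i\<in>{5, 6, 7}. \<forall>u<P. \<forall>v<P. \<forall>a<P. \<forall>b<P. R i u v a \<and> R i u v b \<longrightarrow> a = b"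
    and path: "\<forall>u<P. \<forall>v<P. R 0 u u u \<and> R 0 v v v \<and> u \<noteq> v \<longrightarrow>
      (\<exists>w<P. \<exists>t<P. \<exists>s<P. R 5 u v w \<and> R 6 u v t \<and> R 7 u v s \<and> R 1 w v v \<and> R 4 w v t \<and>
        (w = u \<and> s = t \<or> w \<noteq> u \<and> R 7 u w s \<and> (\<exists>t'<P. R 6 u w t' \<and> t' < t)) \<and>
        (R 2 u v v \<or> (\<exists>j<P. R 3 u v j \<and> \<not> R 8 s t j \<and> (\<forall>k<P. j < k \<longrightarrow> (R 3 u v k \<longleftrightarrow> R 8 s t k)))))"
    and parent: "\<forall>r<P. \<forall>u<P. \<forall>v<P. r = 0 \<and> R 1 u v v \<longrightarrow> u \<noteq> r \<and> R 5 r u v \<or> v \<noteq> r \<and> R 5 r v u"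
    and difference_0: "\<forall>s<P. \<forall>j<P. \<not> R 8 s s j"
    and difference_Suc: "\<forall>s<P. \<forall>t<P. \<forall>t'<P. \<not> t < s \<and> t' = Suc t \<longrightarrow>
      (\<forall>j<P. R 8 s t' j \<longleftrightarrow> (R 8 s t j \<noteq> (\<forall>k<P. k < j \<longrightarrow> R 8 s t k)))"

definition star_certificate :: "nat \<Rightarrow> (nat \<Rightarrow> nat \<Rightarrow> nat \<Rightarrow> nat \<Rightarrow> bool) \<Rightarrow> bool" where
  "star_certificate P R \<longleftrightarrow> (\<exists>c<P. R 0 c c c \<and>
     (\<forall>u<P. \<forall>v<P. R 1 u v v \<longleftrightarrow> R 0 u u u \<and> R 0 v v v \<and> u \<noteq> v \<and> (u = c \<or> v = c)))"

lemma holds_check: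
  "holds P w R (check star \<Delta>) e \<longleftrightarrow> certificate \<Delta> P R \<and> (star \<longrightarrow> star_certificate P R)"
proof -
  have "(\<forall>c\<in>{..<\<Delta>}. Q c) \<longleftrightarrow> (\<forall>c<\<Delta>. Q c)" "(\<exists>c\<in>{..<\<Delta>}. Q c) \<longleftrightarrow> (\<exists>c<\<Delta>. Q c)" for Q by auto
  then show ?thesis unfolding certificate_def star_certificate_def check_def by (simp add: atom_defs atLeast0LessThan conj_assoc)
qed

lemma fm_ok_check: "fm_ok 10 (check star \<Delta>)"
  by (auto simp: check_def atom_defs)

lemma length_le_duration:
  assumes "temporal_path E \<Delta> lam u v P"
  shows "length P \<le> duration P"
proof -
  have "P \<noteq> []" using assms by (simp add: temporal_path_def)
  then have "length P + snd (snd (hd P)) \<le> Suc (snd (snd (last P)))"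
    using assms
  proof (induction P arbitrary: v rule: rev_nonempty_induct)
    case (snoc a P)
    obtain x y t where a: "a = (x, y, t)" by (cases a)
    have "temporal_path E \<Delta> lam u x P" "snd (snd (last P)) < t"
      using snoc.prems snoc.hyps by (auto simp: a temporal_path_snoc)
    then have "length P + snd (snd (hd P)) \<le> Suc (snd (snd (last P)))" "snd (snd (last P)) < t"
      using snoc.IH by blast+
    then show ?case using snoc.hyps by (simp add: a)
  qed simp
  then show ?thesis by (simp add: duration_def)
qed

section \<open>The instance described by a certificate\<close>

context certificate
begin

definition size :: nat where "size = card {u. u < P \<and> R 0 u u u}"
definition edge_set :: "nat set set" where "edge_set = {{u, v} | u v. u < P \<and> v < P \<and> R 1 u v v}"
definition upper_bound :: "nat \<Rightarrow> nat \<Rightarrow> enat" where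
  "upper_bound u v = (if R 2 u v v then \<infinity> else enat (bits_nat P (R 3 u v)))"
definition inst :: ttr_instance where
  "inst = \<lparr>vertex_count = size, edges = edge_set, bound = upper_bound, period = \<Delta>\<rparr>"

lemma vertex_iff: "{u. u < P \<and> R 0 u u u} = {..<size}"
proof -
  define S where "S = {u. u < P \<and> R 0 u u u}"
  have fin: "finite S" and ne: "S \<noteq> {}" using vertex by (auto simp: S_def)
  have "S = {..Max S}"
  proof (intro equalityI subsetI)
    fix u assume "u \<in> {..Max S}"
    moreover have "Max S \<in> S" using Max_in fin ne by blast
    ultimately show "u \<in> S" using downward unfolding S_def
      by (metis (mono_tags, lifting) atMost_iff le_eq_less_or_eq le_less_trans mem_Collect_eq)
  qed (use fin in simp)
  then have S: "S = {..<Suc (Max S)}" by (simp add: lessThan_Suc_atMost)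
  then have "card S = Suc (Max S)" by (metis card_lessThan)
  then show ?thesis using S by (simp add: S_def size_def)
qed

lemma size_le: "size \<le> P" and size_pos: "0 < size" and R_0: "u < P \<Longrightarrow> R 0 u u u \<longleftrightarrow> u < size"
  and size_less: "u < size \<Longrightarrow> u < P \<and> R 0 u u u"
proof -
  show R_0: "u < P \<Longrightarrow> R 0 u u u \<longleftrightarrow> u < size" for u using vertex_iff by blast
  show less: "u < size \<Longrightarrow> u < P \<and> R 0 u u u" for u using vertex_iff by blast
  show "0 < size" using vertex R_0 by force
  show "size \<le> P" using less[of P] by force
qed

lemma edge_iff: "u < P \<Longrightarrow> v < P \<Longrightarrow> {u, v} \<in> edge_set \<longleftrightarrow> R 1 u v v"
  unfolding edge_set_def using adjacency by (auto simp: doubleton_eq_iff)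

lemma edgeE:
  assumes "e \<in> edge_set"
  obtains u v where "e = {u, v}" "R 1 u v v" "u < size" "v < size" "u \<noteq> v"
proof -
  obtain u v where "e = {u, v}" "R 1 u v v" "u < P" "v < P" using assms by (auto simp: edge_set_def)
  then show ?thesis using that adjacency R_0 by blast
qed

lemma edge_set_subset: "\<Union>edge_set \<subseteq> {..<size}"
  by (auto elim: edgeE)

lemma difference:
  assumes "s \<le> t" "t < P" "j < P"
  shows "R 8 s t j \<longleftrightarrow> bit (t - s) j"
  using assms
proof (induction t arbitrary: j rule: dec_induct)
  case base
  then show ?case using difference_0 by simp
next
  case (step t)
  have "R 8 s (Suc t) j \<longleftrightarrow> (R 8 s t j \<noteq> (\<forall>k<P. k < j \<longrightarrow> R 8 s t k))"
    using difference_Suc step.prems step.hyps(1) by simp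
  also have "(\<forall>k<P. k < j \<longrightarrow> R 8 s t k) \<longleftrightarrow> (\<forall>k<j. bit (t - s) k)"
    using step by (metis less_trans Suc_lessD)
  also have "(R 8 s t j \<noteq> (\<forall>k<j. bit (t - s) k)) \<longleftrightarrow> bit (Suc (t - s)) j"
    unfolding bit_Suc_nat using step by simp
  finally show ?case using step by (simp add: Suc_diff_le)
qed

lemma path_step:
  assumes "u < size" "v < size" "u \<noteq> v"
  obtains w t s where "w < P" "t < P" "s < P" "R 5 u v w" "R 6 u v t" "R 7 u v s" "R 1 w v v" "R 4 w v t"
    "w = u \<and> s = t \<or> w \<noteq> u \<and> R 7 u w s \<and> (\<exists>t'<P. R 6 u w t' \<and> t' < t)"
    "R 2 u v v \<or> (\<exists>j<P. R 3 u v j \<and> \<not> R 8 s t j \<and> (\<forall>k<P. j < k \<longrightarrow> (R 3 u v k \<longleftrightarrow> R 8 s t k)))"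
proof -
  have uv: "u < P" "v < P" "R 0 u u u \<and> R 0 v v v \<and> u \<noteq> v" using assms size_less by simp_all
  from path[rule_format, OF uv] show thesis
    by (elim exE conjE) (rule that; assumption)
qed

text \<open>The duration \<open>t + 1 - s\<close> is at most a number iff \<open>t - s\<close> is
  strictly less, so the bits of \<open>t - s\<close> are compared strictly.\<close>

lemma bound_check:
  assumes "s \<le> t" "t < P"
    "R 2 u v v \<or> (\<exists>j<P. R 3 u v j \<and> \<not> R 8 s t j \<and> (\<forall>k<P. j < k \<longrightarrow> (R 3 u v k \<longleftrightarrow> R 8 s t k)))"
  shows "enat (t + 1 - s) \<le> upper_bound u v"
proof (cases "R 2 u v v")
  case False
  then obtain j where j: "j < P" "R 3 u v j" "\<not> bit (t - s) j"
    "\<And>k. k < P \<Longrightarrow> j < k \<Longrightarrow> R 3 u v k \<longleftrightarrow> bit (t - s) k"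
    using assms difference by auto
  have "t - s < bits_nat P (R 3 u v)"
  proof (rule less_if_bit)
    show "bit (bits_nat P (R 3 u v)) j" "\<not> bit (t - s) j" using j by (simp_all add: bit_bits_nat)
    fix k assume "j < k"
    show "bit (bits_nat P (R 3 u v)) k \<longleftrightarrow> bit (t - s) k"
    proof (cases "k < P")
      case False
      then have "\<not> bit (t - s) k" using bit_less_self[of "t - s" k] assms by auto
      then show ?thesis using False by (simp add: bit_bits_nat)
    qed (use j \<open>j < k\<close> in \<open>simp add: bit_bits_nat\<close>)
  qed
  then show ?thesis using False assms(1) by (simp add: upper_bound_def)
qed (simp add: upper_bound_def)

context
  assumes period: "0 < \<Delta>"
begin

lemma residue: "t < P \<Longrightarrow> c < \<Delta> \<Longrightarrow> R (9 + c) t t t \<longleftrightarrow> t mod \<Delta> = c"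
proof (induction t arbitrary: c)
  case 0
  then show ?case using residue_0 by auto
next
  case (Suc t)
  define c' where "c' = (if c = 0 then \<Delta> - 1 else c - 1)"
  have c': "c' < \<Delta>" "Suc c' mod \<Delta> = c" using Suc.prems period by (auto simp: c'_def)
  have "R (9 + c) (Suc t) (Suc t) (Suc t) \<longleftrightarrow> R (9 + c') t t t"
    using residue_Suc Suc.prems c' by (metis Suc_lessD)
  also have "\<dots> \<longleftrightarrow> t mod \<Delta> = c'" using Suc c' by simp
  also have "\<dots> \<longleftrightarrow> Suc t mod \<Delta> = c"
    using Suc.prems period mod_less_divisor[OF period, of t] unfolding mod_Suc c'_def by auto
  finally show ?case .
qed

definition label :: "nat set \<Rightarrow> nat" where
  "label e = (SOME c. c < \<Delta> \<and> (\<exists>u v. e = {u, v} \<and> u < P \<and> v < P \<and> (\<forall>t<P. R 4 u v t \<longleftrightarrow> t mod \<Delta> = c)))"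

lemma label:
  assumes "R 1 u v v" "u < P" "v < P"
  shows "label {u, v} < \<Delta>" "t < P \<Longrightarrow> R 4 u v t \<longleftrightarrow> t mod \<Delta> = label {u, v}"
proof -
  obtain c where "c < \<Delta>" "\<forall>t<P. R 4 u v t \<longleftrightarrow> R (9 + c) t t t" using labels assms by blast
  then have "\<exists>c. c < \<Delta> \<and> (\<exists>u' v'. {u, v} = {u', v'} \<and> u' < P \<and> v' < P \<and> (\<forall>t<P. R 4 u' v' t \<longleftrightarrow> t mod \<Delta> = c))"
    using residue assms by (intro exI[of _ c]) auto
  from someI_ex[OF this, folded label_def] obtain u' v' where l: "label {u, v} < \<Delta>" "{u, v} = {u', v'}"
    "u' < P" "v' < P" "\<forall>t<P. R 4 u' v' t \<longleftrightarrow> t mod \<Delta> = label {u, v}" by blast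
  show "label {u, v} < \<Delta>" by fact
  have "R 4 u' v' t \<longleftrightarrow> R 4 v' u' t" if "t < P" using active_sym l that by blast
  moreover have "u = u' \<and> v = v' \<or> u = v' \<and> v = u'" using l(2) by (auto simp: doubleton_eq_iff)
  ultimately show "t < P \<Longrightarrow> R 4 u v t \<longleftrightarrow> t mod \<Delta> = label {u, v}" using l(5) by auto
qed

lemma functionalD:
  assumes "i \<in> {5, 6, 7}" "u < P" "v < P" "a < P" "b < P" "R i u v a" "R i u v b"
  shows "a = b"
  using functional assms by blast

text \<open>Induction on the arrival time, which is smaller at the preceding vertex. The last
  conjunct records that all visited vertices have arrival times up to \<open>t\<close>; by
  functionality of \<open>R 6\<close> a vertex with a later time is therefore new, which keeps the
  path simple.\<close>

lemma temporal_path_exists: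
  assumes "t < P" "u < size" "v < size" "u \<noteq> v" "R 6 u v t"
  shows "\<exists>Q s. temporal_path edge_set \<Delta> label u v Q \<and> snd (snd (last Q)) = t \<and> snd (snd (hd Q)) = s \<and>
    s < P \<and> R 7 u v s \<and> s \<le> t \<and> (\<forall>x\<in>set (map (fst \<circ> snd) Q). x < P \<and> (\<exists>t'\<le>t. R 6 u x t'))"
  using assms
proof (induction t arbitrary: v rule: less_induct)
  case (less t)
  have uv: "u < P" "v < P" "R 0 u u u" "R 0 v v v" using less.prems size_less by simp_all
  obtain w t1 s where w: "w < P" "t1 < P" "s < P" "R 6 u v t1" "R 7 u v s" "R 1 w v v" "R 4 w v t1"
    "w = u \<and> s = t1 \<or> w \<noteq> u \<and> R 7 u w s \<and> (\<exists>t'<P. R 6 u w t' \<and> t' < t1)"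
    by (rule path_step[OF less.prems(2-4)])
  have "t1 = t" using functionalD[of 6 u v t1 t] w uv less.prems by simp
  note w = w[unfolded this]
  have act: "active_at \<Delta> label {w, v} t"
    using label(2)[OF w(6,1) uv(2) w(2)] w(7) unfolding active_at_def
    by (metis add.commute div_mult_mod_eq)
  have e: "{w, v} \<in> edge_set" using edge_iff w uv by simp
  show ?case
  proof (cases "w = u")
    case True
    have "temporal_path edge_set \<Delta> label u v ([] @ [(u, v, t)])"
      unfolding temporal_path_snoc using True e act less.prems(4) by simp
    then show ?thesis using True w uv less.prems(5) by (intro exI[of _ "[(u, v, t)]"] exI[of _ t]) auto
  next
    case False
    then obtain t' where t': "t' < P" "R 6 u w t'" "t' < t" "R 7 u w s" using w(8) by blast
    have "w < size" using adjacency w uv R_0 by blast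
    obtain Q s' where Q: "temporal_path edge_set \<Delta> label u w Q" "snd (snd (last Q)) = t'"
      "snd (snd (hd Q)) = s'" "s' < P" "R 7 u w s'" "s' \<le> t'"
      "\<forall>x\<in>set (map (fst \<circ> snd) Q). x < P \<and> (\<exists>t''\<le>t'. R 6 u x t'')"
      using less.IH[OF t'(3) t'(1) less.prems(2) \<open>w < size\<close> _ t'(2)] False by auto
    have "s' = s" using functionalD[of 7 u w s' s] Q t' w uv by simp
    have "Q \<noteq> []" using Q(1) by (simp add: temporal_path_def)
    have "v \<notin> set (map (fst \<circ> snd) Q)"
    proof
      assume "v \<in> set (map (fst \<circ> snd) Q)"
      then obtain t'' where "t'' \<le> t'" "R 6 u v t''" using Q(7) by blast
      then show False using functionalD[of 6 u v t'' t] w uv less.prems t' by simp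
    qed
    then have "temporal_path edge_set \<Delta> label u v (Q @ [(w, v, t)])"
      unfolding temporal_path_snoc using Q e act less.prems(4) t' \<open>Q \<noteq> []\<close> by auto
    moreover have "\<forall>x\<in>set (map (fst \<circ> snd) (Q @ [(w, v, t)])). x < P \<and> (\<exists>t'\<le>t. R 6 u x t')"
    proof
      fix x assume "x \<in> set (map (fst \<circ> snd) (Q @ [(w, v, t)]))"
      then consider "x \<in> set (map (fst \<circ> snd) Q)" | "x = v" by auto
      then show "x < P \<and> (\<exists>t'\<le>t. R 6 u x t')"
      proof cases
        case 1
        then obtain t'' where "x < P" "t'' \<le> t'" "R 6 u x t''" using Q(7) by blast
        then show ?thesis using t'(3) by (intro conjI exI[of _ t'']) simp_all
      qed (use uv less.prems(5) in blast)
    qed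
    ultimately show ?thesis using Q \<open>s' = s\<close> \<open>Q \<noteq> []\<close> w t'
      by (intro exI[of _ "Q @ [(w, v, t)]"] exI[of _ s]) auto
  qed
qed

lemma fast_path_exists:
  assumes "u < size" "v < size" "u \<noteq> v"
  obtains Q where "temporal_path edge_set \<Delta> label u v Q" "enat (duration Q) \<le> upper_bound u v"
proof -
  have uv: "u < P" "v < P" "R 0 u u u" "R 0 v v v" using assms size_less by simp_all
  obtain t s where t: "t < P" "s < P" "R 6 u v t" "R 7 u v s"
    "R 2 u v v \<or> (\<exists>j<P. R 3 u v j \<and> \<not> R 8 s t j \<and> (\<forall>k<P. j < k \<longrightarrow> (R 3 u v k \<longleftrightarrow> R 8 s t k)))"
    by (rule path_step[OF assms])
  obtain Q s' where Q: "temporal_path edge_set \<Delta> label u v Q" "snd (snd (last Q)) = t"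
    "snd (snd (hd Q)) = s'" "s' < P" "R 7 u v s'" "s' \<le> t"
    using temporal_path_exists[OF t(1) assms t(3)] by blast
  have "s' = s" using functionalD[of 7 u v s' s] Q t uv by simp
  then show ?thesis using that[OF Q(1)] bound_check[OF _ t(1) t(5)] Q by (simp add: duration_def)
qed

text \<open>Every edge leads from some vertex to its parent in the tree rooted at \<open>0\<close>, and the parent is
  reached earlier from \<open>0\<close>; so the latest vertex of a cycle would have two parents.\<close>

lemma acyclic: "\<nexists>xs. is_cycle edge_set xs"
proof
  assume "\<exists>xs. is_cycle edge_set xs"
  then obtain xs where xs: "is_cycle edge_set xs" by blast
  have "0 < P" using size_pos size_le by simp
  have zero: "R 0 0 0 0" using size_less size_pos by blast
  \<comment> \<open>\<open>Suc\<close> puts the root strictly below all other vertices, whose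
    arrival time may itself be 0.\<close>
  define rank where "rank v = (if v = 0 then 0 else Suc (SOME t. t < P \<and> R 6 0 v t))" for v
  have up: "rank v < rank u" if e: "R 5 0 u v" "u \<noteq> 0" "u < size" "v < P" for u v
  proof -
    have u: "u < P" "R 0 u u u" using size_less e by blast+
    have "0 \<noteq> u" using e(2) by simp
    obtain w t s where w: "w < P" "t < P" "R 5 0 u w" "R 6 0 u t"
      "w = 0 \<and> s = t \<or> w \<noteq> 0 \<and> R 7 0 w s \<and> (\<exists>t'<P. R 6 0 w t' \<and> t' < t)"
      by (rule path_step[OF size_pos e(3) \<open>0 \<noteq> u\<close>])
    have "w = v" using functionalD[of 5 0 u w v] w e u \<open>0 < P\<close> by simp
    have some: "(SOME t. t < P \<and> R 6 0 x t) = t" if "t < P" "R 6 0 x t" "x < P" for x t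
      by (rule some_equality) (use functionalD[of 6 0 x] that \<open>0 < P\<close> in auto)
    show ?thesis using w some u e(2) unfolding \<open>w = v\<close> rank_def by auto
  qed
  have ne: "finite (rank ` set xs)" "rank ` set xs \<noteq> {}" using xs by (auto simp: is_cycle_def)
  obtain v where v: "v \<in> set xs" "rank v = Max (rank ` set xs)" using Max_in[OF ne] by force
  have vmax: "rank x \<le> rank v" if "x \<in> set xs" for x
    unfolding v(2) using Max_ge[OF ne(1)] that by simp
  have parent_v: "R 5 0 v x" if "x \<in> set xs" "{v, x} \<in> edge_set" for x
  proof -
    have vx: "v < size" "x < size" using edge_set_subset that(2) by auto
    then have "R 1 v x x" using edge_iff size_less that by blast
    then have "v \<noteq> 0 \<and> R 5 0 v x \<or> x \<noteq> 0 \<and> R 5 0 x v"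
      using parent vx size_less \<open>0 < P\<close> by blast
    then show ?thesis using up[of x v] vmax[OF that(1)] vx size_less by force
  qed
  obtain a b where ab: "a \<in> set xs" "b \<in> set xs" "a \<noteq> b" "{a, v} \<in> edge_set" "{v, b} \<in> edge_set"
    using cycle_neighbours[OF xs v(1)] by metis
  have "a < P" "b < P" "v < P" using edge_set_subset ab size_less by auto
  moreover have "R 5 0 v a" "R 5 0 v b" using parent_v ab by (simp_all add: insert_commute)
  ultimately show False using functionalD[of 5 0 v a b] \<open>0 < P\<close> ab(3) by simp
qed

text \<open>A temporal path has at most as many edges as its duration. So a fast one also bounds the
  static distance and shows that the bound is positive, and validity needs no check of its
  own.\<close>

lemma inst_yes: "valid_instance inst \<and> realizable inst"
proof
  have path_uv: "\<exists>xs. path_between {..<size} edge_set u v xs \<and> enat (length xs - 1) \<le> upper_bound u v \<and>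
      0 < upper_bound u v" if uv: "u < size" "v < size" "u \<noteq> v" for u v
  proof -
    obtain Q where Q: "temporal_path edge_set \<Delta> label u v Q" "enat (duration Q) \<le> upper_bound u v"
      using fast_path_exists[OF uv] by blast
    have "Q \<noteq> []" using Q(1) by (simp add: temporal_path_def)
    then have "0 < enat (length Q)" "enat (length Q) \<le> upper_bound u v"
      using length_le_duration[OF Q(1)] Q(2) by (simp_all add: order.trans[of _ "enat (duration Q)"] zero_enat_def)
    then show ?thesis using temporal_path_route[OF edge_set_subset Q(1)]
      by (intro exI[of _ "u # map (fst \<circ> snd) Q"]) auto
  qed
  have "\<exists>xs. path_between {..<size} edge_set u v xs" if "u < size" "v < size" for u v
  proof (cases "u = v")
    case True
    then show ?thesis using that by (intro exI[of _ "[u]"]) (simp add: path_between_def)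
  qed (use path_uv that in blast)
  moreover have "fin_graph {..<size} edge_set"
    unfolding fin_graph_def by (auto elim!: edgeE)
  ultimately have "is_tree {..<size} edge_set"
    unfolding is_tree_def connected_graph_def using acyclic size_pos by auto
  moreover have "static_dist {..<size} edge_set u v \<le> upper_bound u v"
    if uv: "u < size" "v < size" "u \<noteq> v" for u v
  proof -
    obtain xs where "path_between {..<size} edge_set u v xs" "enat (length xs - 1) \<le> upper_bound u v"
      using path_uv[OF uv] by blast
    then show ?thesis unfolding static_dist_def by (intro INF_lower2[of xs]) auto
  qed
  ultimately show "valid_instance inst"
    using period path_uv by (auto simp: valid_instance_def inst_def)
  have "periodic_labeling edge_set \<Delta> label"
    unfolding periodic_labeling_def using label(1) size_less by (auto elim!: edgeE)
  moreover have "fastest_duration edge_set \<Delta> label u v \<le> upper_bound u v"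
    if uv: "u < size" "v < size" "u \<noteq> v" for u v
  proof -
    obtain Q where "temporal_path edge_set \<Delta> label u v Q" "enat (duration Q) \<le> upper_bound u v"
      using fast_path_exists[OF uv] by blast
    then show ?thesis unfolding fastest_duration_def by (intro INF_lower2[of Q]) auto
  qed
  ultimately show "realizable inst" by (auto simp: realizable_def inst_def)
qed

end

lemma inst_star:
  assumes "star_certificate P R"
  shows "inst \<in> star_instances"
proof -
  obtain c where c: "c < P" "R 0 c c c"
    "\<forall>u<P. \<forall>v<P. R 1 u v v \<longleftrightarrow> R 0 u u u \<and> R 0 v v v \<and> u \<noteq> v \<and> (u = c \<or> v = c)"
    using assms by (auto simp: star_certificate_def)
  have "edge_set = {{c, v} | v. v \<in> {..<size} - {c}}"
  proof (intro equalityI subsetI)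
    fix e assume "e \<in> edge_set"
    then obtain u v where uv: "e = {u, v}" "R 1 u v v" "u < size" "v < size" "u \<noteq> v" by (rule edgeE)
    then have "u = c \<or> v = c" using c(3) size_less by blast
    then show "e \<in> {{c, v} | v. v \<in> {..<size} - {c}}" using uv by (auto simp: insert_commute)
  next
    fix e assume "e \<in> {{c, v} | v. v \<in> {..<size} - {c}}"
    then obtain v where v: "e = {c, v}" "v < size" "v \<noteq> c" by auto
    then have "R 1 c v v" using c size_less by blast
    then show "e \<in> edge_set" using v c edge_iff size_less by simp
  qed
  then show ?thesis using c(1,2) R_0 by (auto simp: star_instances_def inst_def is_star_def)
qed

end

lemma encode_instance_cong:
  assumes "vertex_count I = vertex_count J" "period I = period J"
    and "\<And>u v. u < vertex_count J \<Longrightarrow> v < vertex_count J \<Longrightarrow>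
      ({u, v} \<in> edges I \<longleftrightarrow> {u, v} \<in> edges J) \<and> bound I u v = bound J u v"
  shows "encode_instance I = encode_instance J"
proof -
  have "concat (map (\<lambda>u. map (f u) [0..<n]) [0..<n]) = concat (map (\<lambda>u. map (g u) [0..<n]) [0..<n])"
    if "\<And>u v. u < n \<Longrightarrow> v < n \<Longrightarrow> f u v = g u v" for f g :: "nat \<Rightarrow> nat \<Rightarrow> 'a" and n
    using that by (intro arg_cong[of _ _ concat] map_cong) auto
  note eq = this
  show ?thesis unfolding encode_instance_def assms(1,2)
    by (intro arg_cong2[of _ _ _ _ "(@)"] arg_cong[of _ _ concat] eq refl) (use assms(3) in simp_all)
qed

section \<open>Certificates of yes-instances\<close>

lemma fastest_duration_le_enatE:
  assumes "fastest_duration E \<Delta> lam u v \<le> enat d"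
  obtains Q where "temporal_path E \<Delta> lam u v Q" "duration Q \<le> d"
proof -
  have "fastest_duration E \<Delta> lam u v < enat (Suc d)"
    using assms by (rule le_less_trans) simp
  then show ?thesis using that unfolding fastest_duration_def INF_less_iff by auto
qed

locale realized =
  fixes I :: ttr_instance and lam :: "nat set \<Rightarrow> nat" and n \<Delta> :: nat and E :: "nat set set"
  assumes n: "vertex_count I = n" and E: "edges I = E" and \<Delta>: "period I = \<Delta>"
    and valid: "valid_instance I"
    and lam: "periodic_labeling E \<Delta> lam"
    and fast: "\<And>u v. u < n \<Longrightarrow> v < n \<Longrightarrow> u \<noteq> v \<Longrightarrow> fastest_duration E \<Delta> lam u v \<le> bound I u v"
begin

lemma tree: "is_tree {..<n} E" and period_pos: "0 < \<Delta>"
  and bound_pos: "u < n \<Longrightarrow> v < n \<Longrightarrow> u \<noteq> v \<Longrightarrow> 0 < bound I u v"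
  using valid n E \<Delta> by (auto simp: valid_instance_def)

lemma n_pos: "0 < n" and edge_subset: "\<Union>E \<subseteq> {..<n}" and no_loop: "{u, u} \<notin> E"
  and no_cycle: "\<nexists>xs. is_cycle E xs"
  using tree by (auto simp: is_tree_def fin_graph_def)

lemma lam_less: "e \<in> E \<Longrightarrow> lam e < \<Delta>"
  using lam by (simp add: periodic_labeling_def)

definition pth :: "nat \<Rightarrow> nat \<Rightarrow> nat list" where "pth u v = (SOME p. path_between {..<n} E u v p)"

lemma pth:
  assumes "u < n" "v < n"
  shows "path_between {..<n} E u v (pth u v)"
proof -
  have "\<exists>p. path_between {..<n} E u v p" using tree assms by (auto simp: is_tree_def connected_graph_def)
  then show ?thesis unfolding pth_def by (rule someI_ex)
qed

lemma pth_eqI: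
  assumes "path_between {..<n} E u v p"
  shows "pth u v = p"
proof -
  have "u \<in> set p" "v \<in> set p" using assms last_in_set[of p] hd_in_set[of p] by (auto simp: path_between_def)
  then have "u < n" "v < n" using assms by (auto simp: path_between_def)
  then show ?thesis using path_unique[OF no_cycle pth assms] by blast
qed

definition prv :: "nat \<Rightarrow> nat \<Rightarrow> nat" where "prv u v = last (butlast (pth u v))"
definition arr :: "nat \<Rightarrow> nat \<Rightarrow> nat" where "arr u v = arrival lam \<Delta> (rev (pth u v))"
definition sta :: "nat \<Rightarrow> nat \<Rightarrow> nat" where "sta u v = lam {u, pth u v ! 1}"

lemma pth_self: "u < n \<Longrightarrow> pth u u = [u]"
  by (rule pth_eqI) (simp add: path_between_def)

lemma pth_snoc:
  assumes "u < n" "v < n" "v \<notin> set (pth u w)" "{w, v} \<in> E"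
  shows "pth u v = pth u w @ [v]" "prv u v = w"
proof -
  have "w < n" using assms(4) edge_subset by auto
  note p = pth[OF assms(1) this]
  have "pth u w \<noteq> []" "last (pth u w) = w" using p by (simp_all add: path_between_def)
  then show "pth u v = pth u w @ [v]"
    by (intro pth_eqI) (simp add: path_between_snoc assms p)
  then show "prv u v = w" using \<open>last (pth u w) = w\<close> by (simp add: prv_def)
qed

lemma prv:
  assumes "u < n" "v < n" "u \<noteq> v"
  shows "pth u v = pth u (prv u v) @ [v]" "prv u v < n" "{prv u v, v} \<in> E"
proof -
  have "pth u v \<noteq> []" "last (pth u v) = v" using pth[OF assms(1,2)] by (auto simp: path_between_def)
  then obtain p where p: "pth u v = p @ [v]" by (metis append_butlast_last_id)
  then have P: "p \<noteq> []" "{last p, v} \<in> E" "path_between {..<n} E u (last p) p"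
    using pth[OF assms(1,2)] assms(3) by (auto simp: path_between_snoc split: if_splits)
  have w: "prv u v = last p" by (simp add: prv_def p)
  show "pth u v = pth u (prv u v) @ [v]" using pth_eqI[OF P(3)] p w by simp
  show "{prv u v, v} \<in> E" using P(2) w by simp
  then show "prv u v < n" using edge_subset by auto
qed

lemma arr_sta_first:
  assumes "u < n" "v < n" "u \<noteq> v" "prv u v = u"
  shows "arr u v = lam {u, v}" "sta u v = lam {u, v}"
  using prv(1)[OF assms(1-3)] pth_self[OF assms(1)] assms(4) by (simp_all add: arr_def sta_def)

lemma arr_sta_step:
  assumes "u < n" "v < n" "u \<noteq> v" "prv u v = w" "w \<noteq> u"
  shows "arr u v = next_time \<Delta> (lam {w, v}) (arr u w)" "sta u v = sta u w"
proof -
  note pv = prv[OF assms(1-3), unfolded assms(4)]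
  have w: "pth u w = pth u (prv u w) @ [w]" using prv(1) pv(2) assms by metis
  have "pth u (prv u w) \<noteq> []" using pth[OF assms(1)] prv(2) pv(2) assms by (metis path_between_def)
  then obtain q where q: "rev (pth u w) = w # q" "q \<noteq> []" using w by simp
  then show "arr u v = next_time \<Delta> (lam {w, v}) (arr u w)"
    by (simp add: arr_def pv(1) arrival_Cons_Cons)
  have "1 < length (pth u w)" using q by (metis One_nat_def Suc_less_eq length_Cons length_greater_0_conv length_rev)
  then show "sta u v = sta u w" by (simp add: sta_def pv(1) nth_append)
qed

lemma arr_less: "u < n \<Longrightarrow> v < n \<Longrightarrow> arr u v < n * \<Delta>"
proof -
  assume uv: "u < n" "v < n"
  let ?p = "pth u v"
  note p = pth[OF uv, unfolded path_between_def]
  have "arr u v < length ?p * \<Delta>"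
    using arrival_bound[where E = E and p = "rev ?p", OF period_pos lam_less] p successively_rev_edges[of E ?p]
    by (auto simp: arr_def)
  also have "length ?p \<le> n"
    using p card_mono[of "{..<n}" "set ?p"] by (simp add: distinct_card)
  finally show "arr u v < n * \<Delta>" by (meson less_le_trans mult_le_mono1 less_trans not_less)
qed

lemma sta_less: "u < n \<Longrightarrow> v < n \<Longrightarrow> u \<noteq> v \<Longrightarrow> sta u v < \<Delta>"
proof -
  assume uv: "u < n" "v < n" "u \<noteq> v"
  obtain p where p: "pth u v = u # p" using pth[OF uv(1,2)] by (cases "pth u v") (auto simp: path_between_def)
  then have "p \<noteq> []" "{u, hd p} \<in> E" using pth[OF uv(1,2)] uv(3) by (auto simp: path_between_Cons split: if_splits)
  then show "sta u v < \<Delta>" using lam_less by (simp add: sta_def p hd_conv_nth)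
qed

text \<open>A temporal path within the bound must follow the unique tree path, and there the greedy
  journey is at least as fast by \<open>arrival_le_last\<close>.\<close>

lemma arr_within_bound:
  assumes "u < n" "v < n" "u \<noteq> v" "bound I u v = enat d"
  shows "arr u v - sta u v < d"
proof -
  obtain Q where Q: "temporal_path E \<Delta> lam u v Q" "duration Q \<le> d"
    using fastest_duration_le_enatE fast[OF assms(1-3)] assms(4) by metis
  have p: "pth u v = u # map (fst \<circ> snd) Q" by (rule pth_eqI, rule temporal_path_route[OF edge_subset Q(1)])
  have "Q \<noteq> []" using Q(1) by (simp add: temporal_path_def)
  then have "pth u v ! 1 = fst (snd (hd Q))" by (simp add: p hd_conv_nth)
  then obtain m where "snd (snd (hd Q)) = sta u v + m * \<Delta>" "arr u v + m * \<Delta> \<le> snd (snd (last Q))"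
    using arrival_le_last[OF period_pos lam_less Q(1)] unfolding sta_def arr_def p by auto
  moreover have "0 < d" using bound_pos[OF assms(1-3)] assms(4) by (simp add: zero_enat_def)
  ultimately show ?thesis using Q(2) unfolding duration_def by linarith
qed

text \<open>If \<open>v\<close> is not on the path from 0 to \<open>u\<close>, the edge extends that
  path to \<open>v\<close>. Otherwise the path to \<open>v\<close> is a prefix of it without
  \<open>u\<close>, and the edge extends this prefix to \<open>u\<close>.\<close>

lemma parent_edge:
  assumes "{u, v} \<in> E"
  shows "u \<noteq> 0 \<and> prv 0 u = v \<or> v \<noteq> 0 \<and> prv 0 v = u"
proof -
  have uv: "u < n" "v < n" using assms edge_subset by auto
  have "u \<noteq> v" using assms no_loop by auto
  note p = pth[OF n_pos uv(1)]
  have start: "0 \<in> set (pth 0 w)" if "w < n" for w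
    using pth[OF n_pos that] hd_in_set[of "pth 0 w"] by (simp add: path_between_def)
  show ?thesis
  proof (cases "v \<in> set (pth 0 u)")
    case False
    then have "prv 0 v = u" using pth_snoc[OF n_pos uv(2)] assms by blast
    then show ?thesis using False start[OF uv(1)] by metis
  next
    case True
    then obtain p1 p2 where p12: "pth 0 u = p1 @ v # p2" by (auto simp: in_set_conv_decomp)
    have pv: "pth 0 v = p1 @ [v]" by (rule pth_eqI, rule path_between_prefix, rule p[unfolded p12])
    have "last (v # p2) = u" using p unfolding p12 by (simp add: path_between_def)
    then have "u \<in> set p2" using \<open>u \<noteq> v\<close> last_in_set[of p2] by (auto split: if_splits)
    then have "u \<notin> set (pth 0 v)" using p unfolding p12 pv by (auto simp: path_between_def)
    then have "prv 0 u = v" using pth_snoc[OF n_pos uv(1)] assms by (simp add: insert_commute)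
    then show ?thesis using \<open>u \<notin> set (pth 0 v)\<close> start[OF uv(2)] by metis
  qed
qed

text \<open>The relations of the certificate as a list indexed by \<open>j\<close>; the cut-off at 9
  lets all residue relations share the last entry.\<close>

definition witness :: "nat \<Rightarrow> nat \<Rightarrow> nat \<Rightarrow> nat \<Rightarrow> bool" where
  "witness j a b c = [a < n, {a, b} \<in> E, bound I a b = \<infinity>, (\<exists>d. bound I a b = enat d \<and> bit d c),
     {a, b} \<in> E \<and> c mod \<Delta> = lam {a, b}, a < n \<and> b < n \<and> a \<noteq> b \<and> c = prv a b,
     a < n \<and> b < n \<and> a \<noteq> b \<and> c = arr a b, a < n \<and> b < n \<and> a \<noteq> b \<and> c = sta a b, bit (b - a) c,
     j \<ge> 9 \<and> a mod \<Delta> = j - 9] ! min j 9"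

context
  fixes P :: nat and R :: "nat \<Rightarrow> nat \<Rightarrow> nat \<Rightarrow> nat \<Rightarrow> bool"
  assumes P: "n * \<Delta> \<le> P"
    and bits: "\<And>u v d. u < n \<Longrightarrow> v < n \<Longrightarrow> bound I u v = enat d \<Longrightarrow> d < 2 ^ P"
    and R: "\<And>j a b c. j < 9 + \<Delta> \<Longrightarrow> a < P \<Longrightarrow> b < P \<Longrightarrow> c < P \<Longrightarrow> R j a b c \<longleftrightarrow> witness j a b c"
begin

lemma n_le: "n \<le> P" and period_le: "\<Delta> \<le> P"
  using P period_pos n_pos by (metis One_nat_def Suc_leI le_trans mult.right_neutral mult_le_mono2,
    metis One_nat_def Suc_leI le_trans mult.left_neutral mult_le_mono1)

lemma rel:
  assumes "a < P" "b < P" "c < P"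
  shows "R 0 a b c \<longleftrightarrow> a < n" "R 1 a b c \<longleftrightarrow> {a, b} \<in> E" "R (Suc 0) a b c \<longleftrightarrow> {a, b} \<in> E" "R 2 a b c \<longleftrightarrow> bound I a b = \<infinity>"
    "R 3 a b c \<longleftrightarrow> (\<exists>d. bound I a b = enat d \<and> bit d c)"
    "R 4 a b c \<longleftrightarrow> {a, b} \<in> E \<and> c mod \<Delta> = lam {a, b}"
    "R 5 a b c \<longleftrightarrow> a < n \<and> b < n \<and> a \<noteq> b \<and> c = prv a b"
    "R 6 a b c \<longleftrightarrow> a < n \<and> b < n \<and> a \<noteq> b \<and> c = arr a b"
    "R 7 a b c \<longleftrightarrow> a < n \<and> b < n \<and> a \<noteq> b \<and> c = sta a b" "R 8 a b c \<longleftrightarrow> bit (b - a) c"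
  using R assms by (simp_all add: witness_def nth_Cons numeral_eq_Suc)

lemma rel_residue: "a < P \<Longrightarrow> c < \<Delta> \<Longrightarrow> R (9 + c) a a a \<longleftrightarrow> a mod \<Delta> = c"
  using R[of "9 + c" a a a] by (simp add: witness_def)

lemma witness_path:
  assumes "u < n" "v < n" "u \<noteq> v"
  shows "\<exists>w<P. \<exists>t<P. \<exists>s<P. R 5 u v w \<and> R 6 u v t \<and> R 7 u v s \<and> R 1 w v v \<and> R 4 w v t \<and>
        (w = u \<and> s = t \<or> w \<noteq> u \<and> R 7 u w s \<and> (\<exists>t'<P. R 6 u w t' \<and> t' < t)) \<and>
        (R 2 u v v \<or> (\<exists>j<P. R 3 u v j \<and> \<not> R 8 s t j \<and> (\<forall>k<P. j < k \<longrightarrow> (R 3 u v k \<longleftrightarrow> R 8 s t k))))"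
proof -
  define w where "w = prv u v"
  note pv = prv[OF assms, folded w_def]
  have small: "u < P" "v < P" "w < P" "arr u v < P" "arr u w < P" "sta u v < P"
    using assms pv(2) n_le arr_less[OF assms(1,2)] arr_less[OF assms(1) pv(2)] sta_less[OF assms] P period_le
    by simp_all
  have "R 4 w v (arr u v) \<and> (w = u \<and> sta u v = arr u v \<or>
      w \<noteq> u \<and> R 7 u w (sta u v) \<and> (\<exists>t'<P. R 6 u w t' \<and> t' < arr u v))"
  proof (cases "w = u")
    case True
    then show ?thesis using arr_sta_first[OF assms] lam_less[OF pv(3)] pv(3) small by (simp add: rel w_def)
  next
    case False
    note st = arr_sta_step[OF assms w_def[symmetric] False]
    have "arr u w < arr u v" "arr u v mod \<Delta> = lam {w, v}"
      unfolding st using next_time[OF lam_less[OF pv(3)]] by blast+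
    then show ?thesis using False st(2) pv small assms
      by (intro conjI disjI2 exI[of _ "arr u w"]) (simp_all add: rel)
  qed
  moreover have "R 2 u v v \<or> (\<exists>j<P. R 3 u v j \<and> \<not> R 8 (sta u v) (arr u v) j \<and>
      (\<forall>k<P. j < k \<longrightarrow> (R 3 u v k \<longleftrightarrow> R 8 (sta u v) (arr u v) k)))"
  proof (cases "bound I u v")
    case (enat d)
    obtain j where j: "bit d j" "\<not> bit (arr u v - sta u v) j"
      "\<forall>k>j. bit d k \<longleftrightarrow> bit (arr u v - sta u v) k"
      using arr_within_bound[OF assms enat] less_iff_bit by blast
    have "j < P" using j(1) bits_nat_bit[OF bits[OF assms(1,2) enat]] by (metis bit_bits_nat)
    then show ?thesis using j enat small by (auto simp: rel)
  qed (use small in \<open>simp add: rel\<close>)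
  ultimately show ?thesis
    using small assms pv(3)
    by (intro exI[of _ w] conjI exI[of _ "arr u v"] exI[of _ "sta u v"]) (simp_all add: rel w_def)
qed

lemma witness_certificate: "certificate \<Delta> P R"
proof
  have zero: "0 < P" using n_pos n_le by simp
  show "\<exists>u<P. R 0 u u u" using zero n_pos by (auto simp: rel)
  show "\<forall>u<P. \<forall>v<P. u < v \<and> R 0 v v v \<longrightarrow> R 0 u u u" by (simp add: rel)
  show "\<forall>u<P. \<forall>v<P. R 1 u v v \<longrightarrow> R 0 u u u \<and> R 0 v v v \<and> R 1 v u u \<and> u \<noteq> v"
    using edge_subset no_loop by (auto simp: rel insert_commute)
  show "\<forall>t<P. t = 0 \<longrightarrow> (\<forall>c<\<Delta>. R (9 + c) t t t \<longleftrightarrow> c = 0)"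
    using zero by (auto simp only: rel_residue mod_0)
  show "\<forall>t<P. \<forall>t'<P. t' = Suc t \<longrightarrow> (\<forall>c<\<Delta>. R (9 + Suc c mod \<Delta>) t' t' t' \<longleftrightarrow> R (9 + c) t t t)"
  proof (intro allI impI)
    fix t t' c assume "t < P" "t' < P" "t' = Suc t" "c < \<Delta>"
    moreover have "Suc t mod \<Delta> = Suc c mod \<Delta> \<longleftrightarrow> t mod \<Delta> = c"
      using \<open>c < \<Delta>\<close> mod_less_divisor[OF period_pos, of t] by (auto simp: mod_Suc)
    ultimately show "R (9 + Suc c mod \<Delta>) t' t' t' \<longleftrightarrow> R (9 + c) t t t"
      using period_pos by (simp only: rel_residue mod_less_divisor)
  qed
  show "\<forall>u<P. \<forall>v<P. R 1 u v v \<longrightarrow> (\<exists>c<\<Delta>. \<forall>t<P. R 4 u v t \<longleftrightarrow> R (9 + c) t t t)"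
  proof (intro allI impI)
    fix u v assume "u < P" "v < P" "R 1 u v v"
    then show "\<exists>c<\<Delta>. \<forall>t<P. R 4 u v t \<longleftrightarrow> R (9 + c) t t t"
      using lam_less[of "{u, v}"] by (intro exI[of _ "lam {u, v}"]) (simp add: rel rel_residue)
  qed
  show "\<forall>u<P. \<forall>v<P. \<forall>t<P. R 4 u v t \<longrightarrow> R 4 v u t" by (simp add: rel insert_commute)
  show "\<forall>i\<in>{5, 6, 7}. \<forall>u<P. \<forall>v<P. \<forall>a<P. \<forall>b<P. R i u v a \<and> R i u v b \<longrightarrow> a = b"
    by (simp add: rel)
  show "\<forall>u<P. \<forall>v<P. R 0 u u u \<and> R 0 v v v \<and> u \<noteq> v \<longrightarrow>
      (\<exists>w<P. \<exists>t<P. \<exists>s<P. R 5 u v w \<and> R 6 u v t \<and> R 7 u v s \<and> R 1 w v v \<and> R 4 w v t \<and>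
        (w = u \<and> s = t \<or> w \<noteq> u \<and> R 7 u w s \<and> (\<exists>t'<P. R 6 u w t' \<and> t' < t)) \<and>
        (R 2 u v v \<or> (\<exists>j<P. R 3 u v j \<and> \<not> R 8 s t j \<and> (\<forall>k<P. j < k \<longrightarrow> (R 3 u v k \<longleftrightarrow> R 8 s t k)))))"
  proof (intro allI impI)
    fix u v assume "u < P" "v < P" "R 0 u u u \<and> R 0 v v v \<and> u \<noteq> v"
    then have "u < n" "v < n" "u \<noteq> v" by (simp_all add: rel)
    then show "\<exists>w<P. \<exists>t<P. \<exists>s<P. R 5 u v w \<and> R 6 u v t \<and> R 7 u v s \<and> R 1 w v v \<and> R 4 w v t \<and>
        (w = u \<and> s = t \<or> w \<noteq> u \<and> R 7 u w s \<and> (\<exists>t'<P. R 6 u w t' \<and> t' < t)) \<and>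
        (R 2 u v v \<or> (\<exists>j<P. R 3 u v j \<and> \<not> R 8 s t j \<and> (\<forall>k<P. j < k \<longrightarrow> (R 3 u v k \<longleftrightarrow> R 8 s t k))))"
      by (rule witness_path)
  qed
  show "\<forall>r<P. \<forall>u<P. \<forall>v<P. r = 0 \<and> R 1 u v v \<longrightarrow> u \<noteq> r \<and> R 5 r u v \<or> v \<noteq> r \<and> R 5 r v u"
  proof (intro allI impI)
    fix r u v assume a: "r < P" "u < P" "v < P" "r = 0 \<and> R 1 u v v"
    then have e: "{u, v} \<in> E" by (simp add: rel)
    then have "u < n" "v < n" using edge_subset by auto
    then show "u \<noteq> r \<and> R 5 r u v \<or> v \<noteq> r \<and> R 5 r v u"
      using parent_edge[OF e] a n_pos by (auto simp: rel)
  qed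
  show "\<forall>s<P. \<forall>j<P. \<not> R 8 s s j" by (simp add: rel)
  show "\<forall>s<P. \<forall>t<P. \<forall>t'<P. \<not> t < s \<and> t' = Suc t \<longrightarrow>
      (\<forall>j<P. R 8 s t' j \<longleftrightarrow> (R 8 s t j \<noteq> (\<forall>k<P. k < j \<longrightarrow> R 8 s t k)))"
  proof (intro allI impI)
    fix s t t' j assume a: "s < P" "t < P" "t' < P" "\<not> t < s \<and> t' = Suc t" "j < P"
    have "(\<forall>k<P. k < j \<longrightarrow> bit (t - s) k) \<longleftrightarrow> (\<forall>k<j. bit (t - s) k)" using a(5) by (meson less_trans)
    moreover have "t' - s = Suc (t - s)" using a(4) by (simp add: Suc_diff_le)
    moreover have "(\<forall>k<P. k < j \<longrightarrow> R 8 s t k) \<longleftrightarrow> (\<forall>k<P. k < j \<longrightarrow> bit (t - s) k)" using a by (simp add: rel)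
    ultimately show "R 8 s t' j \<longleftrightarrow> (R 8 s t j \<noteq> (\<forall>k<P. k < j \<longrightarrow> R 8 s t k))"
      using a bit_Suc_nat[of "t - s" j] by (simp add: rel)
  qed
qed

lemma witness_star:
  assumes "I \<in> star_instances"
  shows "star_certificate P R"
proof -
  obtain c where c: "c < n" "E = {{c, v} | v. v \<in> {..<n} - {c}}"
    using assms by (auto simp: star_instances_def is_star_def n E)
  have "{u, v} \<in> E \<longleftrightarrow> u < n \<and> v < n \<and> u \<noteq> v \<and> (u = c \<or> v = c)" for u v
    using c by (auto simp: doubleton_eq_iff)
  then show ?thesis unfolding star_certificate_def using c(1) n_le
    by (intro exI[of _ c]) (simp add: rel)
qed

lemma witness_inst: "encode_instance (certificate.inst \<Delta> P R) = encode_instance I"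
proof -
  interpret certificate \<Delta> P R by (rule witness_certificate)
  have "{u. u < P \<and> R 0 u u u} = {..<n}" using n_le by (auto simp: rel)
  then have sz: "size = n" by (simp add: size_def)
  show ?thesis
  proof (rule encode_instance_cong)
    fix u v assume "u < vertex_count I" "v < vertex_count I"
    then have uv: "u < n" "v < n" "u < P" "v < P" using n n_le by simp_all
    have "upper_bound u v = bound I u v"
    proof (cases "bound I u v")
      case (enat d)
      then have "bits_nat P (R 3 u v) = bits_nat P (bit d)"
        unfolding bits_nat_def using uv by (intro arg_cong[of _ _ "horner_sum of_bool 2"] map_cong) (auto simp: rel)
      then show ?thesis using bits_nat_bit[OF bits[OF uv(1,2) enat]] enat uv by (simp add: upper_bound_def rel)
    qed (use uv in \<open>simp add: upper_bound_def rel\<close>)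
    then show "({u, v} \<in> edges inst \<longleftrightarrow> {u, v} \<in> edges I) \<and> bound inst u v = bound I u v"
      using edge_iff uv by (simp add: inst_def E rel)
  qed (simp_all add: inst_def sz n \<Delta>)
qed

end

end

section \<open>The verifier\<close>

definition size_gen :: gen where
  "size_gen = GFor 0 (GIf (is_vertex 0) (Emit [True]) (Emit []))"

definition pairs_gen :: "gen \<Rightarrow> gen" where
  "pairs_gen g = GFor 0 (GFor 1 (GIf (And (is_vertex 0) (is_vertex 1)) g (Emit [])))"

definition bound_gen :: gen where
  "bound_gen = GIf (unbounded 0 1) (Emit [False, True])
     (GSeq (GFor 6 (GIf (Ex 7 (And (Neg (Less 7 6)) (Rel 3 0 1 7)))
        (GIf (Rel 3 0 1 6) (Emit [True, True]) (Emit [True, False])) (Emit []))) (Emit [False, False]))"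

text \<open>If the check fails, the output is made longer than the input it is compared with.\<close>

definition verify_gen :: "bool \<Rightarrow> nat \<Rightarrow> gen" where
  "verify_gen star \<Delta> = GIf (check star \<Delta>)
     (gen_seq [Emit (encode_enat (enat \<Delta>)), pairs_gen (GIf (adjacent 0 1) (Emit [True]) (Emit [False])),
        pairs_gen bound_gen])
     (GFor 0 (Emit [True]))"

lemma gen_ok_size_gen: "gen_ok 10 size_gen"
  by (simp add: size_gen_def atom_defs)

lemma gen_ok_verify_gen: "gen_ok 10 (verify_gen star \<Delta>)"
  by (simp add: verify_gen_def pairs_gen_def bound_gen_def fm_ok_check atom_defs)

lemma length_size_gen: "length (out P w R size_gen e) \<le> P"
proof -
  have "length (concat (map f [0..<P])) \<le> P" if "\<And>i. length (f i) \<le> 1" for f :: "nat \<Rightarrow> bool list"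
  proof (induction P)
    case (Suc P)
    then show ?case using that[of P] by simp
  qed simp
  then show ?thesis by (simp add: size_gen_def)
qed

lemma concat_upt_filter:
  assumes "n \<le> P"
  shows "concat (map (\<lambda>i. if i < n then f i else []) [0..<P]) = concat (map f [0..<n])"
proof -
  have "[0..<P] = [0..<n] @ [n..<P]" using assms by (metis le_add_diff_inverse upt_add_eq_append zero_le)
  moreover have "concat (map (\<lambda>i. if i < n then f i else []) [n..<P]) = []" by (auto simp: concat_eq_Nil_conv)
  moreover have "map (\<lambda>i. if i < n then f i else []) [0..<n] = map f [0..<n]" by simp
  ultimately show ?thesis by (simp only: map_append concat_append append_Nil2)
qed

context certificate
begin

lemma out_size_gen: "out P w R size_gen e = replicate size True"
proof -
  have "out P w R size_gen e = concat (map (\<lambda>i. if i < size then [True] else []) [0..<P])"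
    unfolding size_gen_def by (auto simp: atom_defs R_0 intro!: arg_cong[of _ _ concat] map_cong)
  then show ?thesis by (simp add: concat_upt_filter[OF size_le] map_replicate_const concat_map_singleton)
qed

lemma out_pairs_gen:
  "out P w R (pairs_gen g) e =
     concat (map (\<lambda>u. concat (map (\<lambda>v. out P w R g (e(0 := u, 1 := v))) [0..<size])) [0..<size])"
proof -
  have "out P w R (pairs_gen g) e = concat (map (\<lambda>u. if u < size then
      concat (map (\<lambda>v. if v < size then out P w R g (e(0 := u, 1 := v)) else []) [0..<P]) else []) [0..<P])"
    unfolding pairs_gen_def
    by (auto simp: atom_defs R_0 concat_eq_Nil_conv intro!: arg_cong[of _ _ concat] map_cong)
  then show ?thesis by (simp only: concat_upt_filter[OF size_le])
qed

lemma out_bound_gen: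
  "out P w R bound_gen (e(0 := u, 1 := v)) = encode_enat (upper_bound u v)"
proof (cases "R 2 u v v")
  case True
  then show ?thesis by (simp add: bound_gen_def atom_defs upper_bound_def encode_enat_def)
next
  case False
  have "out P w R (GFor 6 (GIf (Ex 7 (And (Neg (Less 7 6)) (Rel 3 0 1 7)))
        (GIf (Rel 3 0 1 6) (Emit [True, True]) (Emit [True, False])) (Emit []))) (e(0 := u, 1 := v)) =
      concat (map (\<lambda>b. [True, b]) (binary (bits_nat P (R 3 u v))))"
    unfolding binary_bits_nat out.simps
    by (rule arg_cong[of _ _ concat], rule map_cong) (auto simp: not_less)
  then show ?thesis using False unfolding bound_gen_def out.simps(2,3)
    by (simp add: atom_defs upper_bound_def encode_enat_def del: out.simps(4))
qed

lemma out_verify_gen: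
  assumes "star \<longrightarrow> star_certificate P R"
  shows "encode_enat (enat (length (out P w R size_gen e))) @ out P w R (verify_gen star \<Delta>) e = encode_instance inst"
proof -
  have adj: "out P w R (GIf (adjacent 0 1) (Emit [True]) (Emit [False])) (e(0 := u, 1 := v)) = [R 1 u v v]" for u v
    by (simp add: atom_defs)
  have "certificate \<Delta> P R" by unfold_locales
  then have "holds P w R (check star \<Delta>) e" using assms by (simp add: holds_check)
  then have "out P w R (verify_gen star \<Delta>) e = encode_enat (enat \<Delta>) @
      out P w R (pairs_gen (GIf (adjacent 0 1) (Emit [True]) (Emit [False]))) e @ out P w R (pairs_gen bound_gen) e"
    by (simp add: verify_gen_def)
  also have "\<dots> = encode_enat (enat \<Delta>) @
      concat (map (\<lambda>u. concat (map (\<lambda>v. [R 1 u v v]) [0..<size])) [0..<size]) @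
      concat (map (\<lambda>u. concat (map (\<lambda>v. encode_enat (upper_bound u v)) [0..<size])) [0..<size])"
    unfolding out_pairs_gen out_bound_gen adj ..
  also have "concat (map (\<lambda>u. concat (map (\<lambda>v. [R 1 u v v]) [0..<size])) [0..<size]) =
      concat (map (\<lambda>u. map (\<lambda>v. {u, v} \<in> edge_set) [0..<size]) [0..<size])"
    using size_less by (intro arg_cong[of _ _ concat] map_cong refl) (simp add: edge_iff)
  finally show ?thesis
    unfolding encode_instance_def by (simp add: inst_def out_size_gen concat_concat comp_def)
qed

end

lemma gen_string_verify:
  fixes x y :: "bool list" and a b :: "nat poly"
  defines "P \<equiv> length (domain_word a b x)"
  shows "gen_string a b size_gen (verify_gen star \<Delta>) x y = x \<longleftrightarrow>
    certificate \<Delta> P (relation_of P y) \<and> (star \<longrightarrow> star_certificate P (relation_of P y)) \<and>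
    encode_instance (certificate.inst \<Delta> P (relation_of P y)) = x" (is "?l \<longleftrightarrow> ?cert \<and> ?star \<and> ?eq")
proof (cases "?cert \<and> ?star")
  case True
  then interpret certificate \<Delta> P "relation_of P y" by blast
  show ?thesis using True out_verify_gen[of star] by (simp add: gen_string_def Let_def P_def)
next
  case False
  then have "\<not> holds P (\<lambda>i. domain_word a b x ! i) (relation_of P y) (check star \<Delta>) (\<lambda>_. 0)"
    unfolding holds_check by blast
  then have "length (out P (\<lambda>i. domain_word a b x ! i) (relation_of P y) (verify_gen star \<Delta>) (\<lambda>_. 0)) = P"
    by (simp add: verify_gen_def)
  moreover have "length x < P" by (simp add: P_def domain_word_def Let_def)
  ultimately have "length x < length (gen_string a b size_gen (verify_gen star \<Delta>) x y)"
    by (simp add: gen_string_def Let_def P_def)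
  then show ?thesis using False by auto
qed

section \<open>Size of the certificate and membership in NP\<close>

definition table :: "nat \<Rightarrow> nat \<Rightarrow> (nat \<Rightarrow> nat \<Rightarrow> nat \<Rightarrow> nat \<Rightarrow> bool) \<Rightarrow> bool list" where
  "table P k R = map (\<lambda>i. R (i div P div P div P) (i div P div P mod P) (i div P mod P) (i mod P)) [0..<k * P * P * P]"

lemma relation_of_table:
  assumes "j < k" "a < P" "b < P" "c < P"
  shows "relation_of P (table P k R) j a b c \<longleftrightarrow> R j a b c"
proof -
  have step: "m * P + d < l * P" if "m < l" "d < P" for m l d
  proof -
    have "m * P + d < Suc m * P" using that by simp
    also have "\<dots> \<le> l * P" using that by (intro mult_le_mono1) simp
    finally show ?thesis .
  qed
  have "((j * P + a) * P + b) * P + c < k * P * P * P" using assms by (intro step)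
  moreover have "(m * P + d) div P = m" "(m * P + d) mod P = d" if "d < P" for m d
    using that by simp_all
  ultimately show ?thesis using assms by (simp add: relation_of_def table_def Let_def)
qed

text \<open>The adjacency matrix alone takes \<open>n * n\<close> bits for \<open>n\<close>
  vertices, and every digit of every finite bound occurs in the code.\<close>

lemma encode_instance_length:
  assumes "x = encode_instance I"
  shows "vertex_count I \<le> length x"
    "u < vertex_count I \<Longrightarrow> v < vertex_count I \<Longrightarrow> bound I u v = enat d \<Longrightarrow> d < 2 ^ length x"
proof -
  let ?n = "vertex_count I" and ?b = "concat (map (\<lambda>u. map (\<lambda>v. encode_enat (bound I u v)) [0..<vertex_count I]) [0..<vertex_count I])"
  have len: "?n * ?n + length (concat ?b) \<le> length x"
    unfolding assms encode_instance_def by (simp add: length_pairs)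
  then show "?n \<le> length x" by (meson add_leD1 le_square order_trans)
  assume uv: "u < ?n" "v < ?n" "bound I u v = enat d"
  then have "encode_enat (enat d) \<in> set ?b" by force
  then have "length (encode_enat (enat d)) \<in> set (map length ?b)" unfolding set_map by (rule imageI)
  then have "length (encode_enat (enat d)) \<le> length (concat ?b)"
    unfolding length_concat by (rule member_le_sum_list) simp
  then have "length (binary d) \<le> length x" using len by (simp add: length_encode_enat)
  then have "(2 :: nat) ^ length (binary d) \<le> 2 ^ length x" by (rule power_increasing) simp
  then show "d < 2 ^ length x" using less_exp_length_binary[of d] by linarith
qed

theorem TTR_in_NP:
  assumes \<Delta>: "0 < \<Delta>"
  shows "in_NP (TTR (period_instances \<Delta> \<inter> (if star then star_instances else UNIV)))"
proof -
  define C where "C = period_instances \<Delta> \<inter> (if star then star_instances else UNIV)"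
  \<comment> \<open>An instance has at most as many vertices as its code has bits, so padding blocks
    of length \<open>\<Delta> * length x\<close> make all greedy arrival times positions of the
    word. The polynomial 0 in place of \<open>b\<close> leaves out the block of letters 6, which
    only the tableau uses.\<close>
  define a where "a = [:0, \<Delta>:]"
  define len where "len x = length (domain_word a 0 x)" for x
  have len: "len x = (3 * \<Delta> + 1) * length x + 4" for x
    by (simp add: len_def a_def domain_word_def Let_def algebra_simps)
  define V where "V x y \<longleftrightarrow> gen_string a 0 size_gen (verify_gen star \<Delta>) x y = x" for x y
  have V: "V x y \<longleftrightarrow> certificate \<Delta> (len x) (relation_of (len x) y) \<and>
      (star \<longrightarrow> star_certificate (len x) (relation_of (len x) y)) \<and>
      encode_instance (certificate.inst \<Delta> (len x) (relation_of (len x) y)) = x" for x y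
    unfolding V_def len_def by (rule gen_string_verify)
  have "poly_time_decidable2 V"
    unfolding V_def
  proof (rule gen_string_computable(2)[OF gen_ok_size_gen gen_ok_verify_gen])
    fix x y :: "bool list"
    let ?P = "length (domain_word a 0 x)"
    have "?P - 1 < 2 ^ (?P - 1)" by (rule less_exp)
    then have "?P \<le> 2 ^ (?P - 1)" by linarith
    then show "length (out ?P (\<lambda>i. domain_word a 0 x ! i) (relation_of ?P y) size_gen (\<lambda>_. 0)) \<le> 2 ^ (?P - 1)"
      using length_size_gen order_trans by blast
  qed
  \<comment> \<open>There are \<open>9 + \<Delta>\<close> ternary relations, each tabulated over the
    cube of the domain, whose size is \<open>(3 * \<Delta> + 1) * length x + 4\<close>.\<close>
  moreover have "x \<in> TTR C \<longleftrightarrow> (\<exists>y. length y \<le> poly ([:9 + \<Delta>:] * [:4, 3 * \<Delta> + 1:] ^ 3) (length x) \<and> V x y)" for x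
  proof
    assume "x \<in> TTR C"
    then obtain I where I: "x = encode_instance I" "I \<in> C" "valid_instance I" "realizable I"
      by (auto simp: TTR_def)
    then obtain lam where lam: "periodic_labeling (edges I) (period I) lam"
      "\<And>u v. u < vertex_count I \<Longrightarrow> v < vertex_count I \<Longrightarrow> u \<noteq> v \<Longrightarrow>
         fastest_duration (edges I) (period I) lam u v \<le> bound I u v"
      by (auto simp: realizable_def)
    have per: "period I = \<Delta>" using I(2) by (simp add: C_def period_instances_def)
    interpret realized I lam "vertex_count I" \<Delta> "edges I"
      using lam I(3) per by unfold_locales simp_all
    define y where "y = table (len x) (9 + \<Delta>) witness"
    have P: "vertex_count I * \<Delta> \<le> len x"
    proof -
      have "vertex_count I * \<Delta> \<le> length x * \<Delta>" using encode_instance_length(1)[OF I(1)] by simp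
      also have "\<dots> \<le> len x" by (simp add: len algebra_simps)
      finally show ?thesis .
    qed
    have bits: "d < 2 ^ len x" if "u < vertex_count I" "v < vertex_count I" "bound I u v = enat d" for u v d
    proof -
      have "d < 2 ^ length x" by (rule encode_instance_length(2)[OF I(1) that])
      also have "\<dots> \<le> 2 ^ len x" by (rule power_increasing) (simp_all add: len)
      finally show ?thesis .
    qed
    have R: "relation_of (len x) y j b c d \<longleftrightarrow> witness j b c d"
      if "j < 9 + \<Delta>" "b < len x" "c < len x" "d < len x" for j b c d
      unfolding y_def by (rule relation_of_table[OF that])
    have "V x y"
      unfolding V using witness_certificate[OF P bits R] witness_star[OF P bits R] witness_inst[OF P bits R] I
      by (auto simp: C_def)
    moreover have "length y \<le> poly ([:9 + \<Delta>:] * [:4, 3 * \<Delta> + 1:] ^ 3) (length x)"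
      by (simp add: y_def table_def len poly_power power3_eq_cube algebra_simps)
    ultimately show "\<exists>y. length y \<le> poly ([:9 + \<Delta>:] * [:4, 3 * \<Delta> + 1:] ^ 3) (length x) \<and> V x y" by blast
  next
    assume "\<exists>y. length y \<le> poly ([:9 + \<Delta>:] * [:4, 3 * \<Delta> + 1:] ^ 3) (length x) \<and> V x y"
    then obtain y where y: "V x y" by blast
    interpret certificate \<Delta> "len x" "relation_of (len x) y" using y V by blast
    have "inst \<in> C" using inst_star y unfolding V C_def
      by (auto simp: period_instances_def inst_def)
    then show "x \<in> TTR C" using inst_yes[OF \<Delta>] y[unfolded V]
      by (auto simp: TTR_def intro!: exI[of _ inst])
  qed
  ultimately show ?thesis unfolding in_NP_def C_def by blast
qed

theorem mainTheorem6:
  fixes \<Delta> :: nat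
  assumes "3 \<le> \<Delta>"
  shows "NP_complete (TTR (period_instances \<Delta>)) \<and>
         NP_complete (TTR (period_instances \<Delta> \<inter> star_instances))"
  using star_TTR_hard[OF assms] TTR_in_NP[of \<Delta> False] TTR_in_NP[of \<Delta> True] assms
  by (simp add: NP_complete_def)

end
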